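(* Let $\mathcal{C}$ be a 2-category. Then $\mathcal{C}$ is bicocomplete if and only if it has oplax bicolimits and bicoequalizers of codescent objects.
   Context: 2-categories and 2-functors are strict; $\mathcal{K}[X,Y]$ denotes a hom-category; juxtaposition of 1-cells and 2-cells denotes whiskering. **Bicocomplete.** $\mathcal{C}$ is bicocomplete if it has all small weighted bicolimits: for every small 2-category $I$, 2-functors $F:I\to\mathcal{C}$ and $W:I^{\mathrm{op}}\to\mathbf{Cat}$ (small categories as values), there is an object $L$ with equivalences of categories $\mathcal{C}[L,B]\simeq[I^{\mathrm{op}},\mathbf{Cat}]_{\mathrm{ps}}[W,\mathcal{C}[F,B]]$ (pseudonatural transformations and modifications), pseudonatural in $B$. **Oplax bicolimits.** For a 2-functor $F:I\to\mathcal{C}$ with $I$ a small 2-category, an oplax cocone with tip $B$ consists of 1-cells $q_i:F(i)\to B$ and, for each $d:i\to j$, a (not necessarily invertible) 2-cell $q_d:q_jF(d)\Rightarrow q_i$, compatible with identities and composition and such that $q_{d'}\circ(q_jF(\sigma))=q_d$ for each 2-cell $\sigma:d\Rightarrow d'$; morphisms are modifications. The oplax bicolimit of $F$ is an oplax cocone with tip $L$ such that composition with it gives equivalences, natural in $B$, between $\mathcal{C}[L,B]$ and the category of oplax cocones with tip $B$. $\mathcal{C}$ has oplax bicolimits if these exist for all small $I$ and all $F$. **Codescent objects.** A codescent object $\mathscr{X}$ in $\mathcal{K}$ consists of objects $\mathscr{X}(0),\mathscr{X}(1),\mathscr{X}(2)$, 1-cells $p_0,p_1,p_2:\mathscr{X}(2)\to\mathscr{X}(1)$,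 $d_0,d_1:\mathscr{X}(1)\to\mathscr{X}(0)$, $i:\mathscr{X}(0)\to\mathscr{X}(1)$, and invertible 2-cells $n_0:d_0i\Rightarrow 1$, $n_1:d_1i\Rightarrow 1$, $\theta_{01}:d_0p_0\Rightarrow d_0p_1$, $\theta_{02}:d_1p_0\Rightarrow d_0p_2$, $\theta_{12}:d_1p_1\Rightarrow d_1p_2$. A pair $(q:\mathscr{X}(0)\to C,\ \xi:qd_0\Rightarrow qd_1)$ with $\xi$ invertible pseudocoequalizes $\mathscr{X}$ if $(qn_1)\circ(\xi i)=qn_0$ and $(q\theta_{12})\circ(\xi p_1)\circ(q\theta_{01})=(\xi p_2)\circ(q\theta_{02})\circ(\xi p_0)$. Morphisms $(q,\xi)\to(q',\xi')$ are 2-cells $q\Rightarrow q'$ compatible with $\xi,\xi'$. A bicoequalizer of $\mathscr{X}$ is a pseudocoequalizing pair with tip $\mathrm{bicoeq}(\mathscr{X})$ such that composition with it gives equivalences, natural in $C$, from $\mathcal{K}[\mathrm{bicoeq}(\mathscr{X}),C]$ to the category of pseudocoequalizing pairs with tip $C$. *)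

theory Defs
  imports Main "HOL-Library.FuncSet"
begin

unbundle cardinal_syntax

text \<open>
  Smallness. A set is small if its cardinality is strictly below \<open>\<kappa>\<close>, where \<open>\<kappa>\<close> is an arbitrary
  uncountable regular cardinal living on a type \<open>'u\<close>. If \<open>\<kappa>\<close> is inaccessible, this is
  smallness with respect to a Grothendieck universe. Strong limits are not required, so the
  notion also covers "of cardinality at most \<open>\<lambda>\<close>" for every infinite \<open>\<lambda>\<close>. Every small structure
  is isomorphic to one whose cells are elements of \<open>'u\<close>, so small categories and small
  2-categories are taken with carriers in \<open>'u\<close>.
\<close>

definition smallness_cardinal :: "'u rel \<Rightarrow> bool" where
  "smallness_cardinal \<kappa> \<longleftrightarrow> Card_order \<kappa> \<and> regularCard \<kappa> \<and> natLeq <o \<kappa>"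

definition small_set :: "'u rel \<Rightarrow> 'u set \<Rightarrow> bool" where
  "small_set \<kappa> S \<longleftrightarrow> |S| <o \<kappa>"


section \<open>Categories, functors, natural transformations\<close>

text \<open>
  In all structures below only the values on the carriers matter: the axioms constrain nothing
  else. Composition is written in the order of function composition.
\<close>

record ('o, 'a) cat =
  Obj :: "'o set"
  Arr :: "'a set"
  Dom :: "'a \<Rightarrow> 'o"
  Cod :: "'a \<Rightarrow> 'o"
  Idt :: "'o \<Rightarrow> 'a"
  Cmp :: "'a \<Rightarrow> 'a \<Rightarrow> 'a"

definition hom_set :: "('o, 'a) cat \<Rightarrow> 'o \<Rightarrow> 'o \<Rightarrow> 'a set" where
  "hom_set A x y = {f \<in> Arr A. Dom A f = x \<and> Cod A f = y}"

definition category :: "('o, 'a) cat \<Rightarrow> bool" where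
  "category A \<longleftrightarrow>
     (\<forall>f \<in> Arr A. Dom A f \<in> Obj A \<and> Cod A f \<in> Obj A) \<and>
     (\<forall>x \<in> Obj A. Idt A x \<in> hom_set A x x) \<and>
     (\<forall>f \<in> Arr A. \<forall>g \<in> Arr A. Cod A f = Dom A g \<longrightarrow> Cmp A g f \<in> hom_set A (Dom A f) (Cod A g)) \<and>
     (\<forall>f \<in> Arr A. Cmp A f (Idt A (Dom A f)) = f \<and> Cmp A (Idt A (Cod A f)) f = f) \<and>
     (\<forall>f \<in> Arr A. \<forall>g \<in> Arr A. \<forall>h \<in> Arr A. Cod A f = Dom A g \<longrightarrow> Cod A g = Dom A h \<longrightarrow>
        Cmp A h (Cmp A g f) = Cmp A (Cmp A h g) f)"

definition small_category :: "'u rel \<Rightarrow> ('u, 'u) cat \<Rightarrow> bool" where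
  "small_category \<kappa> A \<longleftrightarrow> category A \<and> small_set \<kappa> (Obj A) \<and> small_set \<kappa> (Arr A)"

definition iso_arr :: "('o, 'a) cat \<Rightarrow> 'a \<Rightarrow> bool" where
  "iso_arr A f \<longleftrightarrow> f \<in> Arr A \<and>
     (\<exists>g \<in> hom_set A (Cod A f) (Dom A f).
        Cmp A g f = Idt A (Dom A f) \<and> Cmp A f g = Idt A (Cod A f))"

record ('o, 'a, 'p, 'b) fctr =
  onO :: "'o \<Rightarrow> 'p"
  onA :: "'a \<Rightarrow> 'b"

definition is_functor :: "('o, 'a) cat \<Rightarrow> ('p, 'b) cat \<Rightarrow> ('o, 'a, 'p, 'b) fctr \<Rightarrow> bool" where
  "is_functor A B F \<longleftrightarrow>
     (\<forall>x \<in> Obj A. onO F x \<in> Obj B \<and> onA F (Idt A x) = Idt B (onO F x)) \<and>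
     (\<forall>f \<in> Arr A. onA F f \<in> hom_set B (onO F (Dom A f)) (onO F (Cod A f))) \<and>
     (\<forall>f \<in> Arr A. \<forall>g \<in> Arr A. Cod A f = Dom A g \<longrightarrow>
        onA F (Cmp A g f) = Cmp B (onA F g) (onA F f))"

definition id_fctr :: "('o, 'a, 'o, 'a) fctr" where
  "id_fctr = \<lparr>onO = (\<lambda>x. x), onA = (\<lambda>f. f)\<rparr>"

definition comp_fctr ::
  "('p, 'b, 'q, 'c) fctr \<Rightarrow> ('o, 'a, 'p, 'b) fctr \<Rightarrow> ('o, 'a, 'q, 'c) fctr" where
  "comp_fctr G F = \<lparr>onO = (\<lambda>x. onO G (onO F x)), onA = (\<lambda>f. onA G (onA F f))\<rparr>"

definition nat_trans :: "('o, 'a) cat \<Rightarrow> ('p, 'b) cat \<Rightarrow>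
    ('o, 'a, 'p, 'b) fctr \<Rightarrow> ('o, 'a, 'p, 'b) fctr \<Rightarrow> ('o \<Rightarrow> 'b) \<Rightarrow> bool" where
  "nat_trans A B F G t \<longleftrightarrow>
     (\<forall>x \<in> Obj A. t x \<in> hom_set B (onO F x) (onO G x)) \<and>
     (\<forall>f \<in> Arr A. Cmp B (t (Cod A f)) (onA F f) = Cmp B (onA G f) (t (Dom A f)))"

definition nat_iso :: "('o, 'a) cat \<Rightarrow> ('p, 'b) cat \<Rightarrow>
    ('o, 'a, 'p, 'b) fctr \<Rightarrow> ('o, 'a, 'p, 'b) fctr \<Rightarrow> ('o \<Rightarrow> 'b) \<Rightarrow> bool" where
  "nat_iso A B F G t \<longleftrightarrow> nat_trans A B F G t \<and> (\<forall>x \<in> Obj A. iso_arr B (t x))"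

definition is_equivalence :: "('o, 'a) cat \<Rightarrow> ('p, 'b) cat \<Rightarrow> ('o, 'a, 'p, 'b) fctr \<Rightarrow> bool" where
  "is_equivalence A B F \<longleftrightarrow> is_functor A B F \<and>
     (\<exists>G. is_functor B A G \<and>
        (\<exists>\<eta>. nat_iso A A id_fctr (comp_fctr G F) \<eta>) \<and>
        (\<exists>\<epsilon>. nat_iso B B (comp_fctr F G) id_fctr \<epsilon>))"


section \<open>Strict 2-categories and 2-functors\<close>

text \<open>\<open>vcmp\<close> and \<open>hcmp\<close> are vertical and horizontal composition of 2-cells.\<close>

record ('k0, 'k1, 'k2) two_cat =
  Cell0 :: "'k0 set"
  Cell1 :: "'k1 set"
  Cell2 :: "'k2 set"
  src :: "'k1 \<Rightarrow> 'k0"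
  tgt :: "'k1 \<Rightarrow> 'k0"
  id1 :: "'k0 \<Rightarrow> 'k1"
  cmp1 :: "'k1 \<Rightarrow> 'k1 \<Rightarrow> 'k1"
  dom2 :: "'k2 \<Rightarrow> 'k1"
  cod2 :: "'k2 \<Rightarrow> 'k1"
  id2 :: "'k1 \<Rightarrow> 'k2"
  vcmp :: "'k2 \<Rightarrow> 'k2 \<Rightarrow> 'k2"
  hcmp :: "'k2 \<Rightarrow> 'k2 \<Rightarrow> 'k2"

definition cat1 :: "('k0, 'k1, 'k2) two_cat \<Rightarrow> ('k0, 'k1) cat" where
  "cat1 K = \<lparr>Obj = Cell0 K, Arr = Cell1 K, Dom = src K, Cod = tgt K, Idt = id1 K, Cmp = cmp1 K\<rparr>"

definition vcat :: "('k0, 'k1, 'k2) two_cat \<Rightarrow> ('k1, 'k2) cat" where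
  "vcat K = \<lparr>Obj = Cell1 K, Arr = Cell2 K, Dom = dom2 K, Cod = cod2 K, Idt = id2 K, Cmp = vcmp K\<rparr>"

definition hcat :: "('k0, 'k1, 'k2) two_cat \<Rightarrow> ('k0, 'k2) cat" where
  "hcat K = \<lparr>Obj = Cell0 K, Arr = Cell2 K, Dom = (\<lambda>s. src K (dom2 K s)), Cod = (\<lambda>s. tgt K (dom2 K s)),
     Idt = (\<lambda>x. id2 K (id1 K x)), Cmp = hcmp K\<rparr>"

definition two_category :: "('k0, 'k1, 'k2) two_cat \<Rightarrow> bool" where
  "two_category K \<longleftrightarrow>
     category (cat1 K) \<and> category (vcat K) \<and> category (hcat K) \<and>
     (\<forall>s \<in> Cell2 K. src K (cod2 K s) = src K (dom2 K s) \<and> tgt K (cod2 K s) = tgt K (dom2 K s)) \<and>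
     (\<forall>s \<in> Cell2 K. \<forall>t \<in> Cell2 K. tgt K (dom2 K s) = src K (dom2 K t) \<longrightarrow>
        dom2 K (hcmp K t s) = cmp1 K (dom2 K t) (dom2 K s) \<and>
        cod2 K (hcmp K t s) = cmp1 K (cod2 K t) (cod2 K s)) \<and>
     (\<forall>f \<in> Cell1 K. \<forall>g \<in> Cell1 K. tgt K f = src K g \<longrightarrow>
        hcmp K (id2 K g) (id2 K f) = id2 K (cmp1 K g f)) \<and>
     (\<forall>s \<in> Cell2 K. \<forall>s' \<in> Cell2 K. \<forall>t \<in> Cell2 K. \<forall>t' \<in> Cell2 K.
        cod2 K s = dom2 K s' \<longrightarrow> cod2 K t = dom2 K t' \<longrightarrow> tgt K (dom2 K s) = src K (dom2 K t) \<longrightarrow>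
        hcmp K (vcmp K t' t) (vcmp K s' s) = vcmp K (hcmp K t' s') (hcmp K t s))"

definition small_two_category :: "'u rel \<Rightarrow> ('u, 'u, 'u) two_cat \<Rightarrow> bool" where
  "small_two_category \<kappa> K \<longleftrightarrow> two_category K \<and>
     small_set \<kappa> (Cell0 K) \<and> small_set \<kappa> (Cell1 K) \<and> small_set \<kappa> (Cell2 K)"

text \<open>Reverses 1-cells but not 2-cells.\<close>

definition op2 :: "('k0, 'k1, 'k2) two_cat \<Rightarrow> ('k0, 'k1, 'k2) two_cat" where
  "op2 K = K\<lparr>src := tgt K, tgt := src K, cmp1 := (\<lambda>g f. cmp1 K f g), hcmp := (\<lambda>t s. hcmp K s t)\<rparr>"

definition wl :: "('k0, 'k1, 'k2) two_cat \<Rightarrow> 'k1 \<Rightarrow> 'k2 \<Rightarrow> 'k2" where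
  "wl K f s = hcmp K (id2 K f) s"

definition wr :: "('k0, 'k1, 'k2) two_cat \<Rightarrow> 'k2 \<Rightarrow> 'k1 \<Rightarrow> 'k2" where
  "wr K s f = hcmp K s (id2 K f)"

abbreviation hom1 :: "('k0, 'k1, 'k2) two_cat \<Rightarrow> 'k0 \<Rightarrow> 'k0 \<Rightarrow> 'k1 set" where
  "hom1 K \<equiv> hom_set (cat1 K)"

abbreviation hom2 :: "('k0, 'k1, 'k2) two_cat \<Rightarrow> 'k1 \<Rightarrow> 'k1 \<Rightarrow> 'k2 set" where
  "hom2 K \<equiv> hom_set (vcat K)"

abbreviation inv_hom2 :: "('k0, 'k1, 'k2) two_cat \<Rightarrow> 'k1 \<Rightarrow> 'k1 \<Rightarrow> 'k2 set" where
  "inv_hom2 K f g \<equiv> {s \<in> hom2 K f g. iso_arr (vcat K) s}"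

definition hom_cat :: "('k0, 'k1, 'k2) two_cat \<Rightarrow> 'k0 \<Rightarrow> 'k0 \<Rightarrow> ('k1, 'k2) cat" where
  "hom_cat K x y = \<lparr>Obj = hom1 K x y, Arr = hom_set (hcat K) x y,
     Dom = dom2 K, Cod = cod2 K, Idt = id2 K, Cmp = vcmp K\<rparr>"

record ('i0, 'i1, 'i2, 'k0, 'k1, 'k2) two_fun =
  F0 :: "'i0 \<Rightarrow> 'k0"
  F1 :: "'i1 \<Rightarrow> 'k1"
  F2 :: "'i2 \<Rightarrow> 'k2"

definition two_functor :: "('i0, 'i1, 'i2) two_cat \<Rightarrow> ('k0, 'k1, 'k2) two_cat \<Rightarrow>
    ('i0, 'i1, 'i2, 'k0, 'k1, 'k2) two_fun \<Rightarrow> bool" where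
  "two_functor I K F \<longleftrightarrow>
     is_functor (cat1 I) (cat1 K) \<lparr>onO = F0 F, onA = F1 F\<rparr> \<and>
     is_functor (vcat I) (vcat K) \<lparr>onO = F1 F, onA = F2 F\<rparr> \<and>
     is_functor (hcat I) (hcat K) \<lparr>onO = F0 F, onA = F2 F\<rparr>"


section \<open>2-functors into Cat\<close>

text \<open>
  A Cat-valued 2-functor on \<open>K\<close>. All its values have objects in \<open>'o\<close> and arrows in \<open>'a\<close>, but
  these types may differ from one Cat-valued 2-functor to another; this allows pseudonatural
  transformations from a weight with small values to hom-categories of an arbitrary 2-category.
\<close>

record ('k0, 'k1, 'k2, 'o, 'a) cat_fun =
  C0 :: "'k0 \<Rightarrow> ('o, 'a) cat"
  C1 :: "'k1 \<Rightarrow> ('o, 'a, 'o, 'a) fctr"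
  C2 :: "'k2 \<Rightarrow> 'o \<Rightarrow> 'a"

definition eq_on_cat :: "('o, 'a) cat \<Rightarrow> ('o, 'a, 'p, 'b) fctr \<Rightarrow> ('o, 'a, 'p, 'b) fctr \<Rightarrow> bool" where
  "eq_on_cat A F G \<longleftrightarrow> (\<forall>x \<in> Obj A. onO F x = onO G x) \<and> (\<forall>f \<in> Arr A. onA F f = onA G f)"

definition cat_functor :: "('k0, 'k1, 'k2) two_cat \<Rightarrow> ('k0, 'k1, 'k2, 'o, 'a) cat_fun \<Rightarrow> bool" where
  "cat_functor K W \<longleftrightarrow>
     (\<forall>i \<in> Cell0 K. category (C0 W i)) \<and>
     (\<forall>d \<in> Cell1 K. is_functor (C0 W (src K d)) (C0 W (tgt K d)) (C1 W d)) \<and>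
     (\<forall>s \<in> Cell2 K. nat_trans (C0 W (src K (dom2 K s))) (C0 W (tgt K (dom2 K s)))
        (C1 W (dom2 K s)) (C1 W (cod2 K s)) (C2 W s)) \<and>
     (\<forall>i \<in> Cell0 K. eq_on_cat (C0 W i) (C1 W (id1 K i)) id_fctr) \<and>
     (\<forall>d \<in> Cell1 K. \<forall>e \<in> Cell1 K. tgt K d = src K e \<longrightarrow>
        eq_on_cat (C0 W (src K d)) (C1 W (cmp1 K e d)) (comp_fctr (C1 W e) (C1 W d))) \<and>
     (\<forall>d \<in> Cell1 K. \<forall>x \<in> Obj (C0 W (src K d)).
        C2 W (id2 K d) x = Idt (C0 W (tgt K d)) (onO (C1 W d) x)) \<and>
     (\<forall>s \<in> Cell2 K. \<forall>t \<in> Cell2 K. cod2 K s = dom2 K t \<longrightarrow>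
        (\<forall>x \<in> Obj (C0 W (src K (dom2 K s))).
           C2 W (vcmp K t s) x = Cmp (C0 W (tgt K (dom2 K s))) (C2 W t x) (C2 W s x))) \<and>
     (\<forall>s \<in> Cell2 K. \<forall>t \<in> Cell2 K. tgt K (dom2 K s) = src K (dom2 K t) \<longrightarrow>
        (\<forall>x \<in> Obj (C0 W (src K (dom2 K s))).
           C2 W (hcmp K t s) x =
             Cmp (C0 W (tgt K (dom2 K t)))
               (C2 W t (onO (C1 W (cod2 K s)) x)) (onA (C1 W (dom2 K t)) (C2 W s x))))"

text \<open>
  A pseudonatural transformation \<open>\<alpha> : W \<Rightarrow> G\<close> has functors \<open>\<alpha>\<^sub>i : W i \<rightarrow> G i\<close> and, for
  \<open>d : i \<rightarrow> j\<close>, natural isomorphisms \<open>\<alpha>\<^sub>d : G(d) \<alpha>\<^sub>i \<Rightarrow> \<alpha>\<^sub>j W(d)\<close>.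
\<close>

record ('k0, 'k1, 'o, 'a, 'p, 'b) ps_trans =
  cmpt :: "'k0 \<Rightarrow> ('o, 'a, 'p, 'b) fctr"
  strc :: "'k1 \<Rightarrow> 'o \<Rightarrow> 'b"

definition pseudonatural :: "('k0, 'k1, 'k2) two_cat \<Rightarrow>
    ('k0, 'k1, 'k2, 'o, 'a) cat_fun \<Rightarrow> ('k0, 'k1, 'k2, 'p, 'b) cat_fun \<Rightarrow>
    ('k0, 'k1, 'o, 'a, 'p, 'b) ps_trans \<Rightarrow> bool" where
  "pseudonatural K W G \<alpha> \<longleftrightarrow>
     (\<forall>i \<in> Cell0 K. is_functor (C0 W i) (C0 G i) (cmpt \<alpha> i)) \<and>
     (\<forall>d \<in> Cell1 K. nat_iso (C0 W (src K d)) (C0 G (tgt K d))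
        (comp_fctr (C1 G d) (cmpt \<alpha> (src K d))) (comp_fctr (cmpt \<alpha> (tgt K d)) (C1 W d)) (strc \<alpha> d)) \<and>
     (\<forall>i \<in> Cell0 K. \<forall>x \<in> Obj (C0 W i).
        strc \<alpha> (id1 K i) x = Idt (C0 G i) (onO (cmpt \<alpha> i) x)) \<and>
     (\<forall>d \<in> Cell1 K. \<forall>e \<in> Cell1 K. tgt K d = src K e \<longrightarrow>
        (\<forall>x \<in> Obj (C0 W (src K d)).
           strc \<alpha> (cmp1 K e d) x =
             Cmp (C0 G (tgt K e)) (strc \<alpha> e (onO (C1 W d) x)) (onA (C1 G e) (strc \<alpha> d x)))) \<and>
     (\<forall>s \<in> Cell2 K. \<forall>x \<in> Obj (C0 W (src K (dom2 K s))).
        Cmp (C0 G (tgt K (dom2 K s))) (onA (cmpt \<alpha> (tgt K (dom2 K s))) (C2 W s x)) (strc \<alpha> (dom2 K s) x) =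
        Cmp (C0 G (tgt K (dom2 K s))) (strc \<alpha> (cod2 K s) x) (C2 G s (onO (cmpt \<alpha> (src K (dom2 K s))) x)))"

definition modification :: "('k0, 'k1, 'k2) two_cat \<Rightarrow>
    ('k0, 'k1, 'k2, 'o, 'a) cat_fun \<Rightarrow> ('k0, 'k1, 'k2, 'p, 'b) cat_fun \<Rightarrow>
    ('k0, 'k1, 'o, 'a, 'p, 'b) ps_trans \<Rightarrow> ('k0, 'k1, 'o, 'a, 'p, 'b) ps_trans \<Rightarrow>
    ('k0 \<Rightarrow> 'o \<Rightarrow> 'b) \<Rightarrow> bool" where
  "modification K W G \<alpha> \<beta> m \<longleftrightarrow>
     (\<forall>i \<in> Cell0 K. nat_trans (C0 W i) (C0 G i) (cmpt \<alpha> i) (cmpt \<beta> i) (m i)) \<and>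
     (\<forall>d \<in> Cell1 K. \<forall>x \<in> Obj (C0 W (src K d)).
        Cmp (C0 G (tgt K d)) (strc \<beta> d x) (onA (C1 G d) (m (src K d) x)) =
        Cmp (C0 G (tgt K d)) (m (tgt K d) (onO (C1 W d) x)) (strc \<alpha> d x))"

text \<open>
  The category \<open>[K, Cat]\<^sub>p\<^sub>s[W, G]\<close>. Its objects and arrows are normalised to be undefined outside
  the carriers, so that equality in HOL is equality of transformations and modifications.
  An arrow is a modification together with its domain and codomain.
\<close>

definition ext_ps :: "('k0, 'k1, 'k2) two_cat \<Rightarrow> ('k0, 'k1, 'k2, 'o, 'a) cat_fun \<Rightarrow>
    ('k0, 'k1, 'o, 'a, 'p, 'b) ps_trans \<Rightarrow> bool" where
  "ext_ps K W \<alpha> \<longleftrightarrow>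
     cmpt \<alpha> \<in> extensional (Cell0 K) \<and>
     (\<forall>i \<in> Cell0 K. onO (cmpt \<alpha> i) \<in> extensional (Obj (C0 W i)) \<and>
                     onA (cmpt \<alpha> i) \<in> extensional (Arr (C0 W i))) \<and>
     strc \<alpha> \<in> extensional (Cell1 K) \<and>
     (\<forall>d \<in> Cell1 K. strc \<alpha> d \<in> extensional (Obj (C0 W (src K d))))"

definition ext_mod :: "('k0, 'k1, 'k2) two_cat \<Rightarrow> ('k0, 'k1, 'k2, 'o, 'a) cat_fun \<Rightarrow>
    ('k0 \<Rightarrow> 'o \<Rightarrow> 'b) \<Rightarrow> bool" where
  "ext_mod K W m \<longleftrightarrow>
     m \<in> extensional (Cell0 K) \<and> (\<forall>i \<in> Cell0 K. m i \<in> extensional (Obj (C0 W i)))"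

type_synonym ('k0, 'k1, 'o, 'a, 'p, 'b) ps_mod =
  "('k0, 'k1, 'o, 'a, 'p, 'b) ps_trans \<times> ('k0, 'k1, 'o, 'a, 'p, 'b) ps_trans \<times> ('k0 \<Rightarrow> 'o \<Rightarrow> 'b)"

definition ps_cat :: "('k0, 'k1, 'k2) two_cat \<Rightarrow>
    ('k0, 'k1, 'k2, 'o, 'a) cat_fun \<Rightarrow> ('k0, 'k1, 'k2, 'p, 'b) cat_fun \<Rightarrow>
    (('k0, 'k1, 'o, 'a, 'p, 'b) ps_trans, ('k0, 'k1, 'o, 'a, 'p, 'b) ps_mod) cat" where
  "ps_cat K W G =
     (let obs = {\<alpha>. pseudonatural K W G \<alpha> \<and> ext_ps K W \<alpha>} in
      \<lparr>Obj = obs,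
       Arr = {(\<alpha>, \<beta>, m). \<alpha> \<in> obs \<and> \<beta> \<in> obs \<and> modification K W G \<alpha> \<beta> m \<and> ext_mod K W m},
       Dom = (\<lambda>(\<alpha>, \<beta>, m). \<alpha>),
       Cod = (\<lambda>(\<alpha>, \<beta>, m). \<beta>),
       Idt = (\<lambda>\<alpha>. (\<alpha>, \<alpha>, \<lambda>i \<in> Cell0 K. \<lambda>x \<in> Obj (C0 W i). Idt (C0 G i) (onO (cmpt \<alpha> i) x))),
       Cmp = (\<lambda>(\<beta>, \<gamma>, n) (\<alpha>, \<beta>', m).
                (\<alpha>, \<gamma>, \<lambda>i \<in> Cell0 K. \<lambda>x \<in> Obj (C0 W i). Cmp (C0 G i) (n i x) (m i x)))\<rparr>)"


section \<open>Weighted bicolimits\<close>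

text \<open>The covariant representable 2-functor \<open>K[L, -]\<close>.\<close>

definition rep :: "('k0, 'k1, 'k2) two_cat \<Rightarrow> 'k0 \<Rightarrow> ('k0, 'k1, 'k2, 'k1, 'k2) cat_fun" where
  "rep K L = \<lparr>C0 = (\<lambda>B. hom_cat K L B),
     C1 = (\<lambda>f. \<lparr>onO = (\<lambda>g. cmp1 K f g), onA = (\<lambda>s. wl K f s)\<rparr>),
     C2 = (\<lambda>t g. wr K t g)\<rparr>"

text \<open>The 2-functor \<open>K[F(-), B]\<close> on \<open>op2 I\<close>.\<close>

definition hom_into :: "('k0, 'k1, 'k2) two_cat \<Rightarrow> ('i0, 'i1, 'i2, 'k0, 'k1, 'k2) two_fun \<Rightarrow> 'k0 \<Rightarrow>
    ('i0, 'i1, 'i2, 'k1, 'k2) cat_fun" where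
  "hom_into K F B = \<lparr>C0 = (\<lambda>i. hom_cat K (F0 F i) B),
     C1 = (\<lambda>d. \<lparr>onO = (\<lambda>g. cmp1 K g (F1 F d)), onA = (\<lambda>s. wr K s (F1 F d))\<rparr>),
     C2 = (\<lambda>s g. wl K g (F2 F s))\<rparr>"

text \<open>
  The 2-functor \<open>B \<mapsto> [op2 I, Cat]\<^sub>p\<^sub>s[W, K[F, B]]\<close> on \<open>K\<close>. 1-cells and 2-cells out of \<open>B\<close> act by
  postcomposition.
\<close>

definition post_trans :: "('i0, 'i1, 'i2) two_cat \<Rightarrow> ('i0, 'i1, 'i2, 'o, 'a) cat_fun \<Rightarrow>
    ('k0, 'k1, 'k2) two_cat \<Rightarrow> 'k1 \<Rightarrow>
    ('i0, 'i1, 'o, 'a, 'k1, 'k2) ps_trans \<Rightarrow> ('i0, 'i1, 'o, 'a, 'k1, 'k2) ps_trans" where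
  "post_trans I W K f \<alpha> =
     \<lparr>cmpt = (\<lambda>i \<in> Cell0 I. \<lparr>onO = (\<lambda>x \<in> Obj (C0 W i). cmp1 K f (onO (cmpt \<alpha> i) x)),
                             onA = (\<lambda>a \<in> Arr (C0 W i). wl K f (onA (cmpt \<alpha> i) a))\<rparr>),
      strc = (\<lambda>d \<in> Cell1 I. \<lambda>x \<in> Obj (C0 W (src (op2 I) d)). wl K f (strc \<alpha> d x))\<rparr>"

definition weighted_cocones :: "('i0, 'i1, 'i2) two_cat \<Rightarrow> ('i0, 'i1, 'i2, 'o, 'a) cat_fun \<Rightarrow>
    ('k0, 'k1, 'k2) two_cat \<Rightarrow> ('i0, 'i1, 'i2, 'k0, 'k1, 'k2) two_fun \<Rightarrow>
    ('k0, 'k1, 'k2, ('i0, 'i1, 'o, 'a, 'k1, 'k2) ps_trans, ('i0, 'i1, 'o, 'a, 'k1, 'k2) ps_mod) cat_fun" where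
  "weighted_cocones I W K F =
     \<lparr>C0 = (\<lambda>B. ps_cat (op2 I) W (hom_into K F B)),
      C1 = (\<lambda>f. \<lparr>onO = post_trans I W K f,
                 onA = (\<lambda>(\<alpha>, \<beta>, m). (post_trans I W K f \<alpha>, post_trans I W K f \<beta>,
                          \<lambda>i \<in> Cell0 I. \<lambda>x \<in> Obj (C0 W i). wl K f (m i x)))\<rparr>),
      C2 = (\<lambda>t \<alpha>. (post_trans I W K (dom2 K t) \<alpha>, post_trans I W K (cod2 K t) \<alpha>,
                     \<lambda>i \<in> Cell0 I. \<lambda>x \<in> Obj (C0 W i). wr K t (onO (cmpt \<alpha> i) x)))\<rparr>"

definition is_weighted_bicolimit :: "('i0, 'i1, 'i2) two_cat \<Rightarrow> ('i0, 'i1, 'i2, 'o, 'a) cat_fun \<Rightarrow>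
    ('k0, 'k1, 'k2) two_cat \<Rightarrow> ('i0, 'i1, 'i2, 'k0, 'k1, 'k2) two_fun \<Rightarrow> 'k0 \<Rightarrow> bool" where
  "is_weighted_bicolimit I W K F L \<longleftrightarrow> L \<in> Cell0 K \<and>
     (\<exists>E. pseudonatural K (rep K L) (weighted_cocones I W K F) E \<and>
          (\<forall>B \<in> Cell0 K. is_equivalence (hom_cat K L B) (ps_cat (op2 I) W (hom_into K F B)) (cmpt E B)))"

definition bicocomplete :: "'u rel \<Rightarrow> ('k0, 'k1, 'k2) two_cat \<Rightarrow> bool" where
  "bicocomplete \<kappa> K \<longleftrightarrow>
     (\<forall>(I :: ('u, 'u, 'u) two_cat) F (W :: ('u, 'u, 'u, 'u, 'u) cat_fun).
        small_two_category \<kappa> I \<longrightarrow> two_functor I K F \<longrightarrow> cat_functor (op2 I) W \<longrightarrow>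
        (\<forall>i \<in> Cell0 I. small_category \<kappa> (C0 W i)) \<longrightarrow>
        (\<exists>L. is_weighted_bicolimit I W K F L))"


section \<open>Oplax bicolimits\<close>

type_synonym ('i0, 'i1, 'k1, 'k2) cocone = "('i0 \<Rightarrow> 'k1) \<times> ('i1 \<Rightarrow> 'k2)"

definition oplax_cocone :: "('i0, 'i1, 'i2) two_cat \<Rightarrow> ('k0, 'k1, 'k2) two_cat \<Rightarrow>
    ('i0, 'i1, 'i2, 'k0, 'k1, 'k2) two_fun \<Rightarrow> 'k0 \<Rightarrow> ('i0, 'i1, 'k1, 'k2) cocone \<Rightarrow> bool" where
  "oplax_cocone I K F B = (\<lambda>(q, r).
     q \<in> extensional (Cell0 I) \<and> r \<in> extensional (Cell1 I) \<and>
     (\<forall>i \<in> Cell0 I. q i \<in> hom1 K (F0 F i) B) \<and>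
     (\<forall>d \<in> Cell1 I. r d \<in> hom2 K (cmp1 K (q (tgt I d)) (F1 F d)) (q (src I d))) \<and>
     (\<forall>i \<in> Cell0 I. r (id1 I i) = id2 K (q i)) \<and>
     (\<forall>d \<in> Cell1 I. \<forall>e \<in> Cell1 I. tgt I d = src I e \<longrightarrow>
        r (cmp1 I e d) = vcmp K (r d) (wr K (r e) (F1 F d))) \<and>
     (\<forall>s \<in> Cell2 I.
        vcmp K (r (cod2 I s)) (wl K (q (tgt I (dom2 I s))) (F2 F s)) = r (dom2 I s)))"

definition oplax_modification :: "('i0, 'i1, 'i2) two_cat \<Rightarrow> ('k0, 'k1, 'k2) two_cat \<Rightarrow>
    ('i0, 'i1, 'i2, 'k0, 'k1, 'k2) two_fun \<Rightarrow> ('i0, 'i1, 'k1, 'k2) cocone \<Rightarrow>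
    ('i0, 'i1, 'k1, 'k2) cocone \<Rightarrow> ('i0 \<Rightarrow> 'k2) \<Rightarrow> bool" where
  "oplax_modification I K F = (\<lambda>(q, r) (q', r') m.
     m \<in> extensional (Cell0 I) \<and>
     (\<forall>i \<in> Cell0 I. m i \<in> hom2 K (q i) (q' i)) \<and>
     (\<forall>d \<in> Cell1 I. vcmp K (m (src I d)) (r d) = vcmp K (r' d) (wr K (m (tgt I d)) (F1 F d))))"

definition oplax_cocone_cat :: "('i0, 'i1, 'i2) two_cat \<Rightarrow> ('k0, 'k1, 'k2) two_cat \<Rightarrow>
    ('i0, 'i1, 'i2, 'k0, 'k1, 'k2) two_fun \<Rightarrow> 'k0 \<Rightarrow>
    (('i0, 'i1, 'k1, 'k2) cocone,
     ('i0, 'i1, 'k1, 'k2) cocone \<times> ('i0, 'i1, 'k1, 'k2) cocone \<times> ('i0 \<Rightarrow> 'k2)) cat" where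
  "oplax_cocone_cat I K F B =
     \<lparr>Obj = {Q. oplax_cocone I K F B Q},
      Arr = {(Q, Q', m). oplax_cocone I K F B Q \<and> oplax_cocone I K F B Q' \<and>
                         oplax_modification I K F Q Q' m},
      Dom = (\<lambda>(Q, Q', m). Q),
      Cod = (\<lambda>(Q, Q', m). Q'),
      Idt = (\<lambda>Q. (Q, Q, \<lambda>i \<in> Cell0 I. id2 K (fst Q i))),
      Cmp = (\<lambda>(Q', Q'', n) (Q, P, m). (Q, Q'', \<lambda>i \<in> Cell0 I. vcmp K (n i) (m i)))\<rparr>"

definition cocone_post :: "('i0, 'i1, 'i2) two_cat \<Rightarrow> ('k0, 'k1, 'k2) two_cat \<Rightarrow>
    ('i0, 'i1, 'k1, 'k2) cocone \<Rightarrow> 'k1 \<Rightarrow> ('i0, 'i1, 'k1, 'k2) cocone" where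
  "cocone_post I K Q f =
     (\<lambda>i \<in> Cell0 I. cmp1 K f (fst Q i), \<lambda>d \<in> Cell1 I. wl K f (snd Q d))"

text \<open>
  Composition with a fixed cocone is strictly natural in the tip, so in the universal properties
  of this and the next section naturality needs no separate clause.
\<close>

definition compose_cocone :: "('i0, 'i1, 'i2) two_cat \<Rightarrow> ('k0, 'k1, 'k2) two_cat \<Rightarrow>
    ('i0, 'i1, 'k1, 'k2) cocone \<Rightarrow>
    ('k1, 'k2, ('i0, 'i1, 'k1, 'k2) cocone,
     ('i0, 'i1, 'k1, 'k2) cocone \<times> ('i0, 'i1, 'k1, 'k2) cocone \<times> ('i0 \<Rightarrow> 'k2)) fctr" where
  "compose_cocone I K Q =
     \<lparr>onO = cocone_post I K Q,
      onA = (\<lambda>t. (cocone_post I K Q (dom2 K t), cocone_post I K Q (cod2 K t),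
                    \<lambda>i \<in> Cell0 I. wr K t (fst Q i)))\<rparr>"

definition is_oplax_bicolimit :: "('i0, 'i1, 'i2) two_cat \<Rightarrow> ('k0, 'k1, 'k2) two_cat \<Rightarrow>
    ('i0, 'i1, 'i2, 'k0, 'k1, 'k2) two_fun \<Rightarrow> 'k0 \<Rightarrow> ('i0, 'i1, 'k1, 'k2) cocone \<Rightarrow> bool" where
  "is_oplax_bicolimit I K F L Q \<longleftrightarrow> L \<in> Cell0 K \<and> oplax_cocone I K F L Q \<and>
     (\<forall>B \<in> Cell0 K.
        is_equivalence (hom_cat K L B) (oplax_cocone_cat I K F B) (compose_cocone I K Q))"

definition has_oplax_bicolimits :: "'u rel \<Rightarrow> ('k0, 'k1, 'k2) two_cat \<Rightarrow> bool" where
  "has_oplax_bicolimits \<kappa> K \<longleftrightarrow>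
     (\<forall>(I :: ('u, 'u, 'u) two_cat) F. small_two_category \<kappa> I \<longrightarrow> two_functor I K F \<longrightarrow>
        (\<exists>L Q. is_oplax_bicolimit I K F L Q))"


section \<open>Codescent objects and bicoequalizers\<close>

record ('k0, 'k1, 'k2) codescent =
  X0 :: 'k0
  X1 :: 'k0
  X2 :: 'k0
  p0 :: 'k1
  p1 :: 'k1
  p2 :: 'k1
  d0 :: 'k1
  d1 :: 'k1
  ii :: 'k1
  n0 :: 'k2
  n1 :: 'k2
  th01 :: 'k2
  th02 :: 'k2
  th12 :: 'k2

definition codescent_object :: "('k0, 'k1, 'k2) two_cat \<Rightarrow> ('k0, 'k1, 'k2) codescent \<Rightarrow> bool" where
  "codescent_object K X \<longleftrightarrow>
     X0 X \<in> Cell0 K \<and> X1 X \<in> Cell0 K \<and> X2 X \<in> Cell0 K \<and>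
     p0 X \<in> hom1 K (X2 X) (X1 X) \<and> p1 X \<in> hom1 K (X2 X) (X1 X) \<and> p2 X \<in> hom1 K (X2 X) (X1 X) \<and>
     d0 X \<in> hom1 K (X1 X) (X0 X) \<and> d1 X \<in> hom1 K (X1 X) (X0 X) \<and>
     ii X \<in> hom1 K (X0 X) (X1 X) \<and>
     n0 X \<in> inv_hom2 K (cmp1 K (d0 X) (ii X)) (id1 K (X0 X)) \<and>
     n1 X \<in> inv_hom2 K (cmp1 K (d1 X) (ii X)) (id1 K (X0 X)) \<and>
     th01 X \<in> inv_hom2 K (cmp1 K (d0 X) (p0 X)) (cmp1 K (d0 X) (p1 X)) \<and>
     th02 X \<in> inv_hom2 K (cmp1 K (d1 X) (p0 X)) (cmp1 K (d0 X) (p2 X)) \<and>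
     th12 X \<in> inv_hom2 K (cmp1 K (d1 X) (p1 X)) (cmp1 K (d1 X) (p2 X))"

definition pseudocoequalizes :: "('k0, 'k1, 'k2) two_cat \<Rightarrow> ('k0, 'k1, 'k2) codescent \<Rightarrow> 'k0 \<Rightarrow>
    'k1 \<times> 'k2 \<Rightarrow> bool" where
  "pseudocoequalizes K X B = (\<lambda>(q, \<xi>).
     q \<in> hom1 K (X0 X) B \<and>
     \<xi> \<in> inv_hom2 K (cmp1 K q (d0 X)) (cmp1 K q (d1 X)) \<and>
     vcmp K (wl K q (n1 X)) (wr K \<xi> (ii X)) = wl K q (n0 X) \<and>
     vcmp K (wl K q (th12 X)) (vcmp K (wr K \<xi> (p1 X)) (wl K q (th01 X))) =
     vcmp K (wr K \<xi> (p2 X)) (vcmp K (wl K q (th02 X)) (wr K \<xi> (p0 X))))"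

definition pseudocoeq_morphism :: "('k0, 'k1, 'k2) two_cat \<Rightarrow> ('k0, 'k1, 'k2) codescent \<Rightarrow>
    'k1 \<times> 'k2 \<Rightarrow> 'k1 \<times> 'k2 \<Rightarrow> 'k2 \<Rightarrow> bool" where
  "pseudocoeq_morphism K X = (\<lambda>(q, \<xi>) (q', \<xi>') t.
     t \<in> hom2 K q q' \<and> vcmp K \<xi>' (wr K t (d0 X)) = vcmp K (wr K t (d1 X)) \<xi>)"

definition pseudocoeq_cat :: "('k0, 'k1, 'k2) two_cat \<Rightarrow> ('k0, 'k1, 'k2) codescent \<Rightarrow> 'k0 \<Rightarrow>
    ('k1 \<times> 'k2, ('k1 \<times> 'k2) \<times> ('k1 \<times> 'k2) \<times> 'k2) cat" where
  "pseudocoeq_cat K X B =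
     \<lparr>Obj = {Q. pseudocoequalizes K X B Q},
      Arr = {(Q, Q', t). pseudocoequalizes K X B Q \<and> pseudocoequalizes K X B Q' \<and>
                         pseudocoeq_morphism K X Q Q' t},
      Dom = (\<lambda>(Q, Q', t). Q),
      Cod = (\<lambda>(Q, Q', t). Q'),
      Idt = (\<lambda>Q. (Q, Q, id2 K (fst Q))),
      Cmp = (\<lambda>(Q', Q'', t) (Q, P, s). (Q, Q'', vcmp K t s))\<rparr>"

definition pair_post :: "('k0, 'k1, 'k2) two_cat \<Rightarrow> 'k1 \<times> 'k2 \<Rightarrow> 'k1 \<Rightarrow> 'k1 \<times> 'k2" where
  "pair_post K Q f = (cmp1 K f (fst Q), wl K f (snd Q))"

definition compose_pair :: "('k0, 'k1, 'k2) two_cat \<Rightarrow> 'k1 \<times> 'k2 \<Rightarrow>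
    ('k1, 'k2, 'k1 \<times> 'k2, ('k1 \<times> 'k2) \<times> ('k1 \<times> 'k2) \<times> 'k2) fctr" where
  "compose_pair K Q =
     \<lparr>onO = pair_post K Q,
      onA = (\<lambda>t. (pair_post K Q (dom2 K t), pair_post K Q (cod2 K t), wr K t (fst Q)))\<rparr>"

definition is_bicoequalizer :: "('k0, 'k1, 'k2) two_cat \<Rightarrow> ('k0, 'k1, 'k2) codescent \<Rightarrow> 'k0 \<Rightarrow>
    'k1 \<times> 'k2 \<Rightarrow> bool" where
  "is_bicoequalizer K X L Q \<longleftrightarrow> L \<in> Cell0 K \<and> pseudocoequalizes K X L Q \<and>
     (\<forall>B \<in> Cell0 K. is_equivalence (hom_cat K L B) (pseudocoeq_cat K X B) (compose_pair K Q))"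

definition has_bicoequalizers :: "('k0, 'k1, 'k2) two_cat \<Rightarrow> bool" where
  "has_bicoequalizers K \<longleftrightarrow>
     (\<forall>X. codescent_object K X \<longrightarrow> (\<exists>L Q. is_bicoequalizer K X L Q))"

end

theory Submission
  imports Defs
begin

text \<open>
  Oplax cocones and pseudocoequalizing pairs are families of 1-cells and 2-cells with a common tip
  subject to equations. A weight whose values are the point and the arrow category represents
  such families without equations. The equations are then imposed by a second bicolimit, which
  forces pairs of parallel 2-cells to coincide. Since that condition is stable under isomorphism,
  the second object is reached by a 1-cell that is fully faithful on hom-categories.

  Conversely, a weighted cocone is an oplax cocone under the 2-category of elements of the weight
  whose structure 2-cells at the cartesian 1-cells are invertible. It remains to invert a small family
  of 2-cells into a given object. An oplax bicolimit collects the family into one 2-cell, and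
  inverting a single 2-cell of this kind is a bicoequalizer of a codescent object.
\<close>

section \<open>Calculus of 2-cells\<close>

text \<open>A codescent object needs more than a 2-cell to be inverted: a common section
  \<open>i\<close>, three 1-cells out of a third object, and a pseudocoequalizing pair whose 2-cell
  \<open>\<xi>\<close> is extra data. For an arbitrary family of 2-cells there is no section and
  nothing fixes \<open>\<xi>\<close>. This obstacle shapes the converse direction. The index of the
  oplax bicolimit contains the given object as an isolated point, whose leg is the section
  \<open>i\<close>, and every 2-cell of the family enters through two objects joined by parallel
  arrows, so that an endomorphism \<open>j\<close> of the bicolimit can collapse them. Together
  \<open>i\<close> and \<open>j\<close> force \<open>\<xi>\<close> to be the whiskered 2-cell.

  Passing from a universal family to a more restricted one is a single lemma,
  \<open>ins_rep_localize\<close>, used in both directions: with coequified pairs of 2-cells in one,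
  with inverted 2-cells in the other.

  The hypotheses speak of indices with carriers in \<open>'u\<close>, whereas the shapes built here
  are datatypes and products. They are moved to \<open>'u\<close> along injections.\<close>

lemma in_hom_set [simp]: "f \<in> hom_set A x y \<longleftrightarrow> f \<in> Arr A \<and> Dom A f = x \<and> Cod A f = y"
  by (auto simp: hom_set_def)

lemma cat1_simps [simp]:
  "Obj (cat1 K) = Cell0 K" "Arr (cat1 K) = Cell1 K" "Dom (cat1 K) = src K" "Cod (cat1 K) = tgt K"
  "Idt (cat1 K) = id1 K" "Cmp (cat1 K) = cmp1 K"
  by (simp_all add: cat1_def)

lemma vcat_simps [simp]:
  "Obj (vcat K) = Cell1 K" "Arr (vcat K) = Cell2 K" "Dom (vcat K) = dom2 K" "Cod (vcat K) = cod2 K"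
  "Idt (vcat K) = id2 K" "Cmp (vcat K) = vcmp K"
  by (simp_all add: vcat_def)

lemma hcat_simps [simp]:
  "Obj (hcat K) = Cell0 K" "Arr (hcat K) = Cell2 K" "Dom (hcat K) = (\<lambda>s. src K (dom2 K s))"
  "Cod (hcat K) = (\<lambda>s. tgt K (dom2 K s))"
  "Idt (hcat K) = (\<lambda>x. id2 K (id1 K x))" "Cmp (hcat K) = hcmp K"
  by (simp_all add: hcat_def)

lemma hom_cat_simps [simp]:
  "Obj (hom_cat K x y) = hom1 K x y" "Arr (hom_cat K x y) = hom_set (hcat K) x y"
  "Dom (hom_cat K x y) = dom2 K" "Cod (hom_cat K x y) = cod2 K"
  "Idt (hom_cat K x y) = id2 K" "Cmp (hom_cat K x y) = vcmp K"
  by (simp_all add: hom_cat_def)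

lemma op2_simps [simp]:
  "Cell0 (op2 K) = Cell0 K" "Cell1 (op2 K) = Cell1 K" "Cell2 (op2 K) = Cell2 K"
  "src (op2 K) = tgt K" "tgt (op2 K) = src K" "id1 (op2 K) = id1 K"
  "cmp1 (op2 K) g f = cmp1 K f g" "dom2 (op2 K) = dom2 K" "cod2 (op2 K) = cod2 K"
  "id2 (op2 K) = id2 K" "vcmp (op2 K) = vcmp K" "hcmp (op2 K) t s = hcmp K s t"
  by (simp_all add: op2_def)

locale strict_two_category =
  fixes C :: "('k0, 'k1, 'k2) two_cat"
  assumes two_category: "two_category C"
begin

abbreviation cmp1' (infixr "\<cdot>" 75) where "g \<cdot> f \<equiv> cmp1 C g f"
abbreviation vcmp' (infixr "\<bullet>" 65) where "t \<bullet> s \<equiv> vcmp C t s"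
abbreviation wl' (infixr "\<rhd>" 70) where "f \<rhd> s \<equiv> wl C f s"
abbreviation wr' (infixl "\<lhd>" 70) where "s \<lhd> f \<equiv> wr C s f"

lemma ax:
  "category (cat1 C)" "category (vcat C)" "category (hcat C)"
  "s \<in> Cell2 C \<Longrightarrow> src C (cod2 C s) = src C (dom2 C s)"
  "s \<in> Cell2 C \<Longrightarrow> tgt C (cod2 C s) = tgt C (dom2 C s)"
  using two_category by (auto simp: two_category_def)

lemma cell1 [simp]:
  "f \<in> Cell1 C \<Longrightarrow> src C f \<in> Cell0 C" "f \<in> Cell1 C \<Longrightarrow> tgt C f \<in> Cell0 C"
  "x \<in> Cell0 C \<Longrightarrow> id1 C x \<in> Cell1 C" "x \<in> Cell0 C \<Longrightarrow> src C (id1 C x) = x"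
  "x \<in> Cell0 C \<Longrightarrow> tgt C (id1 C x) = x"
  "\<lbrakk>f \<in> Cell1 C; g \<in> Cell1 C; tgt C f = src C g\<rbrakk> \<Longrightarrow> g \<cdot> f \<in> Cell1 C"
  "\<lbrakk>f \<in> Cell1 C; g \<in> Cell1 C; tgt C f = src C g\<rbrakk> \<Longrightarrow> src C (g \<cdot> f) = src C f"
  "\<lbrakk>f \<in> Cell1 C; g \<in> Cell1 C; tgt C f = src C g\<rbrakk> \<Longrightarrow> tgt C (g \<cdot> f) = tgt C g"
  "\<lbrakk>f \<in> Cell1 C; src C f = x\<rbrakk> \<Longrightarrow> f \<cdot> id1 C x = f"
  "\<lbrakk>f \<in> Cell1 C; tgt C f = y\<rbrakk> \<Longrightarrow> id1 C y \<cdot> f = f"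
  "\<lbrakk>f \<in> Cell1 C; g \<in> Cell1 C; h \<in> Cell1 C; tgt C f = src C g; tgt C g = src C h\<rbrakk> \<Longrightarrow>
     (h \<cdot> g) \<cdot> f = h \<cdot> (g \<cdot> f)"
  using ax(1) by (auto simp: category_def)

lemma cell2 [simp]:
  "s \<in> Cell2 C \<Longrightarrow> dom2 C s \<in> Cell1 C" "s \<in> Cell2 C \<Longrightarrow> cod2 C s \<in> Cell1 C"
  "s \<in> Cell2 C \<Longrightarrow> src C (cod2 C s) = src C (dom2 C s)"
  "s \<in> Cell2 C \<Longrightarrow> tgt C (cod2 C s) = tgt C (dom2 C s)"
  "f \<in> Cell1 C \<Longrightarrow> id2 C f \<in> Cell2 C" "f \<in> Cell1 C \<Longrightarrow> dom2 C (id2 C f) = f"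
  "f \<in> Cell1 C \<Longrightarrow> cod2 C (id2 C f) = f"
  "\<lbrakk>s \<in> Cell2 C; t \<in> Cell2 C; cod2 C s = dom2 C t\<rbrakk> \<Longrightarrow> t \<bullet> s \<in> Cell2 C"
  "\<lbrakk>s \<in> Cell2 C; t \<in> Cell2 C; cod2 C s = dom2 C t\<rbrakk> \<Longrightarrow> dom2 C (t \<bullet> s) = dom2 C s"
  "\<lbrakk>s \<in> Cell2 C; t \<in> Cell2 C; cod2 C s = dom2 C t\<rbrakk> \<Longrightarrow> cod2 C (t \<bullet> s) = cod2 C t"
  "\<lbrakk>s \<in> Cell2 C; dom2 C s = f\<rbrakk> \<Longrightarrow> s \<bullet> id2 C f = s"
  "\<lbrakk>s \<in> Cell2 C; cod2 C s = f\<rbrakk> \<Longrightarrow> id2 C f \<bullet> s = s"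
  "\<lbrakk>s \<in> Cell2 C; t \<in> Cell2 C; u \<in> Cell2 C; cod2 C s = dom2 C t; cod2 C t = dom2 C u\<rbrakk> \<Longrightarrow>
     (u \<bullet> t) \<bullet> s = u \<bullet> (t \<bullet> s)"
  using ax(2,4,5) by (auto simp: category_def)

lemma hcell [simp]:
  "\<lbrakk>s \<in> Cell2 C; t \<in> Cell2 C; tgt C (dom2 C s) = src C (dom2 C t)\<rbrakk> \<Longrightarrow> hcmp C t s \<in> Cell2 C"
  "\<lbrakk>s \<in> Cell2 C; t \<in> Cell2 C; tgt C (dom2 C s) = src C (dom2 C t)\<rbrakk> \<Longrightarrow>
     dom2 C (hcmp C t s) = dom2 C t \<cdot> dom2 C s"
  "\<lbrakk>s \<in> Cell2 C; t \<in> Cell2 C; tgt C (dom2 C s) = src C (dom2 C t)\<rbrakk> \<Longrightarrow>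
     cod2 C (hcmp C t s) = cod2 C t \<cdot> cod2 C s"
  "\<lbrakk>f \<in> Cell1 C; g \<in> Cell1 C; tgt C f = src C g\<rbrakk> \<Longrightarrow>
     hcmp C (id2 C g) (id2 C f) = id2 C (g \<cdot> f)"
  using ax(3) two_category by (auto simp: category_def two_category_def)

lemma hcmp_id:
  "s \<in> Cell2 C \<Longrightarrow> tgt C (dom2 C s) = x \<Longrightarrow> hcmp C (id2 C (id1 C x)) s = s"
  "s \<in> Cell2 C \<Longrightarrow> src C (dom2 C s) = x \<Longrightarrow> hcmp C s (id2 C (id1 C x)) = s"
  using ax(3) by (auto simp: category_def)

lemma hcmp_assoc:
  "\<lbrakk>s \<in> Cell2 C; t \<in> Cell2 C; u \<in> Cell2 C; tgt C (dom2 C s) = src C (dom2 C t);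
    tgt C (dom2 C t) = src C (dom2 C u)\<rbrakk> \<Longrightarrow> hcmp C u (hcmp C t s) = hcmp C (hcmp C u t) s"
  using ax(3) by (auto simp: category_def)

lemma interchange:
  "\<lbrakk>s \<in> Cell2 C; s' \<in> Cell2 C; t \<in> Cell2 C; t' \<in> Cell2 C; cod2 C s = dom2 C s';
    cod2 C t = dom2 C t'; tgt C (dom2 C s) = src C (dom2 C t)\<rbrakk> \<Longrightarrow>
   hcmp C (t' \<bullet> t) (s' \<bullet> s) = hcmp C t' s' \<bullet> hcmp C t s"
  using two_category by (auto simp: two_category_def)

lemma wl_cell [simp]:
  assumes "f \<in> Cell1 C" "s \<in> Cell2 C" "tgt C (dom2 C s) = src C f"
  shows "f \<rhd> s \<in> Cell2 C" "dom2 C (f \<rhd> s) = f \<cdot> dom2 C s" "cod2 C (f \<rhd> s) = f \<cdot> cod2 C s"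
  using assms by (simp_all add: wl_def)

lemma wr_cell [simp]:
  assumes "f \<in> Cell1 C" "s \<in> Cell2 C" "tgt C f = src C (dom2 C s)"
  shows "s \<lhd> f \<in> Cell2 C" "dom2 C (s \<lhd> f) = dom2 C s \<cdot> f" "cod2 C (s \<lhd> f) = cod2 C s \<cdot> f"
  using assms by (simp_all add: wr_def)

lemma wl_simps [simp]:
  "\<lbrakk>f \<in> Cell1 C; g \<in> Cell1 C; tgt C g = src C f\<rbrakk> \<Longrightarrow> f \<rhd> id2 C g = id2 C (f \<cdot> g)"
  "\<lbrakk>s \<in> Cell2 C; tgt C (dom2 C s) = x\<rbrakk> \<Longrightarrow> id1 C x \<rhd> s = s"
  "\<lbrakk>f \<in> Cell1 C; s \<in> Cell2 C; t \<in> Cell2 C; cod2 C s = dom2 C t; tgt C (dom2 C s) = src C f\<rbrakk> \<Longrightarrow>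
    f \<rhd> (t \<bullet> s) = (f \<rhd> t) \<bullet> (f \<rhd> s)"
  "\<lbrakk>f \<in> Cell1 C; g \<in> Cell1 C; s \<in> Cell2 C; tgt C (dom2 C s) = src C f; tgt C f = src C g\<rbrakk> \<Longrightarrow>
    g \<rhd> (f \<rhd> s) = (g \<cdot> f) \<rhd> s"
  apply (simp add: wl_def)
  apply (simp add: wl_def hcmp_id)
  apply (simp add: wl_def interchange[symmetric])
  apply (simp add: wl_def hcmp_assoc)
  done

lemma wr_simps [simp]:
  "\<lbrakk>f \<in> Cell1 C; g \<in> Cell1 C; tgt C f = src C g\<rbrakk> \<Longrightarrow> id2 C g \<lhd> f = id2 C (g \<cdot> f)"
  "\<lbrakk>s \<in> Cell2 C; src C (dom2 C s) = x\<rbrakk> \<Longrightarrow> s \<lhd> id1 C x = s"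
  "\<lbrakk>f \<in> Cell1 C; s \<in> Cell2 C; t \<in> Cell2 C; cod2 C s = dom2 C t; src C (dom2 C s) = tgt C f\<rbrakk> \<Longrightarrow>
    (t \<bullet> s) \<lhd> f = (t \<lhd> f) \<bullet> (s \<lhd> f)"
  "\<lbrakk>f \<in> Cell1 C; g \<in> Cell1 C; s \<in> Cell2 C; src C (dom2 C s) = tgt C f; tgt C g = src C f\<rbrakk> \<Longrightarrow>
    (s \<lhd> f) \<lhd> g = s \<lhd> (f \<cdot> g)"
  "\<lbrakk>f \<in> Cell1 C; g \<in> Cell1 C; s \<in> Cell2 C; src C (dom2 C s) = tgt C f; tgt C (dom2 C s) = src C g\<rbrakk> \<Longrightarrow>
    (g \<rhd> s) \<lhd> f = g \<rhd> (s \<lhd> f)"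
  apply (simp add: wr_def)
  apply (simp add: wr_def hcmp_id)
  apply (simp add: wr_def interchange[symmetric])
  apply (simp add: wr_def hcmp_assoc[symmetric])
  apply (simp add: wr_def wl_def hcmp_assoc)
  done

lemma hcmp_whisker:
  assumes "s \<in> Cell2 C" "t \<in> Cell2 C" "tgt C (dom2 C s) = src C (dom2 C t)"
  shows "hcmp C t s = (t \<lhd> cod2 C s) \<bullet> (dom2 C t \<rhd> s)"
    and "hcmp C t s = (cod2 C t \<rhd> s) \<bullet> (t \<lhd> dom2 C s)"
  using assms interchange[of s "id2 C (cod2 C s)" "id2 C (dom2 C t)" t]
    interchange[of "id2 C (dom2 C s)" s t "id2 C (cod2 C t)"]
  by (simp_all add: wl_def wr_def)

text \<open>Both sides are \<open>hcmp C t s\<close>. Domains and codomains are separate variables,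
  so that the rule still matches after simplification has rewritten them. Naturality squares between
  a 2-cell acting on the left and one acting on the right come from here.\<close>

lemma whisker_swap:
  assumes "s \<in> Cell2 C" "t \<in> Cell2 C" "tgt C (dom2 C s) = src C (dom2 C t)"
    "dom2 C s = f" "cod2 C s = f'" "dom2 C t = g" "cod2 C t = g'"
  shows "(t \<lhd> f') \<bullet> (g \<rhd> s) = (g' \<rhd> s) \<bullet> (t \<lhd> f)"
  using hcmp_whisker[OF assms(1-3)] assms by simp

subsection \<open>Invertible 2-cells\<close>

definition inv2 :: "'k2 \<Rightarrow> bool" where
  "inv2 s \<longleftrightarrow> iso_arr (vcat C) s"

text \<open>Choice makes the inverse a total operation, so cancellation and compatibility with
  whiskering can be simplification rules. Its value is meaningful only under
  \<open>inv2\<close>.\<close>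

definition vinv :: "'k2 \<Rightarrow> 'k2" where
  "vinv s = (SOME t. t \<in> Cell2 C \<and> dom2 C t = cod2 C s \<and> cod2 C t = dom2 C s \<and>
                     t \<bullet> s = id2 C (dom2 C s) \<and> s \<bullet> t = id2 C (cod2 C s))"

lemma inv2I:
  assumes "s \<in> Cell2 C" "t \<in> Cell2 C" "dom2 C t = cod2 C s" "cod2 C t = dom2 C s"
    "t \<bullet> s = id2 C (dom2 C s)" "s \<bullet> t = id2 C (cod2 C s)"
  shows "inv2 s"
  using assms unfolding inv2_def iso_arr_def by auto

lemma inv2_cell [simp]: "inv2 s \<Longrightarrow> s \<in> Cell2 C"
  by (simp add: inv2_def iso_arr_def)

lemma vinv [simp]:
  assumes "inv2 s"
  shows "vinv s \<in> Cell2 C" "dom2 C (vinv s) = cod2 C s" "cod2 C (vinv s) = dom2 C s"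
    "vinv s \<bullet> s = id2 C (dom2 C s)" "s \<bullet> vinv s = id2 C (cod2 C s)"
proof -
  have "\<exists>t. t \<in> Cell2 C \<and> dom2 C t = cod2 C s \<and> cod2 C t = dom2 C s \<and>
                     t \<bullet> s = id2 C (dom2 C s) \<and> s \<bullet> t = id2 C (cod2 C s)"
    using assms unfolding inv2_def iso_arr_def by (simp add: Bex_def)
  from someI_ex[OF this]
  show "vinv s \<in> Cell2 C" "dom2 C (vinv s) = cod2 C s" "cod2 C (vinv s) = dom2 C s"
    "vinv s \<bullet> s = id2 C (dom2 C s)" "s \<bullet> vinv s = id2 C (cod2 C s)"
    unfolding vinv_def by blast+
qed

lemma vinv_cancel [simp]:
  "\<lbrakk>inv2 s; t \<in> Cell2 C; cod2 C t = dom2 C s\<rbrakk> \<Longrightarrow> vinv s \<bullet> s \<bullet> t = t"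
  "\<lbrakk>inv2 s; t \<in> Cell2 C; cod2 C t = cod2 C s\<rbrakk> \<Longrightarrow> s \<bullet> vinv s \<bullet> t = t"
proof -
  assume a: "inv2 s" "t \<in> Cell2 C" "cod2 C t = dom2 C s"
  have "vinv s \<bullet> s \<bullet> t = (vinv s \<bullet> s) \<bullet> t"
    using a by (subst cell2(13)) auto
  then show "vinv s \<bullet> s \<bullet> t = t" using a by simp
next
  assume a: "inv2 s" "t \<in> Cell2 C" "cod2 C t = cod2 C s"
  have "s \<bullet> vinv s \<bullet> t = (s \<bullet> vinv s) \<bullet> t"
    using a by (subst cell2(13)) auto
  then show "s \<bullet> vinv s \<bullet> t = t" using a by simp
qed

lemma inv2_cancel_left:
  assumes "inv2 s" "a \<in> Cell2 C" "b \<in> Cell2 C" "cod2 C a = dom2 C s" "cod2 C b = dom2 C s"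
    "s \<bullet> a = s \<bullet> b"
  shows "a = b"
proof -
  have "vinv s \<bullet> s \<bullet> a = vinv s \<bullet> s \<bullet> b" using assms by simp
  then show ?thesis using assms(1-5) by simp
qed

lemma inv2_cancel_right:
  assumes "inv2 s" "a \<in> Cell2 C" "b \<in> Cell2 C" "dom2 C a = cod2 C s" "dom2 C b = cod2 C s"
    "a \<bullet> s = b \<bullet> s"
  shows "a = b"
proof -
  have "(a \<bullet> s) \<bullet> vinv s = (b \<bullet> s) \<bullet> vinv s" using assms by simp
  then show ?thesis using assms(1-5) by simp
qed

lemma vinv_unique:
  assumes "inv2 s" "t \<in> Cell2 C" "cod2 C t = dom2 C s" "s \<bullet> t = id2 C (cod2 C s)"
  shows "vinv s = t"
  by (rule inv2_cancel_left[of s]) (use assms in auto)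

lemma inv2_vinv [simp]: "inv2 s \<Longrightarrow> inv2 (vinv s)"
  by (rule inv2I[of _ s]) auto

lemma inv2_id [simp]: "f \<in> Cell1 C \<Longrightarrow> inv2 (id2 C f)"
  by (rule inv2I[of _ "id2 C f"]) auto

lemma vinv_id [simp]: "f \<in> Cell1 C \<Longrightarrow> vinv (id2 C f) = id2 C f"
  by (rule vinv_unique) auto

lemma inv2_vcmp [simp]: "\<lbrakk>inv2 s; inv2 t; cod2 C s = dom2 C t\<rbrakk> \<Longrightarrow> inv2 (t \<bullet> s)"
  by (rule inv2I[of _ "vinv s \<bullet> vinv t"]) auto

lemma inv2_wl [simp]: "\<lbrakk>inv2 s; f \<in> Cell1 C; tgt C (dom2 C s) = src C f\<rbrakk> \<Longrightarrow> inv2 (f \<rhd> s)"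
  by (rule inv2I[of _ "f \<rhd> vinv s"]) (auto simp flip: wl_simps(3))

lemma inv2_wr [simp]: "\<lbrakk>inv2 s; f \<in> Cell1 C; src C (dom2 C s) = tgt C f\<rbrakk> \<Longrightarrow> inv2 (s \<lhd> f)"
  by (rule inv2I[of _ "vinv s \<lhd> f"]) (auto simp flip: wr_simps(3))

lemma wl_vinv [simp]:
  "\<lbrakk>inv2 s; f \<in> Cell1 C; tgt C (dom2 C s) = src C f\<rbrakk> \<Longrightarrow> f \<rhd> vinv s = vinv (f \<rhd> s)"
  by (rule vinv_unique[symmetric]) (auto simp flip: wl_simps(3))

lemma wr_vinv [simp]:
  "\<lbrakk>inv2 s; f \<in> Cell1 C; src C (dom2 C s) = tgt C f\<rbrakk> \<Longrightarrow> vinv s \<lhd> f = vinv (s \<lhd> f)"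
  by (rule vinv_unique[symmetric]) (auto simp flip: wr_simps(3))

lemma inv2_left_factor:
  assumes "inv2 (t \<bullet> s)" "inv2 s" "t \<in> Cell2 C" "cod2 C s = dom2 C t"
  shows "inv2 t"
proof -
  have "inv2 ((t \<bullet> s) \<bullet> vinv s)"
    by (rule inv2_vcmp) (use assms in auto)
  then show ?thesis using assms by simp
qed

lemma inv2_right_factor:
  assumes "inv2 (t \<bullet> s)" "inv2 t" "s \<in> Cell2 C" "cod2 C s = dom2 C t"
  shows "inv2 s"
proof -
  have "inv2 (vinv t \<bullet> (t \<bullet> s))"
    by (rule inv2_vcmp) (use assms in auto)
  then show ?thesis using assms by simp
qed

lemma hom_cat_hom_set [simp]:
  "\<lbrakk>f \<in> hom1 C x y\<rbrakk> \<Longrightarrow>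
    t \<in> hom_set (hom_cat C x y) f g \<longleftrightarrow> t \<in> Cell2 C \<and> dom2 C t = f \<and> cod2 C t = g"
  by auto

lemma category_hom_cat: "category (hom_cat C x y)"
  unfolding category_def by (auto simp: hom_set_def)

lemma iso_arr_hom_cat: "iso_arr (hom_cat C x y) t \<longleftrightarrow> inv2 t \<and> src C (dom2 C t) = x \<and> tgt C (dom2 C t) = y"
proof
  assume a: "iso_arr (hom_cat C x y) t"
  then obtain g where "t \<in> Cell2 C" "src C (dom2 C t) = x" "tgt C (dom2 C t) = y"
    "g \<in> Cell2 C" "dom2 C g = cod2 C t" "cod2 C g = dom2 C t"
    "g \<bullet> t = id2 C (dom2 C t)" "t \<bullet> g = id2 C (cod2 C t)"
    unfolding iso_arr_def in_hom_set hom_cat_simps hcat_simps Bex_def by blast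
  then show "inv2 t \<and> src C (dom2 C t) = x \<and> tgt C (dom2 C t) = y"
    using inv2I by blast
next
  assume a: "inv2 t \<and> src C (dom2 C t) = x \<and> tgt C (dom2 C t) = y"
  then have "vinv t \<in> hom_set (hom_cat C x y) (cod2 C t) (dom2 C t)"
    by simp
  with a show "iso_arr (hom_cat C x y) t"
    unfolding iso_arr_def by (intro conjI bexI[of _ "vinv t"]) simp_all
qed

end

section \<open>Equivalences of categories\<close>

definition fully_faithful :: "('o, 'a) cat \<Rightarrow> ('p, 'b) cat \<Rightarrow> ('o, 'a, 'p, 'b) fctr \<Rightarrow> bool" where
  "fully_faithful A B F \<longleftrightarrow> (\<forall>x \<in> Obj A. \<forall>y \<in> Obj A. \<forall>b \<in> hom_set B (onO F x) (onO F y).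
     \<exists>!a. a \<in> hom_set A x y \<and> onA F a = b)"

definition ess_surjective :: "('o, 'a) cat \<Rightarrow> ('p, 'b) cat \<Rightarrow> ('o, 'a, 'p, 'b) fctr \<Rightarrow> bool" where
  "ess_surjective A B F \<longleftrightarrow> (\<forall>y \<in> Obj B. \<exists>x \<in> Obj A. \<exists>b \<in> hom_set B (onO F x) y. iso_arr B b)"

locale category_calc =
  fixes A :: "('o, 'a) cat"
  assumes category: "category A"
begin

lemma cat_simps [simp]:
  "f \<in> Arr A \<Longrightarrow> Dom A f \<in> Obj A" "f \<in> Arr A \<Longrightarrow> Cod A f \<in> Obj A"
  "x \<in> Obj A \<Longrightarrow> Idt A x \<in> Arr A" "x \<in> Obj A \<Longrightarrow> Dom A (Idt A x) = x"
  "x \<in> Obj A \<Longrightarrow> Cod A (Idt A x) = x"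
  "\<lbrakk>f \<in> Arr A; g \<in> Arr A; Cod A f = Dom A g\<rbrakk> \<Longrightarrow> Cmp A g f \<in> Arr A"
  "\<lbrakk>f \<in> Arr A; g \<in> Arr A; Cod A f = Dom A g\<rbrakk> \<Longrightarrow> Dom A (Cmp A g f) = Dom A f"
  "\<lbrakk>f \<in> Arr A; g \<in> Arr A; Cod A f = Dom A g\<rbrakk> \<Longrightarrow> Cod A (Cmp A g f) = Cod A g"
  "\<lbrakk>f \<in> Arr A; Dom A f = x\<rbrakk> \<Longrightarrow> Cmp A f (Idt A x) = f"
  "\<lbrakk>f \<in> Arr A; Cod A f = x\<rbrakk> \<Longrightarrow> Cmp A (Idt A x) f = f"
  "\<lbrakk>f \<in> Arr A; g \<in> Arr A; h \<in> Arr A; Cod A f = Dom A g; Cod A g = Dom A h\<rbrakk> \<Longrightarrow>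
     Cmp A (Cmp A h g) f = Cmp A h (Cmp A g f)"
  using category by (auto simp: category_def)

lemma isoE:
  assumes "iso_arr A f"
  obtains g where "f \<in> Arr A" "g \<in> Arr A" "Dom A g = Cod A f" "Cod A g = Dom A f"
    "Cmp A g f = Idt A (Dom A f)" "Cmp A f g = Idt A (Cod A f)"
  using assms unfolding iso_arr_def by auto

lemma iso_ex:
  "iso_arr A f \<Longrightarrow> \<exists>g. g \<in> Arr A \<and> Dom A g = Cod A f \<and> Cod A g = Dom A f \<and>
    Cmp A g f = Idt A (Dom A f) \<and> Cmp A f g = Idt A (Cod A f)"
  unfolding iso_arr_def by auto

lemma isoI:
  assumes "f \<in> Arr A" "g \<in> Arr A" "Dom A g = Cod A f" "Cod A g = Dom A f"
    "Cmp A g f = Idt A (Dom A f)" "Cmp A f g = Idt A (Cod A f)"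
  shows "iso_arr A f"
  using assms unfolding iso_arr_def by auto

lemma iso_cmp:
  assumes "iso_arr A f" "iso_arr A g" "Cod A f = Dom A g"
  shows "iso_arr A (Cmp A g f)"
proof -
  obtain f' where f: "f \<in> Arr A" "f' \<in> Arr A" "Dom A f' = Cod A f" "Cod A f' = Dom A f"
    "Cmp A f' f = Idt A (Dom A f)" "Cmp A f f' = Idt A (Cod A f)" using assms(1) by (rule isoE)
  obtain g' where g: "g \<in> Arr A" "g' \<in> Arr A" "Dom A g' = Cod A g" "Cod A g' = Dom A g"
    "Cmp A g' g = Idt A (Dom A g)" "Cmp A g g' = Idt A (Cod A g)" using assms(2) by (rule isoE)
  have 1: "Cmp A g' (Cmp A g f) = f"
    using f g assms(3) cat_simps(11)[of f g g', symmetric] by simp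
  have 2: "Cmp A f (Cmp A f' g') = g'"
    using f g assms(3) cat_simps(11)[of g' f' f, symmetric] by simp
  show ?thesis
    by (rule isoI[of _ "Cmp A f' g'"]) (use f g assms(3) 1 2 in auto)
qed

lemma iso_idt: "x \<in> Obj A \<Longrightarrow> iso_arr A (Idt A x)"
  by (rule isoI[of _ "Idt A x"]) auto

lemma mono_iso:
  assumes "iso_arr A f" "a \<in> Arr A" "b \<in> Arr A" "Cod A a = Dom A f" "Cod A b = Dom A f"
    "Cmp A f a = Cmp A f b"
  shows "a = b"
proof -
  obtain f' where f: "f \<in> Arr A" "f' \<in> Arr A" "Dom A f' = Cod A f" "Cod A f' = Dom A f"
    "Cmp A f' f = Idt A (Dom A f)" "Cmp A f f' = Idt A (Cod A f)" using assms(1) by (rule isoE)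
  have "Cmp A (Cmp A f' f) a = Cmp A (Cmp A f' f) b"
    using f(1-4) assms(2-) by simp
  then show ?thesis using f(5) assms(2-) by simp
qed

lemma epi_iso:
  assumes "iso_arr A f" "a \<in> Arr A" "b \<in> Arr A" "Dom A a = Cod A f" "Dom A b = Cod A f"
    "Cmp A a f = Cmp A b f"
  shows "a = b"
proof -
  obtain f' where f: "f \<in> Arr A" "f' \<in> Arr A" "Dom A f' = Cod A f" "Cod A f' = Dom A f"
    "Cmp A f' f = Idt A (Dom A f)" "Cmp A f f' = Idt A (Cod A f)" using assms(1) by (rule isoE)
  have "Cmp A (Cmp A a f) f' = Cmp A (Cmp A b f) f'"
    using f(1-4) assms(2-) by simp
  then show ?thesis using f assms(2-5) by simp
qed

end

lemma functor_simps:
  assumes "is_functor A B F"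
  shows "x \<in> Obj A \<Longrightarrow> onO F x \<in> Obj B" "x \<in> Obj A \<Longrightarrow> onA F (Idt A x) = Idt B (onO F x)"
    "f \<in> Arr A \<Longrightarrow> onA F f \<in> Arr B" "f \<in> Arr A \<Longrightarrow> Dom B (onA F f) = onO F (Dom A f)"
    "f \<in> Arr A \<Longrightarrow> Cod B (onA F f) = onO F (Cod A f)"
    "\<lbrakk>f \<in> Arr A; g \<in> Arr A; Cod A f = Dom A g\<rbrakk> \<Longrightarrow> onA F (Cmp A g f) = Cmp B (onA F g) (onA F f)"
  using assms by (auto simp: is_functor_def)

lemma functor_iso:
  assumes "is_functor A B F" "category A" "iso_arr A f"
  shows "iso_arr B (onA F f)"
proof -
  interpret A: category_calc A using assms(2) by unfold_locales
  obtain g where g: "f \<in> Arr A" "g \<in> Arr A" "Dom A g = Cod A f" "Cod A g = Dom A f"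
    "Cmp A g f = Idt A (Dom A f)" "Cmp A f g = Idt A (Cod A f)" using assms(3) by (rule A.isoE)
  have "Cmp B (onA F g) (onA F f) = Idt B (onO F (Dom A f))"
       "Cmp B (onA F f) (onA F g) = Idt B (onO F (Cod A f))"
    using g functor_simps(6)[OF assms(1), of f g] functor_simps(6)[OF assms(1), of g f]
      functor_simps(2)[OF assms(1)] by auto
  then show ?thesis
    using g functor_simps[OF assms(1)] unfolding iso_arr_def by auto
qed

text \<open>The naturality squares of \<open>\<eta>\<close> at \<open>s\<close> and at
  \<open>t\<close> have the same right-hand side, and \<open>\<eta>\<close> is invertible, so it
  cancels on the left.\<close>

lemma equivalence_faithful:
  assumes "category A" "is_functor A B F" "is_functor B A G"
    and \<eta>: "nat_iso A A id_fctr (comp_fctr G F) \<eta>"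
    and st: "s \<in> Arr A" "t \<in> Arr A" "Dom A s = Dom A t" "Cod A s = Cod A t" "onA F s = onA F t"
  shows "s = t"
proof -
  interpret A: category_calc A using assms(1) by unfold_locales
  have nat: "Cmp A (\<eta> (Cod A s)) u = Cmp A (onA G (onA F u)) (\<eta> (Dom A s))"
    if "u = s \<or> u = t" for u
    using \<eta> st that by (auto simp: nat_iso_def nat_trans_def id_fctr_def comp_fctr_def)
  have "Cmp A (\<eta> (Cod A s)) s = Cmp A (\<eta> (Cod A s)) t"
    using nat st(5) by simp
  moreover have "iso_arr A (\<eta> (Cod A s))" "Dom A (\<eta> (Cod A s)) = Cod A s"
    using \<eta> st A.cat_simps by (auto simp: nat_iso_def nat_trans_def id_fctr_def)
  ultimately show ?thesis using A.mono_iso st by metis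
qed

text \<open>\<open>is_equivalence\<close> provides no triangle identities, so fullness cannot be
  read off \<open>\<eta>\<close> and \<open>\<epsilon>\<close> directly. Naturality of
  \<open>\<epsilon>\<close> makes \<open>G\<close> faithful; the candidate over \<open>b\<close> is
  \<open>G b\<close> conjugated by \<open>\<eta>\<close>, and \<open>G (F a) = G b\<close> then
  gives \<open>F a = b\<close>.\<close>

lemma equivalenceD:
  assumes A: "category A" and B: "category B" and e: "is_equivalence A B F"
  shows "fully_faithful A B F" "ess_surjective A B F"
proof -
  interpret A: category_calc A using A by unfold_locales
  interpret B: category_calc B using B by unfold_locales
  obtain G \<eta> \<epsilon> where F: "is_functor A B F" and G: "is_functor B A G"
    and \<eta>: "nat_iso A A id_fctr (comp_fctr G F) \<eta>" and \<epsilon>: "nat_iso B B (comp_fctr F G) id_fctr \<epsilon>"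
    using e by (auto simp: is_equivalence_def)
  note Fs [simp] = functor_simps[OF F] and Gs [simp] = functor_simps[OF G]
  have \<eta>s [simp]: "\<eta> x \<in> Arr A" "Dom A (\<eta> x) = x" "Cod A (\<eta> x) = onO G (onO F x)" "iso_arr A (\<eta> x)"
    if "x \<in> Obj A" for x
    using \<eta> that by (auto simp: nat_iso_def nat_trans_def id_fctr_def comp_fctr_def)
  have \<epsilon>s [simp]: "\<epsilon> y \<in> Arr B" "Dom B (\<epsilon> y) = onO F (onO G y)" "Cod B (\<epsilon> y) = y" "iso_arr B (\<epsilon> y)"
    if "y \<in> Obj B" for y
    using \<epsilon> that by (auto simp: nat_iso_def nat_trans_def id_fctr_def comp_fctr_def)
  have \<epsilon>n: "Cmp B (\<epsilon> (Cod B b)) (onA F (onA G b)) = Cmp B b (\<epsilon> (Dom B b))" if "b \<in> Arr B" for b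
    using \<epsilon> that by (auto simp: nat_iso_def nat_trans_def id_fctr_def comp_fctr_def)
  have \<eta>n: "Cmp A (\<eta> (Cod A a)) a = Cmp A (onA G (onA F a)) (\<eta> (Dom A a))" if "a \<in> Arr A" for a
    using \<eta> that by (auto simp: nat_iso_def nat_trans_def id_fctr_def comp_fctr_def)
  have Gf: "b = b'" if b: "b \<in> Arr B" "b' \<in> Arr B" "Dom B b = Dom B b'" "Cod B b = Cod B b'"
    "onA G b = onA G b'" for b b'
  proof -
    have "Cmp B b (\<epsilon> (Dom B b)) = Cmp B b' (\<epsilon> (Dom B b))"
      using \<epsilon>n[of b] \<epsilon>n[of b'] b by simp
    then show ?thesis
      by (rule B.epi_iso[rotated -1]) (use b in auto)
  qed
  show "ess_surjective A B F"
    unfolding ess_surjective_def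
  proof
    fix y assume y: "y \<in> Obj B"
    show "\<exists>x\<in>Obj A. \<exists>b\<in>hom_set B (onO F x) y. iso_arr B b"
      using y by (intro bexI[of _ "onO G y"] bexI[of _ "\<epsilon> y"]) auto
  qed
  show "fully_faithful A B F"
    unfolding fully_faithful_def
  proof (intro ballI ex_ex1I)
    fix x y b assume x: "x \<in> Obj A" and y: "y \<in> Obj A" and b: "b \<in> hom_set B (onO F x) (onO F y)"
    obtain h where h: "h \<in> Arr A" "Dom A h = onO G (onO F y)" "Cod A h = y"
      "Cmp A h (\<eta> y) = Idt A y" "Cmp A (\<eta> y) h = Idt A (onO G (onO F y))"
      using y A.iso_ex[OF \<eta>s(4)[OF y]] by auto
    define a where "a = Cmp A h (Cmp A (onA G b) (\<eta> x))"
    have a: "a \<in> hom_set A x y" using b x y h by (auto simp: a_def)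
    have 1: "Cmp A (\<eta> y) a = Cmp A (onA G b) (\<eta> x)"
    proof -
      have "Cmp A (\<eta> y) a = Cmp A (Cmp A (\<eta> y) h) (Cmp A (onA G b) (\<eta> x))"
        using b x y h(1-3) unfolding a_def by (subst A.cat_simps(11)) auto
      also have "\<dots> = Cmp A (onA G b) (\<eta> x)" using b x y h by simp
      finally show ?thesis .
    qed
    have "Cmp A (onA G (onA F a)) (\<eta> x) = Cmp A (onA G b) (\<eta> x)"
      using \<eta>n[of a] a 1 by simp
    then have "onA G (onA F a) = onA G b"
      by (rule A.epi_iso[rotated -1]) (use a b x y in auto)
    then have "onA F a = b" using Gf[of "onA F a" b] a b by auto
    then show "\<exists>a. a \<in> hom_set A x y \<and> onA F a = b" using a by auto
  next
    fix x y b a a' assume "a \<in> hom_set A x y \<and> onA F a = b" "a' \<in> hom_set A x y \<and> onA F a' = b"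
    then show "a = a'" using equivalence_faithful[OF A F G \<eta>] by auto
  qed
qed

lemma fully_faithful_iso:
  assumes A: "category A" and F: "is_functor A B F" and ff: "fully_faithful A B F"
    and a: "a \<in> Arr A" "iso_arr B (onA F a)" and B: "category B"
  shows "iso_arr A a"
proof -
  interpret A: category_calc A using A by unfold_locales
  interpret B: category_calc B using B by unfold_locales
  note Fs [simp] = functor_simps[OF F]
  obtain g where g: "g \<in> Arr B" "Dom B g = onO F (Cod A a)" "Cod B g = onO F (Dom A a)"
    "Cmp B g (onA F a) = Idt B (onO F (Dom A a))" "Cmp B (onA F a) g = Idt B (onO F (Cod A a))"
    using a B.iso_ex[OF a(2)] by auto
  obtain c where c: "c \<in> hom_set A (Cod A a) (Dom A a)" "onA F c = g"
    using ff a g unfolding fully_faithful_def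
    by (metis (no_types, lifting) A.cat_simps(1,2) in_hom_set)
  have uniq: "u = v" if "u \<in> hom_set A x y" "v \<in> hom_set A x y" "onA F u = onA F v" "x \<in> Obj A" "y \<in> Obj A" for u v x y
  proof -
    have "onA F v \<in> hom_set B (onO F x) (onO F y)" using that by auto
    then show ?thesis using ff that unfolding fully_faithful_def by blast
  qed
  have 1: "Cmp A c a = Idt A (Dom A a)"
    by (rule uniq) (use a c g in auto)
  have 2: "Cmp A a c = Idt A (Cod A a)"
    by (rule uniq) (use a c g in auto)
  show ?thesis using A.isoI[of a c] 1 2 a c by auto
qed

text \<open>Objects \<open>G0 y\<close> with isomorphisms \<open>\<epsilon> y\<close> are chosen,
  \<open>\<delta> y\<close> inverts \<open>\<epsilon> y\<close>, and on arrows the quasi-inverse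
  takes the unique lift of \<open>b\<close> conjugated by these. Functoriality and naturality of the
  unit reduce to uniqueness of lifts (\<open>uniq\<close>), since both sides agree after
  \<open>F\<close>.\<close>

lemma equivalenceI:
  assumes A: "category A" and B: "category B" and F: "is_functor A B F"
    and ff: "fully_faithful A B F" and es: "ess_surjective A B F"
  shows "is_equivalence A B F"
proof -
  interpret A: category_calc A using A by unfold_locales
  interpret B: category_calc B using B by unfold_locales
  note Fs [simp] = functor_simps[OF F]
  have "\<forall>y\<in>Obj B. \<exists>x b. x \<in> Obj A \<and> b \<in> hom_set B (onO F x) y \<and> iso_arr B b"
    using es unfolding ess_surjective_def by blast
  then obtain G0 \<epsilon> where G0: "\<And>y. y \<in> Obj B \<Longrightarrow> G0 y \<in> Obj A"
    and \<epsilon>: "\<And>y. y \<in> Obj B \<Longrightarrow> \<epsilon> y \<in> hom_set B (onO F (G0 y)) y \<and> iso_arr B (\<epsilon> y)"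
    by metis
  have \<epsilon>s [simp]: "\<epsilon> y \<in> Arr B" "Dom B (\<epsilon> y) = onO F (G0 y)" "Cod B (\<epsilon> y) = y" "iso_arr B (\<epsilon> y)"
    if "y \<in> Obj B" for y using \<epsilon>[OF that] by auto
  note G0 [simp]
  have "\<forall>y\<in>Obj B. \<exists>d. d \<in> Arr B \<and> Dom B d = y \<and> Cod B d = onO F (G0 y) \<and>
      Cmp B d (\<epsilon> y) = Idt B (onO F (G0 y)) \<and> Cmp B (\<epsilon> y) d = Idt B y"
  proof
    fix y assume y: "y \<in> Obj B"
    show "\<exists>d. d \<in> Arr B \<and> Dom B d = y \<and> Cod B d = onO F (G0 y) \<and>
      Cmp B d (\<epsilon> y) = Idt B (onO F (G0 y)) \<and> Cmp B (\<epsilon> y) d = Idt B y"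
      by (rule B.isoE[OF \<epsilon>s(4)[OF y]]) (use y in auto)
  qed
  then obtain \<delta> where \<delta>: "\<And>y. y \<in> Obj B \<Longrightarrow> \<delta> y \<in> Arr B \<and> Dom B (\<delta> y) = y \<and>
      Cod B (\<delta> y) = onO F (G0 y) \<and>
      Cmp B (\<delta> y) (\<epsilon> y) = Idt B (onO F (G0 y)) \<and> Cmp B (\<epsilon> y) (\<delta> y) = Idt B y"
    by metis
  note \<delta>s [simp] = \<delta>[THEN conjunct1] \<delta>[THEN conjunct2, THEN conjunct1]
    \<delta>[THEN conjunct2, THEN conjunct2, THEN conjunct1]
    \<delta>[THEN conjunct2, THEN conjunct2, THEN conjunct2, THEN conjunct1]
    \<delta>[THEN conjunct2, THEN conjunct2, THEN conjunct2, THEN conjunct2]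
  have \<epsilon>\<delta> [simp]: "Cmp B (\<epsilon> y) (Cmp B (\<delta> y) b) = b" if "y \<in> Obj B" "b \<in> Arr B" "Cod B b = y" for y b
    using that B.cat_simps(11)[of b "\<delta> y" "\<epsilon> y", symmetric] by simp
  have ffE: "\<exists>a. a \<in> hom_set A x y \<and> onA F a = b"
    if "x \<in> Obj A" "y \<in> Obj A" "b \<in> hom_set B (onO F x) (onO F y)" for x y b
    using ff that unfolding fully_faithful_def by blast
  have uniq: "u = v" if "u \<in> hom_set A x y" "v \<in> hom_set A x y" "onA F u = onA F v" "x \<in> Obj A" "y \<in> Obj A" for u v x y
  proof -
    have "onA F v \<in> hom_set B (onO F x) (onO F y)" using that by auto
    then show ?thesis using ff that unfolding fully_faithful_def by blast
  qed
  have "\<forall>b\<in>Arr B. \<exists>a. a \<in> hom_set A (G0 (Dom B b)) (G0 (Cod B b)) \<and>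
      onA F a = Cmp B (\<delta> (Cod B b)) (Cmp B b (\<epsilon> (Dom B b)))"
    by (intro ballI ffE) auto
  then obtain G1 where G1: "\<And>b. b \<in> Arr B \<Longrightarrow> G1 b \<in> hom_set A (G0 (Dom B b)) (G0 (Cod B b)) \<and>
      onA F (G1 b) = Cmp B (\<delta> (Cod B b)) (Cmp B b (\<epsilon> (Dom B b)))"
    by metis
  have G1s [simp]: "G1 b \<in> Arr A" "Dom A (G1 b) = G0 (Dom B b)" "Cod A (G1 b) = G0 (Cod B b)"
    "onA F (G1 b) = Cmp B (\<delta> (Cod B b)) (Cmp B b (\<epsilon> (Dom B b)))"
    if "b \<in> Arr B" for b using G1[OF that] by auto
  define G where "G = \<lparr>onO = G0, onA = G1\<rparr>"
  have Gs [simp]: "onO G = G0" "onA G = G1" by (simp_all add: G_def)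
  have G: "is_functor B A G"
    unfolding is_functor_def
  proof (intro conjI ballI impI)
    fix y assume y: "y \<in> Obj B"
    show "onO G y \<in> Obj A" using y by simp
    show "onA G (Idt B y) = Idt A (onO G y)"
      unfolding Gs by (rule uniq[of _ "G0 y" "G0 y"]) (use y in auto)
  next
    fix f assume f: "f \<in> Arr B"
    then show "onA G f \<in> hom_set A (onO G (Dom B f)) (onO G (Cod B f))" by simp
  next
    fix f g assume f: "f \<in> Arr B" "g \<in> Arr B" "Cod B f = Dom B g"
    show "onA G (Cmp B g f) = Cmp A (onA G g) (onA G f)"
      unfolding Gs by (rule uniq[of _ "G0 (Dom B f)" "G0 (Cod B g)"]) (use f in auto)
  qed
  have nat\<epsilon>: "nat_iso B B (comp_fctr F G) id_fctr \<epsilon>"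
    by (auto simp: nat_iso_def nat_trans_def comp_fctr_def id_fctr_def)
  have "\<forall>x\<in>Obj A. \<exists>a. a \<in> hom_set A x (G0 (onO F x)) \<and> onA F a = \<delta> (onO F x)"
    by (intro ballI ffE) auto
  then obtain \<eta> where \<eta>: "\<And>x. x \<in> Obj A \<Longrightarrow> \<eta> x \<in> hom_set A x (G0 (onO F x)) \<and> onA F (\<eta> x) = \<delta> (onO F x)"
    by metis
  have \<eta>s [simp]: "\<eta> x \<in> Arr A" "Dom A (\<eta> x) = x" "Cod A (\<eta> x) = G0 (onO F x)"
    "onA F (\<eta> x) = \<delta> (onO F x)" if "x \<in> Obj A" for x using \<eta>[OF that] by auto
  have "Cmp A (\<eta> (Cod A f)) f = Cmp A (G1 (onA F f)) (\<eta> (Dom A f))" if f: "f \<in> Arr A" for f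
    by (rule uniq[of _ "Dom A f" "G0 (onO F (Cod A f))"]) (use f in auto)
  moreover have "iso_arr A (\<eta> x)" if x: "x \<in> Obj A" for x
  proof -
    have "iso_arr B (\<delta> (onO F x))"
      by (rule B.isoI[of _ "\<epsilon> (onO F x)"]) (use x in auto)
    then show "iso_arr A (\<eta> x)" using fully_faithful_iso[OF A F ff _ _ B, of "\<eta> x"] x by simp
  qed
  ultimately have "nat_iso A A id_fctr (comp_fctr G F) \<eta>"
    by (simp add: nat_iso_def nat_trans_def comp_fctr_def id_fctr_def)
  then show ?thesis unfolding is_equivalence_def using F G nat\<epsilon> by blast
qed

section \<open>Families of 1-cells and 2-cells with a common tip\<close>

text \<open>
  A cocone over these data with tip \<open>B\<close> consists of 1-cells \<open>q\<^sub>p : ob p \<rightarrow> B\<close> and 2-cells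
  \<open>r\<^sub>k : q\<^bsub>tp k\<^esub> (fl k) \<Rightarrow> q\<^bsub>sp k\<^esub> (gl k)\<close>. Oplax cocones and, up to the inverse of the 2-cell,
  pseudocoequalizing pairs are such families subject to equations.
\<close>

record ('p, 'j, 'k0, 'k1) ins =
  Pt :: "'p set"
  Ed :: "'j set"
  tp :: "'j \<Rightarrow> 'p"
  sp :: "'j \<Rightarrow> 'p"
  ob :: "'p \<Rightarrow> 'k0"
  fl :: "'j \<Rightarrow> 'k1"
  gl :: "'j \<Rightarrow> 'k1"

type_synonym ('p, 'j, 'k1, 'k2) fam = "('p \<Rightarrow> 'k1) \<times> ('j \<Rightarrow> 'k2)"

context strict_two_category
begin

definition wf_ins :: "('p, 'j, 'k0, 'k1) ins \<Rightarrow> bool" where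
  "wf_ins D \<longleftrightarrow> (\<forall>p \<in> Pt D. ob D p \<in> Cell0 C) \<and>
     (\<forall>k \<in> Ed D. tp D k \<in> Pt D \<and> sp D k \<in> Pt D \<and> fl D k \<in> Cell1 C \<and> gl D k \<in> Cell1 C \<and>
        src C (gl D k) = src C (fl D k) \<and> tgt C (fl D k) = ob D (tp D k) \<and>
        tgt C (gl D k) = ob D (sp D k))"

definition ins_cocone :: "('p, 'j, 'k0, 'k1) ins \<Rightarrow> 'k0 \<Rightarrow> ('p, 'j, 'k1, 'k2) fam \<Rightarrow> bool" where
  "ins_cocone D B = (\<lambda>(q, r). q \<in> extensional (Pt D) \<and> r \<in> extensional (Ed D) \<and>
     (\<forall>p \<in> Pt D. q p \<in> hom1 C (ob D p) B) \<and>
     (\<forall>k \<in> Ed D. r k \<in> hom2 C (q (tp D k) \<cdot> fl D k) (q (sp D k) \<cdot> gl D k)))"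

definition ins_mor :: "('p, 'j, 'k0, 'k1) ins \<Rightarrow> ('p, 'j, 'k1, 'k2) fam \<Rightarrow>
    ('p, 'j, 'k1, 'k2) fam \<Rightarrow> ('p \<Rightarrow> 'k2) \<Rightarrow> bool" where
  "ins_mor D = (\<lambda>(q, r) (q', r') m. m \<in> extensional (Pt D) \<and>
     (\<forall>p \<in> Pt D. m p \<in> hom2 C (q p) (q' p)) \<and>
     (\<forall>k \<in> Ed D. (m (sp D k) \<lhd> gl D k) \<bullet> r k = r' k \<bullet> (m (tp D k) \<lhd> fl D k)))"

definition ins_cat :: "('p, 'j, 'k0, 'k1) ins \<Rightarrow> (('p, 'j, 'k1, 'k2) fam \<Rightarrow> bool) \<Rightarrow> 'k0 \<Rightarrow>
    (('p, 'j, 'k1, 'k2) fam,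
     ('p, 'j, 'k1, 'k2) fam \<times> ('p, 'j, 'k1, 'k2) fam \<times> ('p \<Rightarrow> 'k2)) cat" where
  "ins_cat D Pr B =
     \<lparr>Obj = {Q. ins_cocone D B Q \<and> Pr Q},
      Arr = {(Q, Q', m). (ins_cocone D B Q \<and> Pr Q) \<and> (ins_cocone D B Q' \<and> Pr Q') \<and> ins_mor D Q Q' m},
      Dom = (\<lambda>(Q, Q', m). Q),
      Cod = (\<lambda>(Q, Q', m). Q'),
      Idt = (\<lambda>Q. (Q, Q, \<lambda>p \<in> Pt D. id2 C (fst Q p))),
      Cmp = (\<lambda>(Q', Q'', n) (Q, P, m). (Q, Q'', \<lambda>p \<in> Pt D. n p \<bullet> m p))\<rparr>"

definition ins_post :: "('p, 'j, 'k0, 'k1) ins \<Rightarrow> ('p, 'j, 'k1, 'k2) fam \<Rightarrow> 'k1 \<Rightarrow>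
    ('p, 'j, 'k1, 'k2) fam" where
  "ins_post D Q f = (\<lambda>p \<in> Pt D. f \<cdot> fst Q p, \<lambda>k \<in> Ed D. f \<rhd> snd Q k)"

definition ins_fun :: "('p, 'j, 'k0, 'k1) ins \<Rightarrow> ('p, 'j, 'k1, 'k2) fam \<Rightarrow>
    ('k1, 'k2, ('p, 'j, 'k1, 'k2) fam,
     ('p, 'j, 'k1, 'k2) fam \<times> ('p, 'j, 'k1, 'k2) fam \<times> ('p \<Rightarrow> 'k2)) fctr" where
  "ins_fun D Q =
     \<lparr>onO = ins_post D Q,
      onA = (\<lambda>t. (ins_post D Q (dom2 C t), ins_post D Q (cod2 C t), \<lambda>p \<in> Pt D. t \<lhd> fst Q p))\<rparr>"

definition post_stable :: "('p, 'j, 'k0, 'k1) ins \<Rightarrow> (('p, 'j, 'k1, 'k2) fam \<Rightarrow> bool) \<Rightarrow> bool" where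
  "post_stable D Pr \<longleftrightarrow> (\<forall>L Q f. ins_cocone D L Q \<longrightarrow> Pr Q \<longrightarrow> f \<in> Cell1 C \<longrightarrow> src C f = L \<longrightarrow>
     Pr (ins_post D Q f))"

text \<open>The equivalence between hom-category and cocone category in elementary form: unique
  lifting of 2-cells is full faithfulness, and the last clause is essential surjectivity with
  isomorphisms tested pointwise. No quasi-inverse has to be named, which makes the property easy to
  move between different index data.\<close>

definition ins_rep :: "('p, 'j, 'k0, 'k1) ins \<Rightarrow> (('p, 'j, 'k1, 'k2) fam \<Rightarrow> bool) \<Rightarrow> 'k0 \<Rightarrow>
    ('p, 'j, 'k1, 'k2) fam \<Rightarrow> bool" where
  "ins_rep D Pr L Q \<longleftrightarrow> L \<in> Cell0 C \<and> ins_cocone D L Q \<and> Pr Q \<and>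
     (\<forall>B \<in> Cell0 C.
       (\<forall>f \<in> hom1 C L B. \<forall>g \<in> hom1 C L B. \<forall>m. ins_mor D (ins_post D Q f) (ins_post D Q g) m \<longrightarrow>
          (\<exists>!t. t \<in> hom2 C f g \<and> (\<lambda>p \<in> Pt D. t \<lhd> fst Q p) = m)) \<and>
       (\<forall>Y. ins_cocone D B Y \<longrightarrow> Pr Y \<longrightarrow>
          (\<exists>f \<in> hom1 C L B. \<exists>m. ins_mor D (ins_post D Q f) Y m \<and> (\<forall>p \<in> Pt D. inv2 (m p)))))"

lemma wf_ins_simps:
  assumes "wf_ins D"
  shows "p \<in> Pt D \<Longrightarrow> ob D p \<in> Cell0 C"
    "k \<in> Ed D \<Longrightarrow> tp D k \<in> Pt D" "k \<in> Ed D \<Longrightarrow> sp D k \<in> Pt D" "k \<in> Ed D \<Longrightarrow> fl D k \<in> Cell1 C"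
    "k \<in> Ed D \<Longrightarrow> gl D k \<in> Cell1 C" "k \<in> Ed D \<Longrightarrow> src C (gl D k) = src C (fl D k)"
    "k \<in> Ed D \<Longrightarrow> tgt C (fl D k) = ob D (tp D k)" "k \<in> Ed D \<Longrightarrow> tgt C (gl D k) = ob D (sp D k)"
  using assms by (auto simp: wf_ins_def)

lemma ins_cocone_simps:
  assumes "ins_cocone D B Q"
  shows "p \<in> Pt D \<Longrightarrow> fst Q p \<in> Cell1 C" "p \<in> Pt D \<Longrightarrow> src C (fst Q p) = ob D p"
    "p \<in> Pt D \<Longrightarrow> tgt C (fst Q p) = B"
    "k \<in> Ed D \<Longrightarrow> snd Q k \<in> Cell2 C" "k \<in> Ed D \<Longrightarrow> dom2 C (snd Q k) = fst Q (tp D k) \<cdot> fl D k"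
    "k \<in> Ed D \<Longrightarrow> cod2 C (snd Q k) = fst Q (sp D k) \<cdot> gl D k"
    "fst Q \<in> extensional (Pt D)" "snd Q \<in> extensional (Ed D)"
  using assms by (auto simp: ins_cocone_def split: prod.splits)

lemma ins_mor_simps:
  assumes "ins_mor D Q Q' m"
  shows "p \<in> Pt D \<Longrightarrow> m p \<in> Cell2 C" "p \<in> Pt D \<Longrightarrow> dom2 C (m p) = fst Q p"
    "p \<in> Pt D \<Longrightarrow> cod2 C (m p) = fst Q' p" "m \<in> extensional (Pt D)"
  using assms by (auto simp: ins_mor_def split: prod.splits)

lemma ins_mor_eq:
  assumes "ins_mor D Q Q' m" "k \<in> Ed D"
  shows "(m (sp D k) \<lhd> gl D k) \<bullet> snd Q k = snd Q' k \<bullet> (m (tp D k) \<lhd> fl D k)"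
  using assms by (auto simp: ins_mor_def split: prod.splits)

lemma ins_coconeI:
  assumes "\<And>p. p \<in> Pt D \<Longrightarrow> fst Q p \<in> Cell1 C \<and> src C (fst Q p) = ob D p \<and> tgt C (fst Q p) = B"
    "\<And>k. k \<in> Ed D \<Longrightarrow> snd Q k \<in> Cell2 C \<and> dom2 C (snd Q k) = fst Q (tp D k) \<cdot> fl D k \<and>
       cod2 C (snd Q k) = fst Q (sp D k) \<cdot> gl D k"
    "fst Q \<in> extensional (Pt D)" "snd Q \<in> extensional (Ed D)"
  shows "ins_cocone D B Q"
  using assms by (auto simp: ins_cocone_def split: prod.splits)

lemma ins_morI:
  assumes "\<And>p. p \<in> Pt D \<Longrightarrow> m p \<in> Cell2 C \<and> dom2 C (m p) = fst Q p \<and> cod2 C (m p) = fst Q' p"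
    "\<And>k. k \<in> Ed D \<Longrightarrow> (m (sp D k) \<lhd> gl D k) \<bullet> snd Q k = snd Q' k \<bullet> (m (tp D k) \<lhd> fl D k)"
    "m \<in> extensional (Pt D)"
  shows "ins_mor D Q Q' m"
  using assms by (auto simp: ins_mor_def split: prod.splits)

lemma ins_cat_simps [simp]:
  "Q \<in> Obj (ins_cat D Pr B) \<longleftrightarrow> ins_cocone D B Q \<and> Pr Q"
  "a \<in> Arr (ins_cat D Pr B) \<longleftrightarrow> ins_cocone D B (fst a) \<and> Pr (fst a) \<and> ins_cocone D B (fst (snd a)) \<and>
     Pr (fst (snd a)) \<and> ins_mor D (fst a) (fst (snd a)) (snd (snd a))"
  "Dom (ins_cat D Pr B) a = fst a"
  "Cod (ins_cat D Pr B) a = fst (snd a)"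
  "Idt (ins_cat D Pr B) Q = (Q, Q, \<lambda>p \<in> Pt D. id2 C (fst Q p))"
  "Cmp (ins_cat D Pr B) b a = (fst a, fst (snd b), \<lambda>p \<in> Pt D. snd (snd b) p \<bullet> snd (snd a) p)"
  by (auto simp: ins_cat_def split: prod.splits)

lemma ins_mor_id:
  assumes "wf_ins D" "ins_cocone D B Q"
  shows "ins_mor D Q Q (\<lambda>p \<in> Pt D. id2 C (fst Q p))"
  by (rule ins_morI) (simp_all add: wf_ins_simps[OF assms(1)] ins_cocone_simps[OF assms(2)])

lemma ins_mor_cmp:
  assumes wf: "wf_ins D" and Q: "ins_cocone D B Q" "ins_cocone D B Q'" "ins_cocone D B Q''"
    and m: "ins_mor D Q Q' m" and n: "ins_mor D Q' Q'' n"
  shows "ins_mor D Q Q'' (\<lambda>p \<in> Pt D. n p \<bullet> m p)"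
proof (rule ins_morI; (intro conjI)?)
  note [simp] = wf_ins_simps[OF wf] Q[THEN ins_cocone_simps(1)] Q[THEN ins_cocone_simps(2)]
    Q[THEN ins_cocone_simps(3)] Q[THEN ins_cocone_simps(4)] Q[THEN ins_cocone_simps(5)]
    Q[THEN ins_cocone_simps(6)] ins_mor_simps(1-3)[OF m] ins_mor_simps(1-3)[OF n]
  fix k assume k: "k \<in> Ed D"
  have "((n (sp D k) \<bullet> m (sp D k)) \<lhd> gl D k) \<bullet> snd Q k
    = (n (sp D k) \<lhd> gl D k) \<bullet> (snd Q' k \<bullet> (m (tp D k) \<lhd> fl D k))"
    using k ins_mor_eq[OF m k] by simp
  also have "\<dots> = ((n (sp D k) \<lhd> gl D k) \<bullet> snd Q' k) \<bullet> (m (tp D k) \<lhd> fl D k)"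
    using k by simp
  also have "\<dots> = snd Q'' k \<bullet> ((n (tp D k) \<bullet> m (tp D k)) \<lhd> fl D k)"
    unfolding ins_mor_eq[OF n k] using k by simp
  finally show "((\<lambda>p \<in> Pt D. n p \<bullet> m p) (sp D k) \<lhd> gl D k) \<bullet> snd Q k =
      snd Q'' k \<bullet> ((\<lambda>p \<in> Pt D. n p \<bullet> m p) (tp D k) \<lhd> fl D k)"
    using k by simp
qed (simp_all add: wf_ins_simps[OF wf] Q[THEN ins_cocone_simps(1)] ins_mor_simps[OF m] ins_mor_simps[OF n])

lemma category_ins_cat:
  assumes wf: "wf_ins D"
  shows "category (ins_cat D Pr B)"
  unfolding category_def
proof (intro conjI ballI impI)
  fix a assume a: "a \<in> Arr (ins_cat D Pr B)"
  obtain Q Q' m where [simp]: "a = (Q, Q', m)" by (cases a)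
  have Q: "ins_cocone D B Q" "ins_cocone D B Q'" and m: "ins_mor D Q Q' m" using a by auto
  show "Dom (ins_cat D Pr B) a \<in> Obj (ins_cat D Pr B)" "Cod (ins_cat D Pr B) a \<in> Obj (ins_cat D Pr B)"
    using a by auto
  show "Cmp (ins_cat D Pr B) a (Idt (ins_cat D Pr B) (Dom (ins_cat D Pr B) a)) = a"
       "Cmp (ins_cat D Pr B) (Idt (ins_cat D Pr B) (Cod (ins_cat D Pr B) a)) a = a"
    by (auto intro!: extensionalityI[OF restrict_extensional ins_mor_simps(4)[OF m]]
        simp: ins_mor_simps(1-3)[OF m] ins_cocone_simps[OF Q(1)] ins_cocone_simps[OF Q(2)])
next
  fix a b assume a: "a \<in> Arr (ins_cat D Pr B)" and b: "b \<in> Arr (ins_cat D Pr B)"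
    and ab: "Cod (ins_cat D Pr B) a = Dom (ins_cat D Pr B) b"
  then show "Cmp (ins_cat D Pr B) b a \<in> hom_set (ins_cat D Pr B) (Dom (ins_cat D Pr B) a) (Cod (ins_cat D Pr B) b)"
    using ins_mor_cmp[OF wf, of B "fst a" "fst (snd a)" "fst (snd b)"] by auto
next
  fix a b c assume "a \<in> Arr (ins_cat D Pr B)" "b \<in> Arr (ins_cat D Pr B)" "c \<in> Arr (ins_cat D Pr B)"
    and "Cod (ins_cat D Pr B) a = Dom (ins_cat D Pr B) b" "Cod (ins_cat D Pr B) b = Dom (ins_cat D Pr B) c"
  then have "ins_mor D (fst a) (fst b) (snd (snd a))" "ins_mor D (fst b) (fst c) (snd (snd b))"
    "ins_mor D (fst c) (fst (snd c)) (snd (snd c))" by auto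
  note [simp] = this[THEN ins_mor_simps(1)] this[THEN ins_mor_simps(2)] this[THEN ins_mor_simps(3)]
  show "Cmp (ins_cat D Pr B) c (Cmp (ins_cat D Pr B) b a) = Cmp (ins_cat D Pr B) (Cmp (ins_cat D Pr B) c b) a"
    by (auto intro!: restrict_ext)
next
  fix Q assume "Q \<in> Obj (ins_cat D Pr B)"
  then show "Idt (ins_cat D Pr B) Q \<in> hom_set (ins_cat D Pr B) Q Q"
    using ins_mor_id[OF wf, of B Q] by auto
qed

text \<open>Whiskerings of invertible 2-cells are invertible, so each square of \<open>m\<close> can
  be cancelled from both sides and read backwards.\<close>

lemma ins_mor_inverse:
  assumes wf: "wf_ins D" and Q: "ins_cocone D B Q" "ins_cocone D B Q'"
    and m: "ins_mor D Q Q' m" and i: "\<And>p. p \<in> Pt D \<Longrightarrow> inv2 (m p)"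
  shows "ins_mor D Q' Q (\<lambda>p \<in> Pt D. vinv (m p))"
proof (rule ins_morI; (intro conjI)?)
  note [simp] = wf_ins_simps[OF wf] Q[THEN ins_cocone_simps(1)] Q[THEN ins_cocone_simps(2)]
    Q[THEN ins_cocone_simps(3)] Q[THEN ins_cocone_simps(4)] Q[THEN ins_cocone_simps(5)]
    Q[THEN ins_cocone_simps(6)] ins_mor_simps(1-3)[OF m] i
  fix k assume k: "k \<in> Ed D"
  have "(vinv (m (sp D k)) \<lhd> gl D k) \<bullet> snd Q' k = snd Q k \<bullet> (vinv (m (tp D k)) \<lhd> fl D k)"
  proof (rule inv2_cancel_left[of "m (sp D k) \<lhd> gl D k"])
    have "(m (sp D k) \<lhd> gl D k) \<bullet> snd Q k \<bullet> (vinv (m (tp D k)) \<lhd> fl D k)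
      = ((m (sp D k) \<lhd> gl D k) \<bullet> snd Q k) \<bullet> (vinv (m (tp D k)) \<lhd> fl D k)" using k by simp
    also have "\<dots> = snd Q' k" unfolding ins_mor_eq[OF m k] using k by simp
    finally show "(m (sp D k) \<lhd> gl D k) \<bullet> (vinv (m (sp D k)) \<lhd> gl D k) \<bullet> snd Q' k =
        (m (sp D k) \<lhd> gl D k) \<bullet> snd Q k \<bullet> (vinv (m (tp D k)) \<lhd> fl D k)" using k by simp
  qed (use k in simp_all)
  then show "((\<lambda>p \<in> Pt D. vinv (m p)) (sp D k) \<lhd> gl D k) \<bullet> snd Q' k =
      snd Q k \<bullet> ((\<lambda>p \<in> Pt D. vinv (m p)) (tp D k) \<lhd> fl D k)" using k by simp
qed (simp_all add: wf_ins_simps[OF wf] Q[THEN ins_cocone_simps(1)] ins_mor_simps[OF m] i)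

lemma iso_ins_cat:
  assumes wf: "wf_ins D" and a: "(Q, Q', m) \<in> Arr (ins_cat D Pr B)"
  shows "iso_arr (ins_cat D Pr B) (Q, Q', m) \<longleftrightarrow> (\<forall>p \<in> Pt D. inv2 (m p))"
proof
  have Q: "ins_cocone D B Q" "ins_cocone D B Q'" and m: "ins_mor D Q Q' m" using a by auto
  {
    assume "iso_arr (ins_cat D Pr B) (Q, Q', m)"
    then obtain b where b: "b \<in> Arr (ins_cat D Pr B)" "fst b = Q'" "fst (snd b) = Q"
      "(\<lambda>p \<in> Pt D. snd (snd b) p \<bullet> m p) = (\<lambda>p \<in> Pt D. id2 C (fst Q p))"
      "(\<lambda>p \<in> Pt D. m p \<bullet> snd (snd b) p) = (\<lambda>p \<in> Pt D. id2 C (fst Q' p))"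
      unfolding iso_arr_def by auto
    define n where "n = snd (snd b)"
    have n: "ins_mor D Q' Q n" using b(1-3) by (simp add: n_def)
    show "\<forall>p \<in> Pt D. inv2 (m p)"
    proof
      fix p assume p: "p \<in> Pt D"
      have "n p \<bullet> m p = id2 C (fst Q p)" "m p \<bullet> n p = id2 C (fst Q' p)"
        using fun_cong[OF b(4), of p] fun_cong[OF b(5), of p] p by (simp_all add: n_def)
      then show "inv2 (m p)"
        by (intro inv2I[of _ "n p"]) (simp_all add: p ins_mor_simps[OF m] ins_mor_simps[OF n])
    qed
  }
  assume i: "\<forall>p \<in> Pt D. inv2 (m p)"
  have n: "ins_mor D Q' Q (\<lambda>p \<in> Pt D. vinv (m p))"
    using ins_mor_inverse[OF wf Q m] i by blast
  then have "(Q', Q, \<lambda>p \<in> Pt D. vinv (m p)) \<in> hom_set (ins_cat D Pr B) Q' Q" using a by auto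
  moreover have "(\<lambda>p \<in> Pt D. vinv (m p) \<bullet> m p) = (\<lambda>p \<in> Pt D. id2 C (fst Q p))"
     "(\<lambda>p \<in> Pt D. m p \<bullet> vinv (m p)) = (\<lambda>p \<in> Pt D. id2 C (fst Q' p))"
    using i by (auto intro!: restrict_ext simp: ins_mor_simps[OF m])
  ultimately show "iso_arr (ins_cat D Pr B) (Q, Q', m)"
    unfolding iso_arr_def
    using a by (auto intro!: bexI[of _ "(Q', Q, \<lambda>p \<in> Pt D. vinv (m p))"] cong: restrict_cong)
qed

lemma ins_post_cocone:
  assumes wf: "wf_ins D" and Q: "ins_cocone D L Q" and f: "f \<in> Cell1 C" "src C f = L" "tgt C f = B"
  shows "ins_cocone D B (ins_post D Q f)"
  by (rule ins_coconeI)
    (simp_all add: ins_post_def wf_ins_simps[OF wf] ins_cocone_simps[OF Q] f)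

lemma ins_post_mor:
  assumes wf: "wf_ins D" and Q: "ins_cocone D L Q" and t: "t \<in> Cell2 C" "src C (dom2 C t) = L"
    "dom2 C t = f" "cod2 C t = g"
  shows "ins_mor D (ins_post D Q f) (ins_post D Q g) (\<lambda>p \<in> Pt D. t \<lhd> fst Q p)"
proof -
  note [simp] = wf_ins_simps[OF wf] ins_cocone_simps(1-6)[OF Q]
  have "(t \<lhd> fst Q (sp D k) \<cdot> gl D k) \<bullet> (f \<rhd> snd Q k) = (g \<rhd> snd Q k) \<bullet> (t \<lhd> fst Q (tp D k) \<cdot> fl D k)"
    if k: "k \<in> Ed D" for k
    by (rule whisker_swap) (use k t in auto)
  moreover have "f \<in> Cell1 C" "g \<in> Cell1 C" "src C f = L" "src C g = L" using t by auto
  ultimately show ?thesis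
    by (intro ins_morI) (use t in \<open>simp_all add: ins_post_def\<close>)
qed

lemma functor_ins_fun:
  assumes wf: "wf_ins D" and Q: "ins_cocone D L Q" "Pr Q" and st: "post_stable D Pr"
  shows "is_functor (hom_cat C L B) (ins_cat D Pr B) (ins_fun D Q)"
  unfolding is_functor_def
proof (intro conjI ballI impI)
  note [simp] = wf_ins_simps[OF wf] ins_cocone_simps(1-6)[OF Q(1)]
  have st': "Pr (ins_post D Q f)" if "f \<in> Cell1 C" "src C f = L" for f
    using st Q that unfolding post_stable_def by blast
  {
    fix f assume f: "f \<in> Obj (hom_cat C L B)"
    then show "onO (ins_fun D Q) f \<in> Obj (ins_cat D Pr B)"
      using st' ins_post_cocone[OF wf Q(1)] by (auto simp: ins_fun_def)
    show "onA (ins_fun D Q) (Idt (hom_cat C L B) f) = Idt (ins_cat D Pr B) (onO (ins_fun D Q) f)"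
      using f by (auto simp: ins_fun_def ins_post_def intro!: restrict_ext)
  }
  {
    fix t assume t: "t \<in> Arr (hom_cat C L B)"
    then show "onA (ins_fun D Q) t \<in> hom_set (ins_cat D Pr B)
        (onO (ins_fun D Q) (Dom (hom_cat C L B) t)) (onO (ins_fun D Q) (Cod (hom_cat C L B) t))"
      using st' ins_post_cocone[OF wf Q(1)] ins_post_mor[OF wf Q(1), of t]
      by (auto simp: ins_fun_def)
  }
  {
    fix t s assume "s \<in> Arr (hom_cat C L B)" "t \<in> Arr (hom_cat C L B)"
      "Cod (hom_cat C L B) s = Dom (hom_cat C L B) t"
    then show "onA (ins_fun D Q) (Cmp (hom_cat C L B) t s) =
       Cmp (ins_cat D Pr B) (onA (ins_fun D Q) t) (onA (ins_fun D Q) s)"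
      by (auto simp: ins_fun_def intro!: restrict_ext)
  }
qed

text \<open>Bridge to the universal properties stated with \<open>is_equivalence\<close>. An arrow
  of \<open>ins_cat\<close> with fixed ends is determined by its component family, so full
  faithfulness of \<open>ins_fun D Q\<close> is unique lifting of such families, and
  \<open>iso_ins_cat\<close> reads isomorphisms pointwise.\<close>

lemma ins_rep_iff:
  assumes wf: "wf_ins D" and Q: "ins_cocone D L Q" "Pr Q" and st: "post_stable D Pr"
    and L: "L \<in> Cell0 C"
  shows "ins_rep D Pr L Q \<longleftrightarrow>
    (\<forall>B \<in> Cell0 C. is_equivalence (hom_cat C L B) (ins_cat D Pr B) (ins_fun D Q))"
proof -
  have st': "Pr (ins_post D Q f)" if "f \<in> Cell1 C" "src C f = L" for f
    using st Q that unfolding post_stable_def by blast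
  have "is_equivalence (hom_cat C L B) (ins_cat D Pr B) (ins_fun D Q) \<longleftrightarrow>
       fully_faithful (hom_cat C L B) (ins_cat D Pr B) (ins_fun D Q) \<and>
       ess_surjective (hom_cat C L B) (ins_cat D Pr B) (ins_fun D Q)" for B
    using equivalenceI[OF category_hom_cat category_ins_cat[OF wf] functor_ins_fun[OF wf Q st]]
      equivalenceD[OF category_hom_cat category_ins_cat[OF wf]] by blast
  moreover have "fully_faithful (hom_cat C L B) (ins_cat D Pr B) (ins_fun D Q) \<longleftrightarrow>
    (\<forall>f \<in> hom1 C L B. \<forall>g \<in> hom1 C L B. \<forall>m. ins_mor D (ins_post D Q f) (ins_post D Q g) m \<longrightarrow>
          (\<exists>!t. t \<in> hom2 C f g \<and> (\<lambda>p \<in> Pt D. t \<lhd> fst Q p) = m))" for B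
  proof -
    have "(\<forall>b \<in> hom_set (ins_cat D Pr B) (onO (ins_fun D Q) f) (onO (ins_fun D Q) g).
        \<exists>!a. a \<in> hom_set (hom_cat C L B) f g \<and> onA (ins_fun D Q) a = b) \<longleftrightarrow>
      (\<forall>m. ins_mor D (ins_post D Q f) (ins_post D Q g) m \<longrightarrow>
          (\<exists>!t. t \<in> hom2 C f g \<and> (\<lambda>p \<in> Pt D. t \<lhd> fst Q p) = m))" (is "?l \<longleftrightarrow> ?r")
      if f: "f \<in> hom1 C L B" and g: "g \<in> hom1 C L B" for f g
    proof
      have fg: "ins_cocone D B (ins_post D Q f)" "ins_cocone D B (ins_post D Q g)"
        "Pr (ins_post D Q f)" "Pr (ins_post D Q g)"
        using st' ins_post_cocone[OF wf Q(1)] f g by auto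
      have *: "a \<in> hom_set (hom_cat C L B) f g \<and> onA (ins_fun D Q) a = (ins_post D Q f, ins_post D Q g, m)
         \<longleftrightarrow> a \<in> hom2 C f g \<and> (\<lambda>p \<in> Pt D. a \<lhd> fst Q p) = m" for a m
        using f by (auto simp: ins_fun_def)
      show ?r if ?l
      proof (intro allI impI)
        fix m assume m: "ins_mor D (ins_post D Q f) (ins_post D Q g) m"
        show "\<exists>!t. t \<in> hom2 C f g \<and> (\<lambda>p \<in> Pt D. t \<lhd> fst Q p) = m"
          unfolding *[symmetric]
          by (rule that[rule_format]) (use m fg in \<open>simp add: ins_fun_def\<close>)
      qed
      show ?l if r: ?r
      proof
        fix b assume "b \<in> hom_set (ins_cat D Pr B) (onO (ins_fun D Q) f) (onO (ins_fun D Q) g)"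
        then obtain m where "b = (ins_post D Q f, ins_post D Q g, m)"
          "ins_mor D (ins_post D Q f) (ins_post D Q g) m" by (cases b) (auto simp: ins_fun_def)
        then show "\<exists>!a. a \<in> hom_set (hom_cat C L B) f g \<and> onA (ins_fun D Q) a = b"
          using r * by metis
      qed
    qed
    then show ?thesis unfolding fully_faithful_def by simp
  qed
  moreover have "ess_surjective (hom_cat C L B) (ins_cat D Pr B) (ins_fun D Q) \<longleftrightarrow>
    (\<forall>Y. ins_cocone D B Y \<longrightarrow> Pr Y \<longrightarrow>
          (\<exists>f \<in> hom1 C L B. \<exists>m. ins_mor D (ins_post D Q f) Y m \<and> (\<forall>p \<in> Pt D. inv2 (m p))))" for B
  proof -
    have "(\<exists>b \<in> hom_set (ins_cat D Pr B) (onO (ins_fun D Q) f) Y. iso_arr (ins_cat D Pr B) b) \<longleftrightarrow>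
       (\<exists>m. ins_mor D (ins_post D Q f) Y m \<and> (\<forall>p \<in> Pt D. inv2 (m p)))" (is "?l \<longleftrightarrow> ?r")
      if f: "f \<in> hom1 C L B" and Y: "ins_cocone D B Y" "Pr Y" for f Y
    proof
      have f': "ins_cocone D B (ins_post D Q f)" "Pr (ins_post D Q f)"
        using st' ins_post_cocone[OF wf Q(1)] f by auto
      show ?r if ?l
      proof -
        from that obtain m where m: "(ins_post D Q f, Y, m) \<in> Arr (ins_cat D Pr B)"
          "iso_arr (ins_cat D Pr B) (ins_post D Q f, Y, m)" by (auto simp: ins_fun_def)
        then show ?r using iso_ins_cat[OF wf m(1)] by auto
      qed
      show ?l if ?r
      proof -
        from that obtain m where m: "ins_mor D (ins_post D Q f) Y m" "\<forall>p \<in> Pt D. inv2 (m p)" by blast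
        then have a: "(ins_post D Q f, Y, m) \<in> Arr (ins_cat D Pr B)" using f' Y by simp
        then show ?l using iso_ins_cat[OF wf a] m
          by (intro bexI[of _ "(ins_post D Q f, Y, m)"]) (auto simp: ins_fun_def)
      qed
    qed
    then show ?thesis unfolding ess_surjective_def by (auto simp del: in_hom_set)
  qed
  ultimately show ?thesis unfolding ins_rep_def using Q L by simp
qed

section \<open>Localizations\<close>

text \<open>Precomposition with \<open>p\<close> is an equivalence from the 1-cells out of
  \<open>M\<close> onto the full subcategory of those 1-cells out of \<open>L\<close> that satisfy
  \<open>P\<close>. Coequifiers (\<open>P\<close> equates pairs of 2-cells) and coinverters
  (\<open>P\<close> makes 2-cells invertible) are both of this form.\<close>

definition localizes :: "('k1 \<Rightarrow> bool) \<Rightarrow> 'k1 \<Rightarrow> 'k0 \<Rightarrow> 'k0 \<Rightarrow> bool" where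
  "localizes P p L M \<longleftrightarrow> M \<in> Cell0 C \<and> p \<in> hom1 C L M \<and>
     (\<forall>B \<in> Cell0 C.
       (\<forall>g \<in> hom1 C M B. P (g \<cdot> p)) \<and>
       (\<forall>f \<in> hom1 C L B. P f \<longrightarrow> (\<exists>g \<in> hom1 C M B. \<exists>t \<in> hom2 C (g \<cdot> p) f. inv2 t)) \<and>
       (\<forall>g \<in> hom1 C M B. \<forall>h \<in> hom1 C M B. \<forall>t \<in> hom2 C (g \<cdot> p) (h \<cdot> p).
          \<exists>!u. u \<in> hom2 C g h \<and> u \<lhd> p = t))"

text \<open>Invariance under isomorphism is asked only among families satisfying \<open>Pr0\<close>,
  so a condition that refines \<open>Pr0\<close> may rely on \<open>Pr0\<close> at the
  target.\<close>

definition replete :: "('p, 'j, 'k0, 'k1) ins \<Rightarrow> (('p, 'j, 'k1, 'k2) fam \<Rightarrow> bool) \<Rightarrow>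
    (('p, 'j, 'k1, 'k2) fam \<Rightarrow> bool) \<Rightarrow> bool" where
  "replete D Pr0 Pr \<longleftrightarrow> (\<forall>B Q Q' m. ins_cocone D B Q \<longrightarrow> ins_cocone D B Q' \<longrightarrow> Pr0 Q \<longrightarrow> Pr0 Q' \<longrightarrow> Pr Q \<longrightarrow>
     ins_mor D Q Q' m \<longrightarrow> (\<forall>p \<in> Pt D. inv2 (m p)) \<longrightarrow> Pr Q')"

lemma ins_post_post:
  assumes wf: "wf_ins D" and Q: "ins_cocone D L Q" and p: "p \<in> hom1 C L M" "g \<in> hom1 C M B"
  shows "ins_post D (ins_post D Q p) g = ins_post D Q (g \<cdot> p)"
  using p by (auto simp: ins_post_def wf_ins_simps[OF wf] ins_cocone_simps[OF Q] intro!: restrict_ext)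

text \<open>A family \<open>Y\<close> with \<open>Pr\<close> is isomorphic to one induced by some
  \<open>f\<close> out of \<open>L\<close>. Repleteness carries \<open>Pr\<close> to that induced
  family, so \<open>P f\<close> holds and \<open>f\<close> factors through \<open>p\<close> up to
  isomorphism. For 2-cells, lifting along the legs of \<open>Q\<close> is followed by lifting along
  \<open>p\<close>.\<close>

lemma ins_rep_localize:
  assumes wf: "wf_ins D" and rep: "ins_rep D Pr0 L Q" and loc: "localizes P p L M"
    and P: "\<And>f. f \<in> Cell1 C \<Longrightarrow> src C f = L \<Longrightarrow> P f \<longleftrightarrow> Pr (ins_post D Q f)"
    and re: "replete D Pr0 Pr" and st0: "post_stable D Pr0"
    and le: "\<And>Q. Pr Q \<Longrightarrow> Pr0 Q"
  shows "ins_rep D Pr M (ins_post D Q p)"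
  unfolding ins_rep_def
proof (intro conjI ballI allI impI)
  have Q: "ins_cocone D L Q" "Pr0 Q" "L \<in> Cell0 C" using rep by (auto simp: ins_rep_def)
  have M: "M \<in> Cell0 C" and p: "p \<in> Cell1 C" "src C p = L" "tgt C p = M"
    using loc by (auto simp: localizes_def)
  note [simp] = p wf_ins_simps[OF wf] ins_cocone_simps(1-6)[OF Q(1)]
  note pp = ins_post_post[OF wf Q(1), of p M]
  have st': "Pr0 (ins_post D Q f)" if "f \<in> Cell1 C" "src C f = L" for f
    using st0 Q that unfolding post_stable_def by blast
  show "M \<in> Cell0 C" by fact
  show "ins_cocone D M (ins_post D Q p)" using ins_post_cocone[OF wf Q(1)] p by simp
  \<comment> \<open>Taking \<open>g\<close> to be the identity of \<open>M\<close> in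
    \<open>localizes\<close> gives \<open>P p\<close> itself.\<close>
  have "id1 C M \<in> hom1 C M M" using M by simp
  then have "P (id1 C M \<cdot> p)" using loc M unfolding localizes_def by blast
  then show "Pr (ins_post D Q p)" using P[of p] by simp
  fix B assume B: "B \<in> Cell0 C"
  {
    fix g h m assume g: "g \<in> hom1 C M B" and h: "h \<in> hom1 C M B"
      and m: "ins_mor D (ins_post D (ins_post D Q p) g) (ins_post D (ins_post D Q p) h) m"
    have "\<exists>!t. t \<in> hom2 C (g \<cdot> p) (h \<cdot> p) \<and> (\<lambda>k \<in> Pt D. t \<lhd> fst Q k) = m"
    proof -
      have "g \<cdot> p \<in> hom1 C L B" "h \<cdot> p \<in> hom1 C L B" using g h by auto
      moreover have "ins_mor D (ins_post D Q (g \<cdot> p)) (ins_post D Q (h \<cdot> p)) m"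
        using m g h by (simp add: pp)
      ultimately show ?thesis using rep B unfolding ins_rep_def by blast
    qed
    then obtain t where t: "t \<in> hom2 C (g \<cdot> p) (h \<cdot> p)" "(\<lambda>k \<in> Pt D. t \<lhd> fst Q k) = m"
      and tu: "\<And>t'. t' \<in> hom2 C (g \<cdot> p) (h \<cdot> p) \<Longrightarrow> (\<lambda>k \<in> Pt D. t' \<lhd> fst Q k) = m \<Longrightarrow> t' = t" by blast
    have "\<exists>!u. u \<in> hom2 C g h \<and> u \<lhd> p = t"
      using loc B g h t unfolding localizes_def by blast
    moreover have "(\<lambda>k \<in> Pt D. u \<lhd> fst (ins_post D Q p) k) = m \<longleftrightarrow> u \<lhd> p = t"
      if u: "u \<in> hom2 C g h" for u
    proof -
      have 1: "(\<lambda>k \<in> Pt D. u \<lhd> fst (ins_post D Q p) k) = (\<lambda>k \<in> Pt D. (u \<lhd> p) \<lhd> fst Q k)"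
        using u g h by (intro restrict_ext) (auto simp: ins_post_def)
      have "u \<lhd> p \<in> hom2 C (g \<cdot> p) (h \<cdot> p)" using u g h by auto
      then show ?thesis unfolding 1 using t tu by blast
    qed
    ultimately show "\<exists>!u. u \<in> hom2 C g h \<and> (\<lambda>k \<in> Pt D. u \<lhd> fst (ins_post D Q p) k) = m"
      by metis
  }
  {
    fix Y assume Y: "ins_cocone D B Y" "Pr Y"
    obtain f m where f: "f \<in> hom1 C L B" and m: "ins_mor D (ins_post D Q f) Y m" "\<forall>k \<in> Pt D. inv2 (m k)"
      using rep B Y le unfolding ins_rep_def by blast
    have Qf: "ins_cocone D B (ins_post D Q f)" using ins_post_cocone[OF wf Q(1)] f by auto
    have m': "ins_mor D Y (ins_post D Q f) (\<lambda>k \<in> Pt D. vinv (m k))"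
      by (rule ins_mor_inverse[OF wf Qf Y(1)]) (use m in auto)
    have "Pr (ins_post D Q f)"
    proof -
      have "\<forall>k\<in>Pt D. inv2 ((\<lambda>k \<in> Pt D. vinv (m k)) k)" using m(2) by simp
      moreover have "Pr0 (ins_post D Q f)" using st' f by auto
      ultimately show ?thesis using re Y Qf m' le[OF Y(2)] unfolding replete_def by blast
    qed
    then have "P f" using P f by auto
    then obtain g t where g: "g \<in> hom1 C M B" and t: "t \<in> hom2 C (g \<cdot> p) f" "inv2 t"
      using loc B f unfolding localizes_def by blast
    have gp: "ins_cocone D B (ins_post D Q (g \<cdot> p))"
      using ins_post_cocone[OF wf Q(1), of "g \<cdot> p"] g by auto
    have t': "ins_mor D (ins_post D Q (g \<cdot> p)) (ins_post D Q f) (\<lambda>k \<in> Pt D. t \<lhd> fst Q k)"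
      by (rule ins_post_mor[OF wf Q(1)]) (use t g in auto)
    have "ins_mor D (ins_post D Q (g \<cdot> p)) Y (\<lambda>k \<in> Pt D. m k \<bullet> (\<lambda>k \<in> Pt D. t \<lhd> fst Q k) k)"
      by (rule ins_mor_cmp[OF wf gp Qf Y(1) t' m(1)])
    moreover have "inv2 (m k \<bullet> (t \<lhd> fst Q k))" if k: "k \<in> Pt D" for k
      using t m k g ins_mor_simps(1-3)[OF m(1) k] f by (intro inv2_vcmp) (auto simp: ins_post_def)
    ultimately show "\<exists>g\<in>hom1 C M B. \<exists>m. ins_mor D (ins_post D (ins_post D Q p) g) Y m \<and> (\<forall>k\<in>Pt D. inv2 (m k))"
      using pp[of g B] g
      by (intro bexI[of _ g] exI[of _ "\<lambda>k \<in> Pt D. m k \<bullet> (\<lambda>k \<in> Pt D. t \<lhd> fst Q k) k"]) auto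
  }
qed

end

section \<open>Weighted cocones\<close>

lemma hom_into_simps [simp]:
  "C0 (hom_into K F B) i = hom_cat K (F0 F i) B"
  "onO (C1 (hom_into K F B) d) g = cmp1 K g (F1 F d)"
  "onA (C1 (hom_into K F B) d) s = wr K s (F1 F d)"
  "C2 (hom_into K F B) t g = wl K g (F2 F t)"
  by (simp_all add: hom_into_def)

lemma rep_simps [simp]:
  "C0 (rep K L) B = hom_cat K L B"
  "onO (C1 (rep K L) f) g = cmp1 K f g"
  "onA (C1 (rep K L) f) s = wl K f s"
  "C2 (rep K L) t g = wr K t g"
  by (simp_all add: rep_def)

lemma comp_fctr_simps [simp]:
  "onO (comp_fctr G F) x = onO G (onO F x)" "onA (comp_fctr G F) a = onA G (onA F a)"
  by (simp_all add: comp_fctr_def)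

lemma id_fctr_simps [simp]: "onO id_fctr x = x" "onA id_fctr a = a"
  by (simp_all add: id_fctr_def)

text \<open>Conjugation by \<open>\<tau>\<close> matches the lifts of \<open>b\<close> along
  \<open>H\<close> with the lifts of \<open>c\<close> along \<open>F\<close>. The lemma serves to
  replace the components of a pseudonatural equivalence by composition with a universal
  cocone.\<close>

lemma equivalence_nat_iso:
  assumes A: "category A" and B: "category B" and F: "is_equivalence A B F" and H: "is_functor A B H"
    and \<tau>: "nat_iso A B H F \<tau>"
  shows "is_equivalence A B H"
proof (rule equivalenceI[OF A B H])
  interpret A: category_calc A using A by unfold_locales
  interpret B: category_calc B using B by unfold_locales
  have F': "is_functor A B F" using F by (simp add: is_equivalence_def)
  note [simp] = functor_simps[OF F'] functor_simps[OF H]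
  have \<tau>s [simp]: "\<tau> x \<in> Arr B" "Dom B (\<tau> x) = onO H x" "Cod B (\<tau> x) = onO F x" "iso_arr B (\<tau> x)"
    if "x \<in> Obj A" for x
    using \<tau> that by (auto simp: nat_iso_def nat_trans_def)
  have \<tau>n: "Cmp B (\<tau> (Cod A f)) (onA H f) = Cmp B (onA F f) (\<tau> (Dom A f))" if "f \<in> Arr A" for f
    using \<tau> that by (auto simp: nat_iso_def nat_trans_def)
  have "\<forall>x \<in> Obj A. \<exists>d. d \<in> Arr B \<and> Dom B d = onO F x \<and> Cod B d = onO H x \<and>
      Cmp B d (\<tau> x) = Idt B (onO H x) \<and> Cmp B (\<tau> x) d = Idt B (onO F x)"
    using B.iso_ex[OF \<tau>s(4)] by force
  then obtain \<sigma> where \<sigma>: "\<And>x. x \<in> Obj A \<Longrightarrow> \<sigma> x \<in> Arr B \<and> Dom B (\<sigma> x) = onO F x \<and> Cod B (\<sigma> x) = onO H x \<and>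
      Cmp B (\<sigma> x) (\<tau> x) = Idt B (onO H x) \<and> Cmp B (\<tau> x) (\<sigma> x) = Idt B (onO F x)" by metis
  have \<sigma>s [simp]: "\<sigma> x \<in> Arr B" "Dom B (\<sigma> x) = onO F x" "Cod B (\<sigma> x) = onO H x"
     "Cmp B (\<sigma> x) (\<tau> x) = Idt B (onO H x)" "Cmp B (\<tau> x) (\<sigma> x) = Idt B (onO F x)"
    if "x \<in> Obj A" for x using \<sigma>[OF that] by auto
  show "fully_faithful A B H"
    unfolding fully_faithful_def
  proof (intro ballI)
    fix x y b assume x: "x \<in> Obj A" and y: "y \<in> Obj A" and b: "b \<in> hom_set B (onO H x) (onO H y)"
    define c where "c = Cmp B (\<tau> y) (Cmp B b (\<sigma> x))"
    have c: "c \<in> hom_set B (onO F x) (onO F y)" using x y b by (auto simp: c_def)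
    have "onA H a = b \<longleftrightarrow> onA F a = c" if a: "a \<in> hom_set A x y" for a
    proof
      have n: "Cmp B (\<tau> y) (onA H a) = Cmp B (onA F a) (\<tau> x)" using \<tau>n[of a] a by auto
      show "onA F a = c" if "onA H a = b"
      proof -
        have "c = Cmp B (Cmp B (\<tau> y) (onA H a)) (\<sigma> x)" unfolding c_def using that a x y by auto
        also have "\<dots> = onA F a" unfolding n using a x y by auto
        finally show ?thesis by simp
      qed
      show "onA H a = b" if "onA F a = c"
      proof (rule B.mono_iso[of "\<tau> y"])
        have "Cmp B (\<tau> y) (onA H a) = Cmp B (Cmp B (\<tau> y) (Cmp B b (\<sigma> x))) (\<tau> x)"
          unfolding n that c_def ..
        also have "\<dots> = Cmp B (\<tau> y) b" using b x y by auto
        finally show "Cmp B (\<tau> y) (onA H a) = Cmp B (\<tau> y) b" .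
      qed (use a b x y in auto)
    qed
    moreover have "\<exists>!a. a \<in> hom_set A x y \<and> onA F a = c"
      using equivalenceD(1)[OF A B F] x y c unfolding fully_faithful_def by blast
    ultimately show "\<exists>!a. a \<in> hom_set A x y \<and> onA H a = b" by metis
  qed
  show "ess_surjective A B H"
    unfolding ess_surjective_def
  proof
    fix y assume "y \<in> Obj B"
    then obtain x b where x: "x \<in> Obj A" and b: "b \<in> hom_set B (onO F x) y" "iso_arr B b"
      using equivalenceD(2)[OF A B F] unfolding ess_surjective_def by blast
    then show "\<exists>x\<in>Obj A. \<exists>b\<in>hom_set B (onO H x) y. iso_arr B b"
      using B.iso_cmp[of "\<tau> x" b] by (intro bexI[of _ x] bexI[of _ "Cmp B b (\<tau> x)"]) auto
  qed
qed

section \<open>Weighted cocones in elementary terms, and their representability by a universal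
  cocone\<close>

locale diagram = strict_two_category C
  for C :: "('k0, 'k1, 'k2) two_cat" +
  fixes I :: "('i0, 'i1, 'i2) two_cat" and F :: "('i0, 'i1, 'i2, 'k0, 'k1, 'k2) two_fun"
  assumes index: "two_category I" and diagram: "two_functor I C F"
begin

sublocale I: strict_two_category I
  by unfold_locales (rule index)

lemma F_simps [simp]:
  "i \<in> Cell0 I \<Longrightarrow> F0 F i \<in> Cell0 C"
  "d \<in> Cell1 I \<Longrightarrow> F1 F d \<in> Cell1 C" "d \<in> Cell1 I \<Longrightarrow> src C (F1 F d) = F0 F (src I d)"
  "d \<in> Cell1 I \<Longrightarrow> tgt C (F1 F d) = F0 F (tgt I d)"
  "i \<in> Cell0 I \<Longrightarrow> F1 F (id1 I i) = id1 C (F0 F i)"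
  "\<lbrakk>d \<in> Cell1 I; e \<in> Cell1 I; tgt I d = src I e\<rbrakk> \<Longrightarrow> F1 F (cmp1 I e d) = F1 F e \<cdot> F1 F d"
  "s \<in> Cell2 I \<Longrightarrow> F2 F s \<in> Cell2 C" "s \<in> Cell2 I \<Longrightarrow> dom2 C (F2 F s) = F1 F (dom2 I s)"
  "s \<in> Cell2 I \<Longrightarrow> cod2 C (F2 F s) = F1 F (cod2 I s)"
  "d \<in> Cell1 I \<Longrightarrow> F2 F (id2 I d) = id2 C (F1 F d)"
  using diagram by (auto simp: two_functor_def is_functor_def)

end

locale weighted = diagram C I F
  for C :: "('k0, 'k1, 'k2) two_cat" and I :: "('i0, 'i1, 'i2) two_cat"
    and F :: "('i0, 'i1, 'i2, 'k0, 'k1, 'k2) two_fun" +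
  fixes W :: "('i0, 'i1, 'i2, 'o, 'a) cat_fun"
  assumes weight: "cat_functor (op2 I) W"
begin

lemma W_cat: "i \<in> Cell0 I \<Longrightarrow> category (C0 W i)"
  using weight by (auto simp: cat_functor_def)

lemma W_functor: "d \<in> Cell1 I \<Longrightarrow> is_functor (C0 W (tgt I d)) (C0 W (src I d)) (C1 W d)"
  using weight by (auto simp: cat_functor_def)

lemma W_simps [simp]:
  "d \<in> Cell1 I \<Longrightarrow> x \<in> Obj (C0 W (tgt I d)) \<Longrightarrow> onO (C1 W d) x \<in> Obj (C0 W (src I d))"
  "d \<in> Cell1 I \<Longrightarrow> a \<in> Arr (C0 W (tgt I d)) \<Longrightarrow> onA (C1 W d) a \<in> Arr (C0 W (src I d))"
  "d \<in> Cell1 I \<Longrightarrow> a \<in> Arr (C0 W (tgt I d)) \<Longrightarrow>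
    Dom (C0 W (src I d)) (onA (C1 W d) a) = onO (C1 W d) (Dom (C0 W (tgt I d)) a)"
  "d \<in> Cell1 I \<Longrightarrow> a \<in> Arr (C0 W (tgt I d)) \<Longrightarrow>
    Cod (C0 W (src I d)) (onA (C1 W d) a) = onO (C1 W d) (Cod (C0 W (tgt I d)) a)"
  "i \<in> Cell0 I \<Longrightarrow> x \<in> Obj (C0 W i) \<Longrightarrow> onO (C1 W (id1 I i)) x = x"
  "i \<in> Cell0 I \<Longrightarrow> a \<in> Arr (C0 W i) \<Longrightarrow> onA (C1 W (id1 I i)) a = a"
  using functor_simps[OF W_functor] weight by (auto simp: cat_functor_def eq_on_cat_def)

text \<open>Pseudonaturality into the hom-categories of \<open>C\<close> with tip \<open>B\<close>,
  written in 2-cells of \<open>C\<close>. As the weight is contravariant,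
  \<open>strc \<alpha> d\<close> is indexed by an object over the target of \<open>d\<close> and
  ends at a value over its source.\<close>

definition wcone :: "'k0 \<Rightarrow> ('i0, 'i1, 'o, 'a, 'k1, 'k2) ps_trans \<Rightarrow> bool" where
  "wcone B \<alpha> \<longleftrightarrow>
   (\<forall>i\<in>Cell0 I. is_functor (C0 W i) (hom_cat C (F0 F i) B) (cmpt \<alpha> i)) \<and>
   (\<forall>d\<in>Cell1 I. \<forall>x\<in>Obj (C0 W (tgt I d)). inv2 (strc \<alpha> d x) \<and>
      dom2 C (strc \<alpha> d x) = onO (cmpt \<alpha> (tgt I d)) x \<cdot> F1 F d \<and>
      cod2 C (strc \<alpha> d x) = onO (cmpt \<alpha> (src I d)) (onO (C1 W d) x)) \<and>
   (\<forall>d\<in>Cell1 I. \<forall>a\<in>Arr (C0 W (tgt I d)).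
      strc \<alpha> d (Cod (C0 W (tgt I d)) a) \<bullet> (onA (cmpt \<alpha> (tgt I d)) a \<lhd> F1 F d) =
      onA (cmpt \<alpha> (src I d)) (onA (C1 W d) a) \<bullet> strc \<alpha> d (Dom (C0 W (tgt I d)) a)) \<and>
   (\<forall>i\<in>Cell0 I. \<forall>x\<in>Obj (C0 W i). strc \<alpha> (id1 I i) x = id2 C (onO (cmpt \<alpha> i) x)) \<and>
   (\<forall>d\<in>Cell1 I. \<forall>e\<in>Cell1 I. src I d = tgt I e \<longrightarrow> (\<forall>x\<in>Obj (C0 W (tgt I d)).
      strc \<alpha> (cmp1 I d e) x = strc \<alpha> e (onO (C1 W d) x) \<bullet> (strc \<alpha> d x \<lhd> F1 F e))) \<and>
   (\<forall>s\<in>Cell2 I. \<forall>x\<in>Obj (C0 W (tgt I (dom2 I s))).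
      onA (cmpt \<alpha> (src I (dom2 I s))) (C2 W s x) \<bullet> strc \<alpha> (dom2 I s) x =
      strc \<alpha> (cod2 I s) x \<bullet> (onO (cmpt \<alpha> (tgt I (dom2 I s))) x \<rhd> F2 F s))"

lemma pseudonatural_wcone:
  "pseudonatural (op2 I) W (hom_into C F B) \<alpha> \<longleftrightarrow> wcone B \<alpha>"
proof -
  have 1: "nat_iso (C0 W (tgt I d)) (hom_cat C (F0 F (src I d)) B)
       (comp_fctr (C1 (hom_into C F B) d) (cmpt \<alpha> (tgt I d))) (comp_fctr (cmpt \<alpha> (src I d)) (C1 W d)) (strc \<alpha> d)
     \<longleftrightarrow> (\<forall>x\<in>Obj (C0 W (tgt I d)). inv2 (strc \<alpha> d x) \<and>
        dom2 C (strc \<alpha> d x) = onO (cmpt \<alpha> (tgt I d)) x \<cdot> F1 F d \<and>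
        cod2 C (strc \<alpha> d x) = onO (cmpt \<alpha> (src I d)) (onO (C1 W d) x)) \<and>
      (\<forall>a\<in>Arr (C0 W (tgt I d)).
      strc \<alpha> d (Cod (C0 W (tgt I d)) a) \<bullet> (onA (cmpt \<alpha> (tgt I d)) a \<lhd> F1 F d) =
      onA (cmpt \<alpha> (src I d)) (onA (C1 W d) a) \<bullet> strc \<alpha> d (Dom (C0 W (tgt I d)) a))"
    if fn: "\<forall>i\<in>Cell0 I. is_functor (C0 W i) (hom_cat C (F0 F i) B) (cmpt \<alpha> i)" and d: "d \<in> Cell1 I" for d
  proof -
    have "\<And>x. x \<in> Obj (C0 W (tgt I d)) \<Longrightarrow> onO (cmpt \<alpha> (tgt I d)) x \<in> hom1 C (F0 F (tgt I d)) B"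
      using functor_simps(1)[of _ _ "cmpt \<alpha> (tgt I d)"] fn d by fastforce
    then show ?thesis
      unfolding nat_iso_def nat_trans_def using d by (auto simp: iso_arr_hom_cat)
  qed
  show ?thesis
    unfolding pseudonatural_def wcone_def by (simp add: 1 ball_conj_distrib cong: conj_cong)
qed

definition wmod :: "('i0, 'i1, 'o, 'a, 'k1, 'k2) ps_trans \<Rightarrow> ('i0, 'i1, 'o, 'a, 'k1, 'k2) ps_trans \<Rightarrow>
    ('i0 \<Rightarrow> 'o \<Rightarrow> 'k2) \<Rightarrow> bool" where
  "wmod \<alpha> \<beta> m \<longleftrightarrow>
   (\<forall>i\<in>Cell0 I. \<forall>x\<in>Obj (C0 W i). m i x \<in> Cell2 C \<and> dom2 C (m i x) = onO (cmpt \<alpha> i) x \<and>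
      cod2 C (m i x) = onO (cmpt \<beta> i) x) \<and>
   (\<forall>i\<in>Cell0 I. \<forall>a\<in>Arr (C0 W i). m i (Cod (C0 W i) a) \<bullet> onA (cmpt \<alpha> i) a =
      onA (cmpt \<beta> i) a \<bullet> m i (Dom (C0 W i) a)) \<and>
   (\<forall>d\<in>Cell1 I. \<forall>x\<in>Obj (C0 W (tgt I d)).
      strc \<beta> d x \<bullet> (m (tgt I d) x \<lhd> F1 F d) = m (src I d) (onO (C1 W d) x) \<bullet> strc \<alpha> d x)"

lemma wcone_simps:
  assumes "wcone B \<alpha>"
  shows "\<lbrakk>i \<in> Cell0 I; x \<in> Obj (C0 W i)\<rbrakk> \<Longrightarrow> onO (cmpt \<alpha> i) x \<in> Cell1 C"
    "\<lbrakk>i \<in> Cell0 I; x \<in> Obj (C0 W i)\<rbrakk> \<Longrightarrow> src C (onO (cmpt \<alpha> i) x) = F0 F i"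
    "\<lbrakk>i \<in> Cell0 I; x \<in> Obj (C0 W i)\<rbrakk> \<Longrightarrow> tgt C (onO (cmpt \<alpha> i) x) = B"
    "\<lbrakk>i \<in> Cell0 I; a \<in> Arr (C0 W i)\<rbrakk> \<Longrightarrow> onA (cmpt \<alpha> i) a \<in> Cell2 C"
    "\<lbrakk>i \<in> Cell0 I; a \<in> Arr (C0 W i)\<rbrakk> \<Longrightarrow> dom2 C (onA (cmpt \<alpha> i) a) = onO (cmpt \<alpha> i) (Dom (C0 W i) a)"
    "\<lbrakk>i \<in> Cell0 I; a \<in> Arr (C0 W i)\<rbrakk> \<Longrightarrow> cod2 C (onA (cmpt \<alpha> i) a) = onO (cmpt \<alpha> i) (Cod (C0 W i) a)"
    "\<lbrakk>i \<in> Cell0 I; x \<in> Obj (C0 W i)\<rbrakk> \<Longrightarrow> onA (cmpt \<alpha> i) (Idt (C0 W i) x) = id2 C (onO (cmpt \<alpha> i) x)"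
    "\<lbrakk>d \<in> Cell1 I; x \<in> Obj (C0 W (tgt I d))\<rbrakk> \<Longrightarrow> inv2 (strc \<alpha> d x)"
    "\<lbrakk>d \<in> Cell1 I; x \<in> Obj (C0 W (tgt I d))\<rbrakk> \<Longrightarrow> dom2 C (strc \<alpha> d x) = onO (cmpt \<alpha> (tgt I d)) x \<cdot> F1 F d"
    "\<lbrakk>d \<in> Cell1 I; x \<in> Obj (C0 W (tgt I d))\<rbrakk> \<Longrightarrow> cod2 C (strc \<alpha> d x) = onO (cmpt \<alpha> (src I d)) (onO (C1 W d) x)"
    "\<lbrakk>i \<in> Cell0 I; x \<in> Obj (C0 W i)\<rbrakk> \<Longrightarrow> strc \<alpha> (id1 I i) x = id2 C (onO (cmpt \<alpha> i) x)"
    "\<lbrakk>d \<in> Cell1 I; x \<in> Obj (C0 W (tgt I d))\<rbrakk> \<Longrightarrow> strc \<alpha> d x \<in> Cell2 C"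
  using assms functor_simps[of "C0 W i" _ "cmpt \<alpha> i"] unfolding wcone_def by fastforce+

lemma wcone_eqs:
  assumes "wcone B \<alpha>"
  shows "\<lbrakk>i \<in> Cell0 I; a \<in> Arr (C0 W i); b \<in> Arr (C0 W i); Cod (C0 W i) a = Dom (C0 W i) b\<rbrakk> \<Longrightarrow>
      onA (cmpt \<alpha> i) (Cmp (C0 W i) b a) = onA (cmpt \<alpha> i) b \<bullet> onA (cmpt \<alpha> i) a"
    "\<lbrakk>d \<in> Cell1 I; a \<in> Arr (C0 W (tgt I d))\<rbrakk> \<Longrightarrow>
      strc \<alpha> d (Cod (C0 W (tgt I d)) a) \<bullet> (onA (cmpt \<alpha> (tgt I d)) a \<lhd> F1 F d) =
      onA (cmpt \<alpha> (src I d)) (onA (C1 W d) a) \<bullet> strc \<alpha> d (Dom (C0 W (tgt I d)) a)"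
    "\<lbrakk>d \<in> Cell1 I; e \<in> Cell1 I; tgt I e = src I d; x \<in> Obj (C0 W (tgt I d))\<rbrakk> \<Longrightarrow>
      strc \<alpha> (cmp1 I d e) x = strc \<alpha> e (onO (C1 W d) x) \<bullet> (strc \<alpha> d x \<lhd> F1 F e)"
    "\<lbrakk>s \<in> Cell2 I; x \<in> Obj (C0 W (tgt I (dom2 I s)))\<rbrakk> \<Longrightarrow>
      onA (cmpt \<alpha> (src I (dom2 I s))) (C2 W s x) \<bullet> strc \<alpha> (dom2 I s) x =
      strc \<alpha> (cod2 I s) x \<bullet> (onO (cmpt \<alpha> (tgt I (dom2 I s))) x \<rhd> F2 F s)"
proof -
  note ax = assms[unfolded wcone_def]
  have f: "\<forall>i\<in>Cell0 I. is_functor (C0 W i) (hom_cat C (F0 F i) B) (cmpt \<alpha> i)" using ax by blast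
  show "\<lbrakk>i \<in> Cell0 I; a \<in> Arr (C0 W i); b \<in> Arr (C0 W i); Cod (C0 W i) a = Dom (C0 W i) b\<rbrakk> \<Longrightarrow>
      onA (cmpt \<alpha> i) (Cmp (C0 W i) b a) = onA (cmpt \<alpha> i) b \<bullet> onA (cmpt \<alpha> i) a"
    using functor_simps(6)[OF f[rule_format], of i a b] by simp
qed (use assms[unfolded wcone_def] in metis)+

lemma modification_wmod:
  assumes "wcone B \<alpha>" "wcone B \<beta>"
  shows "modification (op2 I) W (hom_into C F B) \<alpha> \<beta> m \<longleftrightarrow> wmod \<alpha> \<beta> m"
  unfolding modification_def wmod_def nat_trans_def
  using wcone_simps(1-3)[OF assms(1)] by auto

lemma wmod_simps:
  assumes "wmod \<alpha> \<beta> m"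
  shows "\<lbrakk>i \<in> Cell0 I; x \<in> Obj (C0 W i)\<rbrakk> \<Longrightarrow> m i x \<in> Cell2 C"
    "\<lbrakk>i \<in> Cell0 I; x \<in> Obj (C0 W i)\<rbrakk> \<Longrightarrow> dom2 C (m i x) = onO (cmpt \<alpha> i) x"
    "\<lbrakk>i \<in> Cell0 I; x \<in> Obj (C0 W i)\<rbrakk> \<Longrightarrow> cod2 C (m i x) = onO (cmpt \<beta> i) x"
  using assms by (auto simp: wmod_def)

lemma wmod_eqs:
  assumes "wmod \<alpha> \<beta> m"
  shows "\<lbrakk>i \<in> Cell0 I; a \<in> Arr (C0 W i)\<rbrakk> \<Longrightarrow> m i (Cod (C0 W i) a) \<bullet> onA (cmpt \<alpha> i) a =
      onA (cmpt \<beta> i) a \<bullet> m i (Dom (C0 W i) a)"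
   "\<lbrakk>d \<in> Cell1 I; x \<in> Obj (C0 W (tgt I d))\<rbrakk> \<Longrightarrow>
      strc \<beta> d x \<bullet> (m (tgt I d) x \<lhd> F1 F d) = m (src I d) (onO (C1 W d) x) \<bullet> strc \<alpha> d x"
  using assms by (auto simp: wmod_def)

abbreviation wcones :: "'k0 \<Rightarrow> (('i0, 'i1, 'o, 'a, 'k1, 'k2) ps_trans, ('i0, 'i1, 'o, 'a, 'k1, 'k2) ps_mod) cat" where
  "wcones B \<equiv> ps_cat (op2 I) W (hom_into C F B)"

lemma wcones_simps [simp]:
  "\<alpha> \<in> Obj (wcones B) \<longleftrightarrow> wcone B \<alpha> \<and> ext_ps (op2 I) W \<alpha>"
  "a \<in> Arr (wcones B) \<longleftrightarrow> wcone B (fst a) \<and> ext_ps (op2 I) W (fst a) \<and>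
     wcone B (fst (snd a)) \<and> ext_ps (op2 I) W (fst (snd a)) \<and>
     wmod (fst a) (fst (snd a)) (snd (snd a)) \<and> ext_mod (op2 I) W (snd (snd a))"
  "Dom (wcones B) a = fst a" "Cod (wcones B) a = fst (snd a)"
  "Idt (wcones B) \<alpha> = (\<alpha>, \<alpha>, \<lambda>i \<in> Cell0 I. \<lambda>x \<in> Obj (C0 W i). id2 C (onO (cmpt \<alpha> i) x))"
  "Cmp (wcones B) b a = (fst a, fst (snd b),
     \<lambda>i \<in> Cell0 I. \<lambda>x \<in> Obj (C0 W i). snd (snd b) i x \<bullet> snd (snd a) i x)"
  by (auto simp: ps_cat_def Let_def pseudonatural_wcone modification_wmod split: prod.splits)

lemma W_ident [simp]: "\<lbrakk>i \<in> Cell0 I; a \<in> Arr (C0 W i)\<rbrakk> \<Longrightarrow> Dom (C0 W i) a \<in> Obj (C0 W i)"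
  "\<lbrakk>i \<in> Cell0 I; a \<in> Arr (C0 W i)\<rbrakk> \<Longrightarrow> Cod (C0 W i) a \<in> Obj (C0 W i)"
  using W_cat[of i] by (auto simp: category_def)

lemma wmod_id: "wcone B \<alpha> \<Longrightarrow> wmod \<alpha> \<alpha> (\<lambda>i \<in> Cell0 I. \<lambda>x \<in> Obj (C0 W i). id2 C (onO (cmpt \<alpha> i) x))"
  unfolding wmod_def using wcone_simps[of B \<alpha>] by auto

lemma wmod_cmp:
  assumes Q: "wcone B \<alpha>" "wcone B \<beta>" "wcone B \<gamma>" and m: "wmod \<alpha> \<beta> m" and n: "wmod \<beta> \<gamma> n"
  shows "wmod \<alpha> \<gamma> (\<lambda>i \<in> Cell0 I. \<lambda>x \<in> Obj (C0 W i). n i x \<bullet> m i x)"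
proof -
  note [simp] = wcone_simps[OF Q(1)] wcone_simps[OF Q(2)] wcone_simps[OF Q(3)] wmod_simps[OF m] wmod_simps[OF n]
  have "(n i (Cod (C0 W i) a) \<bullet> m i (Cod (C0 W i) a)) \<bullet> onA (cmpt \<alpha> i) a =
      onA (cmpt \<gamma> i) a \<bullet> n i (Dom (C0 W i) a) \<bullet> m i (Dom (C0 W i) a)"
    if i: "i \<in> Cell0 I" and a: "a \<in> Arr (C0 W i)" for i a
  proof -
    have "(n i (Cod (C0 W i) a) \<bullet> m i (Cod (C0 W i) a)) \<bullet> onA (cmpt \<alpha> i) a =
      (n i (Cod (C0 W i) a) \<bullet> onA (cmpt \<beta> i) a) \<bullet> m i (Dom (C0 W i) a)"
      using i a wmod_eqs(1)[OF m i a] by simp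
    also have "\<dots> = onA (cmpt \<gamma> i) a \<bullet> n i (Dom (C0 W i) a) \<bullet> m i (Dom (C0 W i) a)"
      unfolding wmod_eqs(1)[OF n i a] using i a by simp
    finally show ?thesis .
  qed
  moreover have "strc \<gamma> d x \<bullet> ((n (tgt I d) x \<bullet> m (tgt I d) x) \<lhd> F1 F d) =
     (n (src I d) (onO (C1 W d) x) \<bullet> m (src I d) (onO (C1 W d) x)) \<bullet> strc \<alpha> d x"
    if d: "d \<in> Cell1 I" and x: "x \<in> Obj (C0 W (tgt I d))" for d x
  proof -
    have "strc \<gamma> d x \<bullet> ((n (tgt I d) x \<bullet> m (tgt I d) x) \<lhd> F1 F d) =
      (strc \<gamma> d x \<bullet> (n (tgt I d) x \<lhd> F1 F d)) \<bullet> (m (tgt I d) x \<lhd> F1 F d)"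
      using d x by simp
    also have "\<dots> = n (src I d) (onO (C1 W d) x) \<bullet> (strc \<beta> d x \<bullet> (m (tgt I d) x \<lhd> F1 F d))"
      unfolding wmod_eqs(2)[OF n d x] using d x by simp
    also have "\<dots> = (n (src I d) (onO (C1 W d) x) \<bullet> m (src I d) (onO (C1 W d) x)) \<bullet> strc \<alpha> d x"
      unfolding wmod_eqs(2)[OF m d x] using d x by simp
    finally show ?thesis .
  qed
  ultimately show ?thesis unfolding wmod_def by simp
qed

lemma ext_mod_restrict [simp]: "ext_mod (op2 I) W (\<lambda>i \<in> Cell0 I. \<lambda>x \<in> Obj (C0 W i). g i x)"
  by (simp add: ext_mod_def)

lemma ext_mod_eqI:
  assumes "ext_mod (op2 I) W m" "\<And>i x. i \<in> Cell0 I \<Longrightarrow> x \<in> Obj (C0 W i) \<Longrightarrow> g i x = m i x"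
  shows "(\<lambda>i \<in> Cell0 I. \<lambda>x \<in> Obj (C0 W i). g i x) = m"
proof (rule extensionalityI[of _ "Cell0 I"])
  show "m \<in> extensional (Cell0 I)" using assms(1) by (simp add: ext_mod_def)
  fix i assume i: "i \<in> Cell0 I"
  have "(\<lambda>x \<in> Obj (C0 W i). g i x) = m i"
    by (rule extensionalityI[of _ "Obj (C0 W i)"]) (use assms i in \<open>auto simp: ext_mod_def\<close>)
  then show "(\<lambda>i \<in> Cell0 I. \<lambda>x \<in> Obj (C0 W i). g i x) i = m i" using i by simp
qed simp

lemma category_wcones: "category (wcones B)"
  unfolding category_def
proof (intro conjI ballI impI)
  fix a assume a: "a \<in> Arr (wcones B)"
  show "Dom (wcones B) a \<in> Obj (wcones B)" "Cod (wcones B) a \<in> Obj (wcones B)" using a by auto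
  have "wmod (fst a) (fst (snd a)) (snd (snd a))" "ext_mod (op2 I) W (snd (snd a))" using a by auto
  then show "Cmp (wcones B) a (Idt (wcones B) (Dom (wcones B) a)) = a"
    "Cmp (wcones B) (Idt (wcones B) (Cod (wcones B) a)) a = a"
    using wmod_simps[of "fst a" "fst (snd a)" "snd (snd a)"]
    by (auto intro!: prod_eqI ext_mod_eqI)
next
  fix a b assume "a \<in> Arr (wcones B)" "b \<in> Arr (wcones B)" "Cod (wcones B) a = Dom (wcones B) b"
  then show "Cmp (wcones B) b a \<in> hom_set (wcones B) (Dom (wcones B) a) (Cod (wcones B) b)"
    using wmod_cmp[of B "fst a" "fst (snd a)" "fst (snd b)"] by auto
next
  fix a b c assume "a \<in> Arr (wcones B)" "b \<in> Arr (wcones B)" "c \<in> Arr (wcones B)"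
    "Cod (wcones B) a = Dom (wcones B) b" "Cod (wcones B) b = Dom (wcones B) c"
  then have "wmod (fst a) (fst b) (snd (snd a))" "wmod (fst b) (fst c) (snd (snd b))"
    "wmod (fst c) (fst (snd c)) (snd (snd c))" by auto
  note [simp] = this[THEN wmod_simps(1)] this[THEN wmod_simps(2)] this[THEN wmod_simps(3)]
  show "Cmp (wcones B) c (Cmp (wcones B) b a) = Cmp (wcones B) (Cmp (wcones B) c b) a"
    by (auto intro!: restrict_ext)
next
  fix \<alpha> assume "\<alpha> \<in> Obj (wcones B)"
  then show "Idt (wcones B) \<alpha> \<in> hom_set (wcones B) \<alpha> \<alpha>"
    using wmod_id[of B \<alpha>] by auto
qed

definition post_mod :: "'k2 \<Rightarrow> ('i0, 'i1, 'o, 'a, 'k1, 'k2) ps_trans \<Rightarrow> 'i0 \<Rightarrow> 'o \<Rightarrow> 'k2" where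
  "post_mod t \<alpha> = (\<lambda>i \<in> Cell0 I. \<lambda>x \<in> Obj (C0 W i). t \<lhd> onO (cmpt \<alpha> i) x)"

abbreviation post :: "'k1 \<Rightarrow> ('i0, 'i1, 'o, 'a, 'k1, 'k2) ps_trans \<Rightarrow> ('i0, 'i1, 'o, 'a, 'k1, 'k2) ps_trans"
  where "post \<equiv> post_trans I W C"

lemma post_simps [simp]:
  "\<lbrakk>i \<in> Cell0 I; x \<in> Obj (C0 W i)\<rbrakk> \<Longrightarrow> onO (cmpt (post f \<alpha>) i) x = f \<cdot> onO (cmpt \<alpha> i) x"
  "\<lbrakk>i \<in> Cell0 I; a \<in> Arr (C0 W i)\<rbrakk> \<Longrightarrow> onA (cmpt (post f \<alpha>) i) a = f \<rhd> onA (cmpt \<alpha> i) a"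
  "\<lbrakk>d \<in> Cell1 I; x \<in> Obj (C0 W (tgt I d))\<rbrakk> \<Longrightarrow> strc (post f \<alpha>) d x = f \<rhd> strc \<alpha> d x"
  by (simp_all add: post_trans_def)

lemma ext_post [simp]: "ext_ps (op2 I) W (post f \<alpha>)"
  by (simp add: ext_ps_def post_trans_def)

lemma W_comp_obj [simp]:
  "\<lbrakk>d \<in> Cell1 I; e \<in> Cell1 I; tgt I d = src I e; x \<in> Obj (C0 W (tgt I e))\<rbrakk> \<Longrightarrow>
    onO (C1 W (cmp1 I e d)) x = onO (C1 W d) (onO (C1 W e) x)"
  "\<lbrakk>d \<in> Cell1 I; e \<in> Cell1 I; tgt I d = src I e; a \<in> Arr (C0 W (tgt I e))\<rbrakk> \<Longrightarrow>
    onA (C1 W (cmp1 I e d)) a = onA (C1 W d) (onA (C1 W e) a)"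
  using weight by (auto simp: cat_functor_def eq_on_cat_def)

lemma W_two_cell [simp]:
  assumes "s \<in> Cell2 I" "x \<in> Obj (C0 W (tgt I (dom2 I s)))"
  shows "C2 W s x \<in> Arr (C0 W (src I (dom2 I s)))"
    "Dom (C0 W (src I (dom2 I s))) (C2 W s x) = onO (C1 W (dom2 I s)) x"
    "Cod (C0 W (src I (dom2 I s))) (C2 W s x) = onO (C1 W (cod2 I s)) x"
  using weight assms by (auto simp: cat_functor_def nat_trans_def)

lemma wcone_post:
  assumes \<alpha>: "wcone L \<alpha>" and f: "f \<in> Cell1 C" "src C f = L" "tgt C f = B"
  shows "wcone B (post f \<alpha>)"
proof -
  note [simp] = wcone_simps[OF \<alpha>] f
  have 1: "is_functor (C0 W i) (hom_cat C (F0 F i) B) (cmpt (post f \<alpha>) i)" if i: "i \<in> Cell0 I" for i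
    using W_cat[OF i] i wcone_eqs(1)[OF \<alpha> i] unfolding is_functor_def category_def
    by (auto simp del: in_hom_set simp: hom_set_def)
  have 2: "strc (post f \<alpha>) d (Cod (C0 W (tgt I d)) a) \<bullet> (onA (cmpt (post f \<alpha>) (tgt I d)) a \<lhd> F1 F d) =
      onA (cmpt (post f \<alpha>) (src I d)) (onA (C1 W d) a) \<bullet> strc (post f \<alpha>) d (Dom (C0 W (tgt I d)) a)"
    if d: "d \<in> Cell1 I" and a: "a \<in> Arr (C0 W (tgt I d))" for d a
    using wcone_eqs(2)[OF \<alpha> d a, THEN arg_cong, of "wl C f"] d a by simp
  have 3: "strc (post f \<alpha>) (cmp1 I d e) x = strc (post f \<alpha>) e (onO (C1 W d) x) \<bullet> (strc (post f \<alpha>) d x \<lhd> F1 F e)"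
    if "d \<in> Cell1 I" "e \<in> Cell1 I" "src I d = tgt I e" "x \<in> Obj (C0 W (tgt I d))" for d e x
    using wcone_eqs(3)[OF \<alpha> that(1,2) that(3)[symmetric] that(4)] that(1,2,4) that(3)[symmetric] by simp
  have 4: "onA (cmpt (post f \<alpha>) (src I (dom2 I s))) (C2 W s x) \<bullet> strc (post f \<alpha>) (dom2 I s) x =
      strc (post f \<alpha>) (cod2 I s) x \<bullet> (onO (cmpt (post f \<alpha>) (tgt I (dom2 I s))) x \<rhd> F2 F s)"
    if s: "s \<in> Cell2 I" and x: "x \<in> Obj (C0 W (tgt I (dom2 I s)))" for s x
    using wcone_eqs(4)[OF \<alpha> s x, THEN arg_cong, of "wl C f"] s x by simp
  show ?thesis unfolding wcone_def using 1 2 3 4 by simp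
qed

lemma wmod_post:
  assumes \<alpha>: "wcone L \<alpha>" and t: "t \<in> Cell2 C" "src C (dom2 C t) = L" "dom2 C t = f" "cod2 C t = g"
  shows "wmod (post f \<alpha>) (post g \<alpha>) (post_mod t \<alpha>)"
proof -
  note [simp] = wcone_simps[OF \<alpha>]
  have fg [simp]: "f \<in> Cell1 C" "g \<in> Cell1 C" "src C f = L" "src C g = L" "tgt C g = tgt C f" using t by auto
  have 1: "(t \<lhd> onO (cmpt \<alpha> i) (Cod (C0 W i) a)) \<bullet> (f \<rhd> onA (cmpt \<alpha> i) a) =
      (g \<rhd> onA (cmpt \<alpha> i) a) \<bullet> (t \<lhd> onO (cmpt \<alpha> i) (Dom (C0 W i) a))"
    if "i \<in> Cell0 I" "a \<in> Arr (C0 W i)" for i a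
    by (rule whisker_swap) (use that t in auto)
  have 2: "(g \<rhd> strc \<alpha> d x) \<bullet> (t \<lhd> (onO (cmpt \<alpha> (tgt I d)) x \<cdot> F1 F d)) =
      (t \<lhd> onO (cmpt \<alpha> (src I d)) (onO (C1 W d) x)) \<bullet> (f \<rhd> strc \<alpha> d x)"
    if "d \<in> Cell1 I" "x \<in> Obj (C0 W (tgt I d))" for d x
    by (rule whisker_swap[symmetric]) (use that t in auto)
  show ?thesis unfolding wmod_def post_mod_def using t by (simp add: 1 2)
qed

lemma weighted_cocones_simps [simp]:
  "C0 (weighted_cocones I W C F) B = wcones B"
  "onO (C1 (weighted_cocones I W C F) f) = post f"
  "onA (C1 (weighted_cocones I W C F) f) a = (post f (fst a), post f (fst (snd a)),
      \<lambda>i \<in> Cell0 I. \<lambda>x \<in> Obj (C0 W i). f \<rhd> snd (snd a) i x)"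
  "C2 (weighted_cocones I W C F) t \<alpha> = (post (dom2 C t) \<alpha>, post (cod2 C t) \<alpha>, post_mod t \<alpha>)"
  by (simp_all add: weighted_cocones_def post_mod_def split: prod.splits)

definition wfun where
  "wfun \<alpha> = \<lparr>onO = (\<lambda>f. post f \<alpha>), onA = (\<lambda>t. (post (dom2 C t) \<alpha>, post (cod2 C t) \<alpha>, post_mod t \<alpha>))\<rparr>"

lemma ext_post_mod [simp]: "ext_mod (op2 I) W (post_mod t \<alpha>)"
  by (simp add: post_mod_def)

lemma functor_wfun:
  assumes \<alpha>: "wcone L \<alpha>"
  shows "is_functor (hom_cat C L B) (wcones B) (wfun \<alpha>)"
  unfolding is_functor_def wfun_def
proof (intro conjI ballI impI)
  note [simp] = wcone_simps[OF \<alpha>]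
  {
    fix f assume f: "f \<in> Obj (hom_cat C L B)"
    show "onO \<lparr>onO = \<lambda>f. post f \<alpha>, onA = \<lambda>t. (post (dom2 C t) \<alpha>, post (cod2 C t) \<alpha>, post_mod t \<alpha>)\<rparr> f
      \<in> Obj (wcones B)" using f wcone_post[OF \<alpha>] by simp
    show "onA \<lparr>onO = \<lambda>f. post f \<alpha>, onA = \<lambda>t. (post (dom2 C t) \<alpha>, post (cod2 C t) \<alpha>, post_mod t \<alpha>)\<rparr>
         (Idt (hom_cat C L B) f) = Idt (wcones B)
         (onO \<lparr>onO = \<lambda>f. post f \<alpha>, onA = \<lambda>t. (post (dom2 C t) \<alpha>, post (cod2 C t) \<alpha>, post_mod t \<alpha>)\<rparr> f)"
      using f by (auto simp: post_mod_def intro!: restrict_ext)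
  }
  {
    fix t assume "t \<in> Arr (hom_cat C L B)"
    then show "onA \<lparr>onO = \<lambda>f. post f \<alpha>, onA = \<lambda>t. (post (dom2 C t) \<alpha>, post (cod2 C t) \<alpha>, post_mod t \<alpha>)\<rparr> t
       \<in> hom_set (wcones B)
           (onO \<lparr>onO = \<lambda>f. post f \<alpha>, onA = \<lambda>t. (post (dom2 C t) \<alpha>, post (cod2 C t) \<alpha>, post_mod t \<alpha>)\<rparr>
             (Dom (hom_cat C L B) t))
           (onO \<lparr>onO = \<lambda>f. post f \<alpha>, onA = \<lambda>t. (post (dom2 C t) \<alpha>, post (cod2 C t) \<alpha>, post_mod t \<alpha>)\<rparr>
             (Cod (hom_cat C L B) t))"
      using wcone_post[OF \<alpha>] wmod_post[OF \<alpha>, of t] by simp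
  }
  {
    fix s t assume "s \<in> Arr (hom_cat C L B)" "t \<in> Arr (hom_cat C L B)"
      "Cod (hom_cat C L B) s = Dom (hom_cat C L B) t"
    then show "onA \<lparr>onO = \<lambda>f. post f \<alpha>, onA = \<lambda>t. (post (dom2 C t) \<alpha>, post (cod2 C t) \<alpha>, post_mod t \<alpha>)\<rparr>
            (Cmp (hom_cat C L B) t s) = Cmp (wcones B)
         (onA \<lparr>onO = \<lambda>f. post f \<alpha>, onA = \<lambda>t. (post (dom2 C t) \<alpha>, post (cod2 C t) \<alpha>, post_mod t \<alpha>)\<rparr> t)
         (onA \<lparr>onO = \<lambda>f. post f \<alpha>, onA = \<lambda>t. (post (dom2 C t) \<alpha>, post (cod2 C t) \<alpha>, post_mod t \<alpha>)\<rparr> s)"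
      by (auto simp: post_mod_def intro!: restrict_ext)
  }
qed

lemma post_post:
  assumes \<alpha>: "wcone L \<alpha>" and "f \<in> Cell1 C" "g \<in> Cell1 C" "src C f = L" "tgt C f = src C g"
  shows "post g (post f \<alpha>) = post (g \<cdot> f) \<alpha>"
  using wcone_simps[OF \<alpha>] assms(2-)
  by (auto simp: post_trans_def intro!: restrict_ext)

text \<open>The Yoneda lemma: a pseudonatural equivalence is given by a universal weighted cocone.\<close>

lemma is_weighted_bicolimit_iff:
  "is_weighted_bicolimit I W C F L \<longleftrightarrow> L \<in> Cell0 C \<and>
    (\<exists>\<alpha> \<in> Obj (wcones L). \<forall>B \<in> Cell0 C. is_equivalence (hom_cat C L B) (wcones B) (wfun \<alpha>))"
proof
  let ?S = "weighted_cocones I W C F"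
  {
    assume "is_weighted_bicolimit I W C F L"
    then obtain E where L: "L \<in> Cell0 C" and E: "pseudonatural C (rep C L) ?S E"
      and eq: "\<And>B. B \<in> Cell0 C \<Longrightarrow> is_equivalence (hom_cat C L B) (wcones B) (cmpt E B)"
      unfolding is_weighted_bicolimit_def by blast
    have idL: "id1 C L \<in> Obj (hom_cat C L L)" using L by simp
    \<comment> \<open>The universal cocone is the value of \<open>E\<close> at the identity of
      \<open>L\<close>; the structure isomorphisms of \<open>E\<close> at that identity compare
      \<open>wfun \<alpha>\<close> with \<open>cmpt E B\<close>.\<close>
    define \<alpha> where "\<alpha> = onO (cmpt E L) (id1 C L)"
    have \<alpha>: "\<alpha> \<in> Obj (wcones L)"
      using eq[OF L] idL unfolding is_equivalence_def is_functor_def \<alpha>_def by blast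
    have "is_equivalence (hom_cat C L B) (wcones B) (wfun \<alpha>)" if B: "B \<in> Cell0 C" for B
    proof (rule equivalence_nat_iso[OF category_hom_cat category_wcones eq[OF B] functor_wfun])
      show "wcone L \<alpha>" using \<alpha> by simp
      have 1: "strc E f (id1 C L) \<in> hom_set (wcones B) (post f \<alpha>) (onO (cmpt E B) f) \<and>
          iso_arr (wcones B) (strc E f (id1 C L))" if f: "f \<in> hom1 C L B" for f
      proof -
        have "nat_iso (hom_cat C L L) (wcones B) (comp_fctr (C1 ?S f) (cmpt E L))
           (comp_fctr (cmpt E B) (C1 (rep C L) f)) (strc E f)"
          using E f unfolding pseudonatural_def by auto
        then have "strc E f (id1 C L) \<in> hom_set (wcones B) (post f \<alpha>) (onO (cmpt E B) (f \<cdot> id1 C L)) \<and>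
          iso_arr (wcones B) (strc E f (id1 C L))"
          unfolding nat_iso_def nat_trans_def \<alpha>_def using idL by (simp del: in_hom_set wcones_simps add: L)
        then show ?thesis using f by (simp del: wcones_simps)
      qed
      have 2: "Cmp (wcones B) (strc E (cod2 C t) (id1 C L)) (onA (wfun \<alpha>) t) =
          Cmp (wcones B) (onA (cmpt E B) t) (strc E (dom2 C t) (id1 C L))"
        if t: "t \<in> Arr (hom_cat C L B)" for t
      proof -
        have ax: "\<forall>s\<in>Cell2 C. \<forall>x\<in>Obj (hom_cat C L (src C (dom2 C s))).
          Cmp (wcones (tgt C (dom2 C s))) (onA (cmpt E (tgt C (dom2 C s))) (s \<lhd> x)) (strc E (dom2 C s) x) =
          Cmp (wcones (tgt C (dom2 C s))) (strc E (cod2 C s) x) (C2 ?S s (onO (cmpt E (src C (dom2 C s))) x))"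
          using E unfolding pseudonatural_def by (simp del: wcones_simps weighted_cocones_simps(4))
        have t': "t \<in> Cell2 C" "src C (dom2 C t) = L" "tgt C (dom2 C t) = B" using t by auto
        show ?thesis
          using ax[rule_format, of t "id1 C L"] t' idL
          by (simp del: wcones_simps weighted_cocones_simps(4) add: \<alpha>_def[symmetric])
             (simp add: wfun_def del: wcones_simps)
      qed
      show "nat_iso (hom_cat C L B) (wcones B) (wfun \<alpha>) (cmpt E B) (\<lambda>f. strc E f (id1 C L))"
        unfolding nat_iso_def nat_trans_def
      proof (intro conjI ballI)
        fix f assume "f \<in> Obj (hom_cat C L B)"
        then show "strc E f (id1 C L) \<in> hom_set (wcones B) (onO (wfun \<alpha>) f) (onO (cmpt E B) f)"
          "iso_arr (wcones B) (strc E f (id1 C L))"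
          using 1[of f] by (simp_all add: wfun_def del: wcones_simps)
      next
        fix t assume "t \<in> Arr (hom_cat C L B)"
        then show "Cmp (wcones B) (strc E (Cod (hom_cat C L B) t) (id1 C L)) (onA (wfun \<alpha>) t) =
          Cmp (wcones B) (onA (cmpt E B) t) (strc E (Dom (hom_cat C L B) t) (id1 C L))"
          using 2[of t] by (simp del: wcones_simps)
      qed
    qed
    then show "L \<in> Cell0 C \<and>
      (\<exists>\<alpha> \<in> Obj (wcones L). \<forall>B \<in> Cell0 C. is_equivalence (hom_cat C L B) (wcones B) (wfun \<alpha>))"
      using L \<alpha> by blast
  }
  assume "L \<in> Cell0 C \<and>
      (\<exists>\<alpha> \<in> Obj (wcones L). \<forall>B \<in> Cell0 C. is_equivalence (hom_cat C L B) (wcones B) (wfun \<alpha>))"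
  then obtain \<alpha> where L: "L \<in> Cell0 C" and \<alpha>: "wcone L \<alpha>"
    and eq: "\<And>B. B \<in> Cell0 C \<Longrightarrow> is_equivalence (hom_cat C L B) (wcones B) (wfun \<alpha>)" by auto
  note [simp] = wcone_simps[OF \<alpha>]
  \<comment> \<open>Postcomposition is strictly functorial in the 1-cell (\<open>post_post\<close>),
    so identities can serve as structure cells.\<close>
  define E where "E = \<lparr>cmpt = (\<lambda>B::'k0. wfun \<alpha>), strc = (\<lambda>d x. Idt (wcones (tgt C d)) (post (d \<cdot> x) \<alpha>))\<rparr>"
  have Es [simp]: "cmpt E B = wfun \<alpha>" "strc E d x = Idt (wcones (tgt C d)) (post (d \<cdot> x) \<alpha>)" for B d x
    by (simp_all add: E_def)
  have wf [simp]: "onO (wfun \<alpha>) f = post f \<alpha>"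
    "onA (wfun \<alpha>) t = (post (dom2 C t) \<alpha>, post (cod2 C t) \<alpha>, post_mod t \<alpha>)" for f t
    by (simp_all add: wfun_def)
  note pp [simp] = post_post[OF \<alpha>]
  have p1: "(\<lambda>i \<in> Cell0 I. \<lambda>x \<in> Obj (C0 W i). f \<rhd> post_mod t \<alpha> i x) = post_mod (f \<rhd> t) \<alpha>"
    if "t \<in> Cell2 C" "src C (dom2 C t) = L" "f \<in> Cell1 C" "src C f = tgt C (dom2 C t)" for f t
    using that by (auto simp: post_mod_def intro!: restrict_ext)
  have p2: "post_mod t (post f \<alpha>) = post_mod (t \<lhd> f) \<alpha>"
    if "t \<in> Cell2 C" "src C (dom2 C t) = tgt C f" "f \<in> Cell1 C" "src C f = L" for f t
    using that by (auto simp: post_mod_def intro!: restrict_ext)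
  have obj: "post f \<alpha> \<in> Obj (wcones B)" if "f \<in> Cell1 C" "src C f = L" "tgt C f = B" for f B
    using wcone_post[OF \<alpha> that] by simp
  have arr: "(post (dom2 C t) \<alpha>, post (cod2 C t) \<alpha>, post_mod t \<alpha>) \<in> hom_set (wcones B) (post (dom2 C t) \<alpha>) (post (cod2 C t) \<alpha>)"
    if "t \<in> Cell2 C" "src C (dom2 C t) = L" "tgt C (dom2 C t) = B" for t B
    using that wcone_post[OF \<alpha>] wmod_post[OF \<alpha>, of t] by simp
  interpret K: category_calc "wcones B" for B using category_wcones by unfold_locales
  have "pseudonatural C (rep C L) ?S E"
    unfolding pseudonatural_def
  proof (intro conjI ballI impI)
    fix B assume "B \<in> Cell0 C"
    then show "is_functor (C0 (rep C L) B) (C0 ?S B) (cmpt E B)"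
      using functor_wfun[OF \<alpha>] by simp
  next
    fix d assume d: "d \<in> Cell1 C"
    show "nat_iso (C0 (rep C L) (src C d)) (C0 ?S (tgt C d)) (comp_fctr (C1 ?S d) (cmpt E (src C d)))
      (comp_fctr (cmpt E (tgt C d)) (C1 (rep C L) d)) (strc E d)"
      unfolding nat_iso_def nat_trans_def
    proof (intro conjI ballI)
      fix x assume x: "x \<in> Obj (C0 (rep C L) (src C d))"
      then show "strc E d x \<in> hom_set (C0 ?S (tgt C d)) (onO (comp_fctr (C1 ?S d) (cmpt E (src C d))) x)
          (onO (comp_fctr (cmpt E (tgt C d)) (C1 (rep C L) d)) x)"
        using obj[of "d \<cdot> x" "tgt C d"] d by (simp del: wcones_simps)
      show "iso_arr (C0 ?S (tgt C d)) (strc E d x)"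
        using obj[of "d \<cdot> x" "tgt C d"] d x by (simp del: wcones_simps add: K.iso_idt)
    next
      fix t assume t: "t \<in> Arr (C0 (rep C L) (src C d))"
      then show "Cmp (C0 ?S (tgt C d)) (strc E d (Cod (C0 (rep C L) (src C d)) t))
            (onA (comp_fctr (C1 ?S d) (cmpt E (src C d))) t) =
           Cmp (C0 ?S (tgt C d)) (onA (comp_fctr (cmpt E (tgt C d)) (C1 (rep C L) d)) t)
            (strc E d (Dom (C0 (rep C L) (src C d)) t))"
        using arr[of "d \<rhd> t" "tgt C d"] d by (simp del: wcones_simps add: p1)
    qed
  next
    fix i x assume "i \<in> Cell0 C" "x \<in> Obj (C0 (rep C L) i)"
    then show "strc E (id1 C i) x = Idt (C0 ?S i) (onO (cmpt E i) x)"
      by (simp del: wcones_simps)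
  next
    fix d e x assume "d \<in> Cell1 C" "e \<in> Cell1 C" "tgt C d = src C e" "x \<in> Obj (C0 (rep C L) (src C d))"
    moreover from this have "wcone (tgt C d) (post (d \<cdot> x) \<alpha>)"
      using wcone_post[OF \<alpha>, of "d \<cdot> x"] by simp
    ultimately show "strc E (e \<cdot> d) x = Cmp (C0 ?S (tgt C e)) (strc E e (onO (C1 (rep C L) d) x))
        (onA (C1 ?S e) (strc E d x))"
      by (auto intro!: restrict_ext)
  next
    fix s x assume "s \<in> Cell2 C" "x \<in> Obj (C0 (rep C L) (src C (dom2 C s)))"
    then show "Cmp (C0 ?S (tgt C (dom2 C s))) (onA (cmpt E (tgt C (dom2 C s))) (C2 (rep C L) s x))
          (strc E (dom2 C s) x) =
         Cmp (C0 ?S (tgt C (dom2 C s))) (strc E (cod2 C s) x)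
          (C2 ?S s (onO (cmpt E (src C (dom2 C s))) x))"
      using arr[of "s \<lhd> x" "tgt C (dom2 C s)"] by (simp del: wcones_simps add: p2)
  qed
  then show "is_weighted_bicolimit I W C F L"
    unfolding is_weighted_bicolimit_def using L eq by auto
qed

end

section \<open>Transfer of equivalences and change of carriers\<close>

text \<open>\<open>P\<close> compares two presentations of the same kind of cocone, and surjectivity
  on objects passes essential surjectivity along it. \<open>H'\<close> is only required to agree
  with the composite of \<open>H\<close> and \<open>P\<close> on the carriers, because functor
  records also have values elsewhere.\<close>

lemma equivalence_transfer:
  assumes A: "category A" and B: "category B" and B': "category B'"
    and H: "is_equivalence A B H" and P: "is_functor B B' P" and ff: "fully_faithful B B' P"
    and surj: "\<And>y. y \<in> Obj B' \<Longrightarrow> \<exists>x \<in> Obj B. onO P x = y"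
    and O: "\<And>x. x \<in> Obj A \<Longrightarrow> onO H' x = onO P (onO H x)"
    and R: "\<And>a. a \<in> Arr A \<Longrightarrow> onA H' a = onA P (onA H a)"
  shows "is_equivalence A B' H'"
proof (rule equivalenceI[OF A B'])
  interpret A: category_calc A using A by unfold_locales
  interpret B: category_calc B using B by unfold_locales
  interpret B': category_calc B' using B' by unfold_locales
  have H': "is_functor A B H" using H by (simp add: is_equivalence_def)
  note [simp] = functor_simps[OF H'] functor_simps[OF P] O R
  show "is_functor A B' H'"
    unfolding is_functor_def by auto
  show "fully_faithful A B' H'"
    unfolding fully_faithful_def
  proof (intro ballI)
    fix x y b assume x: "x \<in> Obj A" and y: "y \<in> Obj A" and b: "b \<in> hom_set B' (onO H' x) (onO H' y)"
    have "b \<in> hom_set B' (onO P (onO H x)) (onO P (onO H y))" using b x y by simp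
    then have "\<exists>!c. c \<in> hom_set B (onO H x) (onO H y) \<and> onA P c = b"
      using ff x y unfolding fully_faithful_def by (simp del: in_hom_set)
    then obtain c where c: "c \<in> hom_set B (onO H x) (onO H y)" "onA P c = b"
      and cu: "\<And>c'. c' \<in> hom_set B (onO H x) (onO H y) \<Longrightarrow> onA P c' = b \<Longrightarrow> c' = c" by blast
    have "\<exists>!a. a \<in> hom_set A x y \<and> onA H a = c"
      using equivalenceD(1)[OF A B H] x y c unfolding fully_faithful_def by blast
    moreover have "onA H a = c \<longleftrightarrow> onA H' a = b" if a: "a \<in> hom_set A x y" for a
    proof -
      have "onA H a \<in> hom_set B (onO H x) (onO H y)" "onA H' a = onA P (onA H a)" using a by auto
      then show ?thesis using c(2) cu by metis
    qed
    ultimately show "\<exists>!a. a \<in> hom_set A x y \<and> onA H' a = b" by metis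
  qed
  show "ess_surjective A B' H'"
    unfolding ess_surjective_def
  proof
    fix z assume "z \<in> Obj B'"
    then obtain y where y: "y \<in> Obj B" "onO P y = z" using surj by blast
    obtain x b where x: "x \<in> Obj A" and b: "b \<in> hom_set B (onO H x) y" "iso_arr B b"
      using equivalenceD(2)[OF A B H] y unfolding ess_surjective_def by blast
    then show "\<exists>x\<in>Obj A. \<exists>b\<in>hom_set B' (onO H' x) z. iso_arr B' b"
      using functor_iso[OF P B b(2)] y by (intro bexI[of _ x] bexI[of _ "onA P b"]) auto
  qed
qed

text \<open>Transport of structure along injections: each operation decodes with \<open>inv\<close>,
  computes, and encodes again. \<open>bicocomplete\<close> and \<open>has_oplax_bicolimits\<close>
  quantify only over indices and weights with carriers in \<open>'u\<close>.\<close>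

definition enc_two :: "('a \<Rightarrow> 'x) \<Rightarrow> ('b \<Rightarrow> 'y) \<Rightarrow> ('c \<Rightarrow> 'z) \<Rightarrow> ('a, 'b, 'c) two_cat \<Rightarrow> ('x, 'y, 'z) two_cat" where
  "enc_two e0 e1 e2 I = \<lparr>Cell0 = e0 ` Cell0 I, Cell1 = e1 ` Cell1 I, Cell2 = e2 ` Cell2 I,
     src = (\<lambda>f. e0 (src I (inv e1 f))), tgt = (\<lambda>f. e0 (tgt I (inv e1 f))),
     id1 = (\<lambda>x. e1 (id1 I (inv e0 x))), cmp1 = (\<lambda>g f. e1 (cmp1 I (inv e1 g) (inv e1 f))),
     dom2 = (\<lambda>s. e1 (dom2 I (inv e2 s))), cod2 = (\<lambda>s. e1 (cod2 I (inv e2 s))),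
     id2 = (\<lambda>f. e2 (id2 I (inv e1 f))), vcmp = (\<lambda>t s. e2 (vcmp I (inv e2 t) (inv e2 s))),
     hcmp = (\<lambda>t s. e2 (hcmp I (inv e2 t) (inv e2 s)))\<rparr>"

definition enc_cat :: "('a \<Rightarrow> 'x) \<Rightarrow> ('b \<Rightarrow> 'y) \<Rightarrow> ('a, 'b) cat \<Rightarrow> ('x, 'y) cat" where
  "enc_cat eo ea A = \<lparr>Obj = eo ` Obj A, Arr = ea ` Arr A, Dom = (\<lambda>a. eo (Dom A (inv ea a))),
     Cod = (\<lambda>a. eo (Cod A (inv ea a))), Idt = (\<lambda>x. ea (Idt A (inv eo x))),
     Cmp = (\<lambda>b a. ea (Cmp A (inv ea b) (inv ea a)))\<rparr>"

definition enc_fun :: "('a \<Rightarrow> 'x) \<Rightarrow> ('b \<Rightarrow> 'y) \<Rightarrow> ('c \<Rightarrow> 'z) \<Rightarrow> ('a, 'b, 'c, 'k0, 'k1, 'k2) two_fun \<Rightarrow>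
    ('x, 'y, 'z, 'k0, 'k1, 'k2) two_fun" where
  "enc_fun e0 e1 e2 F = \<lparr>F0 = (\<lambda>x. F0 F (inv e0 x)), F1 = (\<lambda>f. F1 F (inv e1 f)), F2 = (\<lambda>s. F2 F (inv e2 s))\<rparr>"

definition enc_weight :: "('a \<Rightarrow> 'x) \<Rightarrow> ('b \<Rightarrow> 'y) \<Rightarrow> ('c \<Rightarrow> 'z) \<Rightarrow> ('o \<Rightarrow> 'v) \<Rightarrow> ('r \<Rightarrow> 'w) \<Rightarrow>
    ('a, 'b, 'c, 'o, 'r) cat_fun \<Rightarrow> ('x, 'y, 'z, 'v, 'w) cat_fun" where
  "enc_weight e0 e1 e2 eo ea W = \<lparr>C0 = (\<lambda>x. enc_cat eo ea (C0 W (inv e0 x))),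
     C1 = (\<lambda>f. \<lparr>onO = (\<lambda>x. eo (onO (C1 W (inv e1 f)) (inv eo x))), onA = (\<lambda>a. ea (onA (C1 W (inv e1 f)) (inv ea a)))\<rparr>),
     C2 = (\<lambda>s x. ea (C2 W (inv e2 s) (inv eo x)))\<rparr>"

lemma enc_cat_simps [simp]:
  assumes "inj eo" "inj ea"
  shows "Obj (enc_cat eo ea A) = eo ` Obj A" "Arr (enc_cat eo ea A) = ea ` Arr A"
    "Dom (enc_cat eo ea A) (ea a) = eo (Dom A a)" "Cod (enc_cat eo ea A) (ea a) = eo (Cod A a)"
    "Idt (enc_cat eo ea A) (eo x) = ea (Idt A x)" "Cmp (enc_cat eo ea A) (ea b) (ea a) = ea (Cmp A b a)"
  using assms by (simp_all add: enc_cat_def)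

lemma enc_two_simps [simp]:
  assumes "inj e0" "inj e1" "inj e2"
  shows "Cell0 (enc_two e0 e1 e2 I) = e0 ` Cell0 I" "Cell1 (enc_two e0 e1 e2 I) = e1 ` Cell1 I"
    "Cell2 (enc_two e0 e1 e2 I) = e2 ` Cell2 I"
    "src (enc_two e0 e1 e2 I) (e1 f) = e0 (src I f)" "tgt (enc_two e0 e1 e2 I) (e1 f) = e0 (tgt I f)"
    "id1 (enc_two e0 e1 e2 I) (e0 x) = e1 (id1 I x)"
    "cmp1 (enc_two e0 e1 e2 I) (e1 g) (e1 f) = e1 (cmp1 I g f)"
    "dom2 (enc_two e0 e1 e2 I) (e2 s) = e1 (dom2 I s)" "cod2 (enc_two e0 e1 e2 I) (e2 s) = e1 (cod2 I s)"
    "id2 (enc_two e0 e1 e2 I) (e1 f) = e2 (id2 I f)"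
    "vcmp (enc_two e0 e1 e2 I) (e2 t) (e2 s) = e2 (vcmp I t s)"
    "hcmp (enc_two e0 e1 e2 I) (e2 t) (e2 s) = e2 (hcmp I t s)"
  using assms by (simp_all add: enc_two_def)

lemma enc_fun_simps [simp]:
  assumes "inj e0" "inj e1" "inj e2"
  shows "F0 (enc_fun e0 e1 e2 F) (e0 x) = F0 F x" "F1 (enc_fun e0 e1 e2 F) (e1 f) = F1 F f"
    "F2 (enc_fun e0 e1 e2 F) (e2 s) = F2 F s"
  using assms by (simp_all add: enc_fun_def)

lemma enc_weight_simps [simp]:
  assumes "inj e0" "inj e1" "inj e2" "inj eo" "inj ea"
  shows "C0 (enc_weight e0 e1 e2 eo ea W) (e0 x) = enc_cat eo ea (C0 W x)"
    "onO (C1 (enc_weight e0 e1 e2 eo ea W) (e1 f)) (eo v) = eo (onO (C1 W f) v)"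
    "onA (C1 (enc_weight e0 e1 e2 eo ea W) (e1 f)) (ea a) = ea (onA (C1 W f) a)"
    "C2 (enc_weight e0 e1 e2 eo ea W) (e2 s) (eo v) = ea (C2 W s v)"
  using assms by (simp_all add: enc_weight_def)

lemma category_enc_cat:
  assumes "inj eo" "inj ea" "category A"
  shows "category (enc_cat eo ea A)"
  using assms(3) unfolding category_def
  by (simp add: assms(1,2) inj_eq inj_image_mem_iff)

lemma enc_parts:
  assumes "inj e0" "inj e1" "inj e2" "two_category I"
  shows "category (cat1 (enc_two e0 e1 e2 I))" "category (vcat (enc_two e0 e1 e2 I))"
    "category (hcat (enc_two e0 e1 e2 I))"
  using assms(4) unfolding two_category_def category_def
  by (simp_all add: assms(1-3) inj_eq inj_image_mem_iff)

lemma two_category_enc_two: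
  assumes "inj e0" "inj e1" "inj e2" "two_category I"
  shows "two_category (enc_two e0 e1 e2 I)"
  unfolding two_category_def using enc_parts[OF assms] assms(4)
  by (simp add: assms(1-3) inj_eq inj_image_mem_iff two_category_def)

lemma two_functor_enc_fun:
  assumes "inj e0" "inj e1" "inj e2" "two_functor I C F"
  shows "two_functor (enc_two e0 e1 e2 I) C (enc_fun e0 e1 e2 F)"
  using assms(4) unfolding two_functor_def is_functor_def
  by (simp add: assms(1-3) inj_eq inj_image_mem_iff) metis

definition enc_fctr :: "('o \<Rightarrow> 'v) \<Rightarrow> ('r \<Rightarrow> 'w) \<Rightarrow> ('o, 'r, 'o, 'r) fctr \<Rightarrow> ('v, 'w, 'v, 'w) fctr" where
  "enc_fctr eo ea F = \<lparr>onO = (\<lambda>x. eo (onO F (inv eo x))), onA = (\<lambda>a. ea (onA F (inv ea a)))\<rparr>"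

lemma enc_fctr_simps [simp]:
  "inj eo \<Longrightarrow> onO (enc_fctr eo ea F) (eo x) = eo (onO F x)"
  "inj ea \<Longrightarrow> onA (enc_fctr eo ea F) (ea a) = ea (onA F a)"
  by (simp_all add: enc_fctr_def)

lemma enc_weight_fctr: "inj e1 \<Longrightarrow> C1 (enc_weight e0 e1 e2 eo ea W) (e1 d) = enc_fctr eo ea (C1 W d)"
  by (simp add: enc_weight_def enc_fctr_def)

lemma functor_enc_fctr:
  assumes "inj eo" "inj ea" "is_functor A B F"
  shows "is_functor (enc_cat eo ea A) (enc_cat eo ea B) (enc_fctr eo ea F)"
  using assms(3) unfolding is_functor_def by (simp add: assms(1,2) inj_eq inj_image_mem_iff)

lemma nat_trans_enc:
  assumes "inj eo" "inj ea" "nat_trans A B F G t" "\<And>x. x \<in> Obj A \<Longrightarrow> t' (eo x) = ea (t x)"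
    "category A"
  shows "nat_trans (enc_cat eo ea A) (enc_cat eo ea B) (enc_fctr eo ea F) (enc_fctr eo ea G) t'"
proof -
  have "\<forall>f \<in> Arr A. Dom A f \<in> Obj A \<and> Cod A f \<in> Obj A" using assms(5) by (simp add: category_def)
  then show ?thesis
    using assms(3) unfolding nat_trans_def by (simp add: assms(1,2,4) inj_eq inj_image_mem_iff)
qed

lemma cat_functor_enc_weight:
  assumes inj: "inj e0" "inj e1" "inj e2" "inj eo" "inj ea" and W: "cat_functor (op2 I) W"
    and I: "two_category I"
  shows "cat_functor (op2 (enc_two e0 e1 e2 I)) (enc_weight e0 e1 e2 eo ea W)"
proof -
  interpret I: strict_two_category I using I by unfold_locales
  have Wc: "\<forall>i\<in>Cell0 I. category (C0 W i)"
    and Wf: "\<forall>d\<in>Cell1 I. is_functor (C0 W (tgt I d)) (C0 W (src I d)) (C1 W d)"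
    and Wn: "\<forall>s \<in> Cell2 I. nat_trans (C0 W (tgt I (dom2 I s))) (C0 W (src I (dom2 I s)))
        (C1 W (dom2 I s)) (C1 W (cod2 I s)) (C2 W s)"
    and Wi: "\<forall>i \<in> Cell0 I. eq_on_cat (C0 W i) (C1 W (id1 I i)) id_fctr"
    and Wm: "\<forall>d \<in> Cell1 I. \<forall>e \<in> Cell1 I. src I d = tgt I e \<longrightarrow>
        eq_on_cat (C0 W (tgt I d)) (C1 W (cmp1 I d e)) (comp_fctr (C1 W e) (C1 W d))"
    and Wi2: "\<forall>d \<in> Cell1 I. \<forall>x \<in> Obj (C0 W (tgt I d)).
        C2 W (id2 I d) x = Idt (C0 W (src I d)) (onO (C1 W d) x)"
    and Wv: "\<forall>s \<in> Cell2 I. \<forall>t \<in> Cell2 I. cod2 I s = dom2 I t \<longrightarrow>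
       (\<forall>x \<in> Obj (C0 W (tgt I (dom2 I s))).
           C2 W (vcmp I t s) x = Cmp (C0 W (src I (dom2 I s))) (C2 W t x) (C2 W s x))"
    and Wh: "\<forall>s \<in> Cell2 I. \<forall>t \<in> Cell2 I. src I (dom2 I s) = tgt I (dom2 I t) \<longrightarrow>
       (\<forall>x \<in> Obj (C0 W (tgt I (dom2 I s))).
           C2 W (hcmp I s t) x =
             Cmp (C0 W (src I (dom2 I t)))
               (C2 W t (onO (C1 W (cod2 I s)) x)) (onA (C1 W (dom2 I t)) (C2 W s x)))"
    using W by (simp_all add: cat_functor_def)
  note [simp] = inj inj_eq[OF inj(1)]  inj_eq[OF inj(2)]
  show ?thesis
    unfolding cat_functor_def
  proof (intro conjI)
    show "\<forall>i\<in>Cell0 (op2 (enc_two e0 e1 e2 I)). category (C0 (enc_weight e0 e1 e2 eo ea W) i)"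
      using Wc by (simp add: category_enc_cat)
  next
    show "\<forall>d\<in>Cell1 (op2 (enc_two e0 e1 e2 I)).
       is_functor (C0 (enc_weight e0 e1 e2 eo ea W) (src (op2 (enc_two e0 e1 e2 I)) d))
        (C0 (enc_weight e0 e1 e2 eo ea W) (tgt (op2 (enc_two e0 e1 e2 I)) d)) (C1 (enc_weight e0 e1 e2 eo ea W) d)"
      using Wf by (simp add: functor_enc_fctr enc_weight_fctr)
  next
    show "\<forall>s\<in>Cell2 (op2 (enc_two e0 e1 e2 I)).
       nat_trans (C0 (enc_weight e0 e1 e2 eo ea W) (src (op2 (enc_two e0 e1 e2 I)) (dom2 (op2 (enc_two e0 e1 e2 I)) s)))
        (C0 (enc_weight e0 e1 e2 eo ea W) (tgt (op2 (enc_two e0 e1 e2 I)) (dom2 (op2 (enc_two e0 e1 e2 I)) s)))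
        (C1 (enc_weight e0 e1 e2 eo ea W) (dom2 (op2 (enc_two e0 e1 e2 I)) s))
        (C1 (enc_weight e0 e1 e2 eo ea W) (cod2 (op2 (enc_two e0 e1 e2 I)) s))
        (C2 (enc_weight e0 e1 e2 eo ea W) s)"
      using Wn Wc by (auto simp: enc_weight_fctr intro!: nat_trans_enc)
  next
    show "\<forall>i\<in>Cell0 (op2 (enc_two e0 e1 e2 I)).
       eq_on_cat (C0 (enc_weight e0 e1 e2 eo ea W) i)
        (C1 (enc_weight e0 e1 e2 eo ea W) (id1 (op2 (enc_two e0 e1 e2 I)) i)) id_fctr"
      using Wi by (simp add: eq_on_cat_def)
  next
    show "\<forall>d\<in>Cell1 (op2 (enc_two e0 e1 e2 I)). \<forall>e\<in>Cell1 (op2 (enc_two e0 e1 e2 I)).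
          tgt (op2 (enc_two e0 e1 e2 I)) d = src (op2 (enc_two e0 e1 e2 I)) e \<longrightarrow>
          eq_on_cat (C0 (enc_weight e0 e1 e2 eo ea W) (src (op2 (enc_two e0 e1 e2 I)) d))
           (C1 (enc_weight e0 e1 e2 eo ea W) (cmp1 (op2 (enc_two e0 e1 e2 I)) e d))
           (comp_fctr (C1 (enc_weight e0 e1 e2 eo ea W) e) (C1 (enc_weight e0 e1 e2 eo ea W) d))"
      using Wm by (simp add: eq_on_cat_def)
  next
    show "\<forall>d\<in>Cell1 (op2 (enc_two e0 e1 e2 I)).
       \<forall>x\<in>Obj (C0 (enc_weight e0 e1 e2 eo ea W) (src (op2 (enc_two e0 e1 e2 I)) d)).
          C2 (enc_weight e0 e1 e2 eo ea W) (id2 (op2 (enc_two e0 e1 e2 I)) d) x =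
          Idt (C0 (enc_weight e0 e1 e2 eo ea W) (tgt (op2 (enc_two e0 e1 e2 I)) d))
           (onO (C1 (enc_weight e0 e1 e2 eo ea W) d) x)"
      using Wi2 by simp
  next
    show "\<forall>s\<in>Cell2 (op2 (enc_two e0 e1 e2 I)). \<forall>t\<in>Cell2 (op2 (enc_two e0 e1 e2 I)).
          cod2 (op2 (enc_two e0 e1 e2 I)) s = dom2 (op2 (enc_two e0 e1 e2 I)) t \<longrightarrow>
          (\<forall>x\<in>Obj (C0 (enc_weight e0 e1 e2 eo ea W)
                       (src (op2 (enc_two e0 e1 e2 I)) (dom2 (op2 (enc_two e0 e1 e2 I)) s))).
              C2 (enc_weight e0 e1 e2 eo ea W) (vcmp (op2 (enc_two e0 e1 e2 I)) t s) x =
              Cmp (C0 (enc_weight e0 e1 e2 eo ea W)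
                    (tgt (op2 (enc_two e0 e1 e2 I)) (dom2 (op2 (enc_two e0 e1 e2 I)) s)))
               (C2 (enc_weight e0 e1 e2 eo ea W) t x) (C2 (enc_weight e0 e1 e2 eo ea W) s x))"
      using Wv by simp
  next
    show "\<forall>s\<in>Cell2 (op2 (enc_two e0 e1 e2 I)). \<forall>t\<in>Cell2 (op2 (enc_two e0 e1 e2 I)).
          tgt (op2 (enc_two e0 e1 e2 I)) (dom2 (op2 (enc_two e0 e1 e2 I)) s) =
          src (op2 (enc_two e0 e1 e2 I)) (dom2 (op2 (enc_two e0 e1 e2 I)) t) \<longrightarrow>
          (\<forall>x\<in>Obj (C0 (enc_weight e0 e1 e2 eo ea W)
                       (src (op2 (enc_two e0 e1 e2 I)) (dom2 (op2 (enc_two e0 e1 e2 I)) s))).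
              C2 (enc_weight e0 e1 e2 eo ea W) (hcmp (op2 (enc_two e0 e1 e2 I)) t s) x =
              Cmp (C0 (enc_weight e0 e1 e2 eo ea W)
                    (tgt (op2 (enc_two e0 e1 e2 I)) (dom2 (op2 (enc_two e0 e1 e2 I)) t)))
               (C2 (enc_weight e0 e1 e2 eo ea W) t
                 (onO (C1 (enc_weight e0 e1 e2 eo ea W) (cod2 (op2 (enc_two e0 e1 e2 I)) s)) x))
               (onA (C1 (enc_weight e0 e1 e2 eo ea W) (dom2 (op2 (enc_two e0 e1 e2 I)) t))
                 (C2 (enc_weight e0 e1 e2 eo ea W) s x)))"
      using Wh by simp
  qed
qed

section \<open>From bicocompleteness to oplax bicolimits and bicoequalizers\<close>

section \<open>Inserters and equifiers as weighted bicolimits\<close>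

text \<open>
  The shape has, for each edge \<open>k\<close>, two 1-cells \<open>FA k : KO k \<rightarrow> PO (tp k)\<close> and
  \<open>GA k : KO k \<rightarrow> PO (sp k)\<close>, and possibly 2-cells \<open>SG k b : FA k \<Rightarrow> GA k\<close>. The weight is the point
  on \<open>PO p\<close> and the category \<open>False \<rightarrow> True\<close> on \<open>KO k\<close>, so a weighted cocone amounts to
  \<open>q\<^sub>p\<close> and \<open>r\<^sub>k : q\<^bsub>tp k\<^esub> (fl k) \<Rightarrow> q\<^bsub>sp k\<^esub> (gl k)\<close>; a 2-cell \<open>SG k b\<close> forces \<open>r\<^sub>k = q\<^bsub>tp k\<^esub> (sg k b)\<close>.
\<close>

datatype ('p, 'j) bob = PO 'p | KO 'j
datatype ('p, 'j) bar = Bid "('p, 'j) bob" | FA 'j | GA 'j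
datatype ('p, 'j) btw = Bid2 "('p, 'j) bar" | SG 'j bool

primrec bsrc :: "('p, 'j) bar \<Rightarrow> ('p, 'j) bob" where
  "bsrc (Bid x) = x" | "bsrc (FA k) = KO k" | "bsrc (GA k) = KO k"

primrec btgt :: "('p, 'j, 'k0, 'k1) ins \<Rightarrow> ('p, 'j) bar \<Rightarrow> ('p, 'j) bob" where
  "btgt D (Bid x) = x" | "btgt D (FA k) = PO (tp D k)" | "btgt D (GA k) = PO (sp D k)"

text \<open>Every non-identity 1-cell goes from some \<open>KO k\<close> to some
  \<open>PO p\<close>, so of two composable 1-cells one is an identity and the outer factor decides
  the composite. \<open>bvcmp\<close> and \<open>bhcmp\<close> use the same observation for
  2-cells.\<close>

primrec bcmp :: "('p, 'j) bar \<Rightarrow> ('p, 'j) bar \<Rightarrow> ('p, 'j) bar" where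
  "bcmp (Bid x) f = f" | "bcmp (FA k) f = FA k" | "bcmp (GA k) f = GA k"

primrec bdom :: "('p, 'j) btw \<Rightarrow> ('p, 'j) bar" where
  "bdom (Bid2 f) = f" | "bdom (SG k b) = FA k"

primrec bcod :: "('p, 'j) btw \<Rightarrow> ('p, 'j) bar" where
  "bcod (Bid2 f) = f" | "bcod (SG k b) = GA k"

primrec bvcmp :: "('p, 'j) btw \<Rightarrow> ('p, 'j) btw \<Rightarrow> ('p, 'j) btw" where
  "bvcmp (Bid2 f) s = s" | "bvcmp (SG k b) s = SG k b"

fun bhcmp :: "('p, 'j) btw \<Rightarrow> ('p, 'j) btw \<Rightarrow> ('p, 'j) btw" where
  "bhcmp (Bid2 (Bid x)) s = s" | "bhcmp t s = t"

text \<open>\<open>\<Sigma>\<close> selects which of the two possible 2-cells exist on every edge: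
  the empty set gives a plain inserter, \<open>UNIV\<close> gives two parallel 2-cells and thereby
  an equifier.\<close>

definition bshape :: "('p, 'j, 'k0, 'k1) ins \<Rightarrow> bool set \<Rightarrow>
    (('p, 'j) bob, ('p, 'j) bar, ('p, 'j) btw) two_cat" where
  "bshape D \<Sigma> = \<lparr>Cell0 = PO ` Pt D \<union> KO ` Ed D,
     Cell1 = Bid ` (PO ` Pt D \<union> KO ` Ed D) \<union> FA ` Ed D \<union> GA ` Ed D,
     Cell2 = Bid2 ` (Bid ` (PO ` Pt D \<union> KO ` Ed D) \<union> FA ` Ed D \<union> GA ` Ed D) \<union> (\<lambda>(k, b). SG k b) ` (Ed D \<times> \<Sigma>),
     src = bsrc, tgt = btgt D, id1 = Bid, cmp1 = bcmp, dom2 = bdom, cod2 = bcod, id2 = Bid2,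
     vcmp = bvcmp, hcmp = bhcmp\<rparr>"

definition bdiag :: "('k0, 'k1, 'k2) two_cat \<Rightarrow> ('p, 'j, 'k0, 'k1) ins \<Rightarrow> ('j \<Rightarrow> bool \<Rightarrow> 'k2) \<Rightarrow>
    (('p, 'j) bob, ('p, 'j) bar, ('p, 'j) btw, 'k0, 'k1, 'k2) two_fun" where
  "bdiag C D sg =
    (let f0 = case_bob (ob D) (\<lambda>k. src C (fl D k)); f1 = case_bar (\<lambda>x. id1 C (f0 x)) (fl D) (gl D)
     in \<lparr>F0 = f0, F1 = f1, F2 = case_btw (\<lambda>f. id2 C (f1 f)) sg\<rparr>)"

text \<open>Arrows are coded as pairs of domain and codomain. By contravariance \<open>FA k\<close>
  becomes the functor from the point that chooses \<open>False\<close> and \<open>GA k\<close> the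
  one that chooses \<open>True\<close>. A 2-cell \<open>SG k b\<close> becomes the arrow from
  \<open>False\<close> to \<open>True\<close>, which is how it ties the edge cell to the
  diagram.\<close>

definition bweight :: "(('p, 'j) bob, ('p, 'j) bar, ('p, 'j) btw, bool, bool \<times> bool) cat_fun" where
  "bweight =
    (let w1 = case_bar (\<lambda>x. id_fctr) (\<lambda>k. \<lparr>onO = (\<lambda>x. False), onA = (\<lambda>a. (False, False))\<rparr>)
        (\<lambda>k. \<lparr>onO = (\<lambda>x. True), onA = (\<lambda>a. (True, True))\<rparr>)
     in \<lparr>C0 = (\<lambda>x. \<lparr>Obj = case_bob (\<lambda>p. {False}) (\<lambda>k. UNIV) x,
          Arr = case_bob (\<lambda>p. {(False, False)}) (\<lambda>k. {(False, False), (False, True), (True, True)}) x,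
          Dom = fst, Cod = snd, Idt = (\<lambda>v. (v, v)), Cmp = (\<lambda>b a. (fst a, snd b))\<rparr>),
        C1 = w1,
        C2 = case_btw (\<lambda>f v. (onO (w1 f) v, onO (w1 f) v)) (\<lambda>k b v. (False, True))\<rparr>)"

lemma bshape_simps [simp]:
  "Cell0 (bshape D \<Sigma>) = PO ` Pt D \<union> KO ` Ed D"
  "Cell1 (bshape D \<Sigma>) = Bid ` (PO ` Pt D \<union> KO ` Ed D) \<union> FA ` Ed D \<union> GA ` Ed D"
  "Cell2 (bshape D \<Sigma>) = Bid2 ` (Bid ` (PO ` Pt D \<union> KO ` Ed D) \<union> FA ` Ed D \<union> GA ` Ed D) \<union> (\<lambda>(k, b). SG k b) ` (Ed D \<times> \<Sigma>)"
  "src (bshape D \<Sigma>) = bsrc" "tgt (bshape D \<Sigma>) = btgt D" "id1 (bshape D \<Sigma>) = Bid"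
  "cmp1 (bshape D \<Sigma>) = bcmp" "dom2 (bshape D \<Sigma>) = bdom" "cod2 (bshape D \<Sigma>) = bcod"
  "id2 (bshape D \<Sigma>) = Bid2" "vcmp (bshape D \<Sigma>) = bvcmp" "hcmp (bshape D \<Sigma>) = bhcmp"
  by (simp_all add: bshape_def)

lemma bdiag_simps [simp]:
  "F0 (bdiag C D sg) (PO p) = ob D p" "F0 (bdiag C D sg) (KO k) = src C (fl D k)"
  "F1 (bdiag C D sg) (Bid x) = id1 C (F0 (bdiag C D sg) x)"
  "F1 (bdiag C D sg) (FA k) = fl D k" "F1 (bdiag C D sg) (GA k) = gl D k"
  "F2 (bdiag C D sg) (Bid2 f) = id2 C (F1 (bdiag C D sg) f)" "F2 (bdiag C D sg) (SG k b) = sg k b"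
  by (simp_all add: bdiag_def Let_def)

lemma bweight_simps [simp]:
  "Obj (C0 bweight (PO p)) = {False}" "Obj (C0 bweight (KO k)) = UNIV"
  "Arr (C0 bweight (PO p)) = {(False, False)}"
  "Arr (C0 bweight (KO k)) = {(False, False), (False, True), (True, True)}"
  "Dom (C0 bweight x) = fst" "Cod (C0 bweight x) = snd" "Idt (C0 bweight x) v = (v, v)"
  "Cmp (C0 bweight x) b a = (fst a, snd b)"
  "C1 bweight (Bid x) = id_fctr" "onO (C1 bweight (FA k)) v = False" "onO (C1 bweight (GA k)) v = True"
  "onA (C1 bweight (FA k)) a = (False, False)" "onA (C1 bweight (GA k)) a = (True, True)"
  "C2 bweight (Bid2 f) v = (onO (C1 bweight f) v, onO (C1 bweight f) v)"
  "C2 bweight (SG k c) v = (False, True)"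
  by (simp_all add: bweight_def Let_def)

text \<open>A 2-cell from \<open>FA k\<close> to \<open>GA k\<close> makes sense only if both have
  the same target, hence the second assumption.\<close>

lemma two_category_bshape:
  assumes "\<And>k. k \<in> Ed D \<Longrightarrow> tp D k \<in> Pt D \<and> sp D k \<in> Pt D"
    and "\<And>k b. k \<in> Ed D \<Longrightarrow> b \<in> \<Sigma> \<Longrightarrow> tp D k = sp D k"
  shows "two_category (bshape D \<Sigma>)"
  unfolding two_category_def category_def using assms
  by (auto simp: ball_Un)

lemma cat_functor_bweight:
  assumes "\<And>k. k \<in> Ed D \<Longrightarrow> tp D k \<in> Pt D \<and> sp D k \<in> Pt D"
    and "\<And>k b. k \<in> Ed D \<Longrightarrow> b \<in> \<Sigma> \<Longrightarrow> tp D k = sp D k"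
  shows "cat_functor (op2 (bshape D \<Sigma>)) bweight"
  unfolding cat_functor_def category_def is_functor_def nat_trans_def eq_on_cat_def using assms
  by (auto simp: ball_Un)

text \<open>The encodings of shape and weight are parameters, so that the calculus of weighted
  cocones can be interpreted directly on data over \<open>'u\<close>.\<close>

locale bipartite = strict_two_category C
  for C :: "('k0, 'k1, 'k2) two_cat" +
  fixes D :: "('p, 'j, 'k0, 'k1) ins" and \<Sigma> :: "bool set" and sg :: "'j \<Rightarrow> bool \<Rightarrow> 'k2"
    and e0 :: "('p, 'j) bob \<Rightarrow> 'u" and e1 :: "('p, 'j) bar \<Rightarrow> 'u" and e2 :: "('p, 'j) btw \<Rightarrow> 'u"
    and eo :: "bool \<Rightarrow> 'u" and ea :: "bool \<times> bool \<Rightarrow> 'u"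
  assumes inj [simp]: "inj e0" "inj e1" "inj e2" "inj eo" "inj ea"
    and wf: "wf_ins D"
    and sg: "\<And>k b. k \<in> Ed D \<Longrightarrow> b \<in> \<Sigma> \<Longrightarrow> tp D k = sp D k \<and> sg k b \<in> hom2 C (fl D k) (gl D k)"
begin

lemmas D_simps [simp] = wf_ins_simps[OF wf]

lemma sg_simps [simp]:
  assumes "k \<in> Ed D" "b \<in> \<Sigma>"
  shows "sg k b \<in> Cell2 C" "dom2 C (sg k b) = fl D k" "cod2 C (sg k b) = gl D k"
  using sg[OF assms] by auto

lemmas inj_eqs [simp] = inj(1)[THEN inj_eq] inj(2)[THEN inj_eq] inj(3)[THEN inj_eq]
  inj(4)[THEN inj_eq] inj(5)[THEN inj_eq]

abbreviation J where "J \<equiv> enc_two e0 e1 e2 (bshape D \<Sigma>)"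
abbreviation G where "G \<equiv> enc_fun e0 e1 e2 (bdiag C D sg)"
abbreviation V where "V \<equiv> enc_weight e0 e1 e2 eo ea (bweight :: (('p, 'j) bob, ('p, 'j) bar, ('p, 'j) btw, bool, bool \<times> bool) cat_fun)"

lemma two_functor_bdiag: "two_functor (bshape D \<Sigma>) C (bdiag C D sg)"
  unfolding two_functor_def is_functor_def
  by (auto simp: ball_Un hcmp_id split: if_splits)

sublocale weighted C J G V
proof unfold_locales
  have b: "two_category (bshape D \<Sigma>)"
    by (rule two_category_bshape) (use sg in auto)
  then show "two_category J" by (simp add: two_category_enc_two)
  show "two_functor J C G" by (rule two_functor_enc_fun[OF inj(1-3) two_functor_bdiag])
  show "cat_functor (op2 J) V"
    by (rule cat_functor_enc_weight[OF inj cat_functor_bweight b]) (use sg in auto)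
qed

definition sg_pred :: "('p, 'j, 'k1, 'k2) fam \<Rightarrow> bool" where
  "sg_pred Q \<longleftrightarrow> (\<forall>k \<in> Ed D. \<forall>b \<in> \<Sigma>. snd Q k = fst Q (tp D k) \<rhd> sg k b)"

text \<open>A weighted cocone also prescribes 1-cells at \<open>KO k\<close>, isomorphic by its
  structure cells to the legs composed with \<open>fl D k\<close> and \<open>gl D k\<close>.
  Composing the image of the arrow from \<open>False\<close> to \<open>True\<close> with these
  isomorphisms eliminates the redundant values.\<close>

abbreviation "to_fam \<alpha> \<equiv>
  (\<lambda>p \<in> Pt D. onO (cmpt \<alpha> (e0 (PO p))) (eo False),
   \<lambda>k \<in> Ed D. vinv (strc \<alpha> (e1 (GA k)) (eo False)) \<bullet>
      (onA (cmpt \<alpha> (e0 (KO k))) (ea (False, True)) \<bullet> strc \<alpha> (e1 (FA k)) (eo False)))"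

definition to_ins where
  "to_ins = \<lparr>onO = (\<lambda>\<alpha>. to_fam \<alpha>),
     onA = (\<lambda>a. (to_fam (fst a), to_fam (fst (snd a)), \<lambda>p \<in> Pt D. snd (snd a) (e0 (PO p)) (eo False)))\<rparr>"

lemma cone_simps:
  assumes "wcone B \<alpha>"
  shows
    "p \<in> Pt D \<Longrightarrow> onO (cmpt \<alpha> (e0 (PO p))) (eo False) \<in> Cell1 C"
    "p \<in> Pt D \<Longrightarrow> src C (onO (cmpt \<alpha> (e0 (PO p))) (eo False)) = ob D p"
    "p \<in> Pt D \<Longrightarrow> tgt C (onO (cmpt \<alpha> (e0 (PO p))) (eo False)) = B"
    "k \<in> Ed D \<Longrightarrow> onO (cmpt \<alpha> (e0 (KO k))) (eo v) \<in> Cell1 C"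
    "k \<in> Ed D \<Longrightarrow> src C (onO (cmpt \<alpha> (e0 (KO k))) (eo v)) = src C (fl D k)"
    "k \<in> Ed D \<Longrightarrow> tgt C (onO (cmpt \<alpha> (e0 (KO k))) (eo v)) = B"
    "k \<in> Ed D \<Longrightarrow> onA (cmpt \<alpha> (e0 (KO k))) (ea (False, True)) \<in> Cell2 C"
    "k \<in> Ed D \<Longrightarrow> dom2 C (onA (cmpt \<alpha> (e0 (KO k))) (ea (False, True))) = onO (cmpt \<alpha> (e0 (KO k))) (eo False)"
    "k \<in> Ed D \<Longrightarrow> cod2 C (onA (cmpt \<alpha> (e0 (KO k))) (ea (False, True))) = onO (cmpt \<alpha> (e0 (KO k))) (eo True)"
    "k \<in> Ed D \<Longrightarrow> inv2 (strc \<alpha> (e1 (FA k)) (eo False))"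
    "k \<in> Ed D \<Longrightarrow> dom2 C (strc \<alpha> (e1 (FA k)) (eo False)) = onO (cmpt \<alpha> (e0 (PO (tp D k)))) (eo False) \<cdot> fl D k"
    "k \<in> Ed D \<Longrightarrow> cod2 C (strc \<alpha> (e1 (FA k)) (eo False)) = onO (cmpt \<alpha> (e0 (KO k))) (eo False)"
    "k \<in> Ed D \<Longrightarrow> inv2 (strc \<alpha> (e1 (GA k)) (eo False))"
    "k \<in> Ed D \<Longrightarrow> dom2 C (strc \<alpha> (e1 (GA k)) (eo False)) = onO (cmpt \<alpha> (e0 (PO (sp D k)))) (eo False) \<cdot> gl D k"
    "k \<in> Ed D \<Longrightarrow> cod2 C (strc \<alpha> (e1 (GA k)) (eo False)) = onO (cmpt \<alpha> (e0 (KO k))) (eo True)"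
    "p \<in> Pt D \<Longrightarrow> onA (cmpt \<alpha> (e0 (PO p))) (ea (False, False)) = id2 C (onO (cmpt \<alpha> (e0 (PO p))) (eo False))"
    "k \<in> Ed D \<Longrightarrow> onA (cmpt \<alpha> (e0 (KO k))) (ea (v, v)) = id2 C (onO (cmpt \<alpha> (e0 (KO k))) (eo v))"
    "p \<in> Pt D \<Longrightarrow> strc \<alpha> (e1 (Bid (PO p))) (eo False) = id2 C (onO (cmpt \<alpha> (e0 (PO p))) (eo False))"
    "k \<in> Ed D \<Longrightarrow> strc \<alpha> (e1 (Bid (KO k))) (eo v) = id2 C (onO (cmpt \<alpha> (e0 (KO k))) (eo v))"
  using wcone_simps(1-3)[OF assms, of "e0 (PO p)" "eo False"]
    wcone_simps(11)[OF assms, of "e0 (PO p)" "eo False"] wcone_simps(11)[OF assms, of "e0 (KO k)" "eo v"]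
    wcone_simps(1-3)[OF assms, of "e0 (KO k)" "eo v"]
    wcone_simps(4-6)[OF assms, of "e0 (KO k)" "ea (False, True)"]
    wcone_simps(8-10)[OF assms, of "e1 (FA k)" "eo False"]
    wcone_simps(8-10)[OF assms, of "e1 (GA k)" "eo False"]
    wcone_simps(7)[OF assms, of "e0 (PO p)" "eo False"] wcone_simps(7)[OF assms, of "e0 (KO k)" "eo v"]
  by simp_all

lemma mod_simps:
  assumes "wmod \<alpha> \<beta> m"
  shows
    "p \<in> Pt D \<Longrightarrow> m (e0 (PO p)) (eo False) \<in> Cell2 C"
    "p \<in> Pt D \<Longrightarrow> dom2 C (m (e0 (PO p)) (eo False)) = onO (cmpt \<alpha> (e0 (PO p))) (eo False)"
    "p \<in> Pt D \<Longrightarrow> cod2 C (m (e0 (PO p)) (eo False)) = onO (cmpt \<beta> (e0 (PO p))) (eo False)"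
    "k \<in> Ed D \<Longrightarrow> m (e0 (KO k)) (eo v) \<in> Cell2 C"
    "k \<in> Ed D \<Longrightarrow> dom2 C (m (e0 (KO k)) (eo v)) = onO (cmpt \<alpha> (e0 (KO k))) (eo v)"
    "k \<in> Ed D \<Longrightarrow> cod2 C (m (e0 (KO k)) (eo v)) = onO (cmpt \<beta> (e0 (KO k))) (eo v)"
    "k \<in> Ed D \<Longrightarrow> m (e0 (KO k)) (eo True) \<bullet> onA (cmpt \<alpha> (e0 (KO k))) (ea (False, True)) =
       onA (cmpt \<beta> (e0 (KO k))) (ea (False, True)) \<bullet> m (e0 (KO k)) (eo False)"
    "k \<in> Ed D \<Longrightarrow> strc \<beta> (e1 (FA k)) (eo False) \<bullet> (m (e0 (PO (tp D k))) (eo False) \<lhd> fl D k) =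
       m (e0 (KO k)) (eo False) \<bullet> strc \<alpha> (e1 (FA k)) (eo False)"
    "k \<in> Ed D \<Longrightarrow> strc \<beta> (e1 (GA k)) (eo False) \<bullet> (m (e0 (PO (sp D k))) (eo False) \<lhd> gl D k) =
       m (e0 (KO k)) (eo True) \<bullet> strc \<alpha> (e1 (GA k)) (eo False)"
  using wmod_simps[OF assms, of "e0 (PO p)" "eo False"] wmod_simps[OF assms, of "e0 (KO k)" "eo v"]
    wmod_eqs(1)[OF assms, of "e0 (KO k)" "ea (False, True)"]
    wmod_eqs(2)[OF assms, of "e1 (FA k)" "eo False"] wmod_eqs(2)[OF assms, of "e1 (GA k)" "eo False"]
  by simp_all

lemma to_fam_cocone:
  assumes "wcone B \<alpha>"
  shows "ins_cocone D B (to_fam \<alpha>)"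
  by (rule ins_coconeI) (simp_all add: cone_simps[OF assms])

text \<open>The 2-cell axiom of pseudonaturality at \<open>SG k b\<close> equates the image of the
  arrow from \<open>False\<close> to \<open>True\<close> after the cell at \<open>FA k\<close> with
  the cell at \<open>GA k\<close> after the whiskered \<open>sg k b\<close>. Cancelling the
  invertible cell at \<open>GA k\<close> leaves the claim.\<close>

lemma to_fam_pred:
  assumes \<alpha>: "wcone B \<alpha>"
  shows "sg_pred (to_fam \<alpha>)"
  unfolding sg_pred_def
proof (intro ballI)
  fix k b assume k: "k \<in> Ed D" and b: "b \<in> \<Sigma>"
  note [simp] = cone_simps[OF \<alpha>]
  have "tp D k = sp D k" using sg[OF k b] by simp
  have "onA (cmpt \<alpha> (e0 (KO k))) (ea (False, True)) \<bullet> strc \<alpha> (e1 (FA k)) (eo False) =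
    strc \<alpha> (e1 (GA k)) (eo False) \<bullet> (onO (cmpt \<alpha> (e0 (PO (tp D k)))) (eo False) \<rhd> sg k b)"
    using wcone_eqs(4)[OF \<alpha>, of "e2 (SG k b)" "eo False"] k b by (auto simp: image_iff)
  then show "snd (to_fam \<alpha>) k = fst (to_fam \<alpha>) (tp D k) \<rhd> sg k b"
    using k b \<open>tp D k = sp D k\<close> by simp
qed

lemma to_fam_mor:
  assumes \<alpha>: "wcone B \<alpha>" and \<beta>: "wcone B \<beta>" and m: "wmod \<alpha> \<beta> m"
  shows "ins_mor D (to_fam \<alpha>) (to_fam \<beta>) (\<lambda>p \<in> Pt D. m (e0 (PO p)) (eo False))"
proof (rule ins_morI)
  note [simp] = cone_simps[OF \<alpha>] cone_simps[OF \<beta>] mod_simps(1-6)[OF m]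
  fix k assume k: "k \<in> Ed D"
  let ?ma = "m (e0 (PO (tp D k))) (eo False) \<lhd> fl D k" and ?mb = "m (e0 (PO (sp D k))) (eo False) \<lhd> gl D k"
    and ?fa = "strc \<alpha> (e1 (FA k)) (eo False)" and ?fb = "strc \<beta> (e1 (FA k)) (eo False)"
    and ?ga = "strc \<alpha> (e1 (GA k)) (eo False)" and ?gb = "strc \<beta> (e1 (GA k)) (eo False)"
    and ?pa = "onA (cmpt \<alpha> (e0 (KO k))) (ea (False, True))" and ?pb = "onA (cmpt \<beta> (e0 (KO k))) (ea (False, True))"
    and ?m0 = "m (e0 (KO k)) (eo False)" and ?m1 = "m (e0 (KO k)) (eo True)"
  have "?mb \<bullet> vinv ?ga \<bullet> ?pa \<bullet> ?fa = vinv ?gb \<bullet> ?pb \<bullet> ?fb \<bullet> ?ma"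
  proof (rule inv2_cancel_left[of ?gb])
    have "?gb \<bullet> ?mb \<bullet> vinv ?ga \<bullet> ?pa \<bullet> ?fa = (?gb \<bullet> ?mb) \<bullet> vinv ?ga \<bullet> ?pa \<bullet> ?fa" using k by simp
    also have "\<dots> = (?m1 \<bullet> ?pa) \<bullet> ?fa" unfolding mod_simps(9)[OF m k] using k by simp
    also have "\<dots> = ?pb \<bullet> ?m0 \<bullet> ?fa" unfolding mod_simps(7)[OF m k] using k by simp
    also have "\<dots> = ?pb \<bullet> ?fb \<bullet> ?ma" unfolding mod_simps(8)[OF m k] ..
    finally show "?gb \<bullet> ?mb \<bullet> vinv ?ga \<bullet> ?pa \<bullet> ?fa = ?gb \<bullet> vinv ?gb \<bullet> ?pb \<bullet> ?fb \<bullet> ?ma"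
      using k by simp
  qed (use k in simp_all)
  then show "((\<lambda>p \<in> Pt D. m (e0 (PO p)) (eo False)) (sp D k) \<lhd> gl D k) \<bullet> snd (to_fam \<alpha>) k =
      snd (to_fam \<beta>) k \<bullet> ((\<lambda>p \<in> Pt D. m (e0 (PO p)) (eo False)) (tp D k) \<lhd> fl D k)"
    using k by simp
qed (simp_all add: cone_simps[OF \<alpha>] cone_simps[OF \<beta>] mod_simps[OF m])

lemma functor_to_ins: "is_functor (wcones B) (ins_cat D sg_pred B) to_ins"
  unfolding is_functor_def
proof (intro conjI ballI impI)
  fix \<alpha> assume "\<alpha> \<in> Obj (wcones B)"
  then have \<alpha>: "wcone B \<alpha>" by simp
  show "onO to_ins \<alpha> \<in> Obj (ins_cat D sg_pred B)"
    using to_fam_cocone[OF \<alpha>] to_fam_pred[OF \<alpha>] by (simp add: to_ins_def)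
  show "onA to_ins (Idt (wcones B) \<alpha>) = Idt (ins_cat D sg_pred B) (onO to_ins \<alpha>)"
    by (auto simp: to_ins_def intro!: restrict_ext)
next
  fix a assume "a \<in> Arr (wcones B)"
  then show "onA to_ins a \<in> hom_set (ins_cat D sg_pred B)
      (onO to_ins (Dom (wcones B) a)) (onO to_ins (Cod (wcones B) a))"
    using to_fam_cocone[of B "fst a"] to_fam_cocone[of B "fst (snd a)"] to_fam_pred[of B "fst a"]
      to_fam_pred[of B "fst (snd a)"] to_fam_mor[of B "fst a" "fst (snd a)" "snd (snd a)"]
    by (simp add: to_ins_def)
next
  fix a b assume "a \<in> Arr (wcones B)" "b \<in> Arr (wcones B)" "Cod (wcones B) a = Dom (wcones B) b"
  then show "onA to_ins (Cmp (wcones B) b a) = Cmp (ins_cat D sg_pred B) (onA to_ins b) (onA to_ins a)"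
    by (auto simp: to_ins_def intro!: restrict_ext)
qed

lemma ball_J0: "(\<forall>i \<in> Cell0 J. P i) \<longleftrightarrow> (\<forall>p \<in> Pt D. P (e0 (PO p))) \<and> (\<forall>k \<in> Ed D. P (e0 (KO k)))"
  by auto

lemma ball_J1: "(\<forall>d \<in> Cell1 J. P d) \<longleftrightarrow> (\<forall>p \<in> Pt D. P (e1 (Bid (PO p)))) \<and> (\<forall>k \<in> Ed D. P (e1 (Bid (KO k)))) \<and>
    (\<forall>k \<in> Ed D. P (e1 (FA k))) \<and> (\<forall>k \<in> Ed D. P (e1 (GA k)))"
  by auto

lemma ball_J2: "(\<forall>d \<in> Cell2 J. P d) \<longleftrightarrow> (\<forall>p \<in> Pt D. P (e2 (Bid2 (Bid (PO p))))) \<and>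
    (\<forall>k \<in> Ed D. P (e2 (Bid2 (Bid (KO k))))) \<and>
    (\<forall>k \<in> Ed D. P (e2 (Bid2 (FA k)))) \<and> (\<forall>k \<in> Ed D. P (e2 (Bid2 (GA k)))) \<and>
    (\<forall>k \<in> Ed D. \<forall>b \<in> \<Sigma>. P (e2 (SG k b)))"
  by auto

text \<open>Given components at the points \<open>PO p\<close>, the two components at
  \<open>KO k\<close> are forced by compatibility with the invertible cells at \<open>FA k\<close>
  and \<open>GA k\<close>. The edge equation of \<open>n\<close> is what makes the forced components
  natural at the arrow from \<open>False\<close> to \<open>True\<close>.\<close>

lemma fully_faithful_to_ins: "fully_faithful (wcones B) (ins_cat D sg_pred B) to_ins"
  unfolding fully_faithful_def
proof (intro ballI)
  fix \<alpha> \<beta> b assume "\<alpha> \<in> Obj (wcones B)" "\<beta> \<in> Obj (wcones B)"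
    and b: "b \<in> hom_set (ins_cat D sg_pred B) (onO to_ins \<alpha>) (onO to_ins \<beta>)"
  then have \<alpha>: "wcone B \<alpha>" "ext_ps (op2 J) V \<alpha>" and \<beta>: "wcone B \<beta>" "ext_ps (op2 J) V \<beta>" by auto
  note [simp] = cone_simps[OF \<alpha>(1)] cone_simps[OF \<beta>(1)]
  obtain n where n: "b = (to_fam \<alpha>, to_fam \<beta>, n)" "ins_mor D (to_fam \<alpha>) (to_fam \<beta>) n"
    using b by (cases b) (auto simp: to_ins_def)
  have ns [simp]: "p \<in> Pt D \<Longrightarrow> n p \<in> Cell2 C"
    "p \<in> Pt D \<Longrightarrow> dom2 C (n p) = onO (cmpt \<alpha> (e0 (PO p))) (eo False)"
    "p \<in> Pt D \<Longrightarrow> cod2 C (n p) = onO (cmpt \<beta> (e0 (PO p))) (eo False)" for p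
    using ins_mor_simps(1-3)[OF n(2), of p] by auto
  define fa fb ga gb pa pb where "fa k = strc \<alpha> (e1 (FA k)) (eo False)" "fb k = strc \<beta> (e1 (FA k)) (eo False)"
    "ga k = strc \<alpha> (e1 (GA k)) (eo False)" "gb k = strc \<beta> (e1 (GA k)) (eo False)"
    "pa k = onA (cmpt \<alpha> (e0 (KO k))) (ea (False, True))" "pb k = onA (cmpt \<beta> (e0 (KO k))) (ea (False, True))" for k
  note defs = this
  define m where "m = (\<lambda>i \<in> Cell0 J. \<lambda>x \<in> Obj (C0 V i). case inv e0 i of PO p \<Rightarrow> n p
     | KO k \<Rightarrow> (if inv eo x then gb k \<bullet> (n (sp D k) \<lhd> gl D k) \<bullet> vinv (ga k)
         else fb k \<bullet> (n (tp D k) \<lhd> fl D k) \<bullet> vinv (fa k)))"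
  have mP: "m (e0 (PO p)) (eo False) = n p" if "p \<in> Pt D" for p
    using that by (auto simp: m_def)
  have mF: "m (e0 (KO k)) (eo False) = fb k \<bullet> (n (tp D k) \<lhd> fl D k) \<bullet> vinv (fa k)" if "k \<in> Ed D" for k
    using that by (auto simp: m_def)
  have mT: "m (e0 (KO k)) (eo True) = gb k \<bullet> (n (sp D k) \<lhd> gl D k) \<bullet> vinv (ga k)" if "k \<in> Ed D" for k
    using that by (auto simp: m_def)
  have ext: "ext_mod (op2 J) V m" by (simp add: m_def ext_mod_def)
  have nat: "(gb k \<bullet> (n (sp D k) \<lhd> gl D k) \<bullet> vinv (ga k)) \<bullet> pa k =
     pb k \<bullet> fb k \<bullet> (n (tp D k) \<lhd> fl D k) \<bullet> vinv (fa k)" if k: "k \<in> Ed D" for k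
  proof (rule inv2_cancel_right[of "fa k"])
    have "(n (sp D k) \<lhd> gl D k) \<bullet> vinv (ga k) \<bullet> pa k \<bullet> fa k = (vinv (gb k) \<bullet> pb k \<bullet> fb k) \<bullet> (n (tp D k) \<lhd> fl D k)"
      using ins_mor_eq[OF n(2) k] k by (simp add: defs)
    then have "gb k \<bullet> (n (sp D k) \<lhd> gl D k) \<bullet> vinv (ga k) \<bullet> pa k \<bullet> fa k
       = gb k \<bullet> (vinv (gb k) \<bullet> pb k \<bullet> fb k) \<bullet> (n (tp D k) \<lhd> fl D k)" by simp
    then show "((gb k \<bullet> (n (sp D k) \<lhd> gl D k) \<bullet> vinv (ga k)) \<bullet> pa k) \<bullet> fa k =
      (pb k \<bullet> fb k \<bullet> (n (tp D k) \<lhd> fl D k) \<bullet> vinv (fa k)) \<bullet> fa k"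
      using k by (simp add: defs)
  qed (use k in \<open>simp_all add: defs\<close>)
  have m: "wmod \<alpha> \<beta> m"
    unfolding wmod_def ball_J0 ball_J1 using nat
    by (simp add: all_bool_eq mP mF mT defs)
  have uniq: "m' = m" if m': "wmod \<alpha> \<beta> m'" "ext_mod (op2 J) V m'" "\<And>p. p \<in> Pt D \<Longrightarrow> m' (e0 (PO p)) (eo False) = n p" for m'
  proof -
    have F: "m' (e0 (KO k)) (eo False) = fb k \<bullet> (n (tp D k) \<lhd> fl D k) \<bullet> vinv (fa k)" if k: "k \<in> Ed D" for k
    proof (rule inv2_cancel_right[of "fa k"])
      show "m' (e0 (KO k)) (eo False) \<bullet> fa k = (fb k \<bullet> (n (tp D k) \<lhd> fl D k) \<bullet> vinv (fa k)) \<bullet> fa k"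
        using mod_simps(8)[OF m'(1) k, symmetric] k m'(3)[of "tp D k"] by (simp add: defs)
    qed (use k mod_simps[OF m'(1)] in \<open>simp_all add: defs\<close>)
    have T: "m' (e0 (KO k)) (eo True) = gb k \<bullet> (n (sp D k) \<lhd> gl D k) \<bullet> vinv (ga k)" if k: "k \<in> Ed D" for k
    proof (rule inv2_cancel_right[of "ga k"])
      show "m' (e0 (KO k)) (eo True) \<bullet> ga k = (gb k \<bullet> (n (sp D k) \<lhd> gl D k) \<bullet> vinv (ga k)) \<bullet> ga k"
        using mod_simps(9)[OF m'(1) k, symmetric] k m'(3)[of "sp D k"] by (simp add: defs)
    qed (use k mod_simps[OF m'(1)] in \<open>simp_all add: defs\<close>)
    have all: "\<forall>i \<in> Cell0 J. \<forall>x \<in> Obj (C0 V i). m' i x = m i x"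
      unfolding ball_J0 by (simp add: all_bool_eq mP mF mT F T m'(3))
    have "(\<lambda>i \<in> Cell0 J. \<lambda>x \<in> Obj (C0 V i). m i x) = m'"
      by (rule ext_mod_eqI[OF m'(2)]) (use all in auto)
    moreover have "(\<lambda>i \<in> Cell0 J. \<lambda>x \<in> Obj (C0 V i). m i x) = m"
      by (rule ext_mod_eqI[OF ext]) auto
    ultimately show ?thesis by simp
  qed
  have nn: "(\<lambda>p \<in> Pt D. m' (e0 (PO p)) (eo False)) = n \<longleftrightarrow> (\<forall>p \<in> Pt D. m' (e0 (PO p)) (eo False) = n p)" for m'
    using ins_mor_simps(4)[OF n(2)] by (auto simp: fun_eq_iff extensional_def restrict_def)
  show "\<exists>!a. a \<in> hom_set (wcones B) \<alpha> \<beta> \<and> onA to_ins a = b"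
  proof (rule ex1I[of _ "(\<alpha>, \<beta>, m)"])
    show "(\<alpha>, \<beta>, m) \<in> hom_set (wcones B) \<alpha> \<beta> \<and> onA to_ins (\<alpha>, \<beta>, m) = b"
      using \<alpha> \<beta> m ext nn[of m] mP by (simp add: to_ins_def n(1))
    fix a assume a: "a \<in> hom_set (wcones B) \<alpha> \<beta> \<and> onA to_ins a = b"
    then have "wmod \<alpha> \<beta> (snd (snd a))" "ext_mod (op2 J) V (snd (snd a))"
      "(\<lambda>p \<in> Pt D. snd (snd a) (e0 (PO p)) (eo False)) = n" by (auto simp: to_ins_def n(1))
    then have "snd (snd a) = m" using uniq nn by blast
    then show "a = (\<alpha>, \<beta>, m)" using a by (cases a) auto
  qed
qed

text \<open>A strict section of \<open>to_ins\<close>: the values at \<open>KO k\<close> are the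
  composites themselves and all structure cells are identities, so \<open>to_fam\<close> returns the
  family on the nose, as \<open>equivalence_transfer\<close> demands.\<close>

definition of_fam :: "('p, 'j, 'k1, 'k2) fam \<Rightarrow> ('u, 'u, 'u, 'u, 'k1, 'k2) ps_trans" where
  "of_fam Q = \<lparr>cmpt = (\<lambda>i \<in> Cell0 J. case inv e0 i of
       PO p \<Rightarrow> \<lparr>onO = \<lambda>x \<in> {eo False}. fst Q p, onA = \<lambda>a \<in> {ea (False, False)}. id2 C (fst Q p)\<rparr>
     | KO k \<Rightarrow> \<lparr>onO = \<lambda>x \<in> range eo. if inv eo x then fst Q (sp D k) \<cdot> gl D k else fst Q (tp D k) \<cdot> fl D k,
         onA = \<lambda>a \<in> {ea (False, False), ea (False, True), ea (True, True)}.
           if a = ea (False, True) then snd Q k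
           else if a = ea (True, True) then id2 C (fst Q (sp D k) \<cdot> gl D k) else id2 C (fst Q (tp D k) \<cdot> fl D k)\<rparr>),
     strc = (\<lambda>d \<in> Cell1 J. \<lambda>x \<in> Obj (C0 V (tgt J d)). case inv e1 d of
       Bid (PO p) \<Rightarrow> id2 C (fst Q p)
     | Bid (KO k) \<Rightarrow> if inv eo x then id2 C (fst Q (sp D k) \<cdot> gl D k) else id2 C (fst Q (tp D k) \<cdot> fl D k)
     | FA k \<Rightarrow> id2 C (fst Q (tp D k) \<cdot> fl D k)
     | GA k \<Rightarrow> id2 C (fst Q (sp D k) \<cdot> gl D k))\<rparr>"

lemma of_fam_simps [simp]:
  "p \<in> Pt D \<Longrightarrow> onO (cmpt (of_fam Q) (e0 (PO p))) (eo False) = fst Q p"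
  "p \<in> Pt D \<Longrightarrow> onA (cmpt (of_fam Q) (e0 (PO p))) (ea (False, False)) = id2 C (fst Q p)"
  "k \<in> Ed D \<Longrightarrow> onO (cmpt (of_fam Q) (e0 (KO k))) (eo v) =
     (if v then fst Q (sp D k) \<cdot> gl D k else fst Q (tp D k) \<cdot> fl D k)"
  "k \<in> Ed D \<Longrightarrow> onA (cmpt (of_fam Q) (e0 (KO k))) (ea (v, v)) =
     id2 C (if v then fst Q (sp D k) \<cdot> gl D k else fst Q (tp D k) \<cdot> fl D k)"
  "k \<in> Ed D \<Longrightarrow> onA (cmpt (of_fam Q) (e0 (KO k))) (ea (False, True)) = snd Q k"
  "p \<in> Pt D \<Longrightarrow> strc (of_fam Q) (e1 (Bid (PO p))) (eo False) = id2 C (fst Q p)"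
  "k \<in> Ed D \<Longrightarrow> strc (of_fam Q) (e1 (Bid (KO k))) (eo v) =
     id2 C (if v then fst Q (sp D k) \<cdot> gl D k else fst Q (tp D k) \<cdot> fl D k)"
  "k \<in> Ed D \<Longrightarrow> strc (of_fam Q) (e1 (FA k)) (eo False) = id2 C (fst Q (tp D k) \<cdot> fl D k)"
  "k \<in> Ed D \<Longrightarrow> strc (of_fam Q) (e1 (GA k)) (eo False) = id2 C (fst Q (sp D k) \<cdot> gl D k)"
  by (auto simp: of_fam_def)

lemma ext_of_fam: "ext_ps (op2 J) V (of_fam Q)"
  unfolding ext_ps_def by (auto simp: of_fam_def)

lemma wcone_of_fam:
  assumes Q: "ins_cocone D B Q" "sg_pred Q"
  shows "wcone B (of_fam Q)"
proof -
  note [simp] = ins_cocone_simps(1-6)[OF Q(1)]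
  have s: "fst Q (tp D k) \<rhd> sg k b = snd Q k" if "k \<in> Ed D" "b \<in> \<Sigma>" for k b
    using Q(2) that by (simp add: sg_pred_def)
  have t: "tp D k = sp D k" if "k \<in> Ed D" "b \<in> \<Sigma>" for k b using sg that by blast
  show ?thesis
    unfolding wcone_def ball_J0 ball_J1 ball_J2 is_functor_def
    by (auto simp: s)
qed

lemma to_ins_of_fam:
  assumes Q: "ins_cocone D B Q"
  shows "to_fam (of_fam Q) = Q"
proof -
  note [simp] = ins_cocone_simps(1-6)[OF Q(1)]
  show ?thesis
    by (rule prod_eqI; simp; rule extensionalityI[OF restrict_extensional])
      (auto simp: ins_cocone_simps(7,8)[OF Q])
qed

lemma post_stable_sg_pred: "post_stable D sg_pred"
  unfolding post_stable_def sg_pred_def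
proof (intro allI impI ballI)
  fix L Q f k b assume Q: "ins_cocone D L Q" and "\<forall>k\<in>Ed D. \<forall>b\<in>\<Sigma>. snd Q k = fst Q (tp D k) \<rhd> sg k b"
    "f \<in> Cell1 C" "src C f = L" and k: "k \<in> Ed D" "b \<in> \<Sigma>"
  moreover have "tp D k = sp D k" using sg k by blast
  ultimately show "snd (ins_post D Q f) k = fst (ins_post D Q f) (tp D k) \<rhd> sg k b"
    using ins_cocone_simps[OF Q] by (simp add: ins_post_def)
qed

text \<open>The universal weighted cocone given by Yoneda is sent by \<open>to_fam\<close> to the
  universal family, and \<open>to_ins\<close> carries the equivalence along.\<close>

lemma ins_rep_of_bicolimit:
  assumes "is_weighted_bicolimit J V C G L"
  shows "\<exists>Q. ins_rep D sg_pred L Q"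
proof -
  obtain \<alpha> where L: "L \<in> Cell0 C" and \<alpha>: "wcone L \<alpha>"
    and eq: "\<And>B. B \<in> Cell0 C \<Longrightarrow> is_equivalence (hom_cat C L B) (wcones B) (wfun \<alpha>)"
    using assms unfolding is_weighted_bicolimit_iff by auto
  note [simp] = cone_simps[OF \<alpha>]
  have Q: "ins_cocone D L (to_fam \<alpha>)" "sg_pred (to_fam \<alpha>)"
    using to_fam_cocone[OF \<alpha>] to_fam_pred[OF \<alpha>] by auto
  have pf: "to_fam (post f \<alpha>) = ins_post D (to_fam \<alpha>) f" if "f \<in> Cell1 C" "src C f = L" for f
    using that by (auto simp: ins_post_def intro!: restrict_ext)
  have "is_equivalence (hom_cat C L B) (ins_cat D sg_pred B) (ins_fun D (to_fam \<alpha>))" if B: "B \<in> Cell0 C" for B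
  proof (rule equivalence_transfer[OF category_hom_cat category_wcones category_ins_cat[OF wf] eq[OF B]
        functor_to_ins fully_faithful_to_ins])
    fix Q assume "Q \<in> Obj (ins_cat D sg_pred B)"
    then show "\<exists>\<beta>\<in>Obj (wcones B). onO to_ins \<beta> = Q"
      using wcone_of_fam[of B Q] ext_of_fam[of Q] to_ins_of_fam[of B Q]
      by (intro bexI[of _ "of_fam Q"]) (auto simp: to_ins_def)
  next
    fix f assume "f \<in> Obj (hom_cat C L B)"
    then show "onO (ins_fun D (to_fam \<alpha>)) f = onO to_ins (onO (wfun \<alpha>) f)"
      using pf by (simp add: ins_fun_def to_ins_def wfun_def)
  next
    fix t assume "t \<in> Arr (hom_cat C L B)"
    then show "onA (ins_fun D (to_fam \<alpha>)) t = onA to_ins (onA (wfun \<alpha>) t)"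
      using pf[of "dom2 C t"] pf[of "cod2 C t"]
      by (simp add: ins_fun_def to_ins_def wfun_def post_mod_def cong: restrict_cong)
  qed
  then have "ins_rep D sg_pred L (to_fam \<alpha>)"
    using ins_rep_iff[OF wf Q post_stable_sg_pred L] by blast
  then show ?thesis by blast
qed

end

section \<open>Smallness\<close>

lemma smallness_infinite:
  fixes \<kappa> :: "'u rel"
  assumes "smallness_cardinal \<kappa>"
  shows "infinite (UNIV :: 'u set)"
proof -
  have "cinfinite \<kappa>"
    using assms cinfinite_mono[OF ordLess_imp_ordLeq natLeq_cinfinite] by (auto simp: smallness_cardinal_def)
  then show ?thesis unfolding cinfinite_def using finite_subset[OF subset_UNIV] by blast
qed

lemma small_cinfinite: "smallness_cardinal \<kappa> \<Longrightarrow> Cinfinite \<kappa>"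
  using cinfinite_mono[OF ordLess_imp_ordLeq natLeq_cinfinite] by (auto simp: smallness_cardinal_def)

lemma small_finite: "\<lbrakk>smallness_cardinal \<kappa>; finite A\<rbrakk> \<Longrightarrow> |A| <o \<kappa>"
  by (meson finite_iff_ordLess_natLeq ordLess_transitive smallness_cardinal_def)

lemma small_image: "|A| <o \<kappa> \<Longrightarrow> |f ` A| <o \<kappa>"
  using card_of_image ordLeq_ordLess_trans by blast

lemma small_subset: "\<lbrakk>A \<subseteq> B; |B| <o \<kappa>\<rbrakk> \<Longrightarrow> |A| <o \<kappa>"
  using card_of_mono1 ordLeq_ordLess_trans by blast

lemma small_Un: "\<lbrakk>smallness_cardinal \<kappa>; |A| <o \<kappa>; |B| <o \<kappa>\<rbrakk> \<Longrightarrow> |A \<union> B| <o \<kappa>"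
  using card_of_Un_ordLess_infinite_Field[of \<kappa> A B] small_cinfinite
  by (auto simp: cinfinite_def)

lemma small_inj:
  fixes \<kappa> :: "'u rel"
  assumes "smallness_cardinal \<kappa>" "|A| <o \<kappa>"
  shows "\<exists>e :: 'a \<Rightarrow> 'u. inj_on e A"
proof -
  have "\<kappa> =o |Field \<kappa>|" using assms(1) card_of_Field_ordIso ordIso_symmetric by (auto simp: smallness_cardinal_def)
  then have "|A| \<le>o |Field \<kappa>|" using assms(2) ordLess_imp_ordLeq ordLeq_ordIso_trans by blast
  then show ?thesis using card_of_ordLeq[of A "Field \<kappa>"] by blast
qed

text \<open>Regularity enters here, through stability of \<open>\<kappa>\<close>. Stability speaks
  of families of subsets of \<open>'u\<close> indexed in \<open>'u\<close>, so the index set and the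
  fibres are first embedded there.\<close>

lemma small_Sigma:
  fixes \<kappa> :: "'u rel"
  assumes \<kappa>: "smallness_cardinal \<kappa>" and A: "|A| <o \<kappa>" and F: "\<And>a. a \<in> A \<Longrightarrow> |F a| <o \<kappa>"
  shows "|SIGMA a:A. F a| <o \<kappa>"
proof -
  obtain e :: "'a \<Rightarrow> 'u" where e: "inj_on e A" using small_inj[OF \<kappa> A] by blast
  have "\<forall>a \<in> A. \<exists>h :: 'b \<Rightarrow> 'u. inj_on h (F a)" using small_inj[OF \<kappa> F] by blast
  then obtain h :: "'a \<Rightarrow> 'b \<Rightarrow> 'u" where h: "\<And>a. a \<in> A \<Longrightarrow> inj_on (h a) (F a)" by metis
  let ?F = "\<lambda>x. h (inv_into A e x) ` F (inv_into A e x)"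
  have "Cinfinite \<kappa>" "regularCard \<kappa>" using \<kappa> small_cinfinite by (auto simp: smallness_cardinal_def)
  then have st: "stable \<kappa>" using regularCard_stable by (auto simp: cinfinite_def)
  have F': "|?F x| <o \<kappa>" if "x \<in> e ` A" for x
    by (intro small_image F inv_into_into that)
  have "|e ` A| <o \<kappa> \<and> (\<forall>x \<in> e ` A. |?F x| <o \<kappa>)"
    by (intro conjI ballI small_image A F')
  then have "|SIGMA x:e ` A. ?F x| <o \<kappa>"
    by (rule st[unfolded stable_def, THEN spec, THEN spec, THEN mp])
  moreover have "|SIGMA a:A. F a| \<le>o |SIGMA x:e ` A. ?F x|"
  proof (rule card_of_ordLeq[THEN iffD1], intro exI conjI)
    show "inj_on (\<lambda>(a, x). (e a, h a x)) (SIGMA a:A. F a)"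
      using e h by (auto simp: inj_on_def)
    show "(\<lambda>(a, x). (e a, h a x)) ` (SIGMA a:A. F a) \<subseteq> (SIGMA x:e ` A. ?F x)"
      using e by auto
  qed
  ultimately show ?thesis using ordLeq_ordLess_trans by blast
qed

lemma small_Times: "\<lbrakk>smallness_cardinal \<kappa>; |A| <o \<kappa>; |B| <o \<kappa>\<rbrakk> \<Longrightarrow> |A \<times> B| <o \<kappa>"
  by (rule small_Sigma)

lemma ex_injI:
  assumes "|UNIV :: 'a set| \<le>o |UNIV :: 'u set|"
  shows "\<exists>e :: 'a \<Rightarrow> 'u. inj e"
  using assms card_of_ordLeq[of "UNIV :: 'a set" "UNIV :: 'u set"] by blast

lemma finite_ordLeq: "\<lbrakk>finite A; infinite B\<rbrakk> \<Longrightarrow> |A| \<le>o |B|"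
  using ordLeq_total[OF card_of_Well_order card_of_Well_order, of A B] card_of_ordLeq_finite by blast

lemma inj_prod:
  assumes "infinite (UNIV :: 'u set)"
  shows "\<exists>e :: 'u \<times> 'u \<Rightarrow> 'u. inj e"
  by (rule ex_injI) (use card_of_Times_same_infinite[OF assms] in \<open>simp add: ordIso_imp_ordLeq\<close>)

lemma Un_ordLeq: "\<lbrakk>infinite B; |A| \<le>o |B|; |A'| \<le>o |B|\<rbrakk> \<Longrightarrow> |A \<union> A'| \<le>o |B|"
  by (rule card_of_Un_ordLeq_infinite_Field) (simp_all add: Field_card_of card_of_card_order_on)

text \<open>The whole datatype is bounded, not just the shape inside it, because
  \<open>enc_two\<close> decodes with \<open>inv\<close> and so works with injections on the entire
  type.\<close>

lemma bob_ordLeq: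
  assumes "infinite (UNIV :: 'u set)" "|UNIV :: 'p set| \<le>o |UNIV :: 'u set|" "|UNIV :: 'j set| \<le>o |UNIV :: 'u set|"
  shows "|UNIV :: ('p, 'j) bob set| \<le>o |UNIV :: 'u set|"
proof -
  have "x \<in> range PO \<union> range KO" for x :: "('p, 'j) bob" by (cases x) auto
  then have *: "(UNIV :: ('p, 'j) bob set) = range PO \<union> range KO" by blast
  show ?thesis
    unfolding * by (intro Un_ordLeq[OF assms(1)] ordLeq_transitive[OF card_of_image] assms)
qed

lemma bar_ordLeq:
  assumes "infinite (UNIV :: 'u set)" "|UNIV :: 'p set| \<le>o |UNIV :: 'u set|" "|UNIV :: 'j set| \<le>o |UNIV :: 'u set|"
  shows "|UNIV :: ('p, 'j) bar set| \<le>o |UNIV :: 'u set|"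
proof -
  have "x \<in> (range Bid \<union> range FA) \<union> range GA" for x :: "('p, 'j) bar" by (cases x) auto
  then have *: "(UNIV :: ('p, 'j) bar set) = (range Bid \<union> range FA) \<union> range GA" by blast
  show ?thesis
    unfolding * by (intro Un_ordLeq[OF assms(1)] ordLeq_transitive[OF card_of_image] bob_ordLeq assms)
qed

lemma btw_ordLeq:
  assumes "infinite (UNIV :: 'u set)" "|UNIV :: 'p set| \<le>o |UNIV :: 'u set|" "|UNIV :: 'j set| \<le>o |UNIV :: 'u set|"
  shows "|UNIV :: ('p, 'j) btw set| \<le>o |UNIV :: 'u set|"
proof -
  have "x \<in> (range Bid2 \<union> range (\<lambda>k. SG k True)) \<union> range (\<lambda>k. SG k False)" for x :: "('p, 'j) btw"
  proof (cases x)
    case (SG k b)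
    then show ?thesis by (cases b) simp_all
  qed simp
  then have *: "(UNIV :: ('p, 'j) btw set) = (range Bid2 \<union> range (\<lambda>k. SG k True)) \<union> range (\<lambda>k. SG k False)"
    by blast
  show ?thesis
    unfolding * by (intro Un_ordLeq[OF assms(1)] ordLeq_transitive[OF card_of_image] bar_ordLeq assms)
qed

lemma small_bshape:
  fixes \<Sigma> :: "bool set"
  assumes \<kappa>: "smallness_cardinal \<kappa>" and small: "|Pt D| <o \<kappa>" "|Ed D| <o \<kappa>"
  shows "|Cell0 (bshape D \<Sigma>)| <o \<kappa>" "|Cell1 (bshape D \<Sigma>)| <o \<kappa>" "|Cell2 (bshape D \<Sigma>)| <o \<kappa>"
proof -
  have f: "|\<Sigma>| <o \<kappa>" by (rule small_finite[OF \<kappa> finite])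
  show "|Cell0 (bshape D \<Sigma>)| <o \<kappa>" "|Cell1 (bshape D \<Sigma>)| <o \<kappa>" "|Cell2 (bshape D \<Sigma>)| <o \<kappa>"
    unfolding bshape_simps by (intro small_Un[OF \<kappa>] small_image small_Times[OF \<kappa>] small f)+
qed

section \<open>Families with equations in a bicocomplete 2-category\<close>

context strict_two_category
begin

text \<open>An infinite \<open>'u\<close> leaves room to code both the shape and the finite values
  of the weight, so bicocompleteness applies to the encoded data and
  \<open>ins_rep_of_bicolimit\<close> reads off the family.\<close>

lemma bicocomplete_ins:
  fixes \<kappa> :: "'u rel" and D :: "('u, 'u, 'k0, 'k1) ins" and \<Sigma> :: "bool set"
  assumes \<kappa>: "smallness_cardinal \<kappa>" and bi: "bicocomplete \<kappa> C" and wf: "wf_ins D"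
    and small: "|Pt D| <o \<kappa>" "|Ed D| <o \<kappa>"
    and sg: "\<And>k b. k \<in> Ed D \<Longrightarrow> b \<in> \<Sigma> \<Longrightarrow> tp D k = sp D k \<and> sg k b \<in> hom2 C (fl D k) (gl D k)"
  shows "\<exists>L Q. ins_rep D (\<lambda>Q. \<forall>k \<in> Ed D. \<forall>b \<in> \<Sigma>. snd Q k = fst Q (tp D k) \<rhd> sg k b) L Q"
proof -
  have inf: "infinite (UNIV :: 'u set)" using smallness_infinite[OF \<kappa>] .
  obtain e0 :: "('u, 'u) bob \<Rightarrow> 'u" where e0: "inj e0" using ex_injI[OF bob_ordLeq[OF inf]] ordLeq_refl[OF card_of_Card_order] by blast
  obtain e1 :: "('u, 'u) bar \<Rightarrow> 'u" where e1: "inj e1" using ex_injI[OF bar_ordLeq[OF inf]] ordLeq_refl[OF card_of_Card_order] by blast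
  obtain e2 :: "('u, 'u) btw \<Rightarrow> 'u" where e2: "inj e2" using ex_injI[OF btw_ordLeq[OF inf]] ordLeq_refl[OF card_of_Card_order] by blast
  obtain eo :: "bool \<Rightarrow> 'u" where eo: "inj eo" using ex_injI[OF finite_ordLeq[OF finite inf]] by blast
  obtain ea :: "bool \<times> bool \<Rightarrow> 'u" where ea: "inj ea" using ex_injI[OF finite_ordLeq[OF finite inf]] by blast
  interpret b: bipartite C D \<Sigma> sg e0 e1 e2 eo ea
    by unfold_locales (use e0 e1 e2 eo ea wf sg in auto)
  have "small_two_category \<kappa> b.J"
    unfolding small_two_category_def small_set_def
    using b.index small_image[OF small_bshape(1)[OF \<kappa> small, of \<Sigma>], of e0]
      small_image[OF small_bshape(2)[OF \<kappa> small, of \<Sigma>], of e1]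
      small_image[OF small_bshape(3)[OF \<kappa> small, of \<Sigma>], of e2] by simp
  moreover have "\<forall>i \<in> Cell0 b.J. small_category \<kappa> (C0 b.V i)"
    unfolding small_category_def small_set_def
    using b.W_cat by (auto simp: b.ball_J0 intro!: small_finite[OF \<kappa>])
  ultimately obtain L where "is_weighted_bicolimit b.J b.V C b.G L"
    using bi b.diagram b.weight unfolding bicocomplete_def by blast
  then obtain Q where "ins_rep D b.sg_pred L Q" using b.ins_rep_of_bicolimit by blast
  moreover have "b.sg_pred = (\<lambda>Q. \<forall>k \<in> Ed D. \<forall>b \<in> \<Sigma>. snd Q k = fst Q (tp D k) \<rhd> sg k b)"
    by (simp add: b.sg_pred_def fun_eq_iff)
  ultimately show ?thesis by metis
qed

text \<open>One point \<open>L\<close> and one edge for each pair, carrying both members of the pair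
  as 2-cells of the shape. A family under this is a 1-cell \<open>f\<close> whose edge cell equals
  both whiskerings, hence just an \<open>f\<close> that equates them.\<close>

lemma bicocomplete_equifier:
  fixes \<kappa> :: "'u rel"
  assumes \<kappa>: "smallness_cardinal \<kappa>" and bi: "bicocomplete \<kappa> C" and L: "L \<in> Cell0 C"
    and small: "|K| <o \<kappa>"
    and K: "\<And>s t. (s, t) \<in> K \<Longrightarrow> s \<in> Cell2 C \<and> t \<in> Cell2 C \<and> dom2 C s = dom2 C t \<and> cod2 C s = cod2 C t \<and>
       tgt C (dom2 C s) = L"
  shows "\<exists>p M. localizes (\<lambda>f. \<forall>(s, t) \<in> K. f \<rhd> s = f \<rhd> t) p L M"
proof -
  obtain e :: "'k2 \<times> 'k2 \<Rightarrow> 'u" where e: "inj_on e K" using small_inj[OF \<kappa> small] by blast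
  \<comment> \<open>Any element of \<open>'u\<close> can name the single point.\<close>
  define c :: 'u where "c = undefined"
  define d where "d = inv_into K e"
  have de [simp]: "x \<in> K \<Longrightarrow> d (e x) = x" for x using e by (simp add: d_def)
  define D :: "('u, 'u, 'k0, 'k1) ins" where "D = \<lparr>Pt = {c}, Ed = e ` K, tp = (\<lambda>_. c), sp = (\<lambda>_. c), ob = (\<lambda>_. L),
     fl = (\<lambda>k. dom2 C (fst (d k))), gl = (\<lambda>k. cod2 C (fst (d k)))\<rparr>"
  have Ds [simp]: "Pt D = {c}" "Ed D = e ` K" "tp D k = c" "sp D k = c" "ob D p = L"
    "fl D k = dom2 C (fst (d k))" "gl D k = cod2 C (fst (d k))" for k p by (simp_all add: D_def)
  define sg where "sg k b = (if b then snd (d k) else fst (d k))" for k b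
  have Ks [simp]: "x \<in> K \<Longrightarrow> fst x \<in> Cell2 C" "x \<in> K \<Longrightarrow> snd x \<in> Cell2 C"
    "x \<in> K \<Longrightarrow> dom2 C (snd x) = dom2 C (fst x)" "x \<in> K \<Longrightarrow> cod2 C (snd x) = cod2 C (fst x)"
    "x \<in> K \<Longrightarrow> tgt C (dom2 C (fst x)) = L" for x
    using K[of "fst x" "snd x"] by auto
  have wf: "wf_ins D" using L by (auto simp: wf_ins_def)
  have sgk: "tp D k = sp D k \<and> sg k b \<in> hom2 C (fl D k) (gl D k)" if "k \<in> Ed D" for k b
  proof -
    have "k \<in> e ` K" using that by simp
    then obtain x where "x \<in> K" "k = e x" by blast
    then show ?thesis by (simp add: sg_def)
  qed
  have "|Pt D| <o \<kappa>" "|Ed D| <o \<kappa>"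
    unfolding Ds using small_image[OF small] small_finite[OF \<kappa>] by (blast, blast)
  then obtain M Q where Q: "ins_rep D (\<lambda>Q. \<forall>k \<in> Ed D. \<forall>b \<in> UNIV. snd Q k = fst Q (tp D k) \<rhd> sg k b) M Q"
    using bicocomplete_ins[OF \<kappa> bi wf, of UNIV sg] sgk by blast
  define p where "p = fst Q c"
  have Q': "ins_cocone D M Q" and M: "M \<in> Cell0 C" using Q by (auto simp: ins_rep_def)
  have p [simp]: "p \<in> Cell1 C" "src C p = L" "tgt C p = M"
    using ins_cocone_simps(1-3)[OF Q', of c] by (auto simp: p_def)
  have Qk: "snd Q (e x) = p \<rhd> fst x" "snd Q (e x) = p \<rhd> snd x" if "x \<in> K" for x
    using Q that by (auto simp: ins_rep_def sg_def p_def all_bool_eq)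
  have "localizes (\<lambda>f. \<forall>(s, t) \<in> K. f \<rhd> s = f \<rhd> t) p L M"
    unfolding localizes_def
  proof (intro conjI ballI impI M)
    show "p \<in> hom1 C L M" by simp
    fix B assume B: "B \<in> Cell0 C"
    {
      fix g x assume g: "g \<in> hom1 C M B" and x: "x \<in> K"
      have "g \<rhd> (p \<rhd> fst x) = g \<rhd> (p \<rhd> snd x)" using Qk[OF x] by simp
      then show "case x of (s, t) \<Rightarrow> (g \<cdot> p) \<rhd> s = (g \<cdot> p) \<rhd> t"
        using g x by (simp add: case_prod_beta)
    }
    {
      fix f assume f: "f \<in> hom1 C L B" and fK: "\<forall>(s, t) \<in> K. f \<rhd> s = f \<rhd> t"
      define Y where "Y = (\<lambda>x \<in> {c}. f, \<lambda>k \<in> e ` K. f \<rhd> fst (d k))"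
      have Y: "ins_cocone D B Y"
      proof (rule ins_coconeI)
        fix k assume "k \<in> Ed D"
        then have "k \<in> e ` K" by simp
        then obtain x where "x \<in> K" "k = e x" by blast
        then show "snd Y k \<in> Cell2 C \<and> dom2 C (snd Y k) = fst Y (tp D k) \<cdot> fl D k \<and>
            cod2 C (snd Y k) = fst Y (sp D k) \<cdot> gl D k"
          using f by (simp add: Y_def)
      qed (use f in \<open>simp_all add: Y_def\<close>)
      moreover have "\<forall>k \<in> Ed D. \<forall>b \<in> UNIV. snd Y k = fst Y (tp D k) \<rhd> sg k b"
        using fK by (auto simp: Y_def sg_def)
      ultimately obtain g m where "g \<in> hom1 C M B" "ins_mor D (ins_post D Q g) Y m" "\<forall>p \<in> Pt D. inv2 (m p)"
        using Q B unfolding ins_rep_def by blast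
      then show "\<exists>g \<in> hom1 C M B. \<exists>t \<in> hom2 C (g \<cdot> p) f. inv2 t"
        using ins_mor_simps(1-3)[of D "ins_post D Q g" Y m c]
        by (intro bexI[of _ g] bexI[of _ "m c"]) (auto simp: ins_post_def Y_def p_def)
    }
    {
      fix g h t assume g: "g \<in> hom1 C M B" and h: "h \<in> hom1 C M B" and t: "t \<in> hom2 C (g \<cdot> p) (h \<cdot> p)"
      \<comment> \<open>By interchange every 2-cell between \<open>g \<cdot> p\<close> and
        \<open>h \<cdot> p\<close> respects the edge cells, so a morphism of these families is just
        a 2-cell.\<close>
      have sw: "(t \<lhd> cod2 C (fst x)) \<bullet> ((g \<cdot> p) \<rhd> fst x) = ((h \<cdot> p) \<rhd> fst x) \<bullet> (t \<lhd> dom2 C (fst x))"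
        if x: "x \<in> K" for x
        by (rule whisker_swap) (use x t g h in auto)
      have "ins_mor D (ins_post D Q g) (ins_post D Q h) (\<lambda>x \<in> {c}. t)"
      proof (rule ins_morI)
        fix k assume "k \<in> Ed D"
        then have "k \<in> e ` K" by simp
        then obtain x where "x \<in> K" "k = e x" by blast
        then show "((\<lambda>x \<in> {c}. t) (sp D k) \<lhd> gl D k) \<bullet> snd (ins_post D Q g) k =
            snd (ins_post D Q h) k \<bullet> ((\<lambda>x \<in> {c}. t) (tp D k) \<lhd> fl D k)"
          using sw[of x] g h t by (simp add: ins_post_def Qk(1))
      qed (use g h t in \<open>simp_all add: ins_post_def p_def[symmetric]\<close>)
      then have "\<exists>!u. u \<in> hom2 C g h \<and> (\<lambda>x \<in> Pt D. u \<lhd> fst Q x) = (\<lambda>x \<in> {c}. t)"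
        using Q B g h unfolding ins_rep_def by blast
      moreover have "(\<lambda>x \<in> Pt D. u \<lhd> fst Q x) = (\<lambda>x \<in> {c}. t) \<longleftrightarrow> u \<lhd> p = t" for u
        by (auto simp: p_def fun_eq_iff restrict_def)
      ultimately show "\<exists>!u. u \<in> hom2 C g h \<and> u \<lhd> p = t" by simp
    }
  qed
  then show ?thesis by blast
qed

text \<open>The pairs \<open>E Q\<close> of the universal unrestricted family \<open>Q\<close> are
  coequified. By \<open>Ef\<close> the pairs of an induced family are the images of
  \<open>E Q\<close>, so a 1-cell equates \<open>E Q\<close> exactly when the family it induces
  satisfies the equations.\<close>

lemma bicocomplete_equations:
  fixes \<kappa> :: "'u rel" and D :: "('u, 'u, 'k0, 'k1) ins"
    and E :: "('u, 'u, 'k1, 'k2) fam \<Rightarrow> ('k2 \<times> 'k2) set"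
  assumes \<kappa>: "smallness_cardinal \<kappa>" and bi: "bicocomplete \<kappa> C" and wf: "wf_ins D"
    and small: "|Pt D| <o \<kappa>" "|Ed D| <o \<kappa>" "\<And>Q. |E Q| <o \<kappa>"
    and E: "\<And>L Q s t. ins_cocone D L Q \<Longrightarrow> (s, t) \<in> E Q \<Longrightarrow>
       s \<in> Cell2 C \<and> t \<in> Cell2 C \<and> dom2 C s = dom2 C t \<and> cod2 C s = cod2 C t \<and> tgt C (dom2 C s) = L"
    and Ef: "\<And>L Q f. ins_cocone D L Q \<Longrightarrow> f \<in> Cell1 C \<Longrightarrow> src C f = L \<Longrightarrow>
       E (ins_post D Q f) = (\<lambda>(s, t). (f \<rhd> s, f \<rhd> t)) ` E Q"
    and re: "replete D (\<lambda>_. True) (\<lambda>Q. \<forall>(s, t) \<in> E Q. s = t)"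
  shows "\<exists>L Q. ins_rep D (\<lambda>Q. \<forall>(s, t) \<in> E Q. s = t) L Q"
proof -
  obtain L Q where Q: "ins_rep D (\<lambda>_. True) L Q"
    using bicocomplete_ins[OF \<kappa> bi wf small(1,2), of "{}"] by auto
  then have Q': "ins_cocone D L Q" "L \<in> Cell0 C" by (auto simp: ins_rep_def)
  obtain p M where p: "localizes (\<lambda>f. \<forall>(s, t) \<in> E Q. f \<rhd> s = f \<rhd> t) p L M"
    using bicocomplete_equifier[OF \<kappa> bi Q'(2) small(3), of Q] E[OF Q'(1)] by blast
  have "ins_rep D (\<lambda>Q. \<forall>(s, t) \<in> E Q. s = t) M (ins_post D Q p)"
    by (rule ins_rep_localize[OF wf Q p _ re]) (use Ef[OF Q'(1)] in \<open>auto simp: post_stable_def\<close>)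
  then show ?thesis by blast
qed

end

section \<open>Oplax cocones\<close>

context diagram
begin

text \<open>Structure cells of an oplax cocone end in a plain leg; the identity as \<open>gl\<close>
  brings this to the two-sided format of \<open>ins\<close>.\<close>

definition oplax_ins :: "('i0, 'i1, 'k0, 'k1) ins" where
  "oplax_ins = \<lparr>Pt = Cell0 I, Ed = Cell1 I, tp = tgt I, sp = src I, ob = F0 F, fl = F1 F,
     gl = (\<lambda>d. id1 C (F0 F (src I d)))\<rparr>"

lemma oplax_ins_simps [simp]:
  "Pt oplax_ins = Cell0 I" "Ed oplax_ins = Cell1 I" "tp oplax_ins = tgt I" "sp oplax_ins = src I"
  "ob oplax_ins = F0 F" "fl oplax_ins = F1 F" "gl oplax_ins d = id1 C (F0 F (src I d))"
  by (simp_all add: oplax_ins_def)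

lemma wf_oplax_ins: "wf_ins oplax_ins"
  by (simp add: wf_ins_def)

text \<open>The unit, composition and 2-cell laws in the form of parallel pairs, so that they can be
  coequified.\<close>

definition oplax_eqs :: "('i0, 'i1, 'k1, 'k2) fam \<Rightarrow> ('k2 \<times> 'k2) set" where
  "oplax_eqs Q = (\<lambda>i. (snd Q (id1 I i), id2 C (fst Q i))) ` Cell0 I \<union>
     (\<lambda>(d, e). (snd Q (cmp1 I e d), snd Q d \<bullet> (snd Q e \<lhd> F1 F d))) `
        {(d, e) \<in> Cell1 I \<times> Cell1 I. tgt I d = src I e} \<union>
     (\<lambda>s. (snd Q (cod2 I s) \<bullet> (fst Q (tgt I (dom2 I s)) \<rhd> F2 F s), snd Q (dom2 I s))) ` Cell2 I"

definition oplax_pred :: "('i0, 'i1, 'k1, 'k2) fam \<Rightarrow> bool" where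
  "oplax_pred Q \<longleftrightarrow> (\<forall>(s, t) \<in> oplax_eqs Q. s = t)"

lemma oplax_pred_iff:
  "oplax_pred Q \<longleftrightarrow> (\<forall>i \<in> Cell0 I. snd Q (id1 I i) = id2 C (fst Q i)) \<and>
     (\<forall>d \<in> Cell1 I. \<forall>e \<in> Cell1 I. tgt I d = src I e \<longrightarrow>
        snd Q (cmp1 I e d) = snd Q d \<bullet> (snd Q e \<lhd> F1 F d)) \<and>
     (\<forall>s \<in> Cell2 I. snd Q (cod2 I s) \<bullet> (fst Q (tgt I (dom2 I s)) \<rhd> F2 F s) = snd Q (dom2 I s))"
  unfolding oplax_pred_def oplax_eqs_def by (auto simp: ball_Un)

lemma oplax_cocone_iff: "oplax_cocone I C F B Q \<longleftrightarrow> ins_cocone oplax_ins B Q \<and> oplax_pred Q"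
proof -
  have "(\<forall>d \<in> Cell1 I. snd Q d \<in> hom2 C (fst Q (tgt I d) \<cdot> F1 F d) (fst Q (src I d))) \<longleftrightarrow>
     (\<forall>d \<in> Cell1 I. snd Q d \<in> hom2 C (fst Q (tgt I d) \<cdot> F1 F d) (fst Q (src I d) \<cdot> id1 C (F0 F (src I d))))"
    if "\<forall>i \<in> Cell0 I. fst Q i \<in> hom1 C (F0 F i) B"
    using that by simp
  then show ?thesis
    unfolding oplax_cocone_def ins_cocone_def oplax_pred_iff by (cases Q) auto
qed

lemma oplax_modification_iff:
  assumes "ins_cocone oplax_ins B Q" "ins_cocone oplax_ins B Q'"
  shows "oplax_modification I C F Q Q' m \<longleftrightarrow> ins_mor oplax_ins Q Q' m"
proof -
  note [simp] = ins_cocone_simps(1-6)[OF assms(1)] ins_cocone_simps(1-6)[OF assms(2)]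
  have "(\<forall>d \<in> Cell1 I. m (src I d) \<bullet> snd Q d = snd Q' d \<bullet> (m (tgt I d) \<lhd> F1 F d)) \<longleftrightarrow>
     (\<forall>d \<in> Cell1 I. (m (src I d) \<lhd> id1 C (F0 F (src I d))) \<bullet> snd Q d = snd Q' d \<bullet> (m (tgt I d) \<lhd> F1 F d))"
    if m: "\<forall>i \<in> Cell0 I. m i \<in> hom2 C (fst Q i) (fst Q' i)"
  proof -
    have "m i \<lhd> id1 C (F0 F i) = m i" if "i \<in> Cell0 I" for i
      using m that assms by simp
    then show ?thesis by simp
  qed
  then show ?thesis
    unfolding oplax_modification_def ins_mor_def by (cases Q; cases Q') auto
qed

text \<open>The two presentations coincide as records, so the universal property transfers by
  rewriting and no comparison functor is required.\<close>

lemma oplax_cocone_cat_eq: "oplax_cocone_cat I C F B = ins_cat oplax_ins oplax_pred B"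
  unfolding oplax_cocone_cat_def ins_cat_def oplax_cocone_iff
  by (auto simp: oplax_modification_iff)

lemma compose_cocone_eq: "compose_cocone I C Q = ins_fun oplax_ins Q"
  by (auto simp: compose_cocone_def ins_fun_def cocone_post_def ins_post_def fun_eq_iff)

lemma post_stable_oplax: "post_stable oplax_ins oplax_pred"
  unfolding post_stable_def
proof (intro allI impI)
  fix L Q f assume Q: "ins_cocone oplax_ins L Q" "oplax_pred Q" and f: "f \<in> Cell1 C" "src C f = L"
  note [simp] = ins_cocone_simps(1-6)[OF Q(1)]
  note eqs = Q(2)[unfolded oplax_pred_iff]
  have s: "f \<rhd> snd Q (cod2 I s) \<bullet> (f \<cdot> fst Q (tgt I (dom2 I s)) \<rhd> F2 F s) = f \<rhd> snd Q (dom2 I s)"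
    if "s \<in> Cell2 I" for s
  proof -
    have "f \<rhd> (snd Q (cod2 I s) \<bullet> (fst Q (tgt I (dom2 I s)) \<rhd> F2 F s)) = f \<rhd> snd Q (dom2 I s)"
      using eqs that by simp
    then show ?thesis using that f by simp
  qed
  show "oplax_pred (ins_post oplax_ins Q f)"
    unfolding oplax_pred_iff using f eqs s by (simp add: ins_post_def)
qed

text \<open>Each law for \<open>Q'\<close> is precomposed with an invertible whiskering of
  \<open>m\<close>. This moves across structure cells by \<open>mn\<close> and across
  \<open>F2 F s\<close> by interchange, and what remains is the law for \<open>Q\<close>.\<close>

lemma replete_oplax: "replete oplax_ins (\<lambda>_. True) oplax_pred"
  unfolding replete_def
proof (intro allI impI)
  fix B Q Q' m
  assume Q: "ins_cocone oplax_ins B Q" and Q': "ins_cocone oplax_ins B Q'" and P: "oplax_pred Q"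
    and m: "ins_mor oplax_ins Q Q' m" and inv: "\<forall>p\<in>Pt oplax_ins. inv2 (m p)"
  note [simp] = ins_cocone_simps(1-6)[OF Q] ins_cocone_simps(1-6)[OF Q'] ins_mor_simps(1-3)[OF m]
  have im [simp]: "inv2 (m i)" if "i \<in> Cell0 I" for i using inv that by simp
  note eqs = P[unfolded oplax_pred_iff]
  have mn: "m (src I d) \<bullet> snd Q d = snd Q' d \<bullet> (m (tgt I d) \<lhd> F1 F d)" if "d \<in> Cell1 I" for d
    using ins_mor_eq[OF m, of d] that by simp
  have 1: "snd Q' (id1 I i) = id2 C (fst Q' i)" if i: "i \<in> Cell0 I" for i
    by (rule inv2_cancel_right[of "m i"]) (use mn[of "id1 I i"] i eqs in simp_all)
  have 2: "snd Q' (cmp1 I e d) = snd Q' d \<bullet> (snd Q' e \<lhd> F1 F d)"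
    if d: "d \<in> Cell1 I" and e: "e \<in> Cell1 I" and de: "tgt I d = src I e" for d e
  proof (rule inv2_cancel_right[of "m (tgt I e) \<lhd> F1 F (cmp1 I e d)"])
    have "snd Q' (cmp1 I e d) \<bullet> (m (tgt I e) \<lhd> F1 F (cmp1 I e d)) = (m (src I d) \<bullet> snd Q d) \<bullet> (snd Q e \<lhd> F1 F d)"
      using mn[of "cmp1 I e d"] d e de eqs by simp
    also have "\<dots> = snd Q' d \<bullet> ((m (src I e) \<bullet> snd Q e) \<lhd> F1 F d)"
      unfolding mn[OF d] using d e de by simp
    also have "\<dots> = (snd Q' d \<bullet> (snd Q' e \<lhd> F1 F d)) \<bullet> (m (tgt I e) \<lhd> F1 F (cmp1 I e d))"
      unfolding mn[OF e] using d e de by simp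
    finally show "snd Q' (cmp1 I e d) \<bullet> (m (tgt I e) \<lhd> F1 F (cmp1 I e d)) =
      (snd Q' d \<bullet> (snd Q' e \<lhd> F1 F d)) \<bullet> (m (tgt I e) \<lhd> F1 F (cmp1 I e d))" .
  qed (use d e de in simp_all)
  have 3: "snd Q' (cod2 I s) \<bullet> (fst Q' (tgt I (dom2 I s)) \<rhd> F2 F s) = snd Q' (dom2 I s)"
    if s: "s \<in> Cell2 I" for s
  proof (rule inv2_cancel_right[of "m (tgt I (dom2 I s)) \<lhd> F1 F (dom2 I s)"])
    have sw: "(fst Q' (tgt I (dom2 I s)) \<rhd> F2 F s) \<bullet> (m (tgt I (dom2 I s)) \<lhd> F1 F (dom2 I s)) =
      (m (tgt I (dom2 I s)) \<lhd> F1 F (cod2 I s)) \<bullet> (fst Q (tgt I (dom2 I s)) \<rhd> F2 F s)"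
      by (rule whisker_swap[symmetric]) (use s in auto)
    have "(snd Q' (cod2 I s) \<bullet> (fst Q' (tgt I (dom2 I s)) \<rhd> F2 F s)) \<bullet> (m (tgt I (dom2 I s)) \<lhd> F1 F (dom2 I s)) =
      (snd Q' (cod2 I s) \<bullet> (m (tgt I (dom2 I s)) \<lhd> F1 F (cod2 I s))) \<bullet> (fst Q (tgt I (dom2 I s)) \<rhd> F2 F s)"
      using s sw by simp
    also have "\<dots> = m (src I (dom2 I s)) \<bullet> (snd Q (cod2 I s) \<bullet> (fst Q (tgt I (dom2 I s)) \<rhd> F2 F s))"
      using mn[of "cod2 I s", symmetric] s by simp
    also have "\<dots> = snd Q' (dom2 I s) \<bullet> (m (tgt I (dom2 I s)) \<lhd> F1 F (dom2 I s))"
      using eqs s mn[of "dom2 I s"] by simp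
    finally show "(snd Q' (cod2 I s) \<bullet> (fst Q' (tgt I (dom2 I s)) \<rhd> F2 F s)) \<bullet> (m (tgt I (dom2 I s)) \<lhd> F1 F (dom2 I s)) =
      snd Q' (dom2 I s) \<bullet> (m (tgt I (dom2 I s)) \<lhd> F1 F (dom2 I s))" .
  qed (use s in simp_all)
  show "oplax_pred Q'" unfolding oplax_pred_iff using 1 2 3 by simp
qed

lemma is_oplax_bicolimit_iff: "is_oplax_bicolimit I C F L Q \<longleftrightarrow> ins_rep oplax_ins oplax_pred L Q"
proof -
  have "ins_rep oplax_ins oplax_pred L Q \<Longrightarrow> L \<in> Cell0 C \<and> ins_cocone oplax_ins L Q \<and> oplax_pred Q"
    by (simp add: ins_rep_def)
  then show ?thesis
    unfolding is_oplax_bicolimit_def oplax_cocone_iff oplax_cocone_cat_eq compose_cocone_eq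
    using ins_rep_iff[OF wf_oplax_ins _ _ post_stable_oplax] by blast
qed

end

lemma bicocomplete_has_oplax_bicolimits:
  fixes \<kappa> :: "'u rel" and C :: "('k0, 'k1, 'k2) two_cat"
  assumes \<kappa>: "smallness_cardinal \<kappa>" and C: "two_category C" and bi: "bicocomplete \<kappa> C"
  shows "has_oplax_bicolimits \<kappa> C"
  unfolding has_oplax_bicolimits_def
proof (intro allI impI)
  fix I :: "('u, 'u, 'u) two_cat" and F :: "('u, 'u, 'u, 'k0, 'k1, 'k2) two_fun"
  assume I: "small_two_category \<kappa> I" and F: "two_functor I C F"
  interpret diagram C I F
    using C I F by unfold_locales (auto simp: small_two_category_def)
  have small: "|Cell0 I| <o \<kappa>" "|Cell1 I| <o \<kappa>" "|Cell2 I| <o \<kappa>"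
    using I by (auto simp: small_two_category_def small_set_def)
  have "\<exists>L Q. ins_rep oplax_ins (\<lambda>Q. \<forall>(s, t) \<in> oplax_eqs Q. s = t) L Q"
  proof (rule bicocomplete_equations[OF \<kappa> bi wf_oplax_ins])
    show "|Pt oplax_ins| <o \<kappa>" "|Ed oplax_ins| <o \<kappa>" using small by simp_all
    have "|{(d, e) \<in> Cell1 I \<times> Cell1 I. tgt I d = src I e}| <o \<kappa>"
      by (rule small_subset[OF _ small_Times[OF \<kappa> small(2) small(2)]]) auto
    then show "|oplax_eqs Q| <o \<kappa>" for Q
      unfolding oplax_eqs_def by (intro small_Un[OF \<kappa>] small_image small)
  next
    fix L Q s t assume Q: "ins_cocone oplax_ins L Q" and st: "(s, t) \<in> oplax_eqs Q"
    note [simp] = ins_cocone_simps(1-6)[OF Q]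
    show "s \<in> Cell2 C \<and> t \<in> Cell2 C \<and> dom2 C s = dom2 C t \<and> cod2 C s = cod2 C t \<and> tgt C (dom2 C s) = L"
      using st unfolding oplax_eqs_def by auto
  next
    fix L Q f assume Q: "ins_cocone oplax_ins L Q" and f: "f \<in> Cell1 C" "src C f = L"
    note [simp] = ins_cocone_simps(1-6)[OF Q]
    show "oplax_eqs (ins_post oplax_ins Q f) = (\<lambda>(s, t). (f \<rhd> s, f \<rhd> t)) ` oplax_eqs Q"
      unfolding oplax_eqs_def image_Un image_image
      using f by (intro arg_cong2[where f = "(\<union>)"] image_cong refl) (auto simp: ins_post_def)
  next
    show "replete oplax_ins (\<lambda>_. True) (\<lambda>Q. \<forall>(s, t) \<in> oplax_eqs Q. s = t)"
      unfolding oplax_pred_def[abs_def, symmetric] by (rule replete_oplax)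
  qed
  then show "\<exists>L Q. is_oplax_bicolimit I C F L Q"
    unfolding is_oplax_bicolimit_iff oplax_pred_def[abs_def] .
qed

section \<open>Pseudocoequalizing pairs\<close>

context strict_two_category
begin

lemma codescent_simps:
  assumes "codescent_object C X"
  shows "X0 X \<in> Cell0 C" "X1 X \<in> Cell0 C" "X2 X \<in> Cell0 C"
    "p0 X \<in> Cell1 C" "src C (p0 X) = X2 X" "tgt C (p0 X) = X1 X"
    "p1 X \<in> Cell1 C" "src C (p1 X) = X2 X" "tgt C (p1 X) = X1 X"
    "p2 X \<in> Cell1 C" "src C (p2 X) = X2 X" "tgt C (p2 X) = X1 X"
    "d0 X \<in> Cell1 C" "src C (d0 X) = X1 X" "tgt C (d0 X) = X0 X"
    "d1 X \<in> Cell1 C" "src C (d1 X) = X1 X" "tgt C (d1 X) = X0 X"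
    "ii X \<in> Cell1 C" "src C (ii X) = X0 X" "tgt C (ii X) = X1 X"
    "inv2 (n0 X)" "dom2 C (n0 X) = d0 X \<cdot> ii X" "cod2 C (n0 X) = id1 C (X0 X)"
    "inv2 (n1 X)" "dom2 C (n1 X) = d1 X \<cdot> ii X" "cod2 C (n1 X) = id1 C (X0 X)"
    "inv2 (th01 X)" "dom2 C (th01 X) = d0 X \<cdot> p0 X" "cod2 C (th01 X) = d0 X \<cdot> p1 X"
    "inv2 (th02 X)" "dom2 C (th02 X) = d1 X \<cdot> p0 X" "cod2 C (th02 X) = d0 X \<cdot> p2 X"
    "inv2 (th12 X)" "dom2 C (th12 X) = d1 X \<cdot> p1 X" "cod2 C (th12 X) = d1 X \<cdot> p2 X"
  using assms by (auto simp: codescent_object_def inv2_def)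

lemma pseudocoequalizes_iff:
  "pseudocoequalizes C X B Q \<longleftrightarrow>
     fst Q \<in> Cell1 C \<and> src C (fst Q) = X0 X \<and> tgt C (fst Q) = B \<and>
     inv2 (snd Q) \<and> dom2 C (snd Q) = fst Q \<cdot> d0 X \<and> cod2 C (snd Q) = fst Q \<cdot> d1 X \<and>
     (fst Q \<rhd> n1 X) \<bullet> (snd Q \<lhd> ii X) = fst Q \<rhd> n0 X \<and>
     (fst Q \<rhd> th12 X) \<bullet> (snd Q \<lhd> p1 X) \<bullet> (fst Q \<rhd> th01 X) =
     (snd Q \<lhd> p2 X) \<bullet> (fst Q \<rhd> th02 X) \<bullet> (snd Q \<lhd> p0 X)"
  by (cases Q) (auto simp: pseudocoequalizes_def inv2_def[symmetric])

lemma pseudocoeq_morphism_iff: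
  "pseudocoeq_morphism C X Q Q' t \<longleftrightarrow> t \<in> Cell2 C \<and> dom2 C t = fst Q \<and> cod2 C t = fst Q' \<and>
     snd Q' \<bullet> (t \<lhd> d0 X) = (t \<lhd> d1 X) \<bullet> snd Q"
  by (cases Q; cases Q') (auto simp: pseudocoeq_morphism_def)

lemma pseudocoeq_cat_simps [simp]:
  "Q \<in> Obj (pseudocoeq_cat C X B) \<longleftrightarrow> pseudocoequalizes C X B Q"
  "a \<in> Arr (pseudocoeq_cat C X B) \<longleftrightarrow> pseudocoequalizes C X B (fst a) \<and>
     pseudocoequalizes C X B (fst (snd a)) \<and> pseudocoeq_morphism C X (fst a) (fst (snd a)) (snd (snd a))"
  "Dom (pseudocoeq_cat C X B) a = fst a"
  "Cod (pseudocoeq_cat C X B) a = fst (snd a)"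
  "Idt (pseudocoeq_cat C X B) Q = (Q, Q, id2 C (fst Q))"
  "Cmp (pseudocoeq_cat C X B) b a = (fst a, fst (snd b), snd (snd b) \<bullet> snd (snd a))"
  by (auto simp: pseudocoeq_cat_def split: prod.splits)

lemma category_pseudocoeq_cat:
  assumes X: "codescent_object C X"
  shows "category (pseudocoeq_cat C X B)"
  unfolding category_def
proof (intro conjI ballI impI)
  note [simp] = codescent_simps[OF X]
  let ?A = "pseudocoeq_cat C X B"
  {
    fix a assume a: "a \<in> Arr ?A"
    show "Dom ?A a \<in> Obj ?A" "Cod ?A a \<in> Obj ?A" using a by auto
    show "Cmp ?A a (Idt ?A (Dom ?A a)) = a" "Cmp ?A (Idt ?A (Cod ?A a)) a = a"
      using a by (auto simp: pseudocoeq_morphism_iff intro!: prod_eqI)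
  }
  {
    fix Q assume "Q \<in> Obj ?A"
    then show "Idt ?A Q \<in> hom_set ?A Q Q"
      by (simp add: pseudocoeq_morphism_iff pseudocoequalizes_iff)
  }
  {
    fix a b assume a: "a \<in> Arr ?A" and b: "b \<in> Arr ?A" and ab: "Cod ?A a = Dom ?A b"
    obtain P Q m where a': "a = (P, Q, m)" by (cases a)
    obtain R n where b': "b = (Q, R, n)" using ab a' by (cases b) auto
    have P: "pseudocoequalizes C X B P" and Q: "pseudocoequalizes C X B Q" and R: "pseudocoequalizes C X B R"
      and m: "pseudocoeq_morphism C X P Q m" and n: "pseudocoeq_morphism C X Q R n"
      using a b a' b' by auto
    note [simp] = P[unfolded pseudocoequalizes_iff] Q[unfolded pseudocoequalizes_iff] R[unfolded pseudocoequalizes_iff]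
    have m': "m \<in> Cell2 C" "dom2 C m = fst P" "cod2 C m = fst Q" "snd Q \<bullet> (m \<lhd> d0 X) = (m \<lhd> d1 X) \<bullet> snd P"
      and n': "n \<in> Cell2 C" "dom2 C n = fst Q" "cod2 C n = fst R" "snd R \<bullet> (n \<lhd> d0 X) = (n \<lhd> d1 X) \<bullet> snd Q"
      using m n by (auto simp: pseudocoeq_morphism_iff)
    have "snd R \<bullet> ((n \<bullet> m) \<lhd> d0 X) = (snd R \<bullet> (n \<lhd> d0 X)) \<bullet> (m \<lhd> d0 X)"
      using m'(1-3) n'(1-3) by simp
    also have "\<dots> = (n \<lhd> d1 X) \<bullet> (snd Q \<bullet> (m \<lhd> d0 X))"
      unfolding n'(4) using m'(1-3) n'(1-3) by simp
    also have "\<dots> = ((n \<bullet> m) \<lhd> d1 X) \<bullet> snd P"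
      unfolding m'(4) using m'(1-3) n'(1-3) by simp
    finally have "pseudocoeq_morphism C X P R (n \<bullet> m)"
      unfolding pseudocoeq_morphism_iff using m'(1-3) n'(1-3) by simp
    then show "Cmp ?A b a \<in> hom_set ?A (Dom ?A a) (Cod ?A b)"
      using P R a' b' by simp
  }
  {
    fix a b c assume "a \<in> Arr ?A" "b \<in> Arr ?A" "c \<in> Arr ?A" "Cod ?A a = Dom ?A b" "Cod ?A b = Dom ?A c"
    then show "Cmp ?A c (Cmp ?A b a) = Cmp ?A (Cmp ?A c b) a"
      by (auto simp: pseudocoeq_morphism_iff)
  }
qed

end

locale codescent_ins = strict_two_category C
  for C :: "('k0, 'k1, 'k2) two_cat" +
  fixes X :: "('k0, 'k1, 'k2) codescent" and c z0 z1 :: 'u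
  assumes X: "codescent_object C X" and z: "z0 \<noteq> z1"
begin

lemmas X_simps [simp] = codescent_simps[OF X]

lemma z_simps [simp]: "z0 \<noteq> z1" "z1 \<noteq> z0" using z by auto

text \<open>Families cannot demand invertible 2-cells, so \<open>\<xi>\<close> at \<open>z0\<close>
  is accompanied by a candidate inverse at \<open>z1\<close> in the opposite direction; the first
  two pairs of \<open>cod_eqs\<close> make it an inverse.\<close>

definition cod_ins :: "('u, 'u, 'k0, 'k1) ins" where
  "cod_ins = \<lparr>Pt = {c}, Ed = {z0, z1}, tp = (\<lambda>_. c), sp = (\<lambda>_. c), ob = (\<lambda>_. X0 X),
     fl = (\<lambda>k. if k = z0 then d0 X else d1 X), gl = (\<lambda>k. if k = z0 then d1 X else d0 X)\<rparr>"

lemma cod_ins_simps [simp]: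
  "Pt cod_ins = {c}" "Ed cod_ins = {z0, z1}" "tp cod_ins k = c" "sp cod_ins k = c" "ob cod_ins p = X0 X"
  "fl cod_ins k = (if k = z0 then d0 X else d1 X)" "gl cod_ins k = (if k = z0 then d1 X else d0 X)"
  by (simp_all add: cod_ins_def)

lemma wf_cod_ins: "wf_ins cod_ins"
  by (simp add: wf_ins_def)

definition cod_eqs :: "('u, 'u, 'k1, 'k2) fam \<Rightarrow> ('k2 \<times> 'k2) set" where
  "cod_eqs Q = (let q = fst Q c; \<xi> = snd Q z0; \<zeta> = snd Q z1 in
     {(\<zeta> \<bullet> \<xi>, id2 C (q \<cdot> d0 X)), (\<xi> \<bullet> \<zeta>, id2 C (q \<cdot> d1 X)),
      ((q \<rhd> n1 X) \<bullet> (\<xi> \<lhd> ii X), q \<rhd> n0 X),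
      ((q \<rhd> th12 X) \<bullet> (\<xi> \<lhd> p1 X) \<bullet> (q \<rhd> th01 X), (\<xi> \<lhd> p2 X) \<bullet> (q \<rhd> th02 X) \<bullet> (\<xi> \<lhd> p0 X))})"

definition cod_pred :: "('u, 'u, 'k1, 'k2) fam \<Rightarrow> bool" where
  "cod_pred Q \<longleftrightarrow> (\<forall>(s, t) \<in> cod_eqs Q. s = t)"

lemma cod_cocone_simps:
  assumes "ins_cocone cod_ins B Q"
  shows "fst Q c \<in> Cell1 C" "src C (fst Q c) = X0 X" "tgt C (fst Q c) = B"
    "snd Q z0 \<in> Cell2 C" "dom2 C (snd Q z0) = fst Q c \<cdot> d0 X" "cod2 C (snd Q z0) = fst Q c \<cdot> d1 X"
    "snd Q z1 \<in> Cell2 C" "dom2 C (snd Q z1) = fst Q c \<cdot> d1 X" "cod2 C (snd Q z1) = fst Q c \<cdot> d0 X"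
  using ins_cocone_simps(1-3)[OF assms, of c] ins_cocone_simps(4-6)[OF assms, of z0]
    ins_cocone_simps(4-6)[OF assms, of z1] by simp_all

lemma cod_pred_iff: "cod_pred Q \<longleftrightarrow>
   snd Q z1 \<bullet> snd Q z0 = id2 C (fst Q c \<cdot> d0 X) \<and> snd Q z0 \<bullet> snd Q z1 = id2 C (fst Q c \<cdot> d1 X) \<and>
   (fst Q c \<rhd> n1 X) \<bullet> (snd Q z0 \<lhd> ii X) = fst Q c \<rhd> n0 X \<and>
   (fst Q c \<rhd> th12 X) \<bullet> (snd Q z0 \<lhd> p1 X) \<bullet> (fst Q c \<rhd> th01 X) =
   (snd Q z0 \<lhd> p2 X) \<bullet> (fst Q c \<rhd> th02 X) \<bullet> (snd Q z0 \<lhd> p0 X)"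
  by (simp add: cod_pred_def cod_eqs_def Let_def)

lemma cod_pred_pair:
  assumes "ins_cocone cod_ins B Q" "cod_pred Q"
  shows "pseudocoequalizes C X B (fst Q c, snd Q z0)" "inv2 (snd Q z0)" "snd Q z1 = vinv (snd Q z0)"
proof -
  note [simp] = cod_cocone_simps[OF assms(1)]
  show i: "inv2 (snd Q z0)"
    by (rule inv2I[of _ "snd Q z1"]) (use assms(2) in \<open>simp_all add: cod_pred_iff\<close>)
  show "snd Q z1 = vinv (snd Q z0)"
    by (rule vinv_unique[symmetric, OF i]) (use assms(2) in \<open>simp_all add: cod_pred_iff\<close>)
  show "pseudocoequalizes C X B (fst Q c, snd Q z0)"
    unfolding pseudocoequalizes_iff using assms(2) i by (simp add: cod_pred_iff)
qed

text \<open>Each equation is checked after composing with an invertible whiskering of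
  \<open>t\<close>. This is pushed from right to left, across \<open>\<xi>'\<close> by
  \<open>w\<close> and across the whiskered cells of the codescent object by \<open>sw\<close>,
  until the equation for \<open>Q\<close> applies.\<close>

lemma replete_cod: "replete cod_ins (\<lambda>_. True) cod_pred"
  unfolding replete_def
proof (intro allI impI)
  fix B Q Q' m
  assume Q: "ins_cocone cod_ins B Q" and Q': "ins_cocone cod_ins B Q'" and P: "cod_pred Q"
    and m: "ins_mor cod_ins Q Q' m" and inv: "\<forall>p\<in>Pt cod_ins. inv2 (m p)"
  define q p \<xi> \<zeta> \<xi>' \<zeta>' t where defs: "q = fst Q c" "p = fst Q' c" "\<xi> = snd Q z0" "\<zeta> = snd Q z1"
    "\<xi>' = snd Q' z0" "\<zeta>' = snd Q' z1" "t = m c"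
  note [simp] = cod_cocone_simps[OF Q, folded defs] cod_cocone_simps[OF Q', folded defs]
  have it [simp]: "inv2 t" using inv by (simp add: defs)
  have ts [simp]: "dom2 C t = q" "cod2 C t = p" using ins_mor_simps(1-3)[OF m, of c] by (auto simp: defs)
  have e0: "\<xi>' \<bullet> (t \<lhd> d0 X) = (t \<lhd> d1 X) \<bullet> \<xi>" and e1: "\<zeta>' \<bullet> (t \<lhd> d1 X) = (t \<lhd> d0 X) \<bullet> \<zeta>"
    using ins_mor_eq[OF m, of z0] ins_mor_eq[OF m, of z1] by (simp_all add: defs)
  note eqs = P[unfolded cod_pred_iff, folded defs]
  have "\<zeta>' \<bullet> \<xi>' = id2 C (p \<cdot> d0 X)"
  proof (rule inv2_cancel_right[of "t \<lhd> d0 X"])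
    have "(\<zeta>' \<bullet> \<xi>') \<bullet> (t \<lhd> d0 X) = (\<zeta>' \<bullet> (t \<lhd> d1 X)) \<bullet> \<xi>" using e0 by simp
    also have "\<dots> = id2 C (p \<cdot> d0 X) \<bullet> (t \<lhd> d0 X)" unfolding e1 using eqs by simp
    finally show "(\<zeta>' \<bullet> \<xi>') \<bullet> (t \<lhd> d0 X) = id2 C (p \<cdot> d0 X) \<bullet> (t \<lhd> d0 X)" .
  qed simp_all
  moreover have "\<xi>' \<bullet> \<zeta>' = id2 C (p \<cdot> d1 X)"
  proof (rule inv2_cancel_right[of "t \<lhd> d1 X"])
    have "(\<xi>' \<bullet> \<zeta>') \<bullet> (t \<lhd> d1 X) = (\<xi>' \<bullet> (t \<lhd> d0 X)) \<bullet> \<zeta>" using e1 by simp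
    also have "\<dots> = id2 C (p \<cdot> d1 X) \<bullet> (t \<lhd> d1 X)" unfolding e0 using eqs by simp
    finally show "(\<xi>' \<bullet> \<zeta>') \<bullet> (t \<lhd> d1 X) = id2 C (p \<cdot> d1 X) \<bullet> (t \<lhd> d1 X)" .
  qed simp_all
  moreover have sw: "(p \<rhd> s) \<bullet> (t \<lhd> f) = (t \<lhd> g) \<bullet> (q \<rhd> s)"
    if "s \<in> Cell2 C" "tgt C (dom2 C s) = X0 X" "dom2 C s = f" "cod2 C s = g" for s f g
    by (rule whisker_swap[symmetric]) (use that in auto)
  have w: "(\<xi>' \<lhd> f) \<bullet> (t \<lhd> d0 X \<cdot> f) = (t \<lhd> d1 X \<cdot> f) \<bullet> (\<xi> \<lhd> f)"
    if "f \<in> Cell1 C" "tgt C f = X1 X" for f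
    using arg_cong[OF e0, of "\<lambda>s. s \<lhd> f"] that by simp
  have "(p \<rhd> n1 X) \<bullet> (\<xi>' \<lhd> ii X) = p \<rhd> n0 X"
  proof (rule inv2_cancel_right[of "t \<lhd> d0 X \<cdot> ii X"])
    have "((p \<rhd> n1 X) \<bullet> (\<xi>' \<lhd> ii X)) \<bullet> (t \<lhd> d0 X \<cdot> ii X) = ((p \<rhd> n1 X) \<bullet> (t \<lhd> d1 X \<cdot> ii X)) \<bullet> (\<xi> \<lhd> ii X)"
      using w[of "ii X"] by simp
    also have "(p \<rhd> n1 X) \<bullet> (t \<lhd> d1 X \<cdot> ii X) = (t \<lhd> id1 C (X0 X)) \<bullet> (q \<rhd> n1 X)"
      by (rule sw) simp_all
    also have "((t \<lhd> id1 C (X0 X)) \<bullet> (q \<rhd> n1 X)) \<bullet> (\<xi> \<lhd> ii X) = t \<bullet> ((q \<rhd> n1 X) \<bullet> (\<xi> \<lhd> ii X))"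
      by simp
    also have "\<dots> = (t \<lhd> id1 C (X0 X)) \<bullet> (q \<rhd> n0 X)" using eqs by simp
    also have "\<dots> = (p \<rhd> n0 X) \<bullet> (t \<lhd> d0 X \<cdot> ii X)" by (rule sw[symmetric]) simp_all
    finally show "((p \<rhd> n1 X) \<bullet> (\<xi>' \<lhd> ii X)) \<bullet> (t \<lhd> d0 X \<cdot> ii X) = (p \<rhd> n0 X) \<bullet> (t \<lhd> d0 X \<cdot> ii X)" .
  qed simp_all
  moreover have "(p \<rhd> th12 X) \<bullet> (\<xi>' \<lhd> p1 X) \<bullet> (p \<rhd> th01 X) = (\<xi>' \<lhd> p2 X) \<bullet> (p \<rhd> th02 X) \<bullet> (\<xi>' \<lhd> p0 X)"
  proof (rule inv2_cancel_right[of "t \<lhd> d0 X \<cdot> p0 X"])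
    have "((p \<rhd> th12 X) \<bullet> (\<xi>' \<lhd> p1 X) \<bullet> (p \<rhd> th01 X)) \<bullet> (t \<lhd> d0 X \<cdot> p0 X) =
       (p \<rhd> th12 X) \<bullet> (\<xi>' \<lhd> p1 X) \<bullet> ((p \<rhd> th01 X) \<bullet> (t \<lhd> d0 X \<cdot> p0 X))" by simp
    also have "\<dots> = (p \<rhd> th12 X) \<bullet> ((\<xi>' \<lhd> p1 X) \<bullet> (t \<lhd> d0 X \<cdot> p1 X)) \<bullet> (q \<rhd> th01 X)" by (subst sw) simp_all
    also have "\<dots> = ((p \<rhd> th12 X) \<bullet> (t \<lhd> d1 X \<cdot> p1 X)) \<bullet> (\<xi> \<lhd> p1 X) \<bullet> (q \<rhd> th01 X)" by (subst w) simp_all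
    also have "(p \<rhd> th12 X) \<bullet> (t \<lhd> d1 X \<cdot> p1 X) = (t \<lhd> d1 X \<cdot> p2 X) \<bullet> (q \<rhd> th12 X)"
      by (rule sw) simp_all
    also have "((t \<lhd> d1 X \<cdot> p2 X) \<bullet> (q \<rhd> th12 X)) \<bullet> (\<xi> \<lhd> p1 X) \<bullet> (q \<rhd> th01 X) =
        (t \<lhd> d1 X \<cdot> p2 X) \<bullet> ((q \<rhd> th12 X) \<bullet> (\<xi> \<lhd> p1 X) \<bullet> (q \<rhd> th01 X))" by simp
    also have "\<dots> = ((t \<lhd> d1 X \<cdot> p2 X) \<bullet> (\<xi> \<lhd> p2 X)) \<bullet> (q \<rhd> th02 X) \<bullet> (\<xi> \<lhd> p0 X)" using eqs by simp
    also have "\<dots> = (\<xi>' \<lhd> p2 X) \<bullet> ((t \<lhd> d0 X \<cdot> p2 X) \<bullet> (q \<rhd> th02 X)) \<bullet> (\<xi> \<lhd> p0 X)" by (subst w[symmetric]) simp_all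
    also have "(t \<lhd> d0 X \<cdot> p2 X) \<bullet> (q \<rhd> th02 X) = (p \<rhd> th02 X) \<bullet> (t \<lhd> d1 X \<cdot> p0 X)"
      by (rule sw[symmetric]) simp_all
    also have "(\<xi>' \<lhd> p2 X) \<bullet> ((p \<rhd> th02 X) \<bullet> (t \<lhd> d1 X \<cdot> p0 X)) \<bullet> (\<xi> \<lhd> p0 X) =
      (\<xi>' \<lhd> p2 X) \<bullet> (p \<rhd> th02 X) \<bullet> ((t \<lhd> d1 X \<cdot> p0 X) \<bullet> (\<xi> \<lhd> p0 X))" by simp
    also have "\<dots> = ((\<xi>' \<lhd> p2 X) \<bullet> (p \<rhd> th02 X) \<bullet> (\<xi>' \<lhd> p0 X)) \<bullet> (t \<lhd> d0 X \<cdot> p0 X)" by (subst w[symmetric]) simp_all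
    finally show "((p \<rhd> th12 X) \<bullet> (\<xi>' \<lhd> p1 X) \<bullet> (p \<rhd> th01 X)) \<bullet> (t \<lhd> d0 X \<cdot> p0 X) =
      ((\<xi>' \<lhd> p2 X) \<bullet> (p \<rhd> th02 X) \<bullet> (\<xi>' \<lhd> p0 X)) \<bullet> (t \<lhd> d0 X \<cdot> p0 X)" .
  qed simp_all
  ultimately show "cod_pred Q'" unfolding cod_pred_iff defs by blast
qed

lemma cod_eqs_post:
  assumes "ins_cocone cod_ins L Q" "f \<in> Cell1 C" "src C f = L"
  shows "cod_eqs (ins_post cod_ins Q f) = (\<lambda>(s, t). (f \<rhd> s, f \<rhd> t)) ` cod_eqs Q"
  using cod_cocone_simps[OF assms(1)] assms(2,3) by (simp add: cod_eqs_def Let_def ins_post_def)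

lemma post_stable_cod: "post_stable cod_ins cod_pred"
  unfolding post_stable_def cod_pred_def by (auto simp: cod_eqs_post)

definition cod_pair where
  "cod_pair = \<lparr>onO = (\<lambda>Q. (fst Q c, snd Q z0)),
     onA = (\<lambda>a. ((fst (fst a) c, snd (fst a) z0), (fst (fst (snd a)) c, snd (fst (snd a)) z0), snd (snd a) c))\<rparr>"

text \<open>Only the edge \<open>z0\<close> imposes a condition: the cells at \<open>z1\<close> are
  the inverses of those at \<open>z0\<close>, so compatibility with them follows by
  cancellation.\<close>

lemma cod_mor_iff:
  assumes Q: "ins_cocone cod_ins B Q" "cod_pred Q" and Q': "ins_cocone cod_ins B Q'" "cod_pred Q'"
  shows "ins_mor cod_ins Q Q' m \<longleftrightarrow> m \<in> extensional {c} \<and>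
     pseudocoeq_morphism C X (fst Q c, snd Q z0) (fst Q' c, snd Q' z0) (m c)"
proof -
  note [simp] = cod_cocone_simps[OF Q(1)] cod_cocone_simps[OF Q'(1)] cod_pred_pair(2)[OF Q] cod_pred_pair(2)[OF Q']
  have "(m c \<lhd> d0 X) \<bullet> snd Q z1 = snd Q' z1 \<bullet> (m c \<lhd> d1 X)"
    if m: "m c \<in> Cell2 C" "dom2 C (m c) = fst Q c" "cod2 C (m c) = fst Q' c"
      "snd Q' z0 \<bullet> (m c \<lhd> d0 X) = (m c \<lhd> d1 X) \<bullet> snd Q z0"
  proof (rule inv2_cancel_left[of "snd Q' z0"])
    have "snd Q' z0 \<bullet> (m c \<lhd> d0 X) \<bullet> snd Q z1 = (snd Q' z0 \<bullet> (m c \<lhd> d0 X)) \<bullet> snd Q z1" using m(1-3) by simp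
    also have "\<dots> = snd Q' z0 \<bullet> snd Q' z1 \<bullet> (m c \<lhd> d1 X)"
      unfolding m(4) cod_pred_pair(3)[OF Q] cod_pred_pair(3)[OF Q'] using m(1-3) by simp
    finally show "snd Q' z0 \<bullet> (m c \<lhd> d0 X) \<bullet> snd Q z1 = snd Q' z0 \<bullet> snd Q' z1 \<bullet> (m c \<lhd> d1 X)" .
  qed (use m(1-3) in simp_all)
  then show ?thesis
    unfolding pseudocoeq_morphism_iff ins_mor_def by (cases Q; cases Q') auto
qed

lemma functor_cod_pair: "is_functor (ins_cat cod_ins cod_pred B) (pseudocoeq_cat C X B) cod_pair"
  unfolding is_functor_def using cod_pred_pair(1)
  by (auto simp: cod_pair_def cod_mor_iff)

lemma fully_faithful_cod_pair:
  "fully_faithful (ins_cat cod_ins cod_pred B) (pseudocoeq_cat C X B) cod_pair"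
  unfolding fully_faithful_def
proof (intro ballI)
  fix Q Q' b assume "Q \<in> Obj (ins_cat cod_ins cod_pred B)" "Q' \<in> Obj (ins_cat cod_ins cod_pred B)"
    and b: "b \<in> hom_set (pseudocoeq_cat C X B) (onO cod_pair Q) (onO cod_pair Q')"
  then have Q: "ins_cocone cod_ins B Q" "cod_pred Q" and Q': "ins_cocone cod_ins B Q'" "cod_pred Q'" by auto
  obtain t where t: "b = ((fst Q c, snd Q z0), (fst Q' c, snd Q' z0), t)"
    "pseudocoeq_morphism C X (fst Q c, snd Q z0) (fst Q' c, snd Q' z0) t"
    using b by (cases b) (auto simp: cod_pair_def)
  show "\<exists>!a. a \<in> hom_set (ins_cat cod_ins cod_pred B) Q Q' \<and> onA cod_pair a = b"
  proof (rule ex1I[of _ "(Q, Q', \<lambda>p \<in> {c}. t)"])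
    show "(Q, Q', \<lambda>p \<in> {c}. t) \<in> hom_set (ins_cat cod_ins cod_pred B) Q Q' \<and>
       onA cod_pair (Q, Q', \<lambda>p \<in> {c}. t) = b"
      using Q Q' t by (simp add: cod_mor_iff cod_pair_def)
    fix a assume a: "a \<in> hom_set (ins_cat cod_ins cod_pred B) Q Q' \<and> onA cod_pair a = b"
    then have "ins_mor cod_ins Q Q' (snd (snd a))" "snd (snd a) c = t" by (auto simp: cod_pair_def t)
    then have "snd (snd a) = (\<lambda>p \<in> {c}. t)"
      using cod_mor_iff[OF Q Q'] by (auto intro!: extensionalityI[of _ "{c}"])
    then show "a = (Q, Q', \<lambda>p \<in> {c}. t)" using a by (cases a) auto
  qed
qed

lemma surj_cod_pair:
  assumes "pseudocoequalizes C X B P"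
  shows "\<exists>Q. ins_cocone cod_ins B Q \<and> cod_pred Q \<and> (fst Q c, snd Q z0) = P"
proof -
  define Q where "Q = (\<lambda>p \<in> {c}. fst P, \<lambda>k \<in> {z0, z1}. if k = z0 then snd P else vinv (snd P))"
  note [simp] = assms[unfolded pseudocoequalizes_iff]
  have [simp]: "fst Q c = fst P" "snd Q z0 = snd P" "snd Q z1 = vinv (snd P)" by (simp_all add: Q_def)
  have "ins_cocone cod_ins B Q"
    by (rule ins_coconeI) (auto simp: Q_def)
  moreover have "cod_pred Q" unfolding cod_pred_iff by simp
  ultimately show ?thesis by (intro exI[of _ Q]) simp
qed

text \<open>\<open>cod_pair\<close> forgets the inverse cell, which is determined. It is fully
  faithful and surjective on objects, so \<open>equivalence_transfer\<close> applies.\<close>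

lemma is_bicoequalizer_of_rep:
  assumes "ins_rep cod_ins cod_pred L Q"
  shows "is_bicoequalizer C X L (fst Q c, snd Q z0)"
  unfolding is_bicoequalizer_def
proof (intro conjI ballI)
  have L: "L \<in> Cell0 C" and Q: "ins_cocone cod_ins L Q" "cod_pred Q" using assms by (auto simp: ins_rep_def)
  note [simp] = cod_cocone_simps[OF Q(1)]
  show "L \<in> Cell0 C" by fact
  show "pseudocoequalizes C X L (fst Q c, snd Q z0)" using cod_pred_pair[OF Q] by simp
  fix B assume B: "B \<in> Cell0 C"
  show "is_equivalence (hom_cat C L B) (pseudocoeq_cat C X B) (compose_pair C (fst Q c, snd Q z0))"
  proof (rule equivalence_transfer[OF category_hom_cat category_ins_cat[OF wf_cod_ins] category_pseudocoeq_cat[OF X]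
        _ functor_cod_pair fully_faithful_cod_pair])
    show "is_equivalence (hom_cat C L B) (ins_cat cod_ins cod_pred B) (ins_fun cod_ins Q)"
      using assms B ins_rep_iff[OF wf_cod_ins Q post_stable_cod L] by blast
  next
    fix P assume "P \<in> Obj (pseudocoeq_cat C X B)"
    then obtain R where "ins_cocone cod_ins B R" "cod_pred R" "(fst R c, snd R z0) = P"
      using surj_cod_pair[of B P] by auto
    then show "\<exists>R\<in>Obj (ins_cat cod_ins cod_pred B). onO cod_pair R = P"
      by (intro bexI[of _ R]) (simp_all add: cod_pair_def)
  qed (simp_all add: compose_pair_def ins_fun_def cod_pair_def ins_post_def pair_post_def)
qed

end

lemma bicocomplete_has_bicoequalizers:
  fixes \<kappa> :: "'u rel" and C :: "('k0, 'k1, 'k2) two_cat"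
  assumes \<kappa>: "smallness_cardinal \<kappa>" and C: "two_category C" and bi: "bicocomplete \<kappa> C"
  shows "has_bicoequalizers C"
  unfolding has_bicoequalizers_def
proof (intro allI impI)
  fix X assume X: "codescent_object C X"
  \<comment> \<open>Supplies two distinct elements of \<open>'u\<close>, naming the edges for
    \<open>\<xi>\<close> and its inverse.\<close>
  obtain e :: "bool \<Rightarrow> 'u" where e: "inj e"
    using ex_injI[OF finite_ordLeq[OF finite smallness_infinite[OF \<kappa>]]] by blast
  interpret codescent_ins C X "e False" "e False" "e True"
    using C X e by unfold_locales (auto simp: inj_eq)
  have "\<exists>L Q. ins_rep cod_ins (\<lambda>Q. \<forall>(s, t) \<in> cod_eqs Q. s = t) L Q"
  proof (rule bicocomplete_equations[OF \<kappa> bi wf_cod_ins])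
    show "|Pt cod_ins| <o \<kappa>" "|Ed cod_ins| <o \<kappa>" "|cod_eqs Q| <o \<kappa>" for Q
      by (rule small_finite[OF \<kappa>]; simp add: cod_eqs_def Let_def)+
  next
    fix L Q s t assume Q: "ins_cocone cod_ins L Q" and st: "(s, t) \<in> cod_eqs Q"
    note [simp] = cod_cocone_simps[OF Q]
    show "s \<in> Cell2 C \<and> t \<in> Cell2 C \<and> dom2 C s = dom2 C t \<and> cod2 C s = cod2 C t \<and> tgt C (dom2 C s) = L"
      using st unfolding cod_eqs_def Let_def by auto
  next
    show "replete cod_ins (\<lambda>_. True) (\<lambda>Q. \<forall>(s, t) \<in> cod_eqs Q. s = t)"
      unfolding cod_pred_def[abs_def, symmetric] by (rule replete_cod)
  qed (rule cod_eqs_post)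
  then show "\<exists>L Q. is_bicoequalizer C X L Q"
    using is_bicoequalizer_of_rep unfolding cod_pred_def[abs_def] by blast
qed

section \<open>From oplax bicolimits and bicoequalizers to weighted bicolimits\<close>

section \<open>Coinverters from codescent objects\<close>

context strict_two_category
begin

lemma ins_rep_faithful:
  assumes wf: "wf_ins D" and rep: "ins_rep D Pr L Q"
    and t: "t \<in> hom2 C f g" "t' \<in> hom2 C f g" and f: "src C f = L"
    and eq: "\<And>p. p \<in> Pt D \<Longrightarrow> t \<lhd> fst Q p = t' \<lhd> fst Q p"
  shows "t = t'"
proof -
  have Q: "ins_cocone D L Q" using rep by (simp add: ins_rep_def)
  have fg: "f \<in> hom1 C L (tgt C f)" "g \<in> hom1 C L (tgt C f)" "tgt C f \<in> Cell0 C" using t f by auto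
  have "ins_mor D (ins_post D Q f) (ins_post D Q g) (\<lambda>p \<in> Pt D. t \<lhd> fst Q p)"
    by (rule ins_post_mor[OF wf Q]) (use t f in auto)
  then have "\<exists>!u. u \<in> hom2 C f g \<and> (\<lambda>p \<in> Pt D. u \<lhd> fst Q p) = (\<lambda>p \<in> Pt D. t \<lhd> fst Q p)"
    using rep fg unfolding ins_rep_def by blast
  moreover have "(\<lambda>p \<in> Pt D. t' \<lhd> fst Q p) = (\<lambda>p \<in> Pt D. t \<lhd> fst Q p)"
    using eq by (auto intro: restrict_ext)
  ultimately show ?thesis using t by blast
qed

lemma ins_rep_full:
  assumes rep: "ins_rep D Pr L Q" and f: "f \<in> hom1 C L B" "g \<in> hom1 C L B" "B \<in> Cell0 C"
    and m: "ins_mor D (ins_post D Q f) (ins_post D Q g) m"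
  obtains t where "t \<in> hom2 C f g" "\<And>p. p \<in> Pt D \<Longrightarrow> t \<lhd> fst Q p = m p"
proof -
  obtain t where t: "t \<in> hom2 C f g" "(\<lambda>p \<in> Pt D. t \<lhd> fst Q p) = m"
    using rep f m unfolding ins_rep_def by blast
  show thesis
  proof (rule that[OF t(1)])
    fix p assume "p \<in> Pt D"
    then show "t \<lhd> fst Q p = m p" using fun_cong[OF t(2), of p] by simp
  qed
qed

text \<open>The pointwise inverses form a morphism of families and lift to a 2-cell
  \<open>u\<close>. Both composites with \<open>t\<close> are identities on every leg, hence
  identities by \<open>ins_rep_faithful\<close>.\<close>

lemma ins_rep_inv2:
  assumes wf: "wf_ins D" and rep: "ins_rep D Pr L Q"
    and t: "t \<in> hom2 C f g" and f: "src C f = L"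
    and inv: "\<And>p. p \<in> Pt D \<Longrightarrow> inv2 (t \<lhd> fst Q p)"
  shows "inv2 t"
proof -
  have Q: "ins_cocone D L Q" using rep by (simp add: ins_rep_def)
  note [simp] = ins_cocone_simps(1-6)[OF Q]
  have ts [simp]: "t \<in> Cell2 C" "dom2 C t = f" "cod2 C t = g" "f \<in> Cell1 C" "g \<in> Cell1 C" "src C g = L"
    "tgt C g = tgt C f" "tgt C f \<in> Cell0 C" "src C f = L"
    using t f by auto
  have fg: "f \<in> hom1 C L (tgt C f)" "g \<in> hom1 C L (tgt C f)" "tgt C f \<in> Cell0 C" by simp_all
  have m: "ins_mor D (ins_post D Q f) (ins_post D Q g) (\<lambda>p \<in> Pt D. t \<lhd> fst Q p)"
    by (rule ins_post_mor[OF wf Q]) simp_all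
  have "ins_mor D (ins_post D Q g) (ins_post D Q f) (\<lambda>p \<in> Pt D. vinv ((\<lambda>p \<in> Pt D. t \<lhd> fst Q p) p))"
    by (rule ins_mor_inverse[OF wf ins_post_cocone[OF wf Q, of f "tgt C f"]
          ins_post_cocone[OF wf Q, of g "tgt C f"] m]) (use inv in simp_all)
  then obtain u where u: "u \<in> hom2 C g f" "\<And>p. p \<in> Pt D \<Longrightarrow> u \<lhd> fst Q p = vinv (t \<lhd> fst Q p)"
    by (rule ins_rep_full[OF rep fg(2,1,3)]) simp
  have us [simp]: "u \<in> Cell2 C" "dom2 C u = g" "cod2 C u = f" using u by auto
  have 1: "u \<bullet> t = id2 C f"
    by (rule ins_rep_faithful[OF wf rep, of _ f f]) (use u inv in simp_all)
  have 2: "t \<bullet> u = id2 C g"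
    by (rule ins_rep_faithful[OF wf rep, of _ g g]) (use u inv in simp_all)
  show ?thesis by (rule inv2I[of _ u]) (simp_all add: 1 2)
qed

text \<open>
  The codescent object is chosen so that its first equation says \<open>\<xi> i = (q s) i\<close> and, given this,
  its second equation reduces to \<open>\<xi> j = (q s) j\<close>. As \<open>i\<close> and \<open>j\<close> jointly detect 2-cells of this kind,
  a pseudocoequalizing pair is just a \<open>q\<close> that inverts \<open>s\<close>, with \<open>\<xi> = q s\<close>.
\<close>

lemma coinverter_of_bicoequalizer:
  assumes bc: "has_bicoequalizers C"
    and cells: "B0 \<in> Cell0 C" "a0 \<in> hom1 C Y1 B0" "a1 \<in> hom1 C Y1 B0" "i \<in> hom1 C B0 Y1" "j \<in> hom1 C Y2 Y1"
    and m0: "inv2 m0" "dom2 C m0 = a0 \<cdot> i" "cod2 C m0 = id1 C B0"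
    and m1: "inv2 m1" "dom2 C m1 = a1 \<cdot> i" "cod2 C m1 = id1 C B0"
    and s: "s \<in> hom2 C a0 a1" and si: "m1 \<bullet> (s \<lhd> i) = m0" and sj: "inv2 (s \<lhd> j)"
    and unique: "\<And>q \<xi>. q \<in> Cell1 C \<Longrightarrow> src C q = B0 \<Longrightarrow> \<xi> \<in> hom2 C (q \<cdot> a0) (q \<cdot> a1) \<Longrightarrow>
       \<xi> \<lhd> i = q \<rhd> (s \<lhd> i) \<Longrightarrow> \<xi> \<lhd> j = q \<rhd> (s \<lhd> j) \<Longrightarrow> \<xi> = q \<rhd> s"
  shows "\<exists>p M. localizes (\<lambda>f. inv2 (f \<rhd> s)) p B0 M"
proof -
  have c1 [simp]: "a0 \<in> Cell1 C" "src C a0 = Y1" "tgt C a0 = B0" "a1 \<in> Cell1 C" "src C a1 = Y1" "tgt C a1 = B0"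
    "i \<in> Cell1 C" "src C i = B0" "tgt C i = Y1" "j \<in> Cell1 C" "src C j = Y2" "tgt C j = Y1"
    "Y1 \<in> Cell0 C" "Y2 \<in> Cell0 C"
    using cells by auto
  have c2 [simp]: "s \<in> Cell2 C" "dom2 C s = a0" "cod2 C s = a1" using s by auto
  note [simp] = cells(1) m0 m1 sj
  have isi: "inv2 (s \<lhd> i)"
    by (rule inv2_right_factor[of m1]) (simp_all add: si)
  \<comment> \<open>The codescent object has \<open>p0 = p2 = i \<cdot> w\<close> and
    \<open>p1 = j\<close>. Up to \<open>m0\<close>, \<open>m1\<close> and \<open>s \<lhd> j\<close>,
    all composites of these with \<open>a0\<close> and \<open>a1\<close> are \<open>w\<close>, which
    supplies the three theta cells; invertibility of \<open>s \<lhd> j\<close> enters in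
    \<open>th12\<close>.\<close>
  define w where "w = a0 \<cdot> j"
  have w [simp]: "w \<in> Cell1 C" "src C w = Y2" "tgt C w = B0" by (simp_all add: w_def)
  define X where "X = \<lparr>X0 = B0, X1 = Y1, X2 = Y2, p0 = i \<cdot> w, p1 = j, p2 = i \<cdot> w, d0 = a0, d1 = a1, ii = i,
     n0 = m0, n1 = m1, th01 = m0 \<lhd> w, th02 = vinv (m0 \<lhd> w) \<bullet> (m1 \<lhd> w), th12 = vinv (m1 \<lhd> w) \<bullet> vinv (s \<lhd> j)\<rparr>"
  have Xs [simp]: "X0 X = B0" "X1 X = Y1" "X2 X = Y2" "p0 X = i \<cdot> w" "p1 X = j" "p2 X = i \<cdot> w"
    "d0 X = a0" "d1 X = a1" "ii X = i" "n0 X = m0" "n1 X = m1"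
    "th01 X = m0 \<lhd> w" "th02 X = vinv (m0 \<lhd> w) \<bullet> (m1 \<lhd> w)" "th12 X = vinv (m1 \<lhd> w) \<bullet> vinv (s \<lhd> j)"
    by (simp_all add: X_def)
  have ww: "a0 \<cdot> j = w" by (simp add: w_def)
  have X: "codescent_object C X"
    unfolding codescent_object_def inv2_def[symmetric]
    by (simp add: inv2_def[symmetric]) (simp add: ww)
  have niw: "(m1 \<lhd> w) \<bullet> (s \<lhd> i \<cdot> w) = m0 \<lhd> w"
    using arg_cong[OF si, of "\<lambda>s. s \<lhd> w"] by simp
  have isiw: "inv2 (s \<lhd> i \<cdot> w)" using inv2_wr[OF isi, of w] by simp
  have pair: "pseudocoequalizes C X B (q, \<xi>) \<longleftrightarrow> \<xi> = q \<rhd> s \<and> inv2 (q \<rhd> s)"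
    if q [simp]: "q \<in> Cell1 C" "src C q = B0" "tgt C q = B" for q \<xi> B
  proof -
    let ?N0 = "q \<rhd> (m0 \<lhd> w)" and ?N1 = "q \<rhd> (m1 \<lhd> w)" and ?S = "q \<rhd> (s \<lhd> i \<cdot> w)"
    have N: "?N1 \<bullet> ?S = ?N0" using arg_cong[OF niw, of "wl C q"] by simp
    have iS [simp]: "inv2 ?S" using isiw by simp
    \<comment> \<open>This is the right side of the second codescent equation once
      \<open>\<xi>\<close> and \<open>q \<rhd> s\<close> agree on \<open>i\<close>; it collapses
      because \<open>N\<close> turns the last two factors into \<open>?N0\<close>.\<close>
    have rhs: "?S \<bullet> vinv ?N0 \<bullet> ?N1 \<bullet> ?S = ?S" unfolding N by simp
    have lhs: "vinv ?N1 \<bullet> ?N0 = ?S" unfolding N[symmetric] by simp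
    show ?thesis
    proof
      assume "pseudocoequalizes C X B (q, \<xi>)"
      then have \<xi> [simp]: "inv2 \<xi>" "dom2 C \<xi> = q \<cdot> a0" "cod2 C \<xi> = q \<cdot> a1"
        and u: "(q \<rhd> m1) \<bullet> (\<xi> \<lhd> i) = q \<rhd> m0"
        and coc: "(q \<rhd> (vinv (m1 \<lhd> w) \<bullet> vinv (s \<lhd> j))) \<bullet> (\<xi> \<lhd> j) \<bullet> ?N0 =
           (\<xi> \<lhd> i \<cdot> w) \<bullet> (q \<rhd> (vinv (m0 \<lhd> w) \<bullet> (m1 \<lhd> w))) \<bullet> (\<xi> \<lhd> i \<cdot> w)"
        by (simp_all add: pseudocoequalizes_iff)
      have \<xi>i: "\<xi> \<lhd> i = q \<rhd> (s \<lhd> i)"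
      proof (rule inv2_cancel_left[of "q \<rhd> m1"])
        show "(q \<rhd> m1) \<bullet> (\<xi> \<lhd> i) = (q \<rhd> m1) \<bullet> (q \<rhd> (s \<lhd> i))"
          unfolding u si[symmetric] by simp
      qed simp_all
      have "\<xi> \<lhd> i \<cdot> w = (\<xi> \<lhd> i) \<lhd> w" by simp
      also have "\<dots> = ?S" unfolding \<xi>i by simp
      finally have \<xi>iw: "\<xi> \<lhd> i \<cdot> w = ?S" .
      have \<xi>j: "\<xi> \<lhd> j = q \<rhd> (s \<lhd> j)"
      proof (rule inv2_cancel_right[of ?N0])
        have "vinv ?N1 \<bullet> vinv (q \<rhd> (s \<lhd> j)) \<bullet> (\<xi> \<lhd> j) \<bullet> ?N0 = vinv ?N1 \<bullet> ?N0"
          using coc unfolding \<xi>iw lhs by (simp add: ww rhs)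
        then have "vinv (q \<rhd> (s \<lhd> j)) \<bullet> (\<xi> \<lhd> j) \<bullet> ?N0 = ?N0"
          by (rule inv2_cancel_left[rotated -1]) (simp_all add: ww)
        then have "(q \<rhd> (s \<lhd> j)) \<bullet> vinv (q \<rhd> (s \<lhd> j)) \<bullet> (\<xi> \<lhd> j) \<bullet> ?N0 = (q \<rhd> (s \<lhd> j)) \<bullet> ?N0" by simp
        then show "(\<xi> \<lhd> j) \<bullet> ?N0 = (q \<rhd> (s \<lhd> j)) \<bullet> ?N0" by (simp add: ww)
      qed (simp_all add: ww)
      have "\<xi> = q \<rhd> s" by (rule unique[OF q(1,2) _ \<xi>i \<xi>j]) simp
      then show "\<xi> = q \<rhd> s \<and> inv2 (q \<rhd> s)" using \<xi> by simp
    next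
      assume a: "\<xi> = q \<rhd> s \<and> inv2 (q \<rhd> s)"
      have u: "(q \<rhd> m1) \<bullet> (q \<rhd> (s \<lhd> i)) = q \<rhd> m0" unfolding si[symmetric] by simp
      have coc: "(q \<rhd> (vinv (m1 \<lhd> w) \<bullet> vinv (s \<lhd> j))) \<bullet> (q \<rhd> (s \<lhd> j)) \<bullet> ?N0 =
           ?S \<bullet> (q \<rhd> (vinv (m0 \<lhd> w) \<bullet> (m1 \<lhd> w))) \<bullet> ?S"
        using lhs rhs by (simp add: ww)
      show "pseudocoequalizes C X B (q, \<xi>)"
        using a u coc by (simp add: pseudocoequalizes_iff)
    qed
  qed
  \<comment> \<open>With \<open>\<xi>\<close> equal to the whiskered \<open>s\<close>, compatibility
    of a 2-cell \<open>t\<close> is an instance of interchange, so every 2-cell is a morphism of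
    pairs.\<close>
  have mor: "pseudocoeq_morphism C X (q, q \<rhd> s) (q', q' \<rhd> s) t \<longleftrightarrow> t \<in> hom2 C q q'"
    if "q \<in> Cell1 C" "src C q = B0" for q q' t
  proof -
    have "(q' \<rhd> s) \<bullet> (t \<lhd> a0) = (t \<lhd> a1) \<bullet> (q \<rhd> s)" if "t \<in> hom2 C q q'"
      by (rule whisker_swap[symmetric]) (use that \<open>src C q = B0\<close> in auto)
    then show ?thesis by (auto simp: pseudocoeq_morphism_iff)
  qed
  obtain M Q where M: "is_bicoequalizer C X M Q" using bc X unfolding has_bicoequalizers_def by blast
  define p where "p = fst Q"
  have M0: "M \<in> Cell0 C" and Qp: "pseudocoequalizes C X M Q"
    and eq: "\<And>B. B \<in> Cell0 C \<Longrightarrow> is_equivalence (hom_cat C M B) (pseudocoeq_cat C X B) (compose_pair C Q)"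
    using M by (auto simp: is_bicoequalizer_def)
  have p [simp]: "p \<in> Cell1 C" "src C p = B0" "tgt C p = M"
    using Qp by (auto simp: pseudocoequalizes_iff p_def)
  have Qs: "Q = (p, p \<rhd> s)" using pair[OF p, of "snd Q"] Qp by (simp add: p_def prod_eq_iff)
  have post: "onO (compose_pair C Q) g = (g \<cdot> p, (g \<cdot> p) \<rhd> s)" if "g \<in> Cell1 C" "src C g = M" for g
    using that by (simp add: compose_pair_def pair_post_def Qs)
  have "localizes (\<lambda>f. inv2 (f \<rhd> s)) p B0 M"
    unfolding localizes_def
  proof (intro conjI ballI impI M0)
    show "p \<in> hom1 C B0 M" by simp
    fix B assume B: "B \<in> Cell0 C"
    have fn: "is_functor (hom_cat C M B) (pseudocoeq_cat C X B) (compose_pair C Q)"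
      using eq[OF B] by (simp add: is_equivalence_def)
    note ff = equivalenceD[OF category_hom_cat category_pseudocoeq_cat[OF X] eq[OF B]]
    {
      fix g assume g: "g \<in> hom1 C M B"
      then show "inv2 ((g \<cdot> p) \<rhd> s)"
        using functor_simps(1)[OF fn, of g] post[of g] pair[of "g \<cdot> p" B] by auto
    }
    {
      fix f assume f: "f \<in> hom1 C B0 B" "inv2 (f \<rhd> s)"
      then have "(f, f \<rhd> s) \<in> Obj (pseudocoeq_cat C X B)" using pair[of f B] by auto
      then obtain g b where g: "g \<in> hom1 C M B"
        and b: "b \<in> hom_set (pseudocoeq_cat C X B) (onO (compose_pair C Q) g) (f, f \<rhd> s)"
          "iso_arr (pseudocoeq_cat C X B) b"
        using ff(2) unfolding ess_surjective_def hom_cat_simps by blast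
      then obtain t where t: "b = ((g \<cdot> p, (g \<cdot> p) \<rhd> s), (f, f \<rhd> s), t)" "t \<in> hom2 C (g \<cdot> p) f"
        using post[of g] mor[of "g \<cdot> p" f] g by (cases b) auto
      obtain b' where b': "b' \<in> hom_set (pseudocoeq_cat C X B) (f, f \<rhd> s) (g \<cdot> p, (g \<cdot> p) \<rhd> s)"
        "Cmp (pseudocoeq_cat C X B) b' b = Idt (pseudocoeq_cat C X B) (g \<cdot> p, (g \<cdot> p) \<rhd> s)"
        "Cmp (pseudocoeq_cat C X B) b b' = Idt (pseudocoeq_cat C X B) (f, f \<rhd> s)"
        using b(2) unfolding iso_arr_def t(1) by (auto simp del: in_hom_set)
      have "inv2 t"
        by (rule inv2I[of _ "snd (snd b')"])
          (use b' t f mor[of f "g \<cdot> p" "snd (snd b')"] in \<open>auto simp: t(1)\<close>)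
      then show "\<exists>g \<in> hom1 C M B. \<exists>t \<in> hom2 C (g \<cdot> p) f. inv2 t" using g t(2) by blast
    }
    {
      fix g h t assume g: "g \<in> hom1 C M B" and h: "h \<in> hom1 C M B" and t: "t \<in> hom2 C (g \<cdot> p) (h \<cdot> p)"
      have "pseudocoequalizes C X B (onO (compose_pair C Q) g)" "pseudocoequalizes C X B (onO (compose_pair C Q) h)"
        using functor_simps(1)[OF fn] g h by auto
      then have "(onO (compose_pair C Q) g, onO (compose_pair C Q) h, t) \<in>
          hom_set (pseudocoeq_cat C X B) (onO (compose_pair C Q) g) (onO (compose_pair C Q) h)"
        using g h t post mor[of "g \<cdot> p" "h \<cdot> p" t] by simp
      then have "\<exists>!u. u \<in> hom_set (hom_cat C M B) g h \<and>
          onA (compose_pair C Q) u = (onO (compose_pair C Q) g, onO (compose_pair C Q) h, t)"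
        using ff(1) g h unfolding fully_faithful_def by (simp del: in_hom_set)
      moreover have "u \<in> hom_set (hom_cat C M B) g h \<and>
          onA (compose_pair C Q) u = (onO (compose_pair C Q) g, onO (compose_pair C Q) h, t) \<longleftrightarrow>
          u \<in> hom2 C g h \<and> u \<lhd> p = t" for u
        using g by (auto simp: compose_pair_def p_def)
      ultimately show "\<exists>!u. u \<in> hom2 C g h \<and> u \<lhd> p = t" by simp
    }
  qed
  then show ?thesis by blast
qed

end

section \<open>Oplax bicolimits over indices with arbitrary carrier types\<close>

context diagram
begin

text \<open>The encoded diagram has an oplax bicolimit by hypothesis. Its cocones are translated by
  \<open>re\<close> and \<open>un\<close>, which rename indices and leave the cells of
  \<open>C\<close> untouched, so the two halves of \<open>ins_rep\<close> carry over one by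
  one.\<close>

lemma oplax_bicolimit_enc:
  fixes \<kappa> :: "'u rel" and e0 :: "'i0 \<Rightarrow> 'u" and e1 :: "'i1 \<Rightarrow> 'u" and e2 :: "'i2 \<Rightarrow> 'u"
  assumes inj [simp]: "inj e0" "inj e1" "inj e2"
    and small: "|Cell0 I| <o \<kappa>" "|Cell1 I| <o \<kappa>" "|Cell2 I| <o \<kappa>"
    and op: "has_oplax_bicolimits \<kappa> C"
  shows "\<exists>L Q. ins_rep oplax_ins oplax_pred L Q"
proof -
  let ?I = "enc_two e0 e1 e2 I" and ?F = "enc_fun e0 e1 e2 F"
  interpret D: diagram C ?I ?F
    using index diagram inj by unfold_locales (simp_all add: two_category_enc_two two_functor_enc_fun)
  note [simp] = inj_eq[OF inj(1)] inj_eq[OF inj(2)] inj_eq[OF inj(3)]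
  have "small_two_category \<kappa> ?I"
    unfolding small_two_category_def small_set_def using D.index small by (simp add: small_image)
  then obtain L R where "is_oplax_bicolimit ?I C ?F L R"
    using op D.diagram unfolding has_oplax_bicolimits_def by blast
  then have rep: "ins_rep D.oplax_ins D.oplax_pred L R" by (simp add: D.is_oplax_bicolimit_iff)
  have R: "ins_cocone D.oplax_ins L R" "D.oplax_pred R" "L \<in> Cell0 C" using rep by (auto simp: ins_rep_def)
  define re :: "('u, 'u, 'k1, 'k2) fam \<Rightarrow> ('i0, 'i1, 'k1, 'k2) fam" where
    "re S = (\<lambda>i \<in> Cell0 I. fst S (e0 i), \<lambda>d \<in> Cell1 I. snd S (e1 d))" for S
  define un :: "('i0, 'i1, 'k1, 'k2) fam \<Rightarrow> ('u, 'u, 'k1, 'k2) fam" where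
    "un Y = (\<lambda>x \<in> e0 ` Cell0 I. fst Y (inv e0 x), \<lambda>x \<in> e1 ` Cell1 I. snd Y (inv e1 x))" for Y
  have res [simp]: "i \<in> Cell0 I \<Longrightarrow> fst (re S) i = fst S (e0 i)" "d \<in> Cell1 I \<Longrightarrow> snd (re S) d = snd S (e1 d)" for i d S
    by (simp_all add: re_def)
  have uns [simp]: "i \<in> Cell0 I \<Longrightarrow> fst (un Y) (e0 i) = fst Y i" "d \<in> Cell1 I \<Longrightarrow> snd (un Y) (e1 d) = snd Y d" for i d Y
    by (simp_all add: un_def)
  have reR: "ins_cocone oplax_ins L (re R)" "oplax_pred (re R)"
  proof -
    have Rs: "fst R (e0 i) \<in> Cell1 C \<and> src C (fst R (e0 i)) = F0 F i \<and> tgt C (fst R (e0 i)) = L" if "i \<in> Cell0 I" for i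
      using ins_cocone_simps(1-3)[OF R(1), of "e0 i"] that by simp
    have Rd: "snd R (e1 d) \<in> Cell2 C \<and> dom2 C (snd R (e1 d)) = fst R (e0 (tgt I d)) \<cdot> F1 F d \<and>
       cod2 C (snd R (e1 d)) = fst R (e0 (src I d)) \<cdot> id1 C (F0 F (src I d))" if "d \<in> Cell1 I" for d
      using ins_cocone_simps(4-6)[OF R(1), of "e1 d"] that by simp
    show "ins_cocone oplax_ins L (re R)"
      by (rule ins_coconeI) (use Rs Rd in simp_all, simp_all add: re_def)
    show "oplax_pred (re R)" using R(2) unfolding oplax_pred_iff D.oplax_pred_iff by simp
  qed
  have "ins_rep oplax_ins oplax_pred L (re R)"
    unfolding ins_rep_def
  proof (intro conjI ballI allI impI R reR)
    fix B assume B: "B \<in> Cell0 C"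
    {
      fix f g m assume f: "f \<in> hom1 C L B" and g: "g \<in> hom1 C L B"
        and m: "ins_mor oplax_ins (ins_post oplax_ins (re R) f) (ins_post oplax_ins (re R) g) m"
      have mi: "m i \<in> Cell2 C \<and> dom2 C (m i) = f \<cdot> fst R (e0 i) \<and> cod2 C (m i) = g \<cdot> fst R (e0 i)" if "i \<in> Cell0 I" for i
        using ins_mor_simps(1-3)[OF m, of i] that by (simp add: ins_post_def)
      have md: "(m (src I d) \<lhd> id1 C (F0 F (src I d))) \<bullet> (f \<rhd> snd R (e1 d)) = (g \<rhd> snd R (e1 d)) \<bullet> (m (tgt I d) \<lhd> F1 F d)"
        if "d \<in> Cell1 I" for d
        using ins_mor_eq[OF m, of d] that by (simp add: ins_post_def)
      let ?m = "\<lambda>x \<in> e0 ` Cell0 I. m (inv e0 x)"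
      have "ins_mor D.oplax_ins (ins_post D.oplax_ins R f) (ins_post D.oplax_ins R g) ?m"
        by (rule ins_morI) (use mi md in \<open>auto simp: ins_post_def\<close>)
      then have "\<exists>!t. t \<in> hom2 C f g \<and> (\<lambda>p \<in> Pt D.oplax_ins. t \<lhd> fst R p) = ?m"
        using rep B f g unfolding ins_rep_def by blast
      moreover have "(\<lambda>p \<in> Pt D.oplax_ins. t \<lhd> fst R p) = ?m \<longleftrightarrow> (\<lambda>p \<in> Pt oplax_ins. t \<lhd> fst (re R) p) = m" for t
      proof -
        have "(\<lambda>p \<in> Pt D.oplax_ins. t \<lhd> fst R p) = ?m \<longleftrightarrow> (\<forall>i \<in> Cell0 I. t \<lhd> fst R (e0 i) = m i)"
          by (auto simp: fun_eq_iff restrict_def)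
        also have "\<dots> \<longleftrightarrow> (\<lambda>p \<in> Pt oplax_ins. t \<lhd> fst (re R) p) = m"
          using ins_mor_simps(4)[OF m] by (auto simp: fun_eq_iff restrict_def extensional_def)
        finally show ?thesis .
      qed
      ultimately show "\<exists>!t. t \<in> hom2 C f g \<and> (\<lambda>p \<in> Pt oplax_ins. t \<lhd> fst (re R) p) = m" by simp
    }
    {
      fix Y assume Y: "ins_cocone oplax_ins B Y" "oplax_pred Y"
      note [simp] = ins_cocone_simps(1-6)[OF Y(1)]
      have "ins_cocone D.oplax_ins B (un Y)"
        by (rule ins_coconeI) (auto, auto simp: un_def)
      moreover have "D.oplax_pred (un Y)" using Y(2) unfolding oplax_pred_iff D.oplax_pred_iff by simp
      ultimately obtain f m where f: "f \<in> hom1 C L B" and m: "ins_mor D.oplax_ins (ins_post D.oplax_ins R f) (un Y) m"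
        and im: "\<forall>p \<in> Pt D.oplax_ins. inv2 (m p)"
        using rep B unfolding ins_rep_def by blast
      have mi: "m (e0 i) \<in> Cell2 C \<and> dom2 C (m (e0 i)) = f \<cdot> fst R (e0 i) \<and> cod2 C (m (e0 i)) = fst Y i" if "i \<in> Cell0 I" for i
        using ins_mor_simps(1-3)[OF m, of "e0 i"] that by (simp add: ins_post_def)
      have md: "(m (e0 (src I d)) \<lhd> id1 C (F0 F (src I d))) \<bullet> (f \<rhd> snd R (e1 d)) = snd Y d \<bullet> (m (e0 (tgt I d)) \<lhd> F1 F d)"
        if "d \<in> Cell1 I" for d
        using ins_mor_eq[OF m, of "e1 d"] that by (simp add: ins_post_def)
      have "ins_mor oplax_ins (ins_post oplax_ins (re R) f) Y (\<lambda>i \<in> Cell0 I. m (e0 i))"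
        by (rule ins_morI) (use mi md in \<open>simp_all add: ins_post_def\<close>)
      then show "\<exists>f \<in> hom1 C L B. \<exists>m. ins_mor oplax_ins (ins_post oplax_ins (re R) f) Y m \<and> (\<forall>p \<in> Pt oplax_ins. inv2 (m p))"
        using f im by (intro bexI[of _ f] exI[of _ "\<lambda>i \<in> Cell0 I. m (e0 i)"]) simp_all
    }
  qed
  then show ?thesis by blast
qed

end

context strict_two_category
begin

lemma localizes_cong:
  assumes "localizes P p L M" and PP: "\<And>f. f \<in> Cell1 C \<Longrightarrow> src C f = L \<Longrightarrow> P f \<longleftrightarrow> P' f"
  shows "localizes P' p L M"
proof -
  have "f \<in> hom1 C L B \<Longrightarrow> P f \<longleftrightarrow> P' f" for f B using PP by simp
  moreover have "P (g \<cdot> p) \<longleftrightarrow> P' (g \<cdot> p)" if "g \<in> hom1 C M B" for g B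
    using PP[of "g \<cdot> p"] that assms(1) by (auto simp: localizes_def)
  ultimately show ?thesis using assms(1) unfolding localizes_def by (simp del: in_hom_set)
qed

lemma inv2_middle:
  assumes "inv2 (a \<bullet> b \<bullet> c)" "inv2 a" "inv2 c" "b \<in> Cell2 C" "cod2 C b = dom2 C a" "cod2 C c = dom2 C b"
  shows "inv2 b"
  by (rule inv2_left_factor[of _ c], rule inv2_right_factor[of a]) (use assms in simp_all)

text \<open>
  The cocones \<open>(1; u\<^sub>r \<Rightarrow> v\<^sub>r)\<close> and \<open>(1; v\<^sub>r = v\<^sub>r)\<close> under the diagram consisting of \<open>L\<close> and of an
  arrow (twice) for each \<open>r : u\<^sub>r \<Rightarrow> v\<^sub>r\<close> are related by a morphism with components \<open>1\<close>, \<open>r\<close>, \<open>1\<close>.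
  This turns the family into a single 2-cell on the oplax bicolimit.
\<close>

lemma coinverter_of_family:
  fixes \<kappa> :: "'u rel"
  assumes \<kappa>: "smallness_cardinal \<kappa>" and op: "has_oplax_bicolimits \<kappa> C" and bc: "has_bicoequalizers C"
    and L: "L \<in> Cell0 C" and small: "|R| <o \<kappa>"
    and R: "\<And>r. r \<in> R \<Longrightarrow> r \<in> Cell2 C \<and> tgt C (dom2 C r) = L"
  shows "\<exists>p M. localizes (\<lambda>f. \<forall>r \<in> R. inv2 (f \<rhd> r)) p L M"
proof -
  have inf: "infinite (UNIV :: 'u set)" using smallness_infinite[OF \<kappa>] .
  obtain e :: "'k2 \<Rightarrow> 'u" where e: "inj_on e R" using small_inj[OF \<kappa> small] by blast
  define d where "d = inv_into R e"
  define K where "K = e ` R"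
  have de: "r \<in> R \<Longrightarrow> d (e r) = r" for r using e by (simp add: d_def)
  have dK: "k \<in> K \<Longrightarrow> d k \<in> R" for k using de by (auto simp: K_def)
  have RK: "R = d ` K" using de by (force simp: K_def)
  have ds [simp]: "k \<in> K \<Longrightarrow> d k \<in> Cell2 C" "k \<in> K \<Longrightarrow> tgt C (dom2 C (d k)) = L" for k
    using R dK by auto
  \<comment> \<open>\<open>None\<close> names \<open>L\<close> and \<open>Some k\<close> the source
    of the 2-cell coded by \<open>k\<close>. All edge 1-cells are identities, so in
    \<open>bshape D {}\<close> the objects \<open>PO (Some k)\<close> and \<open>KO k\<close> are
    sent to the same object of \<open>C\<close>, and the two arrows between them to its
    identity.\<close>
  define D :: "('u option, 'u, 'k0, 'k1) ins" where "D = \<lparr>Pt = insert None (Some ` K), Ed = K, tp = Some, sp = Some,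
     ob = case_option L (\<lambda>k. src C (dom2 C (d k))), fl = (\<lambda>k. id1 C (src C (dom2 C (d k)))),
     gl = (\<lambda>k. id1 C (src C (dom2 C (d k))))\<rparr>"
  have Ds [simp]: "Pt D = insert None (Some ` K)" "Ed D = K" "tp D = Some" "sp D = Some" "ob D None = L"
    "ob D (Some k) = src C (dom2 C (d k))" "fl D k = id1 C (src C (dom2 C (d k)))"
    "gl D k = id1 C (src C (dom2 C (d k)))" for k by (simp_all add: D_def)
  have wf: "wf_ins D" using L by (auto simp: wf_ins_def)
  have opt: "|UNIV :: 'u option set| \<le>o |UNIV :: 'u set|"
  proof -
    have *: "(UNIV :: 'u option set) = {None} \<union> range Some" by (auto simp: UNIV_option_conv)
    show ?thesis unfolding * by (intro Un_ordLeq[OF inf] card_of_image finite_ordLeq[OF _ inf]) simp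
  qed
  note U = ordLeq_refl[OF card_of_Card_order, of "UNIV :: 'u set"]
  obtain e0 :: "('u option, 'u) bob \<Rightarrow> 'u" where e0: "inj e0" using ex_injI[OF bob_ordLeq[OF inf opt U]] by blast
  obtain e1 :: "('u option, 'u) bar \<Rightarrow> 'u" where e1: "inj e1" using ex_injI[OF bar_ordLeq[OF inf opt U]] by blast
  obtain e2 :: "('u option, 'u) btw \<Rightarrow> 'u" where e2: "inj e2" using ex_injI[OF btw_ordLeq[OF inf opt U]] by blast
  obtain eo :: "bool \<Rightarrow> 'u" where eo: "inj eo" using ex_injI[OF finite_ordLeq[OF finite inf]] by blast
  obtain ea :: "bool \<times> bool \<Rightarrow> 'u" where ea: "inj ea" using ex_injI[OF finite_ordLeq[OF finite inf]] by blast
  \<comment> \<open>Over the empty set there are no cells \<open>SG\<close>, so any function can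
    stand here.\<close>
  define sg :: "'u \<Rightarrow> bool \<Rightarrow> 'k2" where "sg = undefined"
  interpret b: bipartite C D "{}" sg e0 e1 e2 eo ea
    by unfold_locales (use e0 e1 e2 eo ea wf in auto)
  interpret T: diagram C "bshape D {}" "bdiag C D sg"
    by unfold_locales (use b.two_functor_bdiag in \<open>auto intro!: two_category_bshape\<close>)
  have K: "|K| <o \<kappa>" unfolding K_def by (rule small_image[OF small])
  have "|{None} \<union> Some ` K| <o \<kappa>" by (intro small_Un[OF \<kappa>] small_image[OF K] small_finite[OF \<kappa>]) simp
  then have "|Pt D| <o \<kappa>" "|Ed D| <o \<kappa>" using K by simp_all
  note sb = small_bshape[OF \<kappa> this, of "{}"]
  obtain X Q where rep: "ins_rep T.oplax_ins T.oplax_pred X Q"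
    using T.oplax_bicolimit_enc[OF e0 e1 e2 sb op] by blast
  note wfT = T.wf_oplax_ins
  have Q: "ins_cocone T.oplax_ins X Q" "T.oplax_pred Q" and X: "X \<in> Cell0 C" using rep by (auto simp: ins_rep_def)
  define iB i0 i1 ph where "iB = fst Q (PO None)" and "i0 k = fst Q (PO (Some k))" and "i1 k = fst Q (KO k)"
    and "ph k = snd Q (FA k)" for k
  note idefs = iB_def i0_def i1_def ph_def
  have its [simp]: "iB \<in> Cell1 C" "src C iB = L" "tgt C iB = X"
    "k \<in> K \<Longrightarrow> i0 k \<in> Cell1 C" "k \<in> K \<Longrightarrow> src C (i0 k) = src C (dom2 C (d k))" "k \<in> K \<Longrightarrow> tgt C (i0 k) = X"
    "k \<in> K \<Longrightarrow> i1 k \<in> Cell1 C" "k \<in> K \<Longrightarrow> src C (i1 k) = src C (dom2 C (d k))" "k \<in> K \<Longrightarrow> tgt C (i1 k) = X" for k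
    using ins_cocone_simps(1-3)[OF Q(1), of "PO None"] ins_cocone_simps(1-3)[OF Q(1), of "PO (Some k)"]
      ins_cocone_simps(1-3)[OF Q(1), of "KO k"] by (auto simp: idefs)
  have phs [simp]: "k \<in> K \<Longrightarrow> ph k \<in> Cell2 C" "k \<in> K \<Longrightarrow> dom2 C (ph k) = i0 k" "k \<in> K \<Longrightarrow> cod2 C (ph k) = i1 k" for k
    using ins_cocone_simps(4-6)[OF Q(1), of "FA k"] its(4-9)[of k] by (auto simp: idefs)
  have pt: "(\<forall>x \<in> Pt T.oplax_ins. P x) \<longleftrightarrow> P (PO None) \<and> (\<forall>k \<in> K. P (PO (Some k)) \<and> P (KO k))" for P
    by auto
  \<comment> \<open>Cocones that use one 2-cell \<open>ps k\<close> on both arrows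
    \<open>FA k\<close> and \<open>GA k\<close>; the cells at identities are those forced by the
    unit law.\<close>
  define cone where "cone g f0 f1 ps = (let q = case_bob (case_option g f0) f1 in
      (\<lambda>x \<in> Cell0 (bshape D {}). q x, \<lambda>x \<in> Cell1 (bshape D {}). case x of Bid y \<Rightarrow> id2 C (q y) | FA k \<Rightarrow> ps k | GA k \<Rightarrow> ps k))"
    for g :: 'k1 and f0 f1 :: "'u \<Rightarrow> 'k1" and ps :: "'u \<Rightarrow> 'k2"
  have cone_simps [simp]: "fst (cone g f0 f1 ps) (PO None) = g" "k \<in> K \<Longrightarrow> fst (cone g f0 f1 ps) (PO (Some k)) = f0 k"
    "k \<in> K \<Longrightarrow> fst (cone g f0 f1 ps) (KO k) = f1 k" "k \<in> K \<Longrightarrow> snd (cone g f0 f1 ps) (FA k) = ps k"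
    "k \<in> K \<Longrightarrow> snd (cone g f0 f1 ps) (GA k) = ps k" "snd (cone g f0 f1 ps) (Bid (PO None)) = id2 C g"
    "k \<in> K \<Longrightarrow> snd (cone g f0 f1 ps) (Bid (PO (Some k))) = id2 C (f0 k)"
    "k \<in> K \<Longrightarrow> snd (cone g f0 f1 ps) (Bid (KO k)) = id2 C (f1 k)" for g f0 f1 ps k
    by (auto simp: cone_def Let_def)
  have cone: "ins_cocone T.oplax_ins Y (cone g f0 f1 ps)" "T.oplax_pred (cone g f0 f1 ps)"
    if g: "g \<in> hom1 C L Y" and f: "\<And>k. k \<in> K \<Longrightarrow> ps k \<in> hom2 C (f0 k) (f1 k) \<and> f0 k \<in> hom1 C (src C (dom2 C (d k))) Y"
    for Y g f0 f1 ps
  proof -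
    have fs [simp]: "k \<in> K \<Longrightarrow> ps k \<in> Cell2 C" "k \<in> K \<Longrightarrow> dom2 C (ps k) = f0 k" "k \<in> K \<Longrightarrow> cod2 C (ps k) = f1 k"
      "k \<in> K \<Longrightarrow> f0 k \<in> Cell1 C" "k \<in> K \<Longrightarrow> src C (f0 k) = src C (dom2 C (d k))" "k \<in> K \<Longrightarrow> tgt C (f0 k) = Y"
      "k \<in> K \<Longrightarrow> f1 k \<in> Cell1 C" "k \<in> K \<Longrightarrow> src C (f1 k) = src C (dom2 C (d k))" "k \<in> K \<Longrightarrow> tgt C (f1 k) = Y" for k
      using f[of k] cell2(2-4)[of "ps k"] by auto
    show "ins_cocone T.oplax_ins Y (cone g f0 f1 ps)"
      by (rule ins_coconeI) (use g L in auto, auto simp: cone_def Let_def)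
    show "T.oplax_pred (cone g f0 f1 ps)"
      unfolding T.oplax_pred_iff using g L by (auto simp: ball_Un)
  qed
  \<comment> \<open>The unit law fixes the structure cells at identities, so a morphism of cocones
    has to be checked only at \<open>FA k\<close> and \<open>GA k\<close>.\<close>
  have mor: "ins_mor T.oplax_ins S S' m"
    if "m \<in> extensional (Cell0 (bshape D {}))" "ins_cocone T.oplax_ins Y S" "ins_cocone T.oplax_ins Y S'"
      "T.oplax_pred S" "T.oplax_pred S'"
      "\<forall>x \<in> Pt T.oplax_ins. m x \<in> hom2 C (fst S x) (fst S' x)"
      "\<And>k. k \<in> K \<Longrightarrow> m (KO k) \<bullet> snd S (FA k) = snd S' (FA k) \<bullet> m (PO (Some k))"
      "\<And>k. k \<in> K \<Longrightarrow> m (KO k) \<bullet> snd S (GA k) = snd S' (GA k) \<bullet> m (PO (Some k))" for S S' m Y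
  proof (rule ins_morI)
    note [simp] = ins_cocone_simps(1-3)[OF that(2)] ins_cocone_simps(1-3)[OF that(3)]
    have mx [simp]: "m x \<in> Cell2 C" "dom2 C (m x) = fst S x" "cod2 C (m x) = fst S' x" if "x \<in> Pt T.oplax_ins" for x
      using \<open>\<forall>x \<in> Pt T.oplax_ins. m x \<in> hom2 C (fst S x) (fst S' x)\<close> that by auto
    fix x assume "x \<in> Ed T.oplax_ins"
    then consider y where "x = Bid y" "y \<in> Pt T.oplax_ins" | k where "k \<in> K" "x = FA k" | k where "k \<in> K" "x = GA k"
      by auto
    then show "(m (sp T.oplax_ins x) \<lhd> gl T.oplax_ins x) \<bullet> snd S x = snd S' x \<bullet> (m (tp T.oplax_ins x) \<lhd> fl T.oplax_ins x)"
    proof cases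
      case 1
      have "snd S (Bid y) = id2 C (fst S y)" "snd S' (Bid y) = id2 C (fst S' y)"
        using that(4,5) 1(2) unfolding T.oplax_pred_iff by auto
      then show ?thesis using 1 wf_ins_simps(1)[OF wfT 1(2)] by simp
    next
      case 2
      then show ?thesis using that(7)[OF 2(1)] mx[of "KO k"] mx[of "PO (Some k)"] by simp
    next
      case 3
      then show ?thesis using that(8)[OF 3(1)] mx[of "KO k"] mx[of "PO (Some k)"] by simp
    qed
  next
    show "m x \<in> Cell2 C \<and> dom2 C (m x) = fst S x \<and> cod2 C (m x) = fst S' x" if "x \<in> Pt T.oplax_ins" for x
      using \<open>\<forall>x \<in> Pt T.oplax_ins. m x \<in> hom2 C (fst S x) (fst S' x)\<close> that by (simp del: T.oplax_ins_simps)
    show "m \<in> extensional (Pt T.oplax_ins)" using that(1) by simp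
  qed
  define x0 x1 where "x0 = cone (id1 C L) (\<lambda>k. dom2 C (d k)) (\<lambda>k. cod2 C (d k)) d"
    and "x1 = cone (id1 C L) (\<lambda>k. cod2 C (d k)) (\<lambda>k. cod2 C (d k)) (\<lambda>k. id2 C (cod2 C (d k)))"
  have x0: "ins_cocone T.oplax_ins L x0" "T.oplax_pred x0" and x1: "ins_cocone T.oplax_ins L x1" "T.oplax_pred x1"
    unfolding x0_def x1_def by (rule cone; use L in simp)+
  define \<sigma> where "\<sigma> = (\<lambda>x \<in> Cell0 (bshape D {}). case_bob (case_option (id2 C (id1 C L)) d) (\<lambda>k. id2 C (cod2 C (d k))) x)"
  have \<sigma>s [simp]: "\<sigma> (PO None) = id2 C (id1 C L)" "k \<in> K \<Longrightarrow> \<sigma> (PO (Some k)) = d k"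
    "k \<in> K \<Longrightarrow> \<sigma> (KO k) = id2 C (cod2 C (d k))" for k by (auto simp: \<sigma>_def)
  have \<sigma>: "ins_mor T.oplax_ins x0 x1 \<sigma>"
  proof (rule mor[OF _ x0(1) x1(1) x0(2) x1(2)])
    show "\<sigma> \<in> extensional (Cell0 (bshape D {}))" unfolding \<sigma>_def by (rule restrict_extensional)
    show "\<forall>x \<in> Pt T.oplax_ins. \<sigma> x \<in> hom2 C (fst x0 x) (fst x1 x)"
      unfolding pt using L by (simp add: x0_def x1_def)
  qed (simp_all add: x0_def x1_def)
  \<comment> \<open>Universality realizes \<open>x0\<close> and \<open>x1\<close> by 1-cells
    \<open>a0\<close> and \<open>a1\<close> up to \<open>\<delta>0\<close> and
    \<open>\<delta>1\<close>. At \<open>PO None\<close> these isomorphisms become the cells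
    \<open>m0\<close> and \<open>m1\<close> of \<open>coinverter_of_bicoequalizer\<close>.\<close>
  obtain a0 \<delta>0 where a0: "a0 \<in> hom1 C X L" and \<delta>0: "ins_mor T.oplax_ins (ins_post T.oplax_ins Q a0) x0 \<delta>0"
    and i\<delta>0: "\<forall>x \<in> Pt T.oplax_ins. inv2 (\<delta>0 x)"
    using rep L x0 unfolding ins_rep_def by blast
  obtain a1 \<delta>1 where a1: "a1 \<in> hom1 C X L" and \<delta>1: "ins_mor T.oplax_ins (ins_post T.oplax_ins Q a1) x1 \<delta>1"
    and i\<delta>1: "\<forall>x \<in> Pt T.oplax_ins. inv2 (\<delta>1 x)"
    using rep L x1 unfolding ins_rep_def by blast
  \<comment> \<open>Collapses each pair of legs to \<open>i1 k\<close> with identity structure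
    cells. The induced \<open>j\<close> reaches only legs on which \<open>s\<close>, defined below,
    is invertible.\<close>
  define xj where "xj = cone iB i1 i1 (\<lambda>k. id2 C (i1 k))"
  have xj: "ins_cocone T.oplax_ins X xj" "T.oplax_pred xj"
    unfolding xj_def by (rule cone; simp)+
  obtain j \<rho> where j: "j \<in> hom1 C X X" and \<rho>: "ins_mor T.oplax_ins (ins_post T.oplax_ins Q j) xj \<rho>"
    and i\<rho>: "\<forall>x \<in> Pt T.oplax_ins. inv2 (\<rho> x)"
    using rep X xj unfolding ins_rep_def by blast
  have ats [simp]: "a0 \<in> Cell1 C" "src C a0 = X" "tgt C a0 = L" "a1 \<in> Cell1 C" "src C a1 = X" "tgt C a1 = L"
    "j \<in> Cell1 C" "src C j = X" "tgt C j = X" using a0 a1 j by auto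
  note [simp] = ins_cocone_simps(1-3)[OF Q(1)]
  have p0: "ins_cocone T.oplax_ins L (ins_post T.oplax_ins Q a0)" and p1: "ins_cocone T.oplax_ins L (ins_post T.oplax_ins Q a1)"
    by (rule ins_post_cocone[OF wfT Q(1)]; simp)+
  have \<delta>s: "x \<in> Pt T.oplax_ins \<Longrightarrow> inv2 (\<delta>0 x)" "x \<in> Pt T.oplax_ins \<Longrightarrow> dom2 C (\<delta>0 x) = a0 \<cdot> fst Q x"
    "x \<in> Pt T.oplax_ins \<Longrightarrow> cod2 C (\<delta>0 x) = fst x0 x"
    "x \<in> Pt T.oplax_ins \<Longrightarrow> inv2 (\<delta>1 x)" "x \<in> Pt T.oplax_ins \<Longrightarrow> dom2 C (\<delta>1 x) = a1 \<cdot> fst Q x"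
    "x \<in> Pt T.oplax_ins \<Longrightarrow> cod2 C (\<delta>1 x) = fst x1 x"
    "x \<in> Pt T.oplax_ins \<Longrightarrow> inv2 (\<rho> x)" "x \<in> Pt T.oplax_ins \<Longrightarrow> dom2 C (\<rho> x) = j \<cdot> fst Q x"
    "x \<in> Pt T.oplax_ins \<Longrightarrow> cod2 C (\<rho> x) = fst xj x" for x
    using ins_mor_simps(2,3)[OF \<delta>0, of x] ins_mor_simps(2,3)[OF \<delta>1, of x] ins_mor_simps(2,3)[OF \<rho>, of x] i\<delta>0 i\<delta>1 i\<rho>
    by (auto simp: ins_post_def)
  have "ins_mor T.oplax_ins (ins_post T.oplax_ins Q a0) x1 (\<lambda>x \<in> Pt T.oplax_ins. \<sigma> x \<bullet> \<delta>0 x)"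
    by (rule ins_mor_cmp[OF wfT p0 x0(1) x1(1) \<delta>0 \<sigma>])
  \<comment> \<open>\<open>\<sigma>\<close>, carried along \<open>\<delta>0\<close> and the inverse
    of \<open>\<delta>1\<close>, lifts to the single 2-cell \<open>s\<close> that stands for the
    family: on the leg \<open>PO (Some k)\<close> it is \<open>d k\<close> up to
    isomorphism.\<close>
  from ins_mor_cmp[OF wfT p0 x1(1) p1 this ins_mor_inverse[OF wfT p1 x1(1) \<delta>1]] i\<delta>1
  obtain s where s: "s \<in> hom2 C a0 a1"
    and sx: "\<And>x. x \<in> Pt T.oplax_ins \<Longrightarrow> s \<lhd> fst Q x = vinv (\<delta>1 x) \<bullet> \<sigma> x \<bullet> \<delta>0 x"
    by - (rule ins_rep_full[OF rep a0 a1 L], auto)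
  have ss [simp]: "s \<in> Cell2 C" "dom2 C s = a0" "cod2 C s = a1" using s by auto
  have \<sigma>t: "\<sigma> x \<in> Cell2 C" "dom2 C (\<sigma> x) = fst x0 x" "cod2 C (\<sigma> x) = fst x1 x" if "x \<in> Pt T.oplax_ins" for x
    using ins_mor_simps(1-3)[OF \<sigma> that] by auto
  \<comment> \<open>At these legs the component of \<open>\<sigma>\<close> is an identity.\<close>
  have inv_s: "inv2 (s \<lhd> fst Q x)" if "x = PO None \<or> (\<exists>k \<in> K. x = KO k)" for x
  proof -
    have x: "x \<in> Pt T.oplax_ins" and "inv2 (\<sigma> x)" using that L by auto
    then show ?thesis unfolding sx[OF x] using \<delta>s[OF x] \<sigma>t[OF x] by simp
  qed
  have sj: "inv2 (s \<lhd> j)"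
  proof (rule ins_rep_inv2[OF wfT rep, of _ "a0 \<cdot> j" "a1 \<cdot> j"])
    fix x assume x: "x \<in> Pt T.oplax_ins"
    \<comment> \<open>Up to \<open>\<rho>\<close>, composing \<open>j\<close> with any leg yields a
      leg treated by \<open>inv_s\<close>.\<close>
    have y: "\<exists>y. (y = PO None \<or> (\<exists>k \<in> K. y = KO k)) \<and> fst xj x = fst Q y"
      using x by (auto simp: xj_def idefs)
    then obtain y where y: "y = PO None \<or> (\<exists>k \<in> K. y = KO k)" "fst xj x = fst Q y" by blast
    then have y': "y \<in> Pt T.oplax_ins" by auto
    note [simp] = \<delta>s(7-9)[OF x] ins_cocone_simps(1-3)[OF Q(1) x] ins_cocone_simps(1-3)[OF Q(1) y']
    have "(s \<lhd> fst Q y) \<bullet> (a0 \<rhd> \<rho> x) = (a1 \<rhd> \<rho> x) \<bullet> (s \<lhd> j \<cdot> fst Q x)"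
      by (rule whisker_swap) (use y in simp_all)
    moreover have "inv2 ((s \<lhd> fst Q y) \<bullet> (a0 \<rhd> \<rho> x))"
      using inv_s[OF y(1)] y(2) by simp
    ultimately have "inv2 ((a1 \<rhd> \<rho> x) \<bullet> (s \<lhd> j \<cdot> fst Q x))" by simp
    then have "inv2 (s \<lhd> j \<cdot> fst Q x)"
      by (rule inv2_right_factor) simp_all
    then show "inv2 ((s \<lhd> j) \<lhd> fst Q x)" by simp
  qed simp_all
  have loc: "\<exists>p M. localizes (\<lambda>f. inv2 (f \<rhd> s)) p L M"
  proof (rule coinverter_of_bicoequalizer[OF bc L a0 a1 _ j, of iB "\<delta>0 (PO None)" "\<delta>1 (PO None)"])
    have N: "PO None \<in> Pt T.oplax_ins" by simp
    note [simp] = \<delta>s[OF N, folded iB_def]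
    show "iB \<in> hom1 C L X" by simp
    show "inv2 (\<delta>0 (PO None))" "dom2 C (\<delta>0 (PO None)) = a0 \<cdot> iB" "cod2 C (\<delta>0 (PO None)) = id1 C L"
      "inv2 (\<delta>1 (PO None))" "dom2 C (\<delta>1 (PO None)) = a1 \<cdot> iB" "cod2 C (\<delta>1 (PO None)) = id1 C L"
      by (simp_all add: x0_def x1_def)
    show "s \<in> hom2 C a0 a1" "inv2 (s \<lhd> j)" by fact+
    show "\<delta>1 (PO None) \<bullet> (s \<lhd> iB) = \<delta>0 (PO None)"
      using sx[OF N, folded iB_def] L by (simp add: x0_def x1_def)
    fix q \<xi> assume q [simp]: "q \<in> Cell1 C" "src C q = L" and \<xi>: "\<xi> \<in> hom2 C (q \<cdot> a0) (q \<cdot> a1)"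
      and \<xi>i: "\<xi> \<lhd> iB = q \<rhd> (s \<lhd> iB)" and \<xi>j: "\<xi> \<lhd> j = q \<rhd> (s \<lhd> j)"
    have \<xi>s [simp]: "\<xi> \<in> Cell2 C" "dom2 C \<xi> = q \<cdot> a0" "cod2 C \<xi> = q \<cdot> a1" using \<xi> by auto
    \<comment> \<open>Interchange with \<open>\<rho>\<close> compares the leg \<open>i1 k\<close>
      with \<open>j \<cdot> i1 k\<close>, where \<open>\<xi>\<close> and \<open>q \<rhd> s\<close>
      agree by assumption.\<close>
    have k1: "\<xi> \<lhd> i1 k = (q \<rhd> s) \<lhd> i1 k" if k: "k \<in> K" for k
    proof -
      have x: "KO k \<in> Pt T.oplax_ins" using k by simp
      note [simp] = \<delta>s(7-9)[OF x, folded i1_def] k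
      have c: "cod2 C (\<rho> (KO k)) = i1 k" by (simp add: xj_def)
      have "(t \<lhd> i1 k) \<bullet> (q \<cdot> a0 \<rhd> \<rho> (KO k)) = (q \<cdot> a1 \<rhd> \<rho> (KO k)) \<bullet> ((t \<lhd> j) \<lhd> i1 k)"
        if "t \<in> hom2 C (q \<cdot> a0) (q \<cdot> a1)" for t
      proof -
        have "(t \<lhd> i1 k) \<bullet> (q \<cdot> a0 \<rhd> \<rho> (KO k)) = (q \<cdot> a1 \<rhd> \<rho> (KO k)) \<bullet> (t \<lhd> j \<cdot> i1 k)"
          by (rule whisker_swap) (use that in \<open>auto simp: xj_def\<close>)
        then show ?thesis using that by auto
      qed
      from this[OF \<xi>] this[of "q \<rhd> s"]
      have "(\<xi> \<lhd> i1 k) \<bullet> (q \<cdot> a0 \<rhd> \<rho> (KO k)) = ((q \<rhd> s) \<lhd> i1 k) \<bullet> (q \<cdot> a0 \<rhd> \<rho> (KO k))"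
        unfolding \<xi>j by simp
      then show ?thesis
        by (rule inv2_cancel_right[rotated -1]) (simp_all add: xj_def)
    qed
    \<comment> \<open>In \<open>x1\<close> the structure cell at \<open>FA k\<close> is an identity,
      so \<open>a1 \<rhd> ph k\<close> is invertible; interchange with \<open>ph k\<close> then
      transports the equality from \<open>i1 k\<close> to \<open>i0 k\<close>.\<close>
    have k0: "\<xi> \<lhd> i0 k = (q \<rhd> s) \<lhd> i0 k" if k: "k \<in> K" for k
    proof -
      have x: "KO k \<in> Pt T.oplax_ins" "PO (Some k) \<in> Pt T.oplax_ins" using k by simp_all
      note [simp] = \<delta>s[OF x(1), folded i1_def] \<delta>s[OF x(2), folded i0_def] k
      have "\<delta>1 (KO k) \<bullet> (a1 \<rhd> ph k) = \<delta>1 (PO (Some k))"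
        using ins_mor_eq[OF \<delta>1, of "FA k"] by (simp add: ins_post_def x1_def ph_def)
      then have "inv2 (\<delta>1 (KO k) \<bullet> (a1 \<rhd> ph k))" by simp
      then have iph: "inv2 (a1 \<rhd> ph k)" by (rule inv2_right_factor) simp_all
      have iq: "inv2 (q \<cdot> a1 \<rhd> ph k)" using inv2_wl[OF iph, of q] by simp
      have sw: "(t \<lhd> i1 k) \<bullet> (q \<cdot> a0 \<rhd> ph k) = (q \<cdot> a1 \<rhd> ph k) \<bullet> (t \<lhd> i0 k)"
        if "t \<in> hom2 C (q \<cdot> a0) (q \<cdot> a1)" for t
        by (rule whisker_swap) (use that in auto)
      have "(q \<cdot> a1 \<rhd> ph k) \<bullet> (\<xi> \<lhd> i0 k) = (q \<cdot> a1 \<rhd> ph k) \<bullet> ((q \<rhd> s) \<lhd> i0 k)"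
        using sw[OF \<xi>] sw[of "q \<rhd> s"] k1[OF k] by simp
      then show ?thesis
        by (rule inv2_cancel_left[OF iq, rotated -1]) simp_all
    qed
    show "\<xi> = q \<rhd> s"
    proof (rule ins_rep_faithful[OF wfT rep \<xi>])
      fix x assume "x \<in> Pt T.oplax_ins"
      moreover have "\<forall>x \<in> Pt T.oplax_ins. \<xi> \<lhd> fst Q x = (q \<rhd> s) \<lhd> fst Q x"
        unfolding pt using k0 k1 \<xi>i by (simp add: idefs[symmetric])
      ultimately show "\<xi> \<lhd> fst Q x = (q \<rhd> s) \<lhd> fst Q x" by blast
    qed simp_all
  qed
  \<comment> \<open>On each leg \<open>f \<rhd> s\<close> is \<open>f \<rhd> \<sigma> x\<close> up
    to isomorphism, and apart from identities the components of \<open>\<sigma>\<close> are the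
    cells \<open>d k\<close>.\<close>
  have iff: "inv2 (f \<rhd> s) \<longleftrightarrow> (\<forall>r \<in> R. inv2 (f \<rhd> r))" if f [simp]: "f \<in> Cell1 C" "src C f = L" for f
  proof
    assume i: "inv2 (f \<rhd> s)"
    show "\<forall>r \<in> R. inv2 (f \<rhd> r)"
      unfolding RK
    proof (intro ballI, elim imageE, simp)
      fix k assume k: "k \<in> K"
      have x: "PO (Some k) \<in> Pt T.oplax_ins" using k by simp
      note [simp] = \<delta>s[OF x, folded i0_def] k
      have "inv2 ((f \<rhd> s) \<lhd> i0 k)" by (rule inv2_wr) (use i in simp_all)
      moreover have "(f \<rhd> s) \<lhd> i0 k = vinv (f \<rhd> \<delta>1 (PO (Some k))) \<bullet> (f \<rhd> d k) \<bullet> (f \<rhd> \<delta>0 (PO (Some k)))"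
        using sx[OF x, folded i0_def] by (simp add: x0_def x1_def)
      ultimately have "inv2 (vinv (f \<rhd> \<delta>1 (PO (Some k))) \<bullet> (f \<rhd> d k) \<bullet> (f \<rhd> \<delta>0 (PO (Some k))))" by simp
      then show "inv2 (f \<rhd> d k)"
        by (rule inv2_middle) (simp_all add: x0_def x1_def)
    qed
  next
    assume i: "\<forall>r \<in> R. inv2 (f \<rhd> r)"
    show "inv2 (f \<rhd> s)"
    proof (rule ins_rep_inv2[OF wfT rep, of _ "f \<cdot> a0" "f \<cdot> a1"])
      fix x assume x: "x \<in> Pt T.oplax_ins"
      have "inv2 (f \<rhd> \<sigma> x)" using x i dK L by auto
      then have "inv2 (f \<rhd> (vinv (\<delta>1 x) \<bullet> \<sigma> x \<bullet> \<delta>0 x))"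
        using \<delta>s[OF x] \<sigma>t[OF x] ins_cocone_simps(1-3)[OF x0(1) x] ins_cocone_simps(1-3)[OF x1(1) x]
          ins_cocone_simps(1-3)[OF Q(1) x] by simp
      then show "inv2 ((f \<rhd> s) \<lhd> fst Q x)"
        using sx[OF x] ins_cocone_simps(1-3)[OF Q(1) x] by simp
    qed simp_all
  qed
  obtain p M where "localizes (\<lambda>f. inv2 (f \<rhd> s)) p L M" using loc by blast
  then have "localizes (\<lambda>f. \<forall>r \<in> R. inv2 (f \<rhd> r)) p L M" by (rule localizes_cong) (rule iff)
  then show ?thesis by blast
qed

end

section \<open>Weighted bicolimits from oplax bicolimits\<close>

context weighted
begin

lemmas W_calc [simp] = category_calc.cat_simps[OF category_calc.intro[OF W_cat]]

text \<open>The index of a value of \<open>W\<close> is kept general in these rules, since it is often only provably a source or target.\<close>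

lemma W_at [simp]:
  assumes d: "d \<in> Cell1 I" "src I d = i"
  shows "x \<in> Obj (C0 W (tgt I d)) \<Longrightarrow> onO (C1 W d) x \<in> Obj (C0 W i)"
    "a \<in> Arr (C0 W (tgt I d)) \<Longrightarrow> onA (C1 W d) a \<in> Arr (C0 W i)"
    "a \<in> Arr (C0 W (tgt I d)) \<Longrightarrow> Dom (C0 W i) (onA (C1 W d) a) = onO (C1 W d) (Dom (C0 W (tgt I d)) a)"
    "a \<in> Arr (C0 W (tgt I d)) \<Longrightarrow> Cod (C0 W i) (onA (C1 W d) a) = onO (C1 W d) (Cod (C0 W (tgt I d)) a)"
  using d by auto

lemma W_functor_eqs [simp]:
  assumes d: "d \<in> Cell1 I" "tgt I d = j"
  shows "x \<in> Obj (C0 W j) \<Longrightarrow> onA (C1 W d) (Idt (C0 W j) x) = Idt (C0 W (src I d)) (onO (C1 W d) x)"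
    "\<lbrakk>a \<in> Arr (C0 W j); b \<in> Arr (C0 W j); Cod (C0 W j) a = Dom (C0 W j) b\<rbrakk> \<Longrightarrow>
      onA (C1 W d) (Cmp (C0 W j) b a) = Cmp (C0 W (src I d)) (onA (C1 W d) b) (onA (C1 W d) a)"
  using functor_simps[OF W_functor[OF d(1)]] d(2) by auto

lemma W_two_at [simp]:
  assumes s: "s \<in> Cell2 I" "x \<in> Obj (C0 W (tgt I (dom2 I s)))" "src I (dom2 I s) = i"
  shows "C2 W s x \<in> Arr (C0 W i)" "Dom (C0 W i) (C2 W s x) = onO (C1 W (dom2 I s)) x"
    "Cod (C0 W i) (C2 W s x) = onO (C1 W (cod2 I s)) x"
  using s by auto

lemma W_two_eqs [simp]:
  "\<lbrakk>d \<in> Cell1 I; x \<in> Obj (C0 W (tgt I d))\<rbrakk> \<Longrightarrow> C2 W (id2 I d) x = Idt (C0 W (src I d)) (onO (C1 W d) x)"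
  "\<lbrakk>s \<in> Cell2 I; t \<in> Cell2 I; dom2 I t = cod2 I s; x \<in> Obj (C0 W (tgt I (dom2 I s)))\<rbrakk> \<Longrightarrow>
    C2 W (vcmp I t s) x = Cmp (C0 W (src I (dom2 I s))) (C2 W t x) (C2 W s x)"
  using weight by (auto simp: cat_functor_def)

lemma W_hcmp:
  "\<lbrakk>s \<in> Cell2 I; t \<in> Cell2 I; tgt I (dom2 I s) = src I (dom2 I t); x \<in> Obj (C0 W (tgt I (dom2 I t)))\<rbrakk> \<Longrightarrow>
    C2 W (hcmp I t s) x = Cmp (C0 W (src I (dom2 I s)))
      (C2 W s (onO (C1 W (cod2 I t)) x)) (onA (C1 W (dom2 I s)) (C2 W t x))"
  using weight by (auto simp: cat_functor_def)

lemma W_nat: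
  "\<lbrakk>s \<in> Cell2 I; a \<in> Arr (C0 W (tgt I (dom2 I s)))\<rbrakk> \<Longrightarrow>
    Cmp (C0 W (src I (dom2 I s))) (C2 W s (Cod (C0 W (tgt I (dom2 I s))) a)) (onA (C1 W (dom2 I s)) a) =
    Cmp (C0 W (src I (dom2 I s))) (onA (C1 W (cod2 I s)) a) (C2 W s (Dom (C0 W (tgt I (dom2 I s))) a))"
  using weight by (auto simp: cat_functor_def nat_trans_def)

text \<open>
  The category of elements: a 1-cell \<open>(d, y, a) : (i, x) \<rightarrow> (j, y)\<close> consists of \<open>d : i \<rightarrow> j\<close> and
  \<open>a : W(d) y \<rightarrow> x\<close>, and \<open>(s, y, a')\<close> is the 2-cell \<open>s\<close> into \<open>(d', y, a')\<close>. A weighted cocone is an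
  oplax cocone under it whose 2-cells at the 1-cells \<open>(d, y, 1)\<close> are invertible.
\<close>

definition El :: "('i0 \<times> 'o, 'i1 \<times> 'o \<times> 'a, 'i2 \<times> 'o \<times> 'a) two_cat" where
  "El = \<lparr>Cell0 = {(i, x). i \<in> Cell0 I \<and> x \<in> Obj (C0 W i)},
     Cell1 = {(d, y, a). d \<in> Cell1 I \<and> y \<in> Obj (C0 W (tgt I d)) \<and> a \<in> Arr (C0 W (src I d)) \<and>
       Dom (C0 W (src I d)) a = onO (C1 W d) y},
     Cell2 = {(s, y, a). s \<in> Cell2 I \<and> y \<in> Obj (C0 W (tgt I (dom2 I s))) \<and> a \<in> Arr (C0 W (src I (dom2 I s))) \<and>
       Dom (C0 W (src I (dom2 I s))) a = onO (C1 W (cod2 I s)) y},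
     src = (\<lambda>(d, y, a). (src I d, Cod (C0 W (src I d)) a)),
     tgt = (\<lambda>(d, y, a). (tgt I d, y)),
     id1 = (\<lambda>(i, x). (id1 I i, x, Idt (C0 W i) x)),
     cmp1 = (\<lambda>(e, z, b) (d, y, a). (cmp1 I e d, z, Cmp (C0 W (src I d)) a (onA (C1 W d) b))),
     dom2 = (\<lambda>(s, y, a). (dom2 I s, y, Cmp (C0 W (src I (dom2 I s))) a (C2 W s y))),
     cod2 = (\<lambda>(s, y, a). (cod2 I s, y, a)),
     id2 = (\<lambda>(d, y, a). (id2 I d, y, a)),
     vcmp = (\<lambda>(t, z, b) (s, y, a). (vcmp I t s, y, b)),
     hcmp = (\<lambda>(t, z, b) (s, y, a). (hcmp I t s, z, Cmp (C0 W (src I (dom2 I s))) a (onA (C1 W (cod2 I s)) b)))\<rparr>"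

definition elF :: "('i0 \<times> 'o, 'i1 \<times> 'o \<times> 'a, 'i2 \<times> 'o \<times> 'a, 'k0, 'k1, 'k2) two_fun" where
  "elF = \<lparr>F0 = (\<lambda>(i, x). F0 F i), F1 = (\<lambda>(d, y, a). F1 F d), F2 = (\<lambda>(s, y, a). F2 F s)\<rparr>"

lemma elF_simps [simp]: "F0 elF (i, x) = F0 F i" "F1 elF (d, y, a) = F1 F d" "F2 elF (s, y', a') = F2 F s"
  by (simp_all add: elF_def)

lemma El_simps [simp]:
  "(i, x) \<in> Cell0 El \<longleftrightarrow> i \<in> Cell0 I \<and> x \<in> Obj (C0 W i)"
  "(d, y, a) \<in> Cell1 El \<longleftrightarrow> d \<in> Cell1 I \<and> y \<in> Obj (C0 W (tgt I d)) \<and> a \<in> Arr (C0 W (src I d)) \<and>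
       Dom (C0 W (src I d)) a = onO (C1 W d) y"
  "(s, y, a) \<in> Cell2 El \<longleftrightarrow> s \<in> Cell2 I \<and> y \<in> Obj (C0 W (tgt I (dom2 I s))) \<and> a \<in> Arr (C0 W (src I (dom2 I s))) \<and>
       Dom (C0 W (src I (dom2 I s))) a = onO (C1 W (cod2 I s)) y"
  "src El (d, y, a) = (src I d, Cod (C0 W (src I d)) a)" "tgt El (d, y, a) = (tgt I d, y)"
  "id1 El (i, x) = (id1 I i, x, Idt (C0 W i) x)"
  "cmp1 El (e, z, b) (d, y, a) = (cmp1 I e d, z, Cmp (C0 W (src I d)) a (onA (C1 W d) b))"
  "dom2 El (s, y, a) = (dom2 I s, y, Cmp (C0 W (src I (dom2 I s))) a (C2 W s y))"
  "cod2 El (s, y, a) = (cod2 I s, y, a)" "id2 El (d, y, a) = (id2 I d, y, a)"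
  "vcmp El (t, z, b) (s, y, a) = (vcmp I t s, y, b)"
  "hcmp El (t, z, b) (s, y, a) = (hcmp I t s, z, Cmp (C0 W (src I (dom2 I s))) a (onA (C1 W (cod2 I s)) b))"
  by (simp_all add: El_def)

lemma category_El1: "category (cat1 El)"
  unfolding category_def
  by (auto simp del: in_hom_set simp: hom_set_def)

lemma category_El2: "category (vcat El)"
  unfolding category_def
proof (intro conjI ballI impI)
  fix S T assume S: "S \<in> Arr (vcat El)" and T: "T \<in> Arr (vcat El)" and ST: "Cod (vcat El) S = Dom (vcat El) T"
  obtain s y a t z b where ST': "S = (s, y, a)" "T = (t, z, b)" by (cases S; cases T) auto
  have "dom2 I t = cod2 I s" "z = y" "a = Cmp (C0 W (src I (dom2 I t))) b (C2 W t z)" using ST ST' by auto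
  then show "Cmp (vcat El) T S \<in> hom_set (vcat El) (Dom (vcat El) S) (Cod (vcat El) T)"
    using S T ST' by simp
next
  fix S T U assume "S \<in> Arr (vcat El)" "T \<in> Arr (vcat El)" "U \<in> Arr (vcat El)"
    "Cod (vcat El) S = Dom (vcat El) T" "Cod (vcat El) T = Dom (vcat El) U"
  then show "Cmp (vcat El) U (Cmp (vcat El) T S) = Cmp (vcat El) (Cmp (vcat El) U T) S"
    by (cases S; cases T; cases U) simp
qed (auto simp del: in_hom_set simp: hom_set_def)

lemma category_El3: "category (hcat El)"
  unfolding category_def
  by (auto simp del: in_hom_set simp: hom_set_def I.hcmp_id I.hcmp_assoc)

lemma two_category_El: "two_category El"
  unfolding two_category_def
proof (intro conjI ballI impI category_El1 category_El2 category_El3)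
  fix S assume "S \<in> Cell2 El"
  then show "src El (cod2 El S) = src El (dom2 El S)" "tgt El (cod2 El S) = tgt El (dom2 El S)"
    by (cases S; simp)+
next
  fix S T assume S: "S \<in> Cell2 El" and T: "T \<in> Cell2 El" and ST: "tgt El (dom2 El S) = src El (dom2 El T)"
  obtain s y a t z b where ST': "S = (s, y, a)" "T = (t, z, b)" by (cases S; cases T) auto
  have s [simp]: "s \<in> Cell2 I" "t \<in> Cell2 I" "tgt I (dom2 I s) = src I (dom2 I t)"
    "a \<in> Arr (C0 W (src I (dom2 I s)))" "Dom (C0 W (src I (dom2 I s))) a = onO (C1 W (cod2 I s)) y"
    "b \<in> Arr (C0 W (src I (dom2 I t)))" "Dom (C0 W (src I (dom2 I t))) b = onO (C1 W (cod2 I t)) z"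
    "Cod (C0 W (src I (dom2 I t))) b = y" "z \<in> Obj (C0 W (tgt I (dom2 I t)))"
    "y \<in> Obj (C0 W (src I (dom2 I t)))"
    using S T ST ST' by auto
  show "cod2 El (hcmp El T S) = cmp1 El (cod2 El T) (cod2 El S)" using ST' by simp
  let ?W = "C0 W (src I (dom2 I s))"
  \<comment> \<open>Naturality of the transformation that \<open>W\<close> assigns to
    \<open>s\<close>, taken at \<open>b\<close>; it reconciles the domain of the horizontal
    composite with the composite of the domains.\<close>
  have n: "Cmp ?W (C2 W s y) (onA (C1 W (dom2 I s)) b) =
      Cmp ?W (onA (C1 W (cod2 I s)) b) (C2 W s (onO (C1 W (cod2 I t)) z))"
    using W_nat[of s b] by simp
  have "Cmp ?W (Cmp ?W a (onA (C1 W (cod2 I s)) b)) (C2 W (hcmp I t s) z) =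
      Cmp ?W a (Cmp ?W (Cmp ?W (onA (C1 W (cod2 I s)) b) (C2 W s (onO (C1 W (cod2 I t)) z))) (onA (C1 W (dom2 I s)) (C2 W t z)))"
    by (simp add: W_hcmp)
  also have "\<dots> = Cmp ?W (Cmp ?W a (C2 W s y)) (onA (C1 W (dom2 I s)) (Cmp (C0 W (src I (dom2 I t))) b (C2 W t z)))"
    unfolding n[symmetric] by simp
  finally show "dom2 El (hcmp El T S) = cmp1 El (dom2 El T) (dom2 El S)" using ST' by simp
next
  fix f g assume "f \<in> Cell1 El" "g \<in> Cell1 El" "tgt El f = src El g"
  then show "hcmp El (id2 El g) (id2 El f) = id2 El (cmp1 El g f)"
    by (cases f; cases g) simp
next
  fix S S' T T' assume c: "S \<in> Cell2 El" "S' \<in> Cell2 El" "T \<in> Cell2 El" "T' \<in> Cell2 El"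
    "cod2 El S = dom2 El S'" "cod2 El T = dom2 El T'" "tgt El (dom2 El S) = src El (dom2 El T)"
  obtain s y a s' y' a' where S: "S = (s, y, a)" "S' = (s', y', a')" by (cases S; cases S') auto
  obtain t z b t' z' b' where T: "T = (t, z, b)" "T' = (t', z', b')" by (cases T; cases T') auto
  have st: "dom2 I s' = cod2 I s" "dom2 I t' = cod2 I t" using c S T by auto
  have [simp]: "s \<in> Cell2 I" "s' \<in> Cell2 I" "t \<in> Cell2 I" "t' \<in> Cell2 I" "tgt I (dom2 I s) = src I (dom2 I t)"
    using c S T by auto
  show "hcmp El (vcmp El T' T) (vcmp El S' S) = vcmp El (hcmp El T' S') (hcmp El T S)"
    unfolding S T by (simp add: st I.interchange)
qed

lemma two_functor_elF: "two_functor El C elF"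
  using diagram unfolding two_functor_def is_functor_def
  by (auto simp del: in_hom_set simp: hom_set_def)

section \<open>Weighted cocones as oplax cocones under the 2-category of elements\<close>

interpretation E: diagram C El elF
  by unfold_locales (rule two_category_El, rule two_functor_elF)

definition cart :: "'i1 \<Rightarrow> 'o \<Rightarrow> 'i1 \<times> 'o \<times> 'a" where
  "cart d y = (d, y, Idt (C0 W (src I d)) (onO (C1 W d) y))"

definition el_pred :: "('i0 \<times> 'o, 'i1 \<times> 'o \<times> 'a, 'k1, 'k2) fam \<Rightarrow> bool" where
  "el_pred Q \<longleftrightarrow> E.oplax_pred Q \<and> (\<forall>d \<in> Cell1 I. \<forall>y \<in> Obj (C0 W (tgt I d)). inv2 (snd Q (cart d y)))"

lemma el_simps:
  assumes "ins_cocone E.oplax_ins B Q"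
  shows "\<lbrakk>i \<in> Cell0 I; x \<in> Obj (C0 W i)\<rbrakk> \<Longrightarrow> fst Q (i, x) \<in> Cell1 C"
    "\<lbrakk>i \<in> Cell0 I; x \<in> Obj (C0 W i)\<rbrakk> \<Longrightarrow> src C (fst Q (i, x)) = F0 F i"
    "\<lbrakk>i \<in> Cell0 I; x \<in> Obj (C0 W i)\<rbrakk> \<Longrightarrow> tgt C (fst Q (i, x)) = B"
    "(d, y, a) \<in> Cell1 El \<Longrightarrow> snd Q (d, y, a) \<in> Cell2 C"
    "(d, y, a) \<in> Cell1 El \<Longrightarrow> dom2 C (snd Q (d, y, a)) = fst Q (tgt I d, y) \<cdot> F1 F d"
    "(d, y, a) \<in> Cell1 El \<Longrightarrow> cod2 C (snd Q (d, y, a)) = fst Q (src I d, Cod (C0 W (src I d)) a)"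
    "\<lbrakk>d \<in> Cell1 I; y \<in> Obj (C0 W (tgt I d))\<rbrakk> \<Longrightarrow> snd Q (cart d y) \<in> Cell2 C"
    "\<lbrakk>d \<in> Cell1 I; y \<in> Obj (C0 W (tgt I d))\<rbrakk> \<Longrightarrow> dom2 C (snd Q (cart d y)) = fst Q (tgt I d, y) \<cdot> F1 F d"
    "\<lbrakk>d \<in> Cell1 I; y \<in> Obj (C0 W (tgt I d))\<rbrakk> \<Longrightarrow> cod2 C (snd Q (cart d y)) = fst Q (src I d, onO (C1 W d) y)"
proof -
  show q: "\<lbrakk>i \<in> Cell0 I; x \<in> Obj (C0 W i)\<rbrakk> \<Longrightarrow> fst Q (i, x) \<in> Cell1 C"
    "\<lbrakk>i \<in> Cell0 I; x \<in> Obj (C0 W i)\<rbrakk> \<Longrightarrow> src C (fst Q (i, x)) = F0 F i"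
    "\<lbrakk>i \<in> Cell0 I; x \<in> Obj (C0 W i)\<rbrakk> \<Longrightarrow> tgt C (fst Q (i, x)) = B" for i x
    using ins_cocone_simps(1-3)[OF assms, of "(i, x)"] by simp_all
  show r: "(d, y, a) \<in> Cell1 El \<Longrightarrow> snd Q (d, y, a) \<in> Cell2 C"
    "(d, y, a) \<in> Cell1 El \<Longrightarrow> dom2 C (snd Q (d, y, a)) = fst Q (tgt I d, y) \<cdot> F1 F d"
    "(d, y, a) \<in> Cell1 El \<Longrightarrow> cod2 C (snd Q (d, y, a)) = fst Q (src I d, Cod (C0 W (src I d)) a)" for d y a
    using ins_cocone_simps(4-6)[OF assms, of "(d, y, a)"] q by simp_all
  show "\<lbrakk>d \<in> Cell1 I; y \<in> Obj (C0 W (tgt I d))\<rbrakk> \<Longrightarrow> snd Q (cart d y) \<in> Cell2 C"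
    "\<lbrakk>d \<in> Cell1 I; y \<in> Obj (C0 W (tgt I d))\<rbrakk> \<Longrightarrow> dom2 C (snd Q (cart d y)) = fst Q (tgt I d, y) \<cdot> F1 F d"
    "\<lbrakk>d \<in> Cell1 I; y \<in> Obj (C0 W (tgt I d))\<rbrakk> \<Longrightarrow> cod2 C (snd Q (cart d y)) = fst Q (src I d, onO (C1 W d) y)"
    unfolding cart_def by (simp_all add: r)
qed

lemma el_eqs:
  assumes "E.oplax_pred Q"
  shows "\<lbrakk>i \<in> Cell0 I; x \<in> Obj (C0 W i)\<rbrakk> \<Longrightarrow> snd Q (id1 I i, x, Idt (C0 W i) x) = id2 C (fst Q (i, x))"
    "\<lbrakk>(d, y, a) \<in> Cell1 El; (e, z, b) \<in> Cell1 El; tgt I d = src I e; y = Cod (C0 W (src I e)) b\<rbrakk> \<Longrightarrow>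
      snd Q (cmp1 I e d, z, Cmp (C0 W (src I d)) a (onA (C1 W d) b)) = snd Q (d, y, a) \<bullet> (snd Q (e, z, b) \<lhd> F1 F d)"
    "(s, y, a) \<in> Cell2 El \<Longrightarrow> snd Q (cod2 I s, y, a) \<bullet> (fst Q (tgt I (dom2 I s), y) \<rhd> F2 F s) =
      snd Q (dom2 I s, y, Cmp (C0 W (src I (dom2 I s))) a (C2 W s y))"
proof -
  note p = assms[unfolded E.oplax_pred_iff]
  show "\<lbrakk>i \<in> Cell0 I; x \<in> Obj (C0 W i)\<rbrakk> \<Longrightarrow> snd Q (id1 I i, x, Idt (C0 W i) x) = id2 C (fst Q (i, x))"
    using p[THEN conjunct1, rule_format, of "(i, x)"] by simp
  show "\<lbrakk>(d, y, a) \<in> Cell1 El; (e, z, b) \<in> Cell1 El; tgt I d = src I e; y = Cod (C0 W (src I e)) b\<rbrakk> \<Longrightarrow>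
      snd Q (cmp1 I e d, z, Cmp (C0 W (src I d)) a (onA (C1 W d) b)) = snd Q (d, y, a) \<bullet> (snd Q (e, z, b) \<lhd> F1 F d)"
    using p[THEN conjunct2, THEN conjunct1, rule_format, of "(d, y, a)" "(e, z, b)"] by simp
  show "(s, y, a) \<in> Cell2 El \<Longrightarrow> snd Q (cod2 I s, y, a) \<bullet> (fst Q (tgt I (dom2 I s), y) \<rhd> F2 F s) =
      snd Q (dom2 I s, y, Cmp (C0 W (src I (dom2 I s))) a (C2 W s y))"
    using p[THEN conjunct2, THEN conjunct2, rule_format, of "(s, y, a)"] by simp
qed

text \<open>A 1-cell of \<open>El\<close> is a vertical one, lying over an identity and carrying
  \<open>a\<close>, followed by the cartesian \<open>cart d y\<close>. The composition law of oplax
  cocones splits its structure cell accordingly.\<close>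

lemma el_factor:
  assumes Q: "ins_cocone E.oplax_ins B Q" "E.oplax_pred Q" and c: "(d, y, a) \<in> Cell1 El"
  shows "snd Q (d, y, a) = snd Q (id1 I (src I d), onO (C1 W d) y, a) \<bullet> snd Q (cart d y)"
proof -
  note [simp] = el_simps[OF Q(1)]
  have "snd Q (id1 I (src I d), onO (C1 W d) y, a) \<bullet> (snd Q (cart d y) \<lhd> F1 F (id1 I (src I d))) =
     snd Q (cmp1 I d (id1 I (src I d)), y, Cmp (C0 W (src I d)) a (onA (C1 W (id1 I (src I d))) (Idt (C0 W (src I d)) (onO (C1 W d) y))))"
    unfolding cart_def using c
    by (subst el_eqs(2)[OF Q(2), symmetric]) simp_all
  then show ?thesis using c by simp
qed

text \<open>Vertical 1-cells provide the action of the component functors on arrows, cartesian ones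
  the structure isomorphisms.\<close>

definition of_el :: "('i0 \<times> 'o, 'i1 \<times> 'o \<times> 'a, 'k1, 'k2) fam \<Rightarrow> ('i0, 'i1, 'o, 'a, 'k1, 'k2) ps_trans" where
  "of_el Q = \<lparr>cmpt = (\<lambda>i \<in> Cell0 I. \<lparr>onO = \<lambda>x \<in> Obj (C0 W i). fst Q (i, x),
        onA = \<lambda>a \<in> Arr (C0 W i). snd Q (id1 I i, Dom (C0 W i) a, a)\<rparr>),
     strc = (\<lambda>d \<in> Cell1 I. \<lambda>y \<in> Obj (C0 W (tgt I d)). snd Q (cart d y))\<rparr>"

lemma of_el_simps [simp]:
  "\<lbrakk>i \<in> Cell0 I; x \<in> Obj (C0 W i)\<rbrakk> \<Longrightarrow> onO (cmpt (of_el Q) i) x = fst Q (i, x)"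
  "\<lbrakk>i \<in> Cell0 I; a \<in> Arr (C0 W i)\<rbrakk> \<Longrightarrow> onA (cmpt (of_el Q) i) a = snd Q (id1 I i, Dom (C0 W i) a, a)"
  "\<lbrakk>d \<in> Cell1 I; y \<in> Obj (C0 W (tgt I d))\<rbrakk> \<Longrightarrow> strc (of_el Q) d y = snd Q (cart d y)"
  by (simp_all add: of_el_def)

lemma ext_of_el: "ext_ps (op2 I) W (of_el Q)"
  by (simp add: ext_ps_def of_el_def)

text \<open>Each axiom compares two evaluations of \<open>Q\<close> at one 1-cell of
  \<open>El\<close>. For naturality and for the 2-cell axiom, one evaluation comes from a composite
  or a 2-cell of \<open>El\<close> and the other from \<open>el_factor\<close>.\<close>

lemma wcone_of_el:
  assumes Q: "ins_cocone E.oplax_ins B Q" "el_pred Q"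
  shows "wcone B (of_el Q)"
proof -
  have P: "E.oplax_pred Q" and inv: "\<And>d y. d \<in> Cell1 I \<Longrightarrow> y \<in> Obj (C0 W (tgt I d)) \<Longrightarrow> inv2 (snd Q (cart d y))"
    using Q(2) by (auto simp: el_pred_def)
  note [simp] = el_simps[OF Q(1)] inv
  note comp = el_eqs(2)[OF P]
  have 1: "is_functor (C0 W i) (hom_cat C (F0 F i) B) (cmpt (of_el Q) i)" if i: "i \<in> Cell0 I" for i
  proof -
    have "snd Q (id1 I i, Dom (C0 W i) a, Cmp (C0 W i) b a) =
        snd Q (id1 I i, Dom (C0 W i) b, b) \<bullet> snd Q (id1 I i, Dom (C0 W i) a, a)"
      if a: "a \<in> Arr (C0 W i)" "b \<in> Arr (C0 W i)" "Cod (C0 W i) a = Dom (C0 W i) b" for a b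
    proof -
      have ab: "Dom (C0 W i) b = Cod (C0 W i) a" using a(3) by simp
      show ?thesis
        using comp[of "id1 I i" "Dom (C0 W i) b" b "id1 I i" "Dom (C0 W i) a" a] i a(1,2) ab by simp
    qed
    then show ?thesis
      unfolding is_functor_def using i el_eqs(1)[OF P i] by (simp add: hom_set_def del: in_hom_set)
  qed
  have 2: "snd Q (cart d (Cod (C0 W (tgt I d)) a)) \<bullet> (snd Q (id1 I (tgt I d), Dom (C0 W (tgt I d)) a, a) \<lhd> F1 F d) =
      snd Q (id1 I (src I d), onO (C1 W d) (Dom (C0 W (tgt I d)) a), onA (C1 W d) a) \<bullet> snd Q (cart d (Dom (C0 W (tgt I d)) a))"
    if d: "d \<in> Cell1 I" and a: "a \<in> Arr (C0 W (tgt I d))" for d a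
  proof -
    have "snd Q (cart d (Cod (C0 W (tgt I d)) a)) \<bullet> (snd Q (id1 I (tgt I d), Dom (C0 W (tgt I d)) a, a) \<lhd> F1 F d) =
        snd Q (d, Dom (C0 W (tgt I d)) a, onA (C1 W d) a)"
      unfolding cart_def using d a by (subst comp[symmetric]) simp_all
    also have "\<dots> = snd Q (id1 I (src I d), onO (C1 W d) (Dom (C0 W (tgt I d)) a), onA (C1 W d) a) \<bullet>
        snd Q (cart d (Dom (C0 W (tgt I d)) a))"
      by (rule el_factor[OF Q(1) P]) (use d a in simp)
    finally show ?thesis .
  qed
  have 3: "snd Q (cart (cmp1 I d e) x) = snd Q (cart e (onO (C1 W d) x)) \<bullet> (snd Q (cart d x) \<lhd> F1 F e)"
    if d: "d \<in> Cell1 I" "e \<in> Cell1 I" "tgt I e = src I d" "x \<in> Obj (C0 W (tgt I d))" for d e x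
    unfolding cart_def using d by (subst comp[symmetric]) simp_all
  have 4: "snd Q (id1 I (src I (dom2 I s)), onO (C1 W (dom2 I s)) x, C2 W s x) \<bullet> snd Q (cart (dom2 I s) x) =
      snd Q (cart (cod2 I s) x) \<bullet> (fst Q (tgt I (dom2 I s), x) \<rhd> F2 F s)"
    if s: "s \<in> Cell2 I" and x: "x \<in> Obj (C0 W (tgt I (dom2 I s)))" for s x
  proof -
    have "snd Q (cart (cod2 I s) x) \<bullet> (fst Q (tgt I (dom2 I s), x) \<rhd> F2 F s) = snd Q (dom2 I s, x, C2 W s x)"
      unfolding cart_def using s x by (subst el_eqs(3)[OF P]) simp_all
    also have "\<dots> = snd Q (id1 I (src I (dom2 I s)), onO (C1 W (dom2 I s)) x, C2 W s x) \<bullet> snd Q (cart (dom2 I s) x)"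
      by (rule el_factor[OF Q(1) P]) (use s x in simp)
    finally show ?thesis by simp
  qed
  have 5: "snd Q (cart (id1 I i) x) = id2 C (fst Q (i, x))" if "i \<in> Cell0 I" "x \<in> Obj (C0 W i)" for i x
    unfolding cart_def using that el_eqs(1)[OF P that] by simp
  have c3: "snd Q (cart (cmp1 I d e) x) = strc (of_el Q) e (onO (C1 W d) x) \<bullet> (snd Q (cart d x) \<lhd> F1 F e)"
    if d: "d \<in> Cell1 I" "e \<in> Cell1 I" "src I d = tgt I e" "x \<in> Obj (C0 W (tgt I d))" for d e x
    using 3[OF d(1,2) d(3)[symmetric] d(4)] d(1,2,4) d(3)[symmetric] by simp
  show ?thesis
    unfolding wcone_def using 1 2 c3 4 5 by simp
qed

definition el_mod :: "('i0 \<times> 'o \<Rightarrow> 'k2) \<Rightarrow> 'i0 \<Rightarrow> 'o \<Rightarrow> 'k2" where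
  "el_mod m = (\<lambda>i \<in> Cell0 I. \<lambda>x \<in> Obj (C0 W i). m (i, x))"

lemma el_mod_simps [simp]: "\<lbrakk>i \<in> Cell0 I; x \<in> Obj (C0 W i)\<rbrakk> \<Longrightarrow> el_mod m i x = m (i, x)"
  by (simp add: el_mod_def)

text \<open>Compatibility at vertical 1-cells is naturality, and at cartesian ones the modification
  axiom; by \<open>el_factor\<close> these two imply compatibility at all 1-cells.\<close>

lemma wmod_of_el:
  assumes Q: "ins_cocone E.oplax_ins B Q" "E.oplax_pred Q" and Q': "ins_cocone E.oplax_ins B Q'" "E.oplax_pred Q'"
  shows "ins_mor E.oplax_ins Q Q' m \<longleftrightarrow> m \<in> extensional (Cell0 El) \<and> wmod (of_el Q) (of_el Q') (el_mod m)"
proof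
  note [simp] = el_simps[OF Q(1)] el_simps[OF Q'(1)]
  {
    assume m: "ins_mor E.oplax_ins Q Q' m"
    have c [simp]: "\<lbrakk>i \<in> Cell0 I; x \<in> Obj (C0 W i)\<rbrakk> \<Longrightarrow> m (i, x) \<in> Cell2 C"
      "\<lbrakk>i \<in> Cell0 I; x \<in> Obj (C0 W i)\<rbrakk> \<Longrightarrow> dom2 C (m (i, x)) = fst Q (i, x)"
      "\<lbrakk>i \<in> Cell0 I; x \<in> Obj (C0 W i)\<rbrakk> \<Longrightarrow> cod2 C (m (i, x)) = fst Q' (i, x)" for i x
      using ins_mor_simps(1-3)[OF m, of "(i, x)"] by simp_all
    have n: "m (src I d, Cod (C0 W (src I d)) a) \<bullet> snd Q (d, y, a) = snd Q' (d, y, a) \<bullet> (m (tgt I d, y) \<lhd> F1 F d)"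
      if "(d, y, a) \<in> Cell1 El" for d y a
      using ins_mor_eq[OF m, of "(d, y, a)"] that by simp
    have "m (i, Cod (C0 W i) a) \<bullet> snd Q (id1 I i, Dom (C0 W i) a, a) = snd Q' (id1 I i, Dom (C0 W i) a, a) \<bullet> m (i, Dom (C0 W i) a)"
      if "i \<in> Cell0 I" "a \<in> Arr (C0 W i)" for i a
      using n[of "id1 I i" "Dom (C0 W i) a" a] that by simp
    moreover have "snd Q' (cart d x) \<bullet> (m (tgt I d, x) \<lhd> F1 F d) = m (src I d, onO (C1 W d) x) \<bullet> snd Q (cart d x)"
      if "d \<in> Cell1 I" "x \<in> Obj (C0 W (tgt I d))" for d x
      using n[of d x "Idt (C0 W (src I d)) (onO (C1 W d) x)"] that unfolding cart_def by simp
    ultimately show "m \<in> extensional (Cell0 El) \<and> wmod (of_el Q) (of_el Q') (el_mod m)"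
      using ins_mor_simps(4)[OF m] unfolding wmod_def by simp
  }
  assume e: "m \<in> extensional (Cell0 El) \<and> wmod (of_el Q) (of_el Q') (el_mod m)"
  then have m: "wmod (of_el Q) (of_el Q') (el_mod m)" by blast
  have c [simp]: "\<lbrakk>i \<in> Cell0 I; x \<in> Obj (C0 W i)\<rbrakk> \<Longrightarrow> m (i, x) \<in> Cell2 C"
    "\<lbrakk>i \<in> Cell0 I; x \<in> Obj (C0 W i)\<rbrakk> \<Longrightarrow> dom2 C (m (i, x)) = fst Q (i, x)"
    "\<lbrakk>i \<in> Cell0 I; x \<in> Obj (C0 W i)\<rbrakk> \<Longrightarrow> cod2 C (m (i, x)) = fst Q' (i, x)" for i x
    using wmod_simps[OF m, of i x] by simp_all
  show "ins_mor E.oplax_ins Q Q' m"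
  proof (rule ins_morI)
    show "m \<in> extensional (Pt E.oplax_ins)" using e by simp
    fix D assume D: "D \<in> Ed E.oplax_ins"
    obtain d y a where D': "D = (d, y, a)" by (cases D)
    have d: "(d, y, a) \<in> Cell1 El" using D D' by simp
    have 1: "m (src I d, Cod (C0 W (src I d)) a) \<bullet> snd Q (id1 I (src I d), onO (C1 W d) y, a) =
        snd Q' (id1 I (src I d), onO (C1 W d) y, a) \<bullet> m (src I d, onO (C1 W d) y)"
      using wmod_eqs(1)[OF m, of "src I d" a] d by simp
    have 2: "snd Q' (cart d y) \<bullet> (m (tgt I d, y) \<lhd> F1 F d) = m (src I d, onO (C1 W d) y) \<bullet> snd Q (cart d y)"
      using wmod_eqs(2)[OF m, of d y] d by simp
    have "m (src I d, Cod (C0 W (src I d)) a) \<bullet> snd Q (d, y, a) =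
        (m (src I d, Cod (C0 W (src I d)) a) \<bullet> snd Q (id1 I (src I d), onO (C1 W d) y, a)) \<bullet> snd Q (cart d y)"
      unfolding el_factor[OF Q d] using d by simp
    also have "\<dots> = (snd Q' (id1 I (src I d), onO (C1 W d) y, a) \<bullet> snd Q' (cart d y)) \<bullet> (m (tgt I d, y) \<lhd> F1 F d)"
      unfolding 1 using d 2 by simp
    also have "\<dots> = snd Q' (d, y, a) \<bullet> (m (tgt I d, y) \<lhd> F1 F d)" unfolding el_factor[OF Q' d] ..
    finally show "(m (sp E.oplax_ins D) \<lhd> gl E.oplax_ins D) \<bullet> snd Q D = snd Q' D \<bullet> (m (tp E.oplax_ins D) \<lhd> fl E.oplax_ins D)"
      using d D' by simp
  next
    fix P assume "P \<in> Pt E.oplax_ins"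
    then show "m P \<in> Cell2 C \<and> dom2 C (m P) = fst Q P \<and> cod2 C (m P) = fst Q' P"
      by (cases P) simp
  qed
qed

text \<open>The structure cell at \<open>(d, y, a)\<close> is the one that \<open>el_factor\<close>
  dictates once the vertical and cartesian cells are given by the weighted cocone.\<close>

definition el_of :: "('i0, 'i1, 'o, 'a, 'k1, 'k2) ps_trans \<Rightarrow> ('i0 \<times> 'o, 'i1 \<times> 'o \<times> 'a, 'k1, 'k2) fam" where
  "el_of \<alpha> = (restrict (\<lambda>(i, x). onO (cmpt \<alpha> i) x) (Cell0 El),
     restrict (\<lambda>(d, y, a). onA (cmpt \<alpha> (src I d)) a \<bullet> strc \<alpha> d y) (Cell1 El))"

lemma el_of_simps [simp]:
  "\<lbrakk>i \<in> Cell0 I; x \<in> Obj (C0 W i)\<rbrakk> \<Longrightarrow> fst (el_of \<alpha>) (i, x) = onO (cmpt \<alpha> i) x"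
  "(d, y, a) \<in> Cell1 El \<Longrightarrow> snd (el_of \<alpha>) (d, y, a) = onA (cmpt \<alpha> (src I d)) a \<bullet> strc \<alpha> d y"
  by (simp_all add: el_of_def)

lemma el_of_cart [simp]:
  "\<lbrakk>wcone B \<alpha>; d \<in> Cell1 I; y \<in> Obj (C0 W (tgt I d))\<rbrakk> \<Longrightarrow> snd (el_of \<alpha>) (cart d y) = strc \<alpha> d y"
  using wcone_simps[of B \<alpha>] by (simp add: cart_def)

lemma el_of_cocone:
  assumes \<alpha>: "wcone B \<alpha>"
  shows "ins_cocone E.oplax_ins B (el_of \<alpha>)"
proof (rule ins_coconeI)
  note [simp] = wcone_simps[OF \<alpha>]
  show "fst (el_of \<alpha>) \<in> extensional (Pt E.oplax_ins)" "snd (el_of \<alpha>) \<in> extensional (Ed E.oplax_ins)"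
    by (simp_all add: el_of_def)
  show "fst (el_of \<alpha>) P \<in> Cell1 C \<and> src C (fst (el_of \<alpha>) P) = ob E.oplax_ins P \<and> tgt C (fst (el_of \<alpha>) P) = B"
    if "P \<in> Pt E.oplax_ins" for P
    using that by (cases P) simp
  show "snd (el_of \<alpha>) D \<in> Cell2 C \<and> dom2 C (snd (el_of \<alpha>) D) = fst (el_of \<alpha>) (tp E.oplax_ins D) \<cdot> fl E.oplax_ins D \<and>
      cod2 C (snd (el_of \<alpha>) D) = fst (el_of \<alpha>) (sp E.oplax_ins D) \<cdot> gl E.oplax_ins D"
    if "D \<in> Ed E.oplax_ins" for D
    using that by (cases D) simp
qed

text \<open>The composition law combines functoriality of a component, the composition axiom, and
  naturality of the structure cell of \<open>d\<close> at \<open>b\<close>. The 2-cell law is the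
  2-cell axiom together with functoriality.\<close>

lemma el_of_pred:
  assumes \<alpha>: "wcone B \<alpha>"
  shows "el_pred (el_of \<alpha>)"
  unfolding el_pred_def E.oplax_pred_iff
proof (intro conjI ballI impI)
  note [simp] = wcone_simps[OF \<alpha>]
  {
    fix P assume "P \<in> Cell0 El"
    then show "snd (el_of \<alpha>) (id1 El P) = id2 C (fst (el_of \<alpha>) P)" by (cases P) simp
  next
    fix D E assume "D \<in> Cell1 El" "E \<in> Cell1 El" "tgt El D = src El E"
    moreover obtain d y a e z b where DE: "D = (d, y, a)" "E = (e, z, b)" by (cases D; cases E) auto
    ultimately have y: "y = Cod (C0 W (src I e)) b" and
      [simp]: "d \<in> Cell1 I" "a \<in> Arr (C0 W (src I d))" "Dom (C0 W (src I d)) a = onO (C1 W d) (Cod (C0 W (src I e)) b)"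
      "e \<in> Cell1 I" "z \<in> Obj (C0 W (tgt I e))" "b \<in> Arr (C0 W (src I e))" "Dom (C0 W (src I e)) b = onO (C1 W e) z"
      "tgt I d = src I e"
      by auto
    have "snd (el_of \<alpha>) (cmp1 El E D) = onA (cmpt \<alpha> (src I d)) a \<bullet>
        (onA (cmpt \<alpha> (src I d)) (onA (C1 W d) b) \<bullet> strc \<alpha> d (onO (C1 W e) z)) \<bullet> (strc \<alpha> e z \<lhd> F1 F d)"
      unfolding DE y by (simp add: wcone_eqs(1,3)[OF \<alpha>])
    also have "\<dots> = snd (el_of \<alpha>) D \<bullet> (snd (el_of \<alpha>) E \<lhd> F1 elF D)"
      using wcone_eqs(2)[OF \<alpha>, of d b, symmetric] unfolding DE y by simp
    finally show "snd (el_of \<alpha>) (cmp1 El E D) = snd (el_of \<alpha>) D \<bullet> (snd (el_of \<alpha>) E \<lhd> F1 elF D)" .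
  next
    fix S assume S: "S \<in> Cell2 El"
    obtain s y a where S': "S = (s, y, a)" by (cases S)
    have "snd (el_of \<alpha>) (cod2 El S) \<bullet> (fst (el_of \<alpha>) (tgt El (dom2 El S)) \<rhd> F2 elF S) =
        onA (cmpt \<alpha> (src I (dom2 I s))) a \<bullet> (strc \<alpha> (cod2 I s) y \<bullet> (onO (cmpt \<alpha> (tgt I (dom2 I s))) y \<rhd> F2 F s))"
      using S unfolding S' by simp
    also have "\<dots> = snd (el_of \<alpha>) (dom2 El S)"
      using S wcone_eqs(4)[OF \<alpha>, of s y, symmetric] wcone_eqs(1)[OF \<alpha>, of "src I (dom2 I s)" "C2 W s y" a]
      unfolding S' by simp
    finally show "snd (el_of \<alpha>) (cod2 El S) \<bullet> (fst (el_of \<alpha>) (tgt El (dom2 El S)) \<rhd> F2 elF S) =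
        snd (el_of \<alpha>) (dom2 El S)" .
  next
    fix d y assume "d \<in> Cell1 I" "y \<in> Obj (C0 W (tgt I d))"
    then show "inv2 (snd (el_of \<alpha>) (cart d y))" using \<alpha> by simp
  }
qed

lemma ext_ps_eqI:
  assumes e: "ext_ps (op2 I) W \<alpha>" "ext_ps (op2 I) W \<beta>"
    and O: "\<And>i x. i \<in> Cell0 I \<Longrightarrow> x \<in> Obj (C0 W i) \<Longrightarrow> onO (cmpt \<alpha> i) x = onO (cmpt \<beta> i) x"
    and A: "\<And>i a. i \<in> Cell0 I \<Longrightarrow> a \<in> Arr (C0 W i) \<Longrightarrow> onA (cmpt \<alpha> i) a = onA (cmpt \<beta> i) a"
    and S: "\<And>d x. d \<in> Cell1 I \<Longrightarrow> x \<in> Obj (C0 W (tgt I d)) \<Longrightarrow> strc \<alpha> d x = strc \<beta> d x"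
  shows "\<alpha> = \<beta>"
proof -
  note e' = e[unfolded ext_ps_def, simplified]
  have "cmpt \<alpha> = cmpt \<beta>"
  proof (rule extensionalityI[of _ "Cell0 I"])
    fix i assume i: "i \<in> Cell0 I"
    have "onO (cmpt \<alpha> i) = onO (cmpt \<beta> i)"
      by (rule extensionalityI[of _ "Obj (C0 W i)"]) (use e' i O in auto)
    moreover have "onA (cmpt \<alpha> i) = onA (cmpt \<beta> i)"
      by (rule extensionalityI[of _ "Arr (C0 W i)"]) (use e' i A in auto)
    ultimately show "cmpt \<alpha> i = cmpt \<beta> i" by simp
  qed (use e' in auto)
  moreover have "strc \<alpha> = strc \<beta>"
  proof (rule extensionalityI[of _ "Cell1 I"])
    fix d assume d: "d \<in> Cell1 I"
    show "strc \<alpha> d = strc \<beta> d"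
      by (rule extensionalityI[of _ "Obj (C0 W (tgt I d))"]) (use e' d S in auto)
  qed (use e' in auto)
  ultimately show ?thesis by simp
qed

text \<open>Gives surjectivity on objects of \<open>el_fun\<close>, as
  \<open>equivalence_transfer\<close> demands.\<close>

lemma of_el_of:
  assumes \<alpha>: "wcone B \<alpha>" and e: "ext_ps (op2 I) W \<alpha>"
  shows "of_el (el_of \<alpha>) = \<alpha>"
  by (rule ext_ps_eqI[OF ext_of_el e]) (use \<alpha> wcone_simps[OF \<alpha>] in simp_all)

definition el_fun where
  "el_fun = \<lparr>onO = of_el, onA = (\<lambda>a. (of_el (fst a), of_el (fst (snd a)), el_mod (snd (snd a))))\<rparr>"

lemma ext_el_mod [simp]: "ext_mod (op2 I) W (el_mod m)"
  by (simp add: el_mod_def)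

lemma functor_el_fun: "is_functor (ins_cat E.oplax_ins el_pred B) (wcones B) el_fun"
  unfolding is_functor_def
proof (intro conjI ballI impI)
  {
    fix Q assume Q: "Q \<in> Obj (ins_cat E.oplax_ins el_pred B)"
    then show "onO el_fun Q \<in> Obj (wcones B)" by (simp add: el_fun_def ext_of_el wcone_of_el)
    show "onA el_fun (Idt (ins_cat E.oplax_ins el_pred B) Q) = Idt (wcones B) (onO el_fun Q)"
      by (simp add: el_fun_def el_mod_def cong: restrict_cong)
  next
    fix a assume a: "a \<in> Arr (ins_cat E.oplax_ins el_pred B)"
    then show "onA el_fun a \<in> hom_set (wcones B) (onO el_fun (Dom (ins_cat E.oplax_ins el_pred B) a))
        (onO el_fun (Cod (ins_cat E.oplax_ins el_pred B) a))"
      using wmod_of_el[of B "fst a" "fst (snd a)" "snd (snd a)"]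
      by (simp add: el_fun_def ext_of_el wcone_of_el) (simp add: el_pred_def)
  next
    fix a b assume "a \<in> Arr (ins_cat E.oplax_ins el_pred B)" "b \<in> Arr (ins_cat E.oplax_ins el_pred B)"
      "Cod (ins_cat E.oplax_ins el_pred B) a = Dom (ins_cat E.oplax_ins el_pred B) b"
    show "onA el_fun (Cmp (ins_cat E.oplax_ins el_pred B) b a) = Cmp (wcones B) (onA el_fun b) (onA el_fun a)"
      by (simp add: el_fun_def el_mod_def cong: restrict_cong)
  }
qed

lemma fully_faithful_el_fun: "fully_faithful (ins_cat E.oplax_ins el_pred B) (wcones B) el_fun"
  unfolding fully_faithful_def
proof (intro ballI)
  fix Q Q' b assume Q: "Q \<in> Obj (ins_cat E.oplax_ins el_pred B)" and Q': "Q' \<in> Obj (ins_cat E.oplax_ins el_pred B)"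
    and b: "b \<in> hom_set (wcones B) (onO el_fun Q) (onO el_fun Q')"
  obtain n where b': "b = (of_el Q, of_el Q', n)" and n: "wmod (of_el Q) (of_el Q') n" "ext_mod (op2 I) W n"
    using b by (cases b) (auto simp: el_fun_def)
  have p: "ins_cocone E.oplax_ins B Q" "E.oplax_pred Q" "ins_cocone E.oplax_ins B Q'" "E.oplax_pred Q'"
    using Q Q' by (auto simp: el_pred_def)
  note iff = wmod_of_el[OF p]
  define m where "m = restrict (\<lambda>(i, x). n i x) (Cell0 El)"
  have mn: "el_mod m = n"
    unfolding el_mod_def by (rule ext_mod_eqI[OF n(2)]) (simp add: m_def)
  show "\<exists>!a. a \<in> hom_set (ins_cat E.oplax_ins el_pred B) Q Q' \<and> onA el_fun a = b"
  proof (rule ex1I[of _ "(Q, Q', m)"])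
    have "ins_mor E.oplax_ins Q Q' m" unfolding iff mn using n(1) by (simp add: m_def)
    then show "(Q, Q', m) \<in> hom_set (ins_cat E.oplax_ins el_pred B) Q Q' \<and> onA el_fun (Q, Q', m) = b"
      using Q Q' b' mn by (simp add: el_fun_def)
    fix a assume "a \<in> hom_set (ins_cat E.oplax_ins el_pred B) Q Q' \<and> onA el_fun a = b"
    then obtain m' where a: "a = (Q, Q', m')" and m': "ins_mor E.oplax_ins Q Q' m'" "el_mod m' = n"
      using b' by (cases a) (auto simp: el_fun_def)
    have "m' = m"
    proof (rule extensionalityI[of _ "Cell0 El"])
      show "m' \<in> extensional (Cell0 El)" using m'(1) iff by blast
      show "m \<in> extensional (Cell0 El)" by (simp add: m_def)
      fix P assume P: "P \<in> Cell0 El"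
      then show "m' P = m P"
        unfolding m_def m'(2)[symmetric] by (cases P) simp
    qed
    then show "a = (Q, Q', m)" using a by simp
  qed
qed

lemma post_stable_el: "post_stable E.oplax_ins el_pred"
  unfolding post_stable_def
proof (intro allI impI)
  fix L Q f assume Q: "ins_cocone E.oplax_ins L Q" "el_pred Q" and f: "f \<in> Cell1 C" "src C f = L"
  have "E.oplax_pred (ins_post E.oplax_ins Q f)"
    using E.post_stable_oplax Q f unfolding post_stable_def el_pred_def by blast
  then show "el_pred (ins_post E.oplax_ins Q f)"
    using Q(2) f el_simps[OF Q(1)] unfolding el_pred_def by (simp add: ins_post_def cart_def)
qed

text \<open>At a cartesian 1-cell the structure cells of \<open>Q\<close> and \<open>Q'\<close>
  differ by invertible components of \<open>m\<close>. The oplax laws for \<open>Q'\<close> are part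
  of the ambient condition \<open>E.oplax_pred\<close>.\<close>

lemma replete_el: "replete E.oplax_ins E.oplax_pred el_pred"
  unfolding replete_def
proof (intro allI impI)
  fix B Q Q' m assume Q: "ins_cocone E.oplax_ins B Q" and Q': "ins_cocone E.oplax_ins B Q'"
    and P: "E.oplax_pred Q'" "el_pred Q" and m: "ins_mor E.oplax_ins Q Q' m"
    and inv: "\<forall>p \<in> Pt E.oplax_ins. inv2 (m p)"
  note [simp] = el_simps[OF Q] el_simps[OF Q']
  have i [simp]: "\<lbrakk>i \<in> Cell0 I; x \<in> Obj (C0 W i)\<rbrakk> \<Longrightarrow> inv2 (m (i, x))"
    "\<lbrakk>i \<in> Cell0 I; x \<in> Obj (C0 W i)\<rbrakk> \<Longrightarrow> dom2 C (m (i, x)) = fst Q (i, x)"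
    "\<lbrakk>i \<in> Cell0 I; x \<in> Obj (C0 W i)\<rbrakk> \<Longrightarrow> cod2 C (m (i, x)) = fst Q' (i, x)" for i x
    using inv ins_mor_simps(2,3)[OF m, of "(i, x)"] by simp_all
  have "inv2 (snd Q' (cart d y))" if d: "d \<in> Cell1 I" "y \<in> Obj (C0 W (tgt I d))" for d y
  proof (rule inv2_left_factor)
    have "m (src I d, onO (C1 W d) y) \<bullet> snd Q (cart d y) = snd Q' (cart d y) \<bullet> (m (tgt I d, y) \<lhd> F1 F d)"
      using ins_mor_eq[OF m, of "cart d y"] d unfolding cart_def by simp
    moreover have "inv2 (m (src I d, onO (C1 W d) y) \<bullet> snd Q (cart d y))"
      using P(2) d unfolding el_pred_def by simp
    ultimately show "inv2 (snd Q' (cart d y) \<bullet> (m (tgt I d, y) \<lhd> F1 F d))" by simp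
  qed (use d in simp_all)
  then show "el_pred Q'" using P(1) by (simp add: el_pred_def)
qed

lemma of_el_post:
  assumes "ins_cocone E.oplax_ins L Q" "f \<in> Cell1 C" "src C f = L"
  shows "of_el (ins_post E.oplax_ins Q f) = post f (of_el Q)"
  by (rule ext_ps_eqI[OF ext_of_el ext_post]) (simp_all add: ins_post_def cart_def)

lemma weighted_bicolimit_of_el:
  assumes rep: "ins_rep E.oplax_ins el_pred L Q"
  shows "is_weighted_bicolimit I W C F L"
  unfolding is_weighted_bicolimit_iff
proof (intro conjI bexI[of _ "of_el Q"] ballI)
  have Q: "L \<in> Cell0 C" "ins_cocone E.oplax_ins L Q" "el_pred Q" using rep by (auto simp: ins_rep_def)
  show "L \<in> Cell0 C" by fact
  show "of_el Q \<in> Obj (wcones L)" using wcone_of_el[OF Q(2,3)] by (simp add: ext_of_el)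
  fix B assume B: "B \<in> Cell0 C"
  show "is_equivalence (hom_cat C L B) (wcones B) (wfun (of_el Q))"
  proof (rule equivalence_transfer[OF category_hom_cat category_ins_cat category_wcones _ functor_el_fun fully_faithful_el_fun])
    show "wf_ins E.oplax_ins" by (rule E.wf_oplax_ins)
    show "is_equivalence (hom_cat C L B) (ins_cat E.oplax_ins el_pred B) (ins_fun E.oplax_ins Q)"
      using rep B ins_rep_iff[OF E.wf_oplax_ins Q(2,3) post_stable_el Q(1)] by blast
    show "\<exists>x \<in> Obj (ins_cat E.oplax_ins el_pred B). onO el_fun x = \<alpha>" if "\<alpha> \<in> Obj (wcones B)" for \<alpha>
      using that of_el_of el_of_cocone el_of_pred by (intro bexI[of _ "el_of \<alpha>"]) (auto simp: el_fun_def)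
    show "onO (wfun (of_el Q)) f = onO el_fun (onO (ins_fun E.oplax_ins Q) f)" if "f \<in> Obj (hom_cat C L B)" for f
      using that of_el_post[OF Q(2)] by (simp add: wfun_def el_fun_def ins_fun_def)
    show "onA (wfun (of_el Q)) t = onA el_fun (onA (ins_fun E.oplax_ins Q) t)" if "t \<in> Arr (hom_cat C L B)" for t
      using that of_el_post[OF Q(2)]
      by (simp add: wfun_def el_fun_def ins_fun_def post_mod_def el_mod_def cong: restrict_cong)
  qed
qed

text \<open>In the universal oplax cocone under \<open>El\<close> the cells at cartesian 1-cells
  need not be invertible. They form the small family \<open>R\<close>; coinverting it and applying
  \<open>ins_rep_localize\<close> gives a universal weighted cocone.\<close>

lemma weighted_bicolimit_of_oplax:
  fixes \<kappa> :: "'u rel" and e0 :: "'i0 \<times> 'o \<Rightarrow> 'u" and e1 :: "'i1 \<times> 'o \<times> 'a \<Rightarrow> 'u" and e2 :: "'i2 \<times> 'o \<times> 'a \<Rightarrow> 'u"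
  assumes \<kappa>: "smallness_cardinal \<kappa>" and op: "has_oplax_bicolimits \<kappa> C" and bc: "has_bicoequalizers C"
    and small: "|Cell0 I| <o \<kappa>" "|Cell1 I| <o \<kappa>" "|Cell2 I| <o \<kappa>"
      "\<And>i. i \<in> Cell0 I \<Longrightarrow> |Obj (C0 W i)| <o \<kappa>" "\<And>i. i \<in> Cell0 I \<Longrightarrow> |Arr (C0 W i)| <o \<kappa>"
    and e: "inj e0" "inj e1" "inj e2"
  shows "\<exists>L. is_weighted_bicolimit I W C F L"
proof -
  \<comment> \<open>The cells of \<open>El\<close> lie in dependent sums of small sets over small
    sets.\<close>
  have El: "|Cell0 El| <o \<kappa>" "|Cell1 El| <o \<kappa>" "|Cell2 El| <o \<kappa>"
  proof -
    have "|SIGMA i:Cell0 I. Obj (C0 W i)| <o \<kappa>"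
      by (rule small_Sigma[OF \<kappa>]) (use small in auto)
    then show "|Cell0 El| <o \<kappa>" by (rule small_subset[rotated]) auto
    have "|SIGMA d:Cell1 I. Obj (C0 W (tgt I d)) \<times> Arr (C0 W (src I d))| <o \<kappa>"
      by (intro small_Sigma[OF \<kappa>] small_Times[OF \<kappa>]) (use small in auto)
    then show "|Cell1 El| <o \<kappa>" by (rule small_subset[rotated]) auto
    have "|SIGMA s:Cell2 I. Obj (C0 W (tgt I (dom2 I s))) \<times> Arr (C0 W (src I (dom2 I s)))| <o \<kappa>"
      by (intro small_Sigma[OF \<kappa>] small_Times[OF \<kappa>]) (use small in auto)
    then show "|Cell2 El| <o \<kappa>" by (rule small_subset[rotated]) auto
  qed
  obtain L Q where rep: "ins_rep E.oplax_ins E.oplax_pred L Q"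
    using E.oplax_bicolimit_enc[OF e El op] by blast
  have Q: "L \<in> Cell0 C" "ins_cocone E.oplax_ins L Q" "E.oplax_pred Q" using rep by (auto simp: ins_rep_def)
  note [simp] = el_simps[OF Q(2)]
  define R where "R = (\<lambda>(d, y). snd Q (cart d y)) ` (SIGMA d:Cell1 I. Obj (C0 W (tgt I d)))"
  have small_R: "|R| <o \<kappa>"
    unfolding R_def by (intro small_image small_Sigma[OF \<kappa>]) (use small in auto)
  have "\<exists>p M. localizes (\<lambda>f. \<forall>r \<in> R. inv2 (f \<rhd> r)) p L M"
    by (rule coinverter_of_family[OF \<kappa> op bc Q(1) small_R]) (auto simp: R_def)
  then obtain p M where loc: "localizes (\<lambda>f. \<forall>r \<in> R. inv2 (f \<rhd> r)) p L M" by blast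
  have "ins_rep E.oplax_ins el_pred M (ins_post E.oplax_ins Q p)"
  proof (rule ins_rep_localize[OF E.wf_oplax_ins rep loc _ replete_el E.post_stable_oplax])
    show "E.oplax_pred Y" if "el_pred Y" for Y using that by (simp add: el_pred_def)
    fix f assume f: "f \<in> Cell1 C" "src C f = L"
    then have "E.oplax_pred (ins_post E.oplax_ins Q f)"
      using E.post_stable_oplax Q unfolding post_stable_def by blast
    then show "(\<forall>r \<in> R. inv2 (f \<rhd> r)) \<longleftrightarrow> el_pred (ins_post E.oplax_ins Q f)"
      unfolding el_pred_def R_def by (auto simp: ins_post_def cart_def)
  qed
  then show ?thesis using weighted_bicolimit_of_el by blast
qed

end

theorem theorem1p19:
  fixes \<kappa> :: "'u rel"
    and C :: "('k0, 'k1, 'k2) two_cat"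
  assumes "smallness_cardinal \<kappa>"
    and "two_category C"
  shows "bicocomplete \<kappa> C \<longleftrightarrow> has_oplax_bicolimits \<kappa> C \<and> has_bicoequalizers C"
proof
  assume "bicocomplete \<kappa> C"
  then show "has_oplax_bicolimits \<kappa> C \<and> has_bicoequalizers C"
    using bicocomplete_has_oplax_bicolimits[OF assms] bicocomplete_has_bicoequalizers[OF assms] by blast
next
  assume H: "has_oplax_bicolimits \<kappa> C \<and> has_bicoequalizers C"
  obtain e :: "'u \<times> 'u \<Rightarrow> 'u" where e: "inj e"
    using inj_prod[OF smallness_infinite[OF assms(1)]] by blast
  \<comment> \<open>Codes triples, because 1-cells and 2-cells of the 2-category of elements are
    triples over \<open>'u\<close>.\<close>
  define e' :: "'u \<times> 'u \<times> 'u \<Rightarrow> 'u" where "e' = (\<lambda>(x, y). e (x, e y))"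
  have e': "inj e'" by (rule injI) (auto simp: e'_def inj_eq[OF e])
  show "bicocomplete \<kappa> C"
    unfolding bicocomplete_def
  proof (intro allI impI)
    fix I :: "('u, 'u, 'u) two_cat" and F and W :: "('u, 'u, 'u, 'u, 'u) cat_fun"
    assume I: "small_two_category \<kappa> I" and F: "two_functor I C F" and W: "cat_functor (op2 I) W"
      and small: "\<forall>i \<in> Cell0 I. small_category \<kappa> (C0 W i)"
    interpret weighted C I F W
      by unfold_locales (use assms(2) I F W in \<open>simp_all add: small_two_category_def\<close>)
    have "|Cell0 I| <o \<kappa>" "|Cell1 I| <o \<kappa>" "|Cell2 I| <o \<kappa>"
      using I by (simp_all only: small_two_category_def small_set_def)
    moreover have "|Obj (C0 W i)| <o \<kappa>" "|Arr (C0 W i)| <o \<kappa>" if "i \<in> Cell0 I" for i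
      using small that by (simp_all only: small_category_def small_set_def)
    ultimately show "\<exists>L. is_weighted_bicolimit I W C F L"
      by (intro weighted_bicolimit_of_oplax[OF assms(1) conjunct1[OF H] conjunct2[OF H] _ _ _ _ _ e e' e'])
  qed
qed

end
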